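(* There are absolute constants $C\ge 1$, $c>0$ such that the following holds. Let $N$ be a positive integer, $\delta>0$, and let $f_0, f_1, f_2 : \mathbb{Z}^2 \to \mathbb{C}$ be bounded by $1$ in modulus. Let $\mu_N(d) := \frac{1}{N}\big(1-\frac{|d|}{N}\big)_+$ for $d\in\mathbb{Z}$ and $$\Lambda_N(f_0, f_1, f_2) := \mathbb{E}_{x \in [N]}\mathbb{E}_{y \in [N^2]}\sum_{d\in\mathbb{Z}} \mu_N(d) f_0(x,y)f_1(x+d,y) f_2(x,y+d^2).$$ If $|\Lambda_N(f_0,f_1, f_2)| \geq \delta$, then either $N \leq C\delta^{-C}$, or there exist $\beta \in \mathbb{T}$ and a positive integer $q \leq C\delta^{-C}$ with $\|q\beta\|_{\mathbb{T}} \leq C\delta^{-C}/N$ such that $$\mathbb{E}_{y\in [N^2]} \Big|\mathbb{E}_{x\in [-N, 2N]\cap\mathbb{Z}} f_1(x, y)\, e(\beta x)\Big| \geq c\,\delta^{C} .$$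
   Context: $[X]=\{1,\dots,\lfloor X\rfloor\}$, $t_+=\max\{t,0\}$, $\mathbb{E}_{s\in S}$ is the average over a finite set $S$; $\mathbb{T}=\mathbb{R}/\mathbb{Z}$, $\|\cdot\|_{\mathbb{T}}$ is distance to the nearest integer, $e(t)=e^{2\pi i t}$. *)

theory Defs
  imports "HOL-Analysis.Analysis"
begin

definition avg :: "'a set \<Rightarrow> ('a \<Rightarrow> 'b::field_char_0) \<Rightarrow> 'b" where
  "avg S f = (\<Sum>s\<in>S. f s) / of_nat (card S)"

text \<open>
  Elements of the circle are represented by real numbers: \<open>dist_circle\<close> is invariant under
  integer shifts of its argument, and so is \<open>\<lambda>\<beta>. add_char (\<beta> * of_int x)\<close> for every integer \<open>x\<close>.
\<close>

definition dist_circle :: "real \<Rightarrow> real" where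
  "dist_circle t = infdist t \<int>"

definition add_char :: "real \<Rightarrow> complex" where
  "add_char t = exp (2 * of_real pi * \<i> * of_real t)"

definition fejer :: "nat \<Rightarrow> int \<Rightarrow> real" where
  "fejer N d = 1 / real N * max (1 - \<bar>of_int d\<bar> / real N) 0"

text \<open>
  The sum over \<open>d\<close> has finite support for \<open>N > 0\<close>, so \<open>infsum\<close> is the ordinary sum.
\<close>

definition corner_form ::
  "nat \<Rightarrow> (int \<times> int \<Rightarrow> complex) \<Rightarrow> (int \<times> int \<Rightarrow> complex) \<Rightarrow> (int \<times> int \<Rightarrow> complex) \<Rightarrow> complex"
where
  "corner_form N f0 f1 f2 =
     avg {1..int N} (\<lambda>x. avg {1..(int N)\<^sup>2} (\<lambda>y.
       \<Sum>\<^sub>\<infinity>d\<in>UNIV. of_real (fejer N d) * f0 (x, y) * f1 (x + d, y) * f2 (x, y + d\<^sup>2)))"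

end

theory Submission
  imports Defs
begin

text \<open>
  Fix a window \<open>\<bar>d\<bar> < j\<close> in the Fejer average. By Cauchy--Schwarz the form stays large when \<open>f2\<close> is
  replaced by (the conjugate of) its dual function, the average \<open>F x y\<close> over \<open>d\<close> of
  \<open>f0 x (y - d\<^sup>2) * f1 (x + d) (y - d\<^sup>2)\<close>. Van der Corput differencing and a concatenation
  argument show that, for many \<open>x\<close> and many pairs of steps of the shape \<open>2ab\<close>, the mixed second
  difference of \<open>F x\<close> in \<open>y\<close> has a large Fourier coefficient \<open>\<phi>\<close>. Opening the definition of \<open>F\<close>
  in such a coefficient produces quadratic exponential sums in \<open>d\<close>, so the mixed differences of \<open>\<phi>\<close>
  lie on major arcs; hence \<open>\<phi>\<close> splits as a sum of two phases that each depend on only one of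
  the steps, and these can be absorbed. Lowering the degree twice in this way yields a large Fourier
  coefficient of \<open>F x\<close> itself, at a frequency that is again on a major arc. This means that \<open>f1\<close>
  correlates with \<open>d \<mapsto> e(\<alpha> d\<^sup>2)\<close> for an \<open>\<alpha>\<close> close to a fraction of small denominator \<open>q\<close>;
  this phase is nearly constant along short progressions of step \<open>q\<close>, and Fourier analysis of the
  averages of \<open>f1\<close> along such progressions provides \<open>\<beta>\<close>. Each step costs a fixed power of the
  parameter \<open>K\<close>, with no attempt to optimise the exponents.
\<close>

section \<open>Characters of the circle and recurrence\<close>

text \<open>Two length scales shape the argument. The variable \<open>y\<close> is read modulo
  \<open>M = 2 * N^2\<close>: since \<open>y \<le> N^2\<close> and \<open>d^2 < N^2\<close>, the
  form itself does not see the reduction, and every differencing step becomes an exact identity on a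
  cyclic group. The variable \<open>x\<close> is confined to a block of length \<open>L\<close>,
  shorter than \<open>N\<close> by a fixed power of the parameter. Concatenation has to conclude
  from \<open>l * t\<close> and \<open>l' * t\<close> both being near integers, for two differences
  \<open>l\<close>, \<open>l'\<close> of points of the block, that \<open>gcd l l' * t\<close> is
  near an integer. The errors are of size \<open>K^O(1) / N\<close>, and two rational approximations
  with such errors can be identified only if the error times \<open>L\<close> is below
  \<open>1/2\<close>. On the other hand \<open>L\<close> may lose only a power of \<open>K\<close>
  against \<open>N\<close>, or the conclusion would be too weak for major arcs of width about
  \<open>N^(-2)\<close>. As a typical pair has small gcd, the frequencies that survive form a small
  set independent of the pair, and one of them serves all pairs at once. The initial parameter is
  \<open>2 / \<delta>\<close>; each stage replaces it by a fixed power, and \<open>K \<ge> 2\<close>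
  turns every numerical constant into additional exponent.\<close>

lemma add_char_add: "add_char (s + t) = add_char s * add_char t"
  by (simp add: add_char_def exp_add [symmetric] algebra_simps)

lemma add_char_cis: "add_char t = cis (2 * pi * t)"
  by (simp add: add_char_def cis_conv_exp algebra_simps)

lemma norm_add_char [simp]: "norm (add_char t) = 1"
  by (simp add: add_char_cis)

lemma add_char_0 [simp]: "add_char 0 = 1"
  by (simp add: add_char_def)

lemma add_char_of_int [simp]: "add_char (of_int n) = 1"
  by (simp add: add_char_cis cis_multiple_2pi)

lemma cnj_add_char: "cnj (add_char t) = add_char (- t)"
  by (simp add: add_char_cis cis_cnj)

lemma add_char_diff: "add_char (s - t) = add_char s * cnj (add_char t)"
  by (simp add: cnj_add_char flip: add_char_add)

lemma dist_circle_le: "dist_circle t \<le> \<bar>t - of_int n\<bar>"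
  unfolding dist_circle_def using infdist_le[of "of_int n" \<int> t] by (simp add: dist_real_def)

lemma dist_circle_nonneg [simp]: "0 \<le> dist_circle t"
  unfolding dist_circle_def by (rule infdist_nonneg)

lemma dist_circle_attained: "\<exists>n::int. dist_circle t = \<bar>t - of_int n\<bar>"
proof -
  have "\<bar>t - of_int (round t)\<bar> \<le> \<bar>t - of_int n\<bar>" for n
    using round_diff_minimal[of t n] by (simp add: abs_minus_commute)
  then have "dist_circle t \<ge> \<bar>t - of_int (round t)\<bar>"
    using infdist_notempty[of \<int> t] Ints_0
    by (auto simp: dist_circle_def dist_real_def Ints_def intro!: cINF_greatest)
  then show ?thesis using dist_circle_le by (meson order_antisym)
qed

lemma dist_circle_eqI: "\<bar>t\<bar> \<le> 1 / 2 \<Longrightarrow> dist_circle t = \<bar>t\<bar>"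
proof -
  assume t: "\<bar>t\<bar> \<le> 1 / 2"
  obtain n where n: "dist_circle t = \<bar>t - of_int n\<bar>" using dist_circle_attained by blast
  have "dist_circle t \<le> \<bar>t\<bar>" using dist_circle_le[of t 0] by simp
  moreover have "\<bar>t\<bar> \<le> \<bar>t - of_int n\<bar>"
  proof (cases "n = 0")
    case False
    then have "\<bar>real_of_int n\<bar> \<ge> 1" by linarith
    then show ?thesis using t by linarith
  qed simp
  ultimately show ?thesis using n by linarith
qed

lemma dist_circle_le_half: "dist_circle t \<le> 1 / 2"
  using dist_circle_le[of t "round t"] of_int_round_abs_le[of t] by (simp add: abs_minus_commute)

lemma dist_circle_add: "dist_circle (s + t) \<le> dist_circle s + dist_circle t"
proof -
  obtain m n :: int where "dist_circle s = \<bar>s - of_int m\<bar>" "dist_circle t = \<bar>t - of_int n\<bar>"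
    using dist_circle_attained by metis
  then show ?thesis using dist_circle_le[of "s + t" "m + n"] by simp
qed

lemma dist_circle_minus [simp]: "dist_circle (- t) = dist_circle t"
proof -
  have "dist_circle (- s) \<le> dist_circle s" for s
  proof -
    obtain m :: int where "dist_circle s = \<bar>s - of_int m\<bar>" using dist_circle_attained by metis
    then show ?thesis using dist_circle_le[of "- s" "- m"] by simp
  qed
  from this[of t] this[of "- t"] show ?thesis by simp
qed

lemma dist_circle_diff: "dist_circle (s - t) \<le> dist_circle s + dist_circle t"
  using dist_circle_add[of s "- t"] by simp

lemma dist_circle_add_int [simp]: "dist_circle (t + of_int m) = dist_circle t"
proof -
  have *: "dist_circle (s + of_int k) \<le> dist_circle s" for s k
    using dist_circle_add[of s "of_int k"] dist_circle_le[of "of_int k" k] by simp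
  from *[of t m] *[of "t + of_int m" "- m"] show ?thesis by simp
qed

lemma dist_circle_mult: "dist_circle (of_int m * t) \<le> \<bar>of_int m\<bar> * dist_circle t"
proof -
  obtain n :: int where n: "dist_circle t = \<bar>t - of_int n\<bar>" using dist_circle_attained by metis
  have "dist_circle (of_int m * t) \<le> \<bar>of_int m * t - of_int (m * n)\<bar>" by (rule dist_circle_le)
  also have "\<dots> = \<bar>of_int m\<bar> * \<bar>t - of_int n\<bar>" by (simp add: abs_mult[symmetric] algebra_simps)
  finally show ?thesis using n by simp
qed

lemma norm_add_char_minus_1: "norm (add_char t - 1) = 2 * \<bar>sin (pi * t)\<bar>"
proof -
  have "(norm (add_char t - 1))\<^sup>2 = (cos (2 * (pi * t)) - 1)\<^sup>2 + (sin (2 * (pi * t)))\<^sup>2"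
    by (simp add: add_char_cis cmod_power2 mult.assoc)
  also have "\<dots> = (2 * \<bar>sin (pi * t)\<bar>)\<^sup>2"
    unfolding cos_double sin_double cos_squared_eq power_mult_distrib
    by (simp add: power_mult_distrib cos_squared_eq power2_eq_square algebra_simps)
  finally show ?thesis by (rule power2_eq_imp_eq) auto
qed

lemma norm_add_char_minus_1_le: "norm (add_char t - 1) \<le> 8 * dist_circle t"
proof -
  obtain n :: int where n: "dist_circle t = \<bar>t - of_int n\<bar>" using dist_circle_attained by metis
  have "add_char t = add_char (t - of_int n)"
    using add_char_add[of "t - of_int n" "of_int n"] by simp
  then have "norm (add_char t - 1) = 2 * \<bar>sin (pi * (t - of_int n))\<bar>"
    using norm_add_char_minus_1 by simp
  also have "\<dots> \<le> 2 * \<bar>pi * (t - of_int n)\<bar>"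
    using abs_sin_x_le_abs_x by (intro mult_left_mono) auto
  also have "\<dots> = 2 * pi * dist_circle t" using n by (simp add: abs_mult)
  also have "\<dots> \<le> 8 * dist_circle t" using pi_less_4 by (intro mult_right_mono) auto
  finally show ?thesis .
qed

text \<open>A cubic Taylor bound for the sine suffices: after reduction to
  \<open>\<bar>v\<bar> \<le> pi / 2\<close> one has \<open>v^2 \<le> 3\<close>, so the remainder
  \<open>\<bar>v\<bar>^3 / 6\<close> is at most half of \<open>\<bar>v\<bar>\<close>.\<close>

lemma norm_add_char_minus_1_ge: "2 * dist_circle t \<le> norm (add_char t - 1)"
proof -
  obtain n :: int where n: "dist_circle t = \<bar>t - of_int n\<bar>" using dist_circle_attained by metis
  define u where "u = t - of_int n"
  have u: "\<bar>u\<bar> \<le> 1 / 2" using dist_circle_le_half[of t] n u_def by simp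
  define v where "v = pi * u"
  have v: "\<bar>v\<bar> \<le> pi / 2" using u by (simp add: v_def abs_mult)
  have "\<bar>sin v - (\<Sum>m<3. sin_coeff m * v ^ m)\<bar> \<le> inverse (fact 3) * \<bar>v\<bar> ^ 3"
    by (rule Maclaurin_sin_bound)
  moreover have "(\<Sum>m<3. sin_coeff m * v ^ m) = v"
    by (simp add: sin_coeff_def numeral_eq_Suc)
  ultimately have "\<bar>sin v - v\<bar> \<le> \<bar>v\<bar> ^ 3 / 6"
    by (simp add: fact_numeral field_simps)
  moreover have "\<bar>v\<bar> ^ 3 \<le> 3 * \<bar>v\<bar>"
  proof -
    have "\<bar>v\<bar> \<le> 1.6" using v pi_approx by simp
    then have "\<bar>v\<bar> * \<bar>v\<bar> \<le> 1.6 * 1.6" by (intro mult_mono) auto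
    then have "\<bar>v\<bar> * \<bar>v\<bar> \<le> 3" by simp
    then have "\<bar>v\<bar> * \<bar>v\<bar> * \<bar>v\<bar> \<le> 3 * \<bar>v\<bar>" by (intro mult_right_mono) auto
    then show ?thesis by (simp add: power3_eq_cube)
  qed
  ultimately have "\<bar>sin v\<bar> \<ge> \<bar>v\<bar> / 2" by linarith
  moreover have "add_char t = add_char u"
    using add_char_add[of u "of_int n"] by (simp add: u_def)
  ultimately have "norm (add_char t - 1) \<ge> \<bar>v\<bar>"
    using norm_add_char_minus_1[of u] by (simp add: v_def)
  moreover have "\<bar>v\<bar> \<ge> 2 * \<bar>u\<bar>" using pi_gt3 by (simp add: v_def abs_mult mult_right_mono)
  ultimately show ?thesis using n u_def by simp
qed

text \<open>Geometric series, by telescoping after multiplication with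
  \<open>add_char t - 1\<close>. The product form avoids a case distinction for
  \<open>dist_circle t = 0\<close>, and the bound does not depend on the interval.\<close>

lemma norm_sum_add_char_le:
  "norm (\<Sum>n\<in>{a..b::int}. add_char (of_int n * t)) * dist_circle t \<le> 1"
proof -
  let ?S = "\<lambda>a. \<Sum>n\<in>{a..b::int}. add_char (of_int n * t)"
  have sh: "(\<Sum>n\<in>{a..b}. add_char (of_int (n + 1) * t)) = (\<Sum>n\<in>{a+1..b+1}. add_char (of_int n * t))"
    by (rule sum.reindex_bij_witness[of _ "\<lambda>n. n - 1" "\<lambda>n. n + 1"]) auto
  have "norm ((add_char t - 1) * ?S a) \<le> 2"
  proof (cases "a \<le> b")
    case True
    have "(add_char t - 1) * ?S a = (\<Sum>n\<in>{a+1..b+1}. add_char (of_int n * t)) - ?S a"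
      unfolding sh[symmetric] by (simp add: sum_distrib_left sum_subtractf algebra_simps add_char_add)
    also have "\<dots> = add_char (of_int (b + 1) * t) - add_char (of_int a * t)"
    proof -
      have "{a..b} = insert a {a+1..b}" "{a+1..b+1} = insert (b+1) {a+1..b}" using True by auto
      then show ?thesis by simp
    qed
    finally have "(add_char t - 1) * ?S a = add_char (of_int (b + 1) * t) - add_char (of_int a * t)" .
    then show ?thesis using norm_triangle_ineq4[of "add_char (of_int (b + 1) * t)" "add_char (of_int a * t)"]
      by simp
  qed simp
  then have "norm (?S a) * norm (add_char t - 1) \<le> 2" by (simp add: norm_mult mult.commute)
  moreover have "norm (?S a) * (2 * dist_circle t) \<le> norm (?S a) * norm (add_char t - 1)"
    by (intro mult_left_mono norm_add_char_minus_1_ge) auto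
  ultimately show ?thesis by simp
qed

section \<open>Pigeonhole and recurrence of linear phases\<close>

lemma pigeonhole_real:
  assumes "finite A" "finite B" "f ` A \<subseteq> B" "A \<noteq> {}"
  shows "\<exists>b\<in>B. real (card {a\<in>A. f a = b}) \<ge> real (card A) / real (card B)"
proof -
  have "B \<noteq> {}" using assms by auto
  then obtain b where b: "b \<in> B" "card (f -` {b} \<inter> A) * card B \<ge> card A"
    using pigeonhole_card[of f A B] assms by blast
  have "f -` {b} \<inter> A = {a\<in>A. f a = b}" by auto
  with b have "real (card {a\<in>A. f a = b}) * real (card B) \<ge> real (card A)"
    by (metis of_nat_le_iff of_nat_mult)
  moreover have "real (card B) > 0" using \<open>B \<noteq> {}\<close> assms by (simp add: card_gt_0_iff)
  ultimately show ?thesis using b by (auto simp: divide_simps)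
qed

lemma card_le_diameter:
  fixes A :: "int set"
  assumes "finite A" "A \<noteq> {}" "\<And>a b. a \<in> A \<Longrightarrow> b \<in> A \<Longrightarrow> real_of_int (b - a) \<le> d"
  shows "real (card A) \<le> d + 1"
proof -
  have "A \<subseteq> {Min A..Max A}" using assms by auto
  then have "card A \<le> card {Min A..Max A}" by (intro card_mono) auto
  moreover have "real (card {Min A..Max A}) = real_of_int (Max A - Min A) + 1"
    using assms by simp
  moreover have "real_of_int (Max A - Min A) \<le> d" using assms by auto
  ultimately show ?thesis by linarith
qed

text \<open>The left side counts the cells of length \<open>P\<close> that meet
  \<open>{-B..B}\<close>; both recurrence arguments below sort points into such cells.\<close>

lemma div_cells_le:
  "real_of_int (B div P - (-B) div P) + 1 \<le> 2 * (of_int B / of_int P) + 2"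
proof -
  have "real_of_int (B div P) \<le> of_int B / of_int P" by (rule real_of_int_div4)
  moreover have "of_int (-B) / of_int P \<le> real_of_int ((-B) div P) + 1"
    using real_of_int_div3[of "-B" P] by linarith
  moreover have "real_of_int (-B) / of_int P = - (of_int B / of_int P)" by simp
  moreover have "real_of_int (B div P - (-B) div P) = real_of_int (B div P) - real_of_int ((-B) div P)"
    by (rule of_int_diff)
  ultimately show ?thesis by linarith
qed

text \<open>A set of density \<open>1 / K\<close> has more points than there are cells of length
  about \<open>4 * K\<close>, so two points share a cell and their difference annihilates
  \<open>g\<close> up to \<open>2 * eps\<close>. This is only the starting point; the additional
  factor \<open>1 / B\<close> is gained in \<open>recurrence_major\<close>.\<close>

lemma recurrence_first:
  fixes R :: "int set"
  assumes K: "K \<ge> 2" and B: "real_of_int B > 8 * K" and R: "R \<subseteq> {-B..B}"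
    and cR: "real (card R) \<ge> of_int B / K"
    and eps: "\<And>r. r \<in> R \<Longrightarrow> dist_circle (g * of_int r) \<le> eps"
  shows "\<exists>q::int. 0 < q \<and> of_int q \<le> 5 * K \<and> dist_circle (of_int q * g) \<le> 2 * eps"
proof -
  \<comment> \<open>Cells of this length number at most \<open>B / (2 * K) + 2\<close>, which is
    below \<open>B / K\<close> because \<open>B\<close> exceeds \<open>8 * K\<close>.\<close>
  define Q where "Q = \<lceil>4 * K\<rceil>"
  have Q: "real_of_int Q \<ge> 4 * K" "real_of_int Q \<le> 4 * K + 1" unfolding Q_def by linarith+
  then have Q0: "Q > 0" using K by linarith
  have Bp: "B > 0" using B K by linarith
  have sub: "(\<lambda>r. r div Q) ` R \<subseteq> {(-B) div Q..B div Q}"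
    using R Q0 by (auto intro!: zdiv_mono1)
  have lt: "card ((\<lambda>r. r div Q) ` R) < card R"
  proof -
    have "real (card ((\<lambda>r. r div Q) ` R)) \<le> real (card {(-B) div Q..B div Q})"
      using sub by (intro of_nat_mono card_mono) auto
    also have "\<dots> = real_of_int (B div Q - (-B) div Q) + 1"
      using Q0 Bp by (simp add: zdiv_mono1)
    also have "\<dots> \<le> 2 * (of_int B / of_int Q) + 2" by (rule div_cells_le)
    also have "of_int B / real_of_int Q \<le> of_int B / (4 * K)"
      using Q Bp K by (intro divide_left_mono) auto
    also have "2 * (of_int B / (4 * K)) + 2 < of_int B / K"
      using B K by (simp add: field_simps)
    finally show ?thesis using cR by simp
  qed
  then have "\<not> inj_on (\<lambda>r. r div Q) R" using pigeonhole by blast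
  then obtain r r' where rr: "r \<in> R" "r' \<in> R" "r \<noteq> r'" "r div Q = r' div Q"
    unfolding inj_on_def by blast
  define q where "q = \<bar>r - r'\<bar>"
  have "q > 0" using rr q_def by simp
  moreover have "q < Q"
  proof -
    have "r = Q * (r div Q) + r mod Q" "r' = Q * (r div Q) + r' mod Q"
      using rr(4) by (metis mult_div_mod_eq)+
    moreover have "0 \<le> r mod Q" "r mod Q < Q" "0 \<le> r' mod Q" "r' mod Q < Q" using Q0 by auto
    ultimately show ?thesis unfolding q_def by linarith
  qed
  then have "q \<le> Q - 1" by simp
  then have "real_of_int q \<le> 5 * K" using Q K by linarith
  moreover have "dist_circle (of_int q * g) \<le> 2 * eps"
  proof -
    have "dist_circle (of_int q * g) = dist_circle (g * of_int r - g * of_int r')"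
    proof (cases "r \<ge> r'")
      case True then show ?thesis by (simp add: q_def algebra_simps)
    next
      case False
      then have "of_int q * g = - (g * of_int r - g * of_int r')" by (simp add: q_def algebra_simps)
      then show ?thesis using dist_circle_minus[of "g * of_int r - g * of_int r'"] by simp
    qed
    also have "\<dots> \<le> 2 * eps"
      using dist_circle_diff[of "g * of_int r" "g * of_int r'"] eps[OF rr(1)] eps[OF rr(2)] by linarith
    finally show ?thesis .
  qed
  ultimately show ?thesis by blast
qed

text \<open>Bootstraps \<open>recurrence_first\<close>. Let \<open>s\<close> be the distance of
  \<open>q * g\<close> to the integers and sort \<open>R\<close> by residue modulo \<open>q\<close>
  and by blocks of length \<open>q * V\<close>. Two points of one cell differ by
  \<open>q * n\<close> with \<open>n * s\<close> too small to wrap round the circle, so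
  \<open>n * s \<le> 2 * eps\<close> and a cell holds at most \<open>2 * eps / s + 1\<close> points.
  Some cell holds at least \<open>V / (4 * K)\<close> points. Comparing the two bounds
  \<open>s\<close> by about \<open>K * eps / V\<close>, and \<open>V\<close> turns out to be
  comparable with \<open>B / q\<close>.\<close>

lemma recurrence_major:
  fixes R :: "int set"
  assumes K: "K \<ge> 2" and B: "real_of_int B > 8 * K" and R: "R \<subseteq> {-B..B}"
    and cR: "real (card R) \<ge> of_int B / K"
    and eps: "\<And>r. r \<in> R \<Longrightarrow> dist_circle (g * of_int r) \<le> eps" and epsK: "eps < 1 / (128 * K)"
  shows "\<exists>q::int. 0 < q \<and> of_int q \<le> 5 * K \<and> dist_circle (of_int q * g) \<le> 160 * K\<^sup>2 * eps / of_int B"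
proof -
  have finR: "finite R" using R finite_subset by blast
  have Bp: "real_of_int B > 0" using B K by linarith
  have "real (card R) > 0" using cR Bp K by (smt (verit) divide_pos_pos)
  then have Rne: "R \<noteq> {}" by auto
  then have eps0: "eps \<ge> 0" using eps dist_circle_nonneg order_trans by blast
  obtain q :: int where q: "0 < q" "of_int q \<le> 5 * K" "dist_circle (of_int q * g) \<le> 2 * eps"
    using recurrence_first[OF K B R cR eps] by blast
  define s where "s = dist_circle (of_int q * g)"
  show ?thesis
  proof (cases "s = 0")
    case True
    then show ?thesis using q eps0 Bp unfolding s_def by (intro exI[of _ q]) auto
  next
    case False
    then have s0: "s > 0" unfolding s_def by (simp add: order_less_le)
    have s2: "s \<le> 2 * eps" using q s_def by simp
    \<comment> \<open>The bound \<open>1 / (4 * s)\<close> prevents multiples of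
      \<open>q * g\<close> within a block from wrapping round the circle; the bound
      \<open>B / q\<close> keeps a block inside the range of \<open>R\<close>.\<close>
    define v where "v = min (1 / (4 * s)) (of_int B / of_int q)"
    have v1: "v \<ge> 1"
    proof -
      have "4 * s \<le> 1"
      proof -
        have "1 / (128 * K) \<le> 1 / 256" using K by (simp add: field_simps)
        then show ?thesis using s2 epsK by linarith
      qed
      then have "1 / (4 * s) \<ge> 1" using s0 by (simp add: field_simps)
      moreover have "of_int B / of_int q \<ge> (1::real)" using q B K by (simp add: field_simps)
      ultimately show ?thesis unfolding v_def by simp
    qed
    define V where "V = \<lfloor>v\<rfloor>"
    have V1: "V \<ge> 1" using v1 unfolding V_def by simp
    have V: "real_of_int V \<le> v" "real_of_int V \<ge> v / 2" "V \<ge> 1"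
    proof -
      have "v < of_int V + 1" unfolding V_def by linarith
      moreover have "real_of_int V \<ge> 1" using V1 by simp
      ultimately show "real_of_int V \<ge> v / 2" by linarith
    qed (use V1 in \<open>simp_all add: V_def\<close>)
    have qV: "real_of_int (q * V) \<le> of_int B"
    proof -
      have "of_int V \<le> real_of_int B / of_int q" using V(1) unfolding v_def by linarith
      then show ?thesis using q by (simp add: field_simps)
    qed
    have qV0: "q * V > 0" using q V by simp
    define f where "f = (\<lambda>r. (r mod q, r div (q * V)))"
    define C where "C = {0..<q} \<times> {(-B) div (q*V)..B div (q*V)}"
    have sub: "f ` R \<subseteq> C"
      unfolding f_def C_def using R q qV0 by (auto intro!: zdiv_mono1)
    have cC: "real (card C) \<le> 4 * of_int B / of_int V"
    proof -
      have "real (card C) = of_int q * (real_of_int (B div (q*V) - (-B) div (q*V)) + 1)"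
        using q qV0 Bp unfolding C_def by (simp add: card_cartesian_product zdiv_mono1)
      also have "\<dots> \<le> of_int q * (2 * (of_int B / of_int (q*V)) + 2)"
      proof -
        have "real_of_int (B div (q*V) - (-B) div (q*V)) + 1 \<le> 2 * (of_int B / of_int (q*V)) + 2"
          by (rule div_cells_le)
        then show ?thesis using q by (intro mult_left_mono) auto
      qed
      also have "\<dots> \<le> of_int q * (4 * (of_int B / of_int (q*V)))"
      proof -
        define z where "z = of_int B / real_of_int (q*V)"
        have "1 \<le> z" using qV qV0 unfolding z_def by (simp add: pos_le_divide_eq del: of_int_mult)
        then have "2 * z + 2 \<le> 4 * z" by linarith
        then have "2 * (of_int B / real_of_int (q*V)) + 2 \<le> 4 * (of_int B / real_of_int (q*V))"
          unfolding z_def .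
        then show ?thesis by (rule mult_left_mono) (use q in simp)
      qed
      also have "\<dots> = 4 * of_int B / of_int V" using q by (simp add: field_simps)
      finally show ?thesis .
    qed
    have finC: "finite C" unfolding C_def by simp
    obtain b where b: "b \<in> C" "real (card {r\<in>R. f r = b}) \<ge> real (card R) / real (card C)"
      using pigeonhole_real[of R C f] finR sub Rne finC by auto
    define A where "A = {r\<in>R. f r = b}"
    have cCp: "real (card C) > 0" using b(1) finC by (auto simp: card_gt_0_iff)
    have cA: "real (card A) \<ge> of_int V / (4 * K)"
    proof -
      have "of_int V / (4 * K) = (of_int B / K) / (4 * of_int B / of_int V)"
        using Bp V K by (simp add: field_simps)
      also have "\<dots> \<le> real (card R) / real (card C)"
        using cR cC cCp Bp K by (intro frac_le) auto
      finally show ?thesis using b A_def by simp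
    qed
    then have Ane: "A \<noteq> {}" using V K by (auto simp: divide_simps)
    have diff: "real_of_int (r' - r) \<le> of_int q * (2 * eps / s)" if "r \<in> A" "r' \<in> A" for r r'
    proof (cases "r' \<le> r")
      case True
      then have "real_of_int (r' - r) \<le> 0" by simp
      also have "0 \<le> of_int q * (2 * eps / s)" using q eps0 s0 by simp
      finally show ?thesis .
    next
      case False
      have e1: "r mod q = r' mod q" "r div (q*V) = r' div (q*V)" using that unfolding A_def f_def by auto
      then obtain n where n: "r' = r + q * n" by (metis mod_eqE mult.commute add.commute add_diff_cancel_left' diff_add_cancel mod_eq_dvd_iff dvdE)
      have n0: "n > 0" using False n q by (smt (verit) mult_nonneg_nonpos)
      have "r' - r < q * V"
      proof -
        have "r = q*V * (r div (q*V)) + r mod (q*V)" "r' = q*V * (r div (q*V)) + r' mod (q*V)"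
          using e1(2) by (metis mult_div_mod_eq)+
        moreover have "0 \<le> r mod (q*V)" "r' mod (q*V) < q*V" using qV0 by auto
        ultimately show ?thesis by linarith
      qed
      then have "n < V" using n q by simp
      then have nv: "of_int n \<le> 1 / (4 * s)" using V(1) unfolding v_def by linarith
      obtain m :: int where m: "s = \<bar>of_int q * g - of_int m\<bar>"
        using dist_circle_attained unfolding s_def by metis
      have "dist_circle (g * of_int (r' - r)) = dist_circle (of_int n * (of_int q * g - of_int m))"
      proof -
        have "g * of_int (r' - r) = of_int n * (of_int q * g - of_int m) + of_int (n * m)"
          using n by (simp add: algebra_simps)
        then show ?thesis by (simp only: dist_circle_add_int)
      qed
      also have "\<dots> = of_int n * s"
      proof -
        have "of_int n * s \<le> 1 / 4" using nv s0 by (simp add: field_simps)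
        moreover have "\<bar>of_int n * (of_int q * g - of_int m)\<bar> = of_int n * s"
          using n0 m by (simp add: abs_mult)
        ultimately show ?thesis by (simp add: dist_circle_eqI)
      qed
      finally have "of_int n * s \<le> 2 * eps"
        using dist_circle_diff[of "g * of_int r'" "g * of_int r"] eps[of r] eps[of r'] that A_def
        by (simp add: algebra_simps)
      then have "of_int n \<le> 2 * eps / s" using s0 by (simp add: field_simps)
      then have "of_int q * of_int n \<le> of_int q * (2 * eps / s)" by (rule mult_left_mono) (use q in simp)
      then show ?thesis using n by simp
    qed
    have cA2: "real (card A) \<le> 2 * eps / s + 1"
    proof -
      have "inj_on (\<lambda>r. r div q) A"
        unfolding A_def f_def by (intro inj_onI) (auto, metis mult_div_mod_eq)
      then have "card A = card ((\<lambda>r. r div q) ` A)" by (simp add: card_image)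
      moreover have "real (card ((\<lambda>r. r div q) ` A)) \<le> 2 * eps / s + 1"
      proof (rule card_le_diameter)
        fix a b assume "a \<in> (\<lambda>r. r div q) ` A" "b \<in> (\<lambda>r. r div q) ` A"
        then obtain r r' where r: "r \<in> A" "r' \<in> A" "a = r div q" "b = r' div q" by blast
        have "r mod q = r' mod q" using r unfolding A_def f_def by auto
        then have "r' - r = q * (b - a)" using r
          by (metis (no_types, opaque_lifting) add_diff_cancel_right mult_div_mod_eq right_diff_distrib)
        then have "of_int q * real_of_int (b - a) \<le> of_int q * (2 * eps / s)"
          using diff[OF r(1,2)] by (metis of_int_mult)
        then show "real_of_int (b - a) \<le> 2 * eps / s"
          by (rule mult_left_le_imp_le) (use q in simp)
      qed (use A_def finR Ane in auto)
      ultimately show ?thesis by simp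
    qed
    then have key: "of_int V * s \<le> 16 * K * eps"
    proof -
      have "of_int V / (4 * K) * s \<le> (2 * eps / s + 1) * s"
        using cA cA2 s0 by (intro mult_right_mono) auto
      also have "\<dots> \<le> 4 * eps" using s0 s2 by (simp add: field_simps)
      finally show ?thesis using K by (simp add: field_simps)
    qed
    \<comment> \<open>Were the wrapping bound the active one, \<open>V * s\<close> would be at least
      \<open>1 / 8\<close>. The hypothesis \<open>eps < 1 / (128 * K)\<close> excludes this through
      \<open>key\<close>, so blocks have length about \<open>B\<close>.\<close>
    have "v = of_int B / of_int q"
    proof (rule ccontr)
      assume "v \<noteq> of_int B / of_int q"
      then have "v = 1 / (4 * s)" unfolding v_def by linarith
      then have vs: "v * s = 1 / 4" using s0 by simp
      have "(v / 2) * s \<le> of_int V * s" using V(2) s0 by (intro mult_right_mono) auto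
      then have "of_int V * s \<ge> 1 / 8" using vs by linarith
      moreover have "16 * K * eps < 1 / 8" using epsK K by (simp add: field_simps)
      ultimately show False using key by linarith
    qed
    then have "of_int B / of_int q * s \<le> 32 * K * eps" 
    proof -
      have "v * s \<le> (2 * of_int V) * s" using V(2) s0 by (intro mult_right_mono) auto
      then show ?thesis using key \<open>v = of_int B / of_int q\<close> by simp
    qed
    then have "s \<le> 32 * K * eps * of_int q / of_int B" using q Bp by (simp add: field_simps)
    also have "\<dots> \<le> 32 * K * eps * (5 * K) / of_int B"
      using q Bp K eps0 by (intro divide_right_mono mult_left_mono) auto
    also have "\<dots> = 160 * K\<^sup>2 * eps / of_int B" by (simp add: power2_eq_square)
    finally show ?thesis using q s_def by blast
  qed
qed

section \<open>Removing bounded factors and translating sums\<close>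

lemma norm_sum_squared_le_card:
  fixes a b :: "'a \<Rightarrow> complex"
  assumes "\<And>i. i \<in> A \<Longrightarrow> norm (a i) \<le> 1"
  shows "(norm (\<Sum>i\<in>A. a i * b i))\<^sup>2 \<le> real (card A) * (\<Sum>i\<in>A. (norm (b i))\<^sup>2)"
proof -
  have "norm (\<Sum>i\<in>A. a i * b i) \<le> (\<Sum>i\<in>A. norm (b i))"
    using assms by (intro sum_norm_le) (auto simp: norm_mult intro: mult_left_le_one_le)
  then have "(norm (\<Sum>i\<in>A. a i * b i))\<^sup>2 \<le> (\<Sum>i\<in>A. norm (b i))\<^sup>2"
    by (intro power_mono) auto
  also have "\<dots> \<le> (\<Sum>i\<in>A. (norm (b i))\<^sup>2) * real (card A)"
    by (rule sum_squared_le_sum_of_squares)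
  finally show ?thesis by (simp add: mult.commute)
qed

lemma norm_sum_squared:
  "complex_of_real ((norm (\<Sum>i\<in>A. f i))\<^sup>2) = (\<Sum>i\<in>A. \<Sum>j\<in>A. f i * cnj (f j))"
  unfolding complex_norm_square by (simp add: sum_product)

lemma norm_sum_diff_le:
  fixes H :: "'a \<Rightarrow> complex"
  assumes "finite A" "finite B" "\<And>i. norm (H i) \<le> 1"
  shows "norm (sum H A - sum H B) \<le> real (card (A - B)) + real (card (B - A))"
proof -
  have "sum H A = sum H (A \<inter> B) + sum H (A - B)" using assms(1) by (rule sum.Int_Diff)
  moreover have "sum H B = sum H (A \<inter> B) + sum H (B - A)"
    using sum.Int_Diff[OF assms(2), of H A] by (simp add: Int_commute)
  ultimately have "sum H A - sum H B = sum H (A - B) - sum H (B - A)" by simp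
  also have "norm \<dots> \<le> norm (sum H (A - B)) + norm (sum H (B - A))" by (rule norm_triangle_ineq4)
  also have "\<dots> \<le> real (card (A - B)) * 1 + real (card (B - A)) * 1"
    using assms(3) by (intro add_mono sum_norm_bound)
  finally show ?thesis by simp
qed

lemma norm_interval_shift_le:
  fixes H :: "int \<Rightarrow> complex"
  assumes "\<And>i. norm (H i) \<le> 1" "s \<ge> 0"
  shows "norm ((\<Sum>d\<in>{a..b}. H d) - (\<Sum>d\<in>{a..b}. H (d + s))) \<le> 2 * of_int s"
proof -
  have "(\<Sum>d\<in>{a..b}. H (d + s)) = (\<Sum>d\<in>{a+s..b+s}. H d)"
    by (rule sum.reindex_bij_witness[of _ "\<lambda>d. d - s" "\<lambda>d. d + s"]) (auto)
  moreover have "card ({a..b} - {a+s..b+s}) \<le> card {a..<a+s}" using assms(2) by (intro card_mono) auto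
  moreover have "card ({a+s..b+s} - {a..b}) \<le> card {b<..b+s}" using assms(2) by (intro card_mono) auto
  ultimately show ?thesis
    using norm_sum_diff_le[of "{a..b}" "{a+s..b+s}" H] assms by simp
qed

text \<open>Translating \<open>d\<close> by multiples of \<open>q\<close> leaves a quadratic phase with frequency close to
  a multiple of \<open>1/q\<close> essentially unchanged, so it can be averaged away.\<close>

lemma quadratic_phase_shift:
  fixes h :: "int \<Rightarrow> complex" and q R T :: int
  assumes hb: "\<And>d. norm (h d) \<le> 1" and J: "{a..b} \<subseteq> {-T..T}" and q: "q \<ge> 1" and R: "R \<ge> 1"
    and T: "T \<ge> 0" and kap: "dist_circle (of_int q * \<alpha>) \<le> \<kappa>"
  shows "norm (\<Sum>d\<in>{a..b}. h d * add_char (\<alpha> * (of_int d)\<^sup>2))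
    \<le> (\<Sum>d\<in>{a..b}. norm (\<Sum>r\<in>{0..<R}. h (d + q * r))) / of_int R + 2 * of_int (q * R)
      + (2 * of_int T + 1) * (8 * (of_int (2 * R * T + q * R\<^sup>2) * \<kappa>))"
proof -
  define H where "H = (\<lambda>d. h d * add_char (\<alpha> * (of_int d)\<^sup>2))"
  have Hb: "norm (H d) \<le> 1" for d using hb by (simp add: H_def norm_mult)
  define X where "X = (\<Sum>d\<in>{a..b}. H d)"
  define Xs where "Xs = (\<lambda>r. \<Sum>d\<in>{a..b}. H (d + q * r))"
  define \<epsilon> where "\<epsilon> = 8 * (of_int (2 * R * T + q * R\<^sup>2) * \<kappa>)"
  have kap0: "\<kappa> \<ge> 0" using kap dist_circle_nonneg order_trans by blast
  have eps0: "\<epsilon> \<ge> 0" unfolding \<epsilon>_def using kap0 T R q by simp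
  have cJ: "real (card {a..b}) \<le> 2 * of_int T + 1"
  proof -
    have "card {a..b} \<le> card {-T..T}" using J by (intro card_mono) auto
    then show ?thesis using T by simp
  qed
  have cR: "real (card {0..<R}) = of_int R" using R by simp
  have e1: "norm (\<Sum>r\<in>{0..<R}. X - Xs r) \<le> of_int R * (2 * of_int (q * R))"
  proof -
    have "norm (X - Xs r) \<le> 2 * of_int (q * R)" if "r \<in> {0..<R}" for r
    proof -
      have "norm (X - Xs r) \<le> 2 * of_int (q * r)"
        unfolding X_def Xs_def by (rule norm_interval_shift_le[OF Hb]) (use that q in simp)
      also have "real_of_int (q * r) \<le> of_int (q * R)" using that q by (intro of_int_le_iff[THEN iffD2] mult_left_mono) auto
      finally show ?thesis by simp
    qed
    then show ?thesis using sum_norm_bound[of "{0..<R}" "\<lambda>r. X - Xs r"] cR by simp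
  qed
  have e2: "norm (\<Sum>r\<in>{0..<R}. H (d + q * r)) \<le> norm (\<Sum>r\<in>{0..<R}. h (d + q * r)) + of_int R * \<epsilon>"
    if d: "d \<in> {a..b}" for d
  proof -
    define c where "c = add_char (\<alpha> * (of_int d)\<^sup>2)"
    \<comment> \<open>Expanding the square of \<open>d + q * r\<close> leaves only multiples of
      \<open>q * \<alpha>\<close> besides the term \<open>\<alpha> * d^2\<close>, so closeness of
      \<open>q * \<alpha>\<close> to an integer makes the phase nearly constant in
      \<open>r\<close>.\<close>
    define u where "u = (\<lambda>r. of_int (2 * r * d + q * r\<^sup>2) * (of_int q * \<alpha>))"
    have Hd: "H (d + q * r) = c * h (d + q * r) + c * h (d + q * r) * (add_char (u r) - 1)" for r
    proof -
      have "\<alpha> * (of_int (d + q * r))\<^sup>2 = \<alpha> * (of_int d)\<^sup>2 + u r"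
        by (simp add: u_def power2_eq_square algebra_simps)
      then show ?thesis unfolding H_def c_def by (simp add: add_char_add algebra_simps)
    qed
    have ur: "norm (add_char (u r) - 1) \<le> \<epsilon>" if r: "r \<in> {0..<R}" for r
    proof -
      have "\<bar>2 * r * d + q * r\<^sup>2\<bar> \<le> 2 * R * T + q * R\<^sup>2"
      proof -
        have "\<bar>d\<bar> \<le> T" using d J by auto
        then have "\<bar>2 * r * d\<bar> \<le> 2 * R * T" using r R T
          by (auto simp: abs_mult intro!: mult_mono)
        moreover have "\<bar>q * r\<^sup>2\<bar> \<le> q * R\<^sup>2" using r q by (auto simp: abs_mult intro!: mult_left_mono power_mono)
        ultimately show ?thesis by linarith
      qed
      then have rr: "\<bar>real_of_int (2 * r * d + q * r\<^sup>2)\<bar> \<le> of_int (2 * R * T + q * R\<^sup>2)" by linarith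
      have "norm (add_char (u r) - 1) \<le> 8 * dist_circle (u r)" by (rule norm_add_char_minus_1_le)
      also have "dist_circle (u r) \<le> \<bar>of_int (2 * r * d + q * r\<^sup>2)\<bar> * dist_circle (of_int q * \<alpha>)"
        unfolding u_def by (rule dist_circle_mult)
      also have "\<dots> \<le> of_int (2 * R * T + q * R\<^sup>2) * \<kappa>"
        using rr kap by (intro mult_mono) auto
      finally show ?thesis unfolding \<epsilon>_def by simp
    qed
    have "(\<Sum>r\<in>{0..<R}. H (d + q * r)) = c * (\<Sum>r\<in>{0..<R}. h (d + q * r))
        + (\<Sum>r\<in>{0..<R}. c * h (d + q * r) * (add_char (u r) - 1))"
      unfolding Hd by (simp add: sum.distrib sum_distrib_left)
    also have "norm \<dots> \<le> norm (c * (\<Sum>r\<in>{0..<R}. h (d + q * r)))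
        + norm (\<Sum>r\<in>{0..<R}. c * h (d + q * r) * (add_char (u r) - 1))" by (rule norm_triangle_ineq)
    also have "norm (c * (\<Sum>r\<in>{0..<R}. h (d + q * r))) = norm (\<Sum>r\<in>{0..<R}. h (d + q * r))"
      by (simp add: c_def norm_mult)
    also have "norm (\<Sum>r\<in>{0..<R}. c * h (d + q * r) * (add_char (u r) - 1)) \<le> real (card {0..<R}) * \<epsilon>"
    proof (rule sum_norm_bound)
      fix r assume r: "r \<in> {0..<R}"
      have "norm (c * h (d + q * r) * (add_char (u r) - 1)) = norm (h (d + q * r)) * norm (add_char (u r) - 1)"
        by (simp add: norm_mult c_def)
      also have "\<dots> \<le> 1 * \<epsilon>" using hb ur[OF r] by (intro mult_mono) auto
      finally show "norm (c * h (d + q * r) * (add_char (u r) - 1)) \<le> \<epsilon>" by simp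
    qed
    finally show ?thesis using cR by simp
  qed
  have e3: "norm (\<Sum>r\<in>{0..<R}. Xs r) \<le> (\<Sum>d\<in>{a..b}. norm (\<Sum>r\<in>{0..<R}. h (d + q * r)))
      + (2 * of_int T + 1) * (of_int R * \<epsilon>)"
  proof -
    have "(\<Sum>r\<in>{0..<R}. Xs r) = (\<Sum>d\<in>{a..b}. \<Sum>r\<in>{0..<R}. H (d + q * r))"
      unfolding Xs_def by (rule sum.swap)
    also have "norm \<dots> \<le> (\<Sum>d\<in>{a..b}. norm (\<Sum>r\<in>{0..<R}. h (d + q * r)) + of_int R * \<epsilon>)"
      using e2 by (intro sum_norm_le) auto
    also have "\<dots> = (\<Sum>d\<in>{a..b}. norm (\<Sum>r\<in>{0..<R}. h (d + q * r))) + real (card {a..b}) * (of_int R * \<epsilon>)"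
      by (simp add: sum.distrib)
    also have "real (card {a..b}) * (of_int R * \<epsilon>) \<le> (2 * of_int T + 1) * (of_int R * \<epsilon>)"
      using cJ eps0 R by (intro mult_right_mono) auto
    finally show ?thesis by simp
  qed
  have "of_int R * X = (\<Sum>r\<in>{0..<R}. X - Xs r) + (\<Sum>r\<in>{0..<R}. Xs r)"
    using R by (simp add: sum_subtractf)
  then have "of_int R * norm X \<le> norm (\<Sum>r\<in>{0..<R}. X - Xs r) + norm (\<Sum>r\<in>{0..<R}. Xs r)"
    using norm_triangle_ineq[of "\<Sum>r\<in>{0..<R}. X - Xs r" "\<Sum>r\<in>{0..<R}. Xs r"] R
    by (simp add: norm_mult flip: \<open>of_int R * X = _\<close>)
  also have "\<dots> \<le> of_int R * (2 * of_int (q * R)) + ((\<Sum>d\<in>{a..b}. norm (\<Sum>r\<in>{0..<R}. h (d + q * r)))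
      + (2 * of_int T + 1) * (of_int R * \<epsilon>))" using e1 e3 by linarith
  also have "\<dots> = of_int R * ((\<Sum>d\<in>{a..b}. norm (\<Sum>r\<in>{0..<R}. h (d + q * r))) / of_int R
      + 2 * of_int (q * R) + (2 * of_int T + 1) * \<epsilon>)" using R by (simp add: field_simps)
  finally have "norm X \<le> (\<Sum>d\<in>{a..b}. norm (\<Sum>r\<in>{0..<R}. h (d + q * r))) / of_int R
      + 2 * of_int (q * R) + (2 * of_int T + 1) * \<epsilon>" using R by (simp add: mult_le_cancel_left_pos)
  then show ?thesis unfolding X_def H_def \<epsilon>_def .
qed

section \<open>Weyl sums and major arcs\<close>

text \<open>As \<open>K \<ge> 2\<close>, a constant of at most \<open>2 ^ m\<close> costs
  \<open>m\<close> powers of \<open>K\<close>. All numerical constants below are absorbed in this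
  way, which explains the small increments between successive exponents.\<close>

lemma const_le_power:
  fixes K c :: real
  assumes "K \<ge> 2" "c \<le> 2 ^ m" "m + a \<le> b"
  shows "c * K ^ a \<le> K ^ b"
proof -
  have "c * K ^ a \<le> 2 ^ m * K ^ a" using assms by (intro mult_right_mono) auto
  also have "\<dots> \<le> K ^ m * K ^ a" using assms by (intro mult_right_mono power_mono) auto
  also have "\<dots> = K ^ (m + a)" by (simp add: power_add)
  also have "\<dots> \<le> K ^ b" using assms by (intro power_increasing) auto
  finally show ?thesis .
qed

text \<open>Terms below the threshold \<open>v\<close> contribute at most half of \<open>S\<close>,
  so the terms above it, each at most \<open>u\<close>, carry the other half.\<close>

lemma card_large_terms:
  fixes E :: "'a \<Rightarrow> real"
  assumes "finite A" "\<And>i. i \<in> A \<Longrightarrow> E i \<le> u" "0 \<le> v" "0 \<le> u" "2 * v * real (card A) \<le> S" "S \<le> (\<Sum>i\<in>A. E i)"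
  shows "S / 2 \<le> u * real (card {i\<in>A. v \<le> E i})"
proof -
  have "S \<le> (\<Sum>i\<in>A. E i)" by fact
  also have "\<dots> \<le> (\<Sum>i\<in>A. v + (if v \<le> E i then u else 0))"
    using assms by (intro sum_mono) fastforce
  also have "\<dots> = v * real (card A) + u * real (card {i\<in>A. v \<le> E i})"
    using assms(1) by (simp add: sum.distrib sum.If_cases mult.commute Int_def)
  finally show ?thesis using assms by linarith
qed

lemma exists_ge_average:
  fixes E :: "'a \<Rightarrow> real"
  assumes "finite A" "S \<le> (\<Sum>i\<in>A. E i)" "real (card A) \<le> c" "0 < c" "0 < S"
  shows "\<exists>i\<in>A. S / c \<le> E i"
proof (rule ccontr)
  assume "\<not> ?thesis"
  then have lt: "E i < S / c" if "i \<in> A" for i using that by fastforce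
  have "A \<noteq> {}" using assms by auto
  then have "(\<Sum>i\<in>A. E i) < real (card A) * (S / c)"
    using sum_strict_mono[of A E "\<lambda>_. S / c"] lt assms(1) by simp
  also have "\<dots> \<le> c * (S / c)" using assms by (intro mult_right_mono) auto
  finally show False using assms by simp
qed

text \<open>Weyl differencing kept as an identity: pairs are sorted by their difference
  \<open>r\<close>, and the admissible \<open>d\<close> still form an interval, as the geometric
  series bound requires.\<close>

lemma sum_square_differences:
  fixes f :: "int \<Rightarrow> complex"
  shows "complex_of_real ((norm (\<Sum>d\<in>{a..b}. f d))\<^sup>2)
    = (\<Sum>r\<in>{a-b..b-a}. \<Sum>d\<in>{max a (a-r)..min b (b-r)}. f (d + r) * cnj (f d))"
proof -
  have "complex_of_real ((norm (\<Sum>d\<in>{a..b}. f d))\<^sup>2) = (\<Sum>(d', d)\<in>{a..b} \<times> {a..b}. f d' * cnj (f d))"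
    unfolding norm_sum_squared by (rule sum.cartesian_product)
  also have "\<dots> = (\<Sum>(r, d)\<in>Sigma {a-b..b-a} (\<lambda>r. {max a (a-r)..min b (b-r)}). f (d + r) * cnj (f d))"
    by (rule sum.reindex_bij_witness[of _ "\<lambda>(r, d). (d + r, d)" "\<lambda>(d', d). (d' - d, d)"]) auto
  also have "\<dots> = (\<Sum>r\<in>{a-b..b-a}. \<Sum>d\<in>{max a (a-r)..min b (b-r)}. f (d + r) * cnj (f d))"
    by (rule sum.Sigma[symmetric]) auto
  finally show ?thesis .
qed

text \<open>After one differencing the inner sums are geometric with ratio
  \<open>add_char (2 * \<alpha> * r)\<close>. A large total forces many \<open>r\<close> for which
  \<open>2 * \<alpha> * r\<close> is within about \<open>K^2 / T\<close> of an integer, and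
  \<open>recurrence_major\<close> converts this density into a major arc of width
  \<open>T^(-2)\<close>.\<close>

lemma weyl_quadratic:
  fixes T :: int
  assumes K: "K \<ge> 2" and T: "of_int T \<ge> K ^ 20" and J: "{a..b} \<subseteq> {-T..T}"
    and big: "norm (\<Sum>d\<in>{a..b}. add_char (\<alpha> * (of_int d)\<^sup>2 + \<beta> * of_int d)) \<ge> of_int T / K"
  shows "\<exists>q::int. 0 < q \<and> of_int q \<le> K ^ 10 \<and> dist_circle (of_int q * \<alpha>) \<le> K ^ 25 / (of_int T)\<^sup>2"
proof -
  define t where "t = real_of_int T"
  have "0 < K ^ 20" using K by simp
  then have t: "t \<ge> K ^ 20" "t > 0" using T unfolding t_def by linarith+
  have T0: "T > 0" using t t_def by simp
  define f where "f = (\<lambda>d::int. add_char (\<alpha> * (of_int d)\<^sup>2 + \<beta> * of_int d))"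
  define E where "E = (\<lambda>r. norm (\<Sum>d\<in>{max a (a-r)..min b (b-r)}. add_char (of_int d * (2 * \<alpha> * of_int r))))"
  have ab: "a \<le> b"
  proof (rule ccontr)
    assume "\<not> a \<le> b"
    then have "of_int T / K \<le> 0" using big by simp
    then show False using t K unfolding t_def by (simp add: field_simps)
  qed
  have Jab: "-T \<le> a" "b \<le> T" using J ab by auto
  have Er: "norm (\<Sum>d\<in>{max a (a-r)..min b (b-r)}. f (d + r) * cnj (f d)) = E r" for r
  proof -
    have "f (d + r) * cnj (f d) = add_char (\<alpha> * (of_int r)\<^sup>2 + \<beta> * of_int r) * add_char (of_int d * (2 * \<alpha> * of_int r))" for d
      unfolding f_def add_char_diff[symmetric] add_char_add[symmetric]
      by (rule arg_cong[of _ _ add_char]) (simp add: power2_eq_square algebra_simps)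
    then show ?thesis by (simp add: E_def norm_mult flip: sum_distrib_left)
  qed
  have "(t / K)\<^sup>2 \<le> (norm (\<Sum>d\<in>{a..b}. f d))\<^sup>2"
    using big t K unfolding f_def t_def by (intro power_mono) auto
  also have "\<dots> = norm (complex_of_real ((norm (\<Sum>d\<in>{a..b}. f d))\<^sup>2))"
    by (simp del: of_real_power)
  also have "\<dots> \<le> (\<Sum>r\<in>{a-b..b-a}. E r)"
    unfolding sum_square_differences using Er by (intro sum_norm_le) auto
  also have "\<dots> \<le> (\<Sum>r\<in>{-(2*T)..2*T}. E r)"
    using Jab by (intro sum_mono2) (auto simp: E_def)
  finally have sumE: "(t / K)\<^sup>2 \<le> (\<Sum>r\<in>{-(2*T)..2*T}. E r)" .
  have Eu: "E r \<le> 3 * t" for r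
  proof -
    have "E r \<le> real (card {max a (a-r)..min b (b-r)}) * 1"
      unfolding E_def by (rule sum_norm_bound) simp
    also have "card {max a (a-r)..min b (b-r)} \<le> card {-T..T}" using Jab by (intro card_mono) auto
    then have "real (card {max a (a-r)..min b (b-r)}) * 1 \<le> 3 * t"
      using T0 unfolding t_def by simp
    finally show ?thesis .
  qed
  \<comment> \<open>Half of the average: the total is at least \<open>(t / K)^2\<close> and at most
    \<open>5 * t\<close> values of \<open>r\<close> occur.\<close>
  define v where "v = t / (10 * K\<^sup>2)"
  define R where "R = {r\<in>{-(2*T)..2*T}. v \<le> E r}"
  have "(t / K)\<^sup>2 / 2 \<le> 3 * t * real (card R)"
    unfolding R_def
  proof (rule card_large_terms[OF _ Eu _ _ _ sumE])
    have "real (card {-(2*T)..2*T}) \<le> 5 * t" using T0 unfolding t_def by simp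
    then have "2 * v * real (card {-(2*T)..2*T}) \<le> 2 * v * (5 * t)"
      using t K unfolding v_def by (intro mult_left_mono) auto
    also have "\<dots> = (t / K)\<^sup>2" unfolding v_def using K by (simp add: field_simps power2_eq_square)
    finally show "2 * v * real (card {-(2*T)..2*T}) \<le> (t / K)\<^sup>2" .
  qed (use t K in \<open>auto simp: v_def\<close>)
  then have cR: "real (card R) \<ge> t / (6 * K\<^sup>2)"
    using t K by (simp add: field_simps power2_eq_square)
  \<comment> \<open>The set \<open>R\<close> has density \<open>1 / (12 * K^2)\<close> relative to
    the bound \<open>2 * T\<close> on its elements; a power of \<open>K\<close> above
    \<open>12 * K^2\<close> serves as the density parameter.\<close>
  define K' where "K' = K ^ 6"
  have K': "K' \<ge> 2" using self_le_power[of K 6] K unfolding K'_def by simp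
  have p1: "12 * K\<^sup>2 \<le> K'" unfolding K'_def by (rule const_le_power[OF K, of _ 4]) auto
  have dR: "dist_circle (2 * \<alpha> * of_int r) \<le> 10 * K\<^sup>2 / t" if "r \<in> R" for r
  proof -
    have "v * dist_circle (2 * \<alpha> * of_int r) \<le> E r * dist_circle (2 * \<alpha> * of_int r)"
      using that R_def by (intro mult_right_mono) auto
    also have "\<dots> \<le> 1" unfolding E_def by (rule norm_sum_add_char_le)
    finally show ?thesis unfolding v_def using t K by (simp add: field_simps)
  qed
  have "\<exists>q::int. 0 < q \<and> of_int q \<le> 5 * K' \<and> dist_circle (of_int q * (2 * \<alpha>)) \<le> 160 * K'\<^sup>2 * (10 * K\<^sup>2 / t) / of_int (2 * T)"
  proof (rule recurrence_major[OF K' _ _ _ dR])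
    have "8 * K' \<le> K ^ 9" unfolding K'_def by (rule const_le_power[OF K, of _ 3]) auto
    also have "\<dots> \<le> K ^ 20" using K by (intro power_increasing) auto
    also have "\<dots> < real_of_int (2 * T)" using t unfolding t_def by simp
    finally show "8 * K' < real_of_int (2 * T)" .
    show "R \<subseteq> {-(2*T)..2*T}" unfolding R_def by auto
    have "of_int (2*T) / K' \<le> 2 * t / (12 * K\<^sup>2)"
      using p1 t K K' divide_left_mono[OF p1, of "2 * t"] unfolding t_def by simp
    also have "\<dots> = t / (6 * K\<^sup>2)" by simp
    finally show "of_int (2*T) / K' \<le> real (card R)" using cR by linarith
    have "2000 * K ^ 8 \<le> K ^ 19" by (rule const_le_power[OF K, of _ 11]) auto
    also have "\<dots> < K ^ 20" using K by simp
    also have "\<dots> \<le> t" using t by simp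
    finally have "2000 * K ^ 8 < t" .
    moreover have "10 * K\<^sup>2 * (128 * K') = 1280 * K ^ 8" unfolding K'_def by (simp flip: power_add)
    ultimately have "10 * K\<^sup>2 * (128 * K') < t" using zero_less_power[of K 8] K by linarith
    then show "10 * K\<^sup>2 / t < 1 / (128 * K')" using t K' by (simp add: field_simps)
  qed
  then obtain q where q: "0 < q" "of_int q \<le> 5 * K'"
    "dist_circle (of_int q * (2 * \<alpha>)) \<le> 160 * K'\<^sup>2 * (10 * K\<^sup>2 / t) / of_int (2 * T)" by blast
  \<comment> \<open>Recurrence was applied to \<open>2 * \<alpha>\<close>, the coefficient produced
    by differencing, so the denominator for \<open>\<alpha>\<close> is doubled.\<close>
  show ?thesis
  proof (intro exI[of _ "2 * q"] conjI)
    show "0 < 2 * q" using q by simp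
    have "10 * K' \<le> K ^ 10" unfolding K'_def by (rule const_le_power[OF K, of _ 4]) auto
    then show "real_of_int (2 * q) \<le> K ^ 10" using q by simp
    have "800 * K ^ 14 \<le> K ^ 25" by (rule const_le_power[OF K, of _ 10]) auto
    moreover have "160 * K'\<^sup>2 * (10 * K\<^sup>2 / t) / of_int (2 * T) = 800 * (K'\<^sup>2 * K\<^sup>2) / t\<^sup>2"
      using t by (simp add: t_def power2_eq_square field_simps)
    moreover have "K'\<^sup>2 * K\<^sup>2 = K ^ 14" unfolding K'_def by (simp flip: power_add power_mult)
    ultimately have "160 * K'\<^sup>2 * (10 * K\<^sup>2 / t) / of_int (2 * T) \<le> K ^ 25 / t\<^sup>2"
      by (simp add: divide_right_mono del: of_int_mult)
    then show "dist_circle (of_int (2 * q) * \<alpha>) \<le> K ^ 25 / (of_int T)\<^sup>2"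
      using q unfolding t_def by (simp add: mult.assoc mult.left_commute)
  qed
qed

text \<open>The quadratic coefficient is on a major arc by \<open>weyl_quadratic\<close>, so
  shifting along multiples of its denominator \<open>q\<close> removes it by
  \<open>quadratic_phase_shift\<close>. What remains is a geometric sum with ratio
  \<open>add_char (q * \<beta>)\<close>. The same \<open>q\<close> therefore serves for
  \<open>\<beta>\<close>, whose approximation is of order \<open>1 / T\<close>.\<close>

lemma weyl_linear:
  fixes T :: int
  assumes K: "K \<ge> 2" and T: "of_int T \<ge> K ^ 36" and J: "{a..b} \<subseteq> {-T..T}"
    and big: "norm (\<Sum>d\<in>{a..b}. add_char (\<alpha> * (of_int d)\<^sup>2 + \<beta> * of_int d)) \<ge> of_int T / K"
  shows "\<exists>q::int. 0 < q \<and> of_int q \<le> K ^ 10 \<and> dist_circle (of_int q * \<beta>) \<le> K ^ 41 / of_int T"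
proof -
  define t where "t = real_of_int T"
  have "0 < K ^ 36" using K by simp
  then have t: "t \<ge> K ^ 36" "t > 0" using T unfolding t_def by linarith+
  have T0: "T > 0" using t t_def by simp
  have "K ^ 20 \<le> K ^ 36" using K by (intro power_increasing) auto
  then have "of_int T \<ge> K ^ 20" using T by linarith
  from weyl_quadratic[OF K this J big] obtain q :: int where q: "0 < q" "of_int q \<le> K ^ 10"
    "dist_circle (of_int q * \<alpha>) \<le> K ^ 25 / t\<^sup>2" unfolding t_def by blast
  \<comment> \<open>The length balances two errors of \<open>quadratic_phase_shift\<close>: the
    boundary term \<open>2 * q * R\<close> with \<open>q \<le> K^10\<close>, and the phase variation
    of about \<open>72 * K^25 * R\<close>. Both have to stay below
    \<open>t / (8 * K)\<close>.\<close>
  define R where "R = \<lfloor>t / K ^ 36\<rfloor>"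
  have "t / K ^ 36 \<ge> 1" using t K by simp
  then have R1: "R \<ge> 1" unfolding R_def by simp
  have R: "R \<ge> 1" "of_int R \<le> t / K ^ 36" "t / K ^ 36 \<le> 2 * of_int R"
  proof -
    have "t / K ^ 36 < of_int R + 1" unfolding R_def by linarith
    moreover have "real_of_int R \<ge> 1" using R1 by simp
    ultimately show "t / K ^ 36 \<le> 2 * of_int R" by linarith
  qed (use R1 in \<open>simp_all add: R_def\<close>)
  have RK: "of_int R * K ^ 36 \<le> t" using R(2) K by (simp add: field_simps)
  define h where "h = (\<lambda>d::int. add_char (\<beta> * of_int d))"
  define A where "A = norm (\<Sum>r\<in>{0..<R}. add_char (of_int r * (of_int q * \<beta>)))"
  have "t / K \<le> norm (\<Sum>d\<in>{a..b}. h d * add_char (\<alpha> * (of_int d)\<^sup>2))"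
    using big unfolding h_def t_def by (simp add: add_char_add[symmetric] add.commute)
  also have "\<dots> \<le> (\<Sum>d\<in>{a..b}. norm (\<Sum>r\<in>{0..<R}. h (d + q * r))) / of_int R + 2 * of_int (q * R)
      + (2 * of_int T + 1) * (8 * (of_int (2 * R * T + q * R\<^sup>2) * (K ^ 25 / t\<^sup>2)))"
    by (rule quadratic_phase_shift[OF _ J]) (use q R T0 in \<open>auto simp: h_def\<close>)
  also have "(\<Sum>d\<in>{a..b}. norm (\<Sum>r\<in>{0..<R}. h (d + q * r))) \<le> 3 * t * A"
  proof -
    have "(\<Sum>r\<in>{0..<R}. h (d + q * r)) = add_char (\<beta> * of_int d) * (\<Sum>r\<in>{0..<R}. add_char (of_int r * (of_int q * \<beta>)))" for d
      unfolding sum_distrib_left h_def add_char_add[symmetric]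
      by (intro sum.cong arg_cong[of _ _ add_char]) (auto simp: algebra_simps)
    then have "norm (\<Sum>r\<in>{0..<R}. h (d + q * r)) = A" for d by (simp add: A_def norm_mult)
    then have "(\<Sum>d\<in>{a..b}. norm (\<Sum>r\<in>{0..<R}. h (d + q * r))) = real (card {a..b}) * A" by simp
    also have "card {a..b} \<le> card {-T..T}" using J by (intro card_mono) auto
    then have "real (card {a..b}) * A \<le> 3 * t * A"
      using T0 unfolding t_def A_def by (intro mult_right_mono) auto
    finally show ?thesis .
  qed
  also have "2 * of_int (q * R) \<le> t / (8 * K)"
  proof -
    have "16 * K ^ 11 \<le> K ^ 36" by (rule const_le_power[OF K, of _ 4]) auto
    then have "of_int R * (16 * K ^ 11) \<le> of_int R * K ^ 36" by (rule mult_left_mono) (use R in auto)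
    then have "of_int R * (16 * K ^ 11) \<le> t" using RK by linarith
    moreover have "of_int R * (16 * K * of_int q) \<le> of_int R * (16 * K ^ 11)"
    proof (rule mult_left_mono)
      have "16 * K * of_int q \<le> 16 * K * K ^ 10" using q K by (intro mult_left_mono) auto
      then show "16 * K * of_int q \<le> 16 * K ^ 11" by (simp flip: power_Suc)
    qed (use R in auto)
    ultimately show ?thesis using K by (simp add: field_simps)
  qed
  also have "(2 * of_int T + 1) * (8 * (of_int (2 * R * T + q * R\<^sup>2) * (K ^ 25 / t\<^sup>2))) \<le> t / (8 * K)"
  proof -
    have qR: "of_int q * of_int R \<le> t"
    proof -
      have "of_int q * of_int R \<le> K ^ 10 * of_int R" using q R by (intro mult_right_mono) auto
      also have "\<dots> \<le> K ^ 36 * of_int R" using K R by (intro mult_right_mono power_increasing) auto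
      finally show ?thesis using RK by (simp add: mult.commute)
    qed
    have "of_int (2 * R * T + q * R\<^sup>2) = of_int R * (2 * t + of_int q * of_int R)"
      unfolding t_def by (simp add: algebra_simps power2_eq_square)
    also have "\<dots> \<le> of_int R * (3 * t)" using qR R by (intro mult_left_mono) auto
    finally have i1: "of_int (2 * R * T + q * R\<^sup>2) \<le> of_int R * (3 * t)" .
    have "(2 * of_int T + 1) * (8 * (of_int (2 * R * T + q * R\<^sup>2) * (K ^ 25 / t\<^sup>2)))
       \<le> (3 * t) * (8 * (of_int R * (3 * t) * (K ^ 25 / t\<^sup>2)))"
    proof (rule mult_mono)
      show "2 * of_int T + 1 \<le> 3 * t" using T0 t_def by simp
      show "8 * (of_int (2 * R * T + q * R\<^sup>2) * (K ^ 25 / t\<^sup>2)) \<le> 8 * (of_int R * (3 * t) * (K ^ 25 / t\<^sup>2))"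
        using i1 K by (intro mult_left_mono mult_right_mono) auto
      have "0 \<le> 2 * R * T + q * R\<^sup>2" using R T0 q by simp
      then show "0 \<le> 8 * (real_of_int (2 * R * T + q * R\<^sup>2) * (K ^ 25 / t\<^sup>2))"
        using K by (intro mult_nonneg_nonneg) (auto simp del: of_int_add of_int_mult)
    qed (use t in auto)
    also have "\<dots> = 72 * K ^ 25 * of_int R" using t by (simp add: field_simps power2_eq_square)
    also have "\<dots> \<le> t / (8 * K)"
    proof -
      have "576 * K ^ 26 \<le> K ^ 36" by (rule const_le_power[OF K, of _ 10]) auto
      then have "of_int R * (576 * K ^ 26) \<le> of_int R * K ^ 36" by (rule mult_left_mono) (use R in auto)
      then have "of_int R * (576 * K ^ 26) \<le> t" using RK by linarith
      moreover have "K ^ 26 = K * K ^ 25" by (simp flip: power_Suc)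
      ultimately show ?thesis using K by (simp add: field_simps)
    qed
    finally show ?thesis .
  qed
  finally have "t / K \<le> 3 * t * A / of_int R + t / (8 * K) + t / (8 * K)"
    using R by (simp add: divide_right_mono)
  moreover have "t / (2 * K) \<le> t / K - (t / (8 * K) + t / (8 * K))" using t K by (simp add: field_simps)
  ultimately have "t / (2 * K) \<le> 3 * t * A / of_int R" by linarith
  then have "of_int R \<le> 6 * K * A" using t K R by (simp add: field_simps)
  then have "of_int R * dist_circle (of_int q * \<beta>) \<le> 6 * K * (A * dist_circle (of_int q * \<beta>))"
    using mult_right_mono[of "of_int R" "6 * K * A" "dist_circle (of_int q * \<beta>)"] by (simp add: mult.assoc)
  also have "A * dist_circle (of_int q * \<beta>) \<le> 1"
  proof -
    have "{0..<R} = {0..R-1}" by auto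
    then show ?thesis unfolding A_def by (simp only: norm_sum_add_char_le)
  qed
  finally have i2: "of_int R * dist_circle (of_int q * \<beta>) \<le> 6 * K" using K by simp
  have "t * dist_circle (of_int q * \<beta>) \<le> (2 * K ^ 36 * of_int R) * dist_circle (of_int q * \<beta>)"
    using R(3) K by (intro mult_right_mono) (auto simp: field_simps)
  also have "\<dots> \<le> 2 * K ^ 36 * (6 * K)" using i2 K by (simp add: mult.assoc)
  also have "\<dots> = 12 * K ^ 37" by (simp flip: power_Suc2)
  also have "\<dots> \<le> K ^ 41" by (rule const_le_power[OF K, of _ 4]) auto
  finally show ?thesis using q t unfolding t_def by (auto simp: field_simps)
qed

text \<open>The width \<open>N^(-2)\<close> is the resolution both of frequencies in a variable of
  length \<open>N^2\<close> and of quadratic phases in a variable of length \<open>N\<close>. One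
  parameter bounds denominator and width, so that losses can be tracked by a single
  exponent.\<close>

definition major :: "real \<Rightarrow> int \<Rightarrow> real \<Rightarrow> bool" where
  "major Q N t \<longleftrightarrow> (\<exists>q::int. 0 < q \<and> of_int q \<le> Q \<and> dist_circle (of_int q * t) \<le> Q / (of_int N)\<^sup>2)"

text \<open>After removing \<open>g1\<close> by Cauchy--Schwarz, the sum over \<open>z = x + d\<close> is a quadratic
  exponential sum whose linear coefficient is \<open>- 2 * \<theta> x * (x - x')\<close>; since this is
  close to a rational with small denominator for many \<open>x'\<close>, so is \<open>\<theta> x\<close>.\<close>

lemma major_of_large_phase_sum:
  fixes N L j s :: int and g0 g1 :: "int \<Rightarrow> complex" and \<theta> :: "int \<Rightarrow> real"
  assumes K: "K \<ge> 2" and N: "of_int N \<ge> K ^ 300" and L: "1 \<le> L" "L \<le> N" "of_int N \<le> of_int L * K"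
    and j: "1 \<le> j" "j \<le> N" and X: "X \<subseteq> {s..<s+L}"
    and g0: "\<And>x. norm (g0 x) \<le> 1" and g1: "\<And>x. norm (g1 x) \<le> 1"
    and big: "norm (\<Sum>x\<in>X. \<Sum>d\<in>{-j<..<j}. g0 x * g1 (x + d) * add_char (\<theta> x * (of_int d)\<^sup>2)) \<ge> of_int L * of_int N / K"
  shows "\<exists>x\<in>X. major (K ^ 400) N (\<theta> x)"
proof -
  define n where "n = real_of_int N"
  define l where "l = real_of_int L"
  have Kp: "0 < K" "1 \<le> K" using K by auto
  have "0 < K ^ 300" using K by simp
  then have n: "n \<ge> K ^ 300" "n > 0" using N unfolding n_def by linarith+
  have l: "l \<ge> 1" "l \<le> n" "n \<le> l * K" using L unfolding l_def n_def by auto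
  have finX: "finite X" using X finite_subset by blast
  have cX: "real (card X) \<le> l"
  proof -
    have "card X \<le> card {s..<s+L}" using X by (intro card_mono) auto
    then show ?thesis using L unfolding l_def by simp
  qed
  define Z where "Z = {s-N..s+L+N}"
  define V where "V = (\<lambda>z. {x\<in>X. \<bar>z - x\<bar> < j})"
  define b where "b = (\<lambda>z x. g0 x * add_char (\<theta> x * (of_int (z - x))\<^sup>2))"
  have re: "(\<Sum>x\<in>X. \<Sum>d\<in>{-j<..<j}. g0 x * g1 (x + d) * add_char (\<theta> x * (of_int d)\<^sup>2))
     = (\<Sum>z\<in>Z. g1 z * (\<Sum>x\<in>V z. b z x))"
  proof -
    have "(\<Sum>x\<in>X. \<Sum>d\<in>{-j<..<j}. g0 x * g1 (x + d) * add_char (\<theta> x * (of_int d)\<^sup>2))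
       = (\<Sum>(x, d)\<in>X \<times> {-j<..<j}. g0 x * g1 (x + d) * add_char (\<theta> x * (of_int d)\<^sup>2))"
      by (rule sum.cartesian_product)
    also have "\<dots> = (\<Sum>(z, x)\<in>Sigma Z V. g1 z * b z x)"
      by (rule sum.reindex_bij_witness[of _ "\<lambda>(z, x). (x, z - x)" "\<lambda>(x, d). (x + d, x)"])
        (use X j in \<open>auto simp: V_def Z_def b_def\<close>)
    also have "\<dots> = (\<Sum>z\<in>Z. \<Sum>x\<in>V z. g1 z * b z x)"
      using finX by (intro sum.Sigma[symmetric]) (auto simp: Z_def V_def)
    finally show ?thesis by (simp add: sum_distrib_left)
  qed
  define D where "D = (\<lambda>x x'. {z\<in>Z. \<bar>z - x\<bar> < j \<and> \<bar>z - x'\<bar> < j})"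
  have finD: "finite (D x x')" for x x'
    by (rule finite_subset[of _ Z]) (auto simp: D_def Z_def)
  define E where "E = (\<lambda>x x'. norm (\<Sum>z\<in>D x x'. add_char (\<theta> x * (of_int (z - x))\<^sup>2 - \<theta> x' * (of_int (z - x'))\<^sup>2)))"
  have "(l * n / K)\<^sup>2 \<le> (norm (\<Sum>z\<in>Z. g1 z * (\<Sum>x\<in>V z. b z x)))\<^sup>2"
    using big l n Kp unfolding re l_def n_def by (intro power_mono) auto
  also have "\<dots> \<le> real (card Z) * (\<Sum>z\<in>Z. (norm (\<Sum>x\<in>V z. b z x))\<^sup>2)"
    by (rule norm_sum_squared_le_card) (use g1 in auto)
  finally have c1: "(l * n / K)\<^sup>2 \<le> real (card Z) * (\<Sum>z\<in>Z. (norm (\<Sum>x\<in>V z. b z x))\<^sup>2)" .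
  have c2: "real (card Z) \<le> 4 * n" using L unfolding Z_def n_def by simp
  have c3: "(\<Sum>z\<in>Z. (norm (\<Sum>x\<in>V z. b z x))\<^sup>2) \<le> (\<Sum>x\<in>X. \<Sum>x'\<in>X. E x x')"
  proof -
    have "complex_of_real (\<Sum>z\<in>Z. (norm (\<Sum>x\<in>V z. b z x))\<^sup>2) = (\<Sum>z\<in>Z. \<Sum>x\<in>V z. \<Sum>x'\<in>V z. b z x * cnj (b z x'))"
      by (simp only: of_real_sum norm_sum_squared)
    also have "\<dots> = (\<Sum>z\<in>Z. \<Sum>(x,x')\<in>V z \<times> V z. b z x * cnj (b z x'))"
      by (simp only: sum.cartesian_product)
    also have "\<dots> = (\<Sum>(z,p)\<in>Sigma Z (\<lambda>z. V z \<times> V z). b z (fst p) * cnj (b z (snd p)))"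
      using finX by (subst sum.Sigma) (auto simp: Z_def V_def case_prod_beta)
    also have "\<dots> = (\<Sum>(p,z)\<in>Sigma (X \<times> X) (\<lambda>p. D (fst p) (snd p)). b z (fst p) * cnj (b z (snd p)))"
      by (rule sum.reindex_bij_witness[of _ "\<lambda>(z,p). (p,z)" "\<lambda>(p,z). (z,p)"]) (auto simp: D_def V_def)
    also have "\<dots> = (\<Sum>p\<in>X \<times> X. \<Sum>z\<in>D (fst p) (snd p). b z (fst p) * cnj (b z (snd p)))"
      using finX finD by (subst sum.Sigma) auto
    also have "\<dots> = (\<Sum>x\<in>X. \<Sum>x'\<in>X. \<Sum>z\<in>D x x'. b z x * cnj (b z x'))"
      by (simp add: sum.cartesian_product case_prod_beta)
    finally have "norm (complex_of_real (\<Sum>z\<in>Z. (norm (\<Sum>x\<in>V z. b z x))\<^sup>2)) = norm (\<Sum>x\<in>X. \<Sum>x'\<in>X. \<Sum>z\<in>D x x'. b z x * cnj (b z x'))"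
      by simp
    also have "\<dots> \<le> (\<Sum>x\<in>X. \<Sum>x'\<in>X. norm (\<Sum>z\<in>D x x'. b z x * cnj (b z x')))"
      by (intro sum_norm_le order_refl)
    also have "\<dots> \<le> (\<Sum>x\<in>X. \<Sum>x'\<in>X. E x x')"
    proof (intro sum_mono)
      fix x x'
      have "b z x * cnj (b z x') = g0 x * cnj (g0 x') * add_char (\<theta> x * (of_int (z - x))\<^sup>2 - \<theta> x' * (of_int (z - x'))\<^sup>2)" for z
        unfolding b_def add_char_diff by simp
      then have "norm (\<Sum>z\<in>D x x'. b z x * cnj (b z x')) = norm (g0 x) * norm (g0 x') * E x x'"
        unfolding E_def by (simp add: norm_mult flip: sum_distrib_left)
      also have "\<dots> \<le> 1 * 1 * E x x'"
        using g0 by (intro mult_mono) (auto simp: E_def)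
      finally show "norm (\<Sum>z\<in>D x x'. b z x * cnj (b z x')) \<le> E x x'" by simp
    qed
    finally show ?thesis by (simp add: sum_nonneg del: of_real_sum)
  qed
  have "(l * n / K)\<^sup>2 \<le> 4 * n * (\<Sum>x\<in>X. \<Sum>x'\<in>X. E x x')"
    using c1 mult_mono[OF c2 c3] n by (simp add: sum_nonneg)
  then have sE: "l\<^sup>2 * n / (4 * K\<^sup>2) \<le> (\<Sum>x\<in>X. \<Sum>x'\<in>X. E x x')"
    using n Kp by (simp add: field_simps power2_eq_square)
  \<comment> \<open>From here on \<open>x\<close> is fixed: averaging supplies one with a large sum
    over \<open>x'\<close>, and it is the frequency of this \<open>x\<close> that is shown to be
    major.\<close>
  have "\<exists>x\<in>X. l\<^sup>2 * n / (4 * K\<^sup>2) / l \<le> (\<Sum>x'\<in>X. E x x')"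
    by (rule exists_ge_average[OF finX sE cX]) (use l n Kp in auto)
  moreover have "l\<^sup>2 * n / (4 * K\<^sup>2) / l = l * n / (4 * K\<^sup>2)"
    using l by (simp add: power2_eq_square)
  ultimately obtain x where x: "x \<in> X" "l * n / (4 * K\<^sup>2) \<le> (\<Sum>x'\<in>X. E x x')"
    by auto
  have cD: "D x x' \<subseteq> {x-j<..<x+j}" for x' unfolding D_def by auto
  have Eu: "E x x' \<le> 2 * n" for x'
  proof -
    have "E x x' \<le> real (card (D x x')) * 1" unfolding E_def by (rule sum_norm_bound) simp
    also have "card (D x x') \<le> card {x-j<..<x+j}" using cD by (intro card_mono) auto
    then have "real (card (D x x')) * 1 \<le> 2 * n" using j unfolding n_def by simp
    finally show ?thesis .
  qed
  define X' where "X' = {x'\<in>X. n / (8 * K\<^sup>2) \<le> E x x'}"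
  have "l * n / (4 * K\<^sup>2) / 2 \<le> 2 * n * real (card X')"
    unfolding X'_def
  proof (rule card_large_terms[OF finX Eu _ _ _ x(2)])
    have "2 * (n / (8 * K\<^sup>2)) * real (card X) \<le> 2 * (n / (8 * K\<^sup>2)) * l"
      using cX n Kp by (intro mult_left_mono) auto
    then show "2 * (n / (8 * K\<^sup>2)) * real (card X) \<le> l * n / (4 * K\<^sup>2)" by (simp add: mult.commute)
  qed (use n Kp in auto)
  then have cX': "real (card X') \<ge> l / (16 * K\<^sup>2)" using n Kp by (simp add: field_simps)
  define K1 where "K1 = K ^ 5"
  have K1: "K1 \<ge> 2" using self_le_power[of K 5] K unfolding K1_def by simp
  have p1: "8 * K\<^sup>2 \<le> K1" unfolding K1_def by (rule const_le_power[OF K, of _ 3]) auto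
  have "\<exists>q::int. 0 < q \<and> of_int q \<le> K ^ 50 \<and> dist_circle (of_int q * (2 * \<theta> x) * of_int (x' - x)) \<le> K ^ 205 / n"
    if x': "x' \<in> X'" for x'
  proof -
    have xx: "x \<in> {s..<s+L}" "x' \<in> {s..<s+L}" using x' x X X'_def by auto
    let ?a = "max (-j+1) (-j+1+x-x')" and ?b = "min (j-1) (j-1+x-x')"
    let ?ph = "\<lambda>d. add_char ((\<theta> x - \<theta> x') * (of_int d)\<^sup>2 + (2 * \<theta> x * of_int (x' - x)) * of_int d)"
    have "(\<Sum>z\<in>D x x'. add_char (\<theta> x * (of_int (z - x))\<^sup>2 - \<theta> x' * (of_int (z - x'))\<^sup>2))
       = (\<Sum>d\<in>{?a..?b}. add_char (\<theta> x * (of_int (x' - x))\<^sup>2) * ?ph d)"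
      by (rule sum.reindex_bij_witness[of _ "\<lambda>d. d + x'" "\<lambda>z. z - x'"])
        (use xx j in \<open>auto simp: D_def Z_def power2_eq_square algebra_simps simp flip: add_char_add\<close>)
    then have "E x x' = norm (\<Sum>d\<in>{?a..?b}. ?ph d)"
      unfolding E_def by (simp add: norm_mult flip: sum_distrib_left)
    moreover have "n / K1 \<le> n / (8 * K\<^sup>2)" using p1 n Kp K1 by (intro divide_left_mono) auto
    ultimately have "of_int N / K1 \<le> norm (\<Sum>d\<in>{?a..?b}. ?ph d)" using x' unfolding X'_def n_def by simp
    moreover have "K1 ^ 36 \<le> of_int N"
    proof -
      have "K1 ^ 36 = K ^ 180" unfolding K1_def by (simp flip: power_mult)
      also have "\<dots> \<le> K ^ 300" using K by (intro power_increasing) auto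
      finally show ?thesis using N by linarith
    qed
    moreover have "{?a..?b} \<subseteq> {-j+1..j-1}" by auto
    then have "{?a..?b} \<subseteq> {-N..N}" by (rule subset_trans) (use j in auto)
    ultimately obtain q :: int where "0 < q" "of_int q \<le> K1 ^ 10"
      "dist_circle (of_int q * (2 * \<theta> x * of_int (x' - x))) \<le> K1 ^ 41 / of_int N"
      using weyl_linear[OF K1] by blast
    moreover have "K1 ^ 10 = K ^ 50" "K1 ^ 41 = K ^ 205" unfolding K1_def by (simp_all flip: power_mult)
    ultimately show ?thesis unfolding n_def by (auto simp: mult.assoc)
  qed
  then obtain qf :: "int \<Rightarrow> int" where qf: "\<And>x'. x' \<in> X' \<Longrightarrow> 0 < qf x' \<and> of_int (qf x') \<le> K ^ 50 \<and>
     dist_circle (of_int (qf x') * (2 * \<theta> x) * of_int (x' - x)) \<le> K ^ 205 / n" by metis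
  \<comment> \<open>The denominator obtained from \<open>weyl_linear\<close> varies with
    \<open>x'\<close>. A popular value is fixed, at the cost of a factor \<open>K^50\<close> in
    density, so that one phase remains to which recurrence in \<open>x' - x\<close> applies.\<close>
  define QQ where "QQ = {1..\<lfloor>K ^ 50\<rfloor>}"
  have K50: "1 \<le> K ^ 50" using Kp by simp
  have cQQ: "real (card QQ) \<le> K ^ 50" "card QQ > 0"
    using K50 unfolding QQ_def by (auto simp: le_floor_iff)
  have finX': "finite X'" unfolding X'_def using finX by simp
  have X'ne: "X' \<noteq> {}" using cX' l Kp by (auto simp: divide_simps)
  have "qf x' \<in> QQ" if "x' \<in> X'" for x'
    using qf[OF that] unfolding QQ_def by (simp add: le_floor_iff)
  then have "qf ` X' \<subseteq> QQ" by auto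
  then obtain q where q: "q \<in> QQ" "real (card {x'\<in>X'. qf x' = q}) \<ge> real (card X') / real (card QQ)"
    using pigeonhole_real[OF finX' _ _ X'ne, of QQ qf] unfolding QQ_def by blast
  define R where "R = (\<lambda>x'. x' - x) ` {x'\<in>X'. qf x' = q}"
  have cR: "real (card R) \<ge> l / K ^ 56"
  proof -
    have "card R = card {x'\<in>X'. qf x' = q}" unfolding R_def by (intro card_image) (auto simp: inj_on_def)
    moreover have "l / (16 * K\<^sup>2) / K ^ 50 \<le> real (card X') / real (card QQ)"
      using cX' cQQ l Kp by (intro frac_le) auto
    moreover have "l / K ^ 56 \<le> l / (16 * K ^ 52)"
    proof -
      have "16 * K ^ 52 \<le> K ^ 56" by (rule const_le_power[OF K, of _ 4]) auto
      then show ?thesis using l Kp by (intro divide_left_mono) auto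
    qed
    moreover have "l / (16 * K\<^sup>2) / K ^ 50 = l / (16 * K ^ 52)" by (simp flip: power_add)
    ultimately show ?thesis using q by linarith
  qed
  define K2 where "K2 = K ^ 56"
  have K2: "K2 \<ge> 2" using self_le_power[of K 56] K unfolding K2_def by simp
  have "\<exists>r::int. 0 < r \<and> of_int r \<le> 5 * K2 \<and> dist_circle (of_int r * (of_int q * (2 * \<theta> x))) \<le> 160 * K2\<^sup>2 * (K ^ 205 / n) / of_int L"
  proof (rule recurrence_major[OF K2])
    have "8 * K2 * K \<le> K ^ 60" unfolding K2_def using const_le_power[OF K, of 8 3 57 60] by (simp add: mult.assoc flip: power_Suc2)
    also have "\<dots> < K ^ 300" using K by simp
    also have "\<dots> \<le> l * K" using n l by linarith
    finally show "8 * K2 < of_int L" using Kp unfolding l_def by simp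
    have "x \<in> {s..<s+L}" "x' \<in> X' \<Longrightarrow> x' \<in> {s..<s+L}" for x' using x X unfolding X'_def by blast+
    then show "R \<subseteq> {-L..L}" unfolding R_def by fastforce
    show "of_int L / K2 \<le> real (card R)" using cR unfolding l_def K2_def .
    show "dist_circle (of_int q * (2 * \<theta> x) * of_int r) \<le> K ^ 205 / n" if "r \<in> R" for r
      using that qf unfolding R_def by auto
    have "K ^ 205 * (128 * K2) = 128 * K ^ 261" unfolding K2_def by (simp flip: power_add)
    also have "\<dots> \<le> K ^ 299" by (rule const_le_power[OF K, of _ 7]) auto
    also have "\<dots> < K ^ 300" using K by simp
    also have "\<dots> \<le> n" using n by simp
    finally show "K ^ 205 / n < 1 / (128 * K2)" using n K2 by (simp add: field_simps)
  qed
  then obtain r :: int where r: "0 < r" "of_int r \<le> 5 * K2"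
    "dist_circle (of_int r * (of_int q * (2 * \<theta> x))) \<le> 160 * K2\<^sup>2 * (K ^ 205 / n) / l"
    unfolding l_def by blast
  have q0: "0 < q" "of_int q \<le> K ^ 50" using q(1) unfolding QQ_def by (auto simp: le_floor_iff)
  have "major (K ^ 400) N (\<theta> x)" unfolding major_def
  proof (intro exI[of _ "2 * r * q"] conjI)
    show "0 < 2 * r * q" using r q0 by simp
    have "real_of_int (2 * r * q) \<le> 2 * (5 * K2) * K ^ 50"
      using r q0 K2 by (simp add: mult_mono)
    also have "\<dots> = 10 * K ^ 106" unfolding K2_def by (simp flip: power_add)
    also have "\<dots> \<le> K ^ 400" by (rule const_le_power[OF K, of _ 4]) auto
    finally show "real_of_int (2 * r * q) \<le> K ^ 400" .
    have "160 * K2\<^sup>2 * (K ^ 205 / n) / l = 160 * K ^ 317 / (n * l)"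
      unfolding K2_def by (simp flip: power_add power_mult)
    \<comment> \<open>Recurrence gains only the block length \<open>L\<close>; the hypothesis that
      \<open>N\<close> is at most \<open>L * K\<close> trades it for \<open>N\<close> and yields
      width \<open>N^(-2)\<close>.\<close>
    also have "\<dots> \<le> 160 * K ^ 317 / (n * (n / K))"
      using l n Kp by (intro divide_left_mono mult_left_mono) (auto simp: field_simps)
    also have "\<dots> = 160 * K ^ 318 / n\<^sup>2" using Kp by (simp add: power2_eq_square flip: power_Suc2)
    also have "\<dots> \<le> K ^ 400 / n\<^sup>2"
      by (intro divide_right_mono const_le_power[OF K, of _ 8]) auto
    finally show "dist_circle (of_int (2 * r * q) * \<theta> x) \<le> K ^ 400 / (of_int N)\<^sup>2"
      using r unfolding n_def by (simp add: mult.assoc mult.left_commute)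
  qed
  then show ?thesis using x by blast
qed

section \<open>Fourier analysis on cyclic groups\<close>

text \<open>The 1-bounded functions on the integers modulo \<open>M\<close>. They are kept as
  periodic functions on all integers, so that shifts compose without reductions; only sums are taken
  over the representatives \<open>{0..<M}\<close>.\<close>

definition unit_periodic :: "int \<Rightarrow> (int \<Rightarrow> complex) \<Rightarrow> bool" where
  "unit_periodic M f \<longleftrightarrow> (\<forall>y. norm (f y) \<le> 1) \<and> (\<forall>y. f (y + M) = f y)"

lemma sum_swap3:
  "(\<Sum>a\<in>A. \<Sum>b\<in>B. \<Sum>c\<in>C. f a b c) = (\<Sum>b\<in>B. \<Sum>c\<in>C. \<Sum>a\<in>A. f a b c)"
proof -
  have "(\<Sum>a\<in>A. \<Sum>b\<in>B. \<Sum>c\<in>C. f a b c) = (\<Sum>b\<in>B. \<Sum>a\<in>A. \<Sum>c\<in>C. f a b c)"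
    by (rule sum.swap)
  also have "\<dots> = (\<Sum>b\<in>B. \<Sum>c\<in>C. \<Sum>a\<in>A. f a b c)"
    by (rule sum.cong[OF refl]) (rule sum.swap)
  finally show ?thesis .
qed

lemma unit_periodicI: "(\<And>y. norm (f y) \<le> 1) \<Longrightarrow> (\<And>y. f (y + M) = f y) \<Longrightarrow> unit_periodic M f"
  by (simp add: unit_periodic_def)

lemma unit_periodic_norm: "unit_periodic M f \<Longrightarrow> norm (f y) \<le> 1"
  by (simp add: unit_periodic_def)

lemma unit_periodic_add: "unit_periodic M f \<Longrightarrow> f (y + M) = f y"
  by (simp add: unit_periodic_def)

lemma unit_periodic_mult: "unit_periodic M f \<Longrightarrow> unit_periodic M g \<Longrightarrow> unit_periodic M (\<lambda>y. f y * g y)"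
  by (auto simp: unit_periodic_def norm_mult intro: mult_le_one)

lemma unit_periodic_cnj: "unit_periodic M f \<Longrightarrow> unit_periodic M (\<lambda>y. cnj (f y))"
  by (auto simp: unit_periodic_def)

lemma unit_periodic_comp:
  "unit_periodic M f \<Longrightarrow> (\<And>y. h (y + M) = h y + M) \<Longrightarrow> unit_periodic M (\<lambda>y. f (h y))"
  by (auto simp: unit_periodic_def)

lemma unit_periodic_const: "norm c \<le> 1 \<Longrightarrow> unit_periodic M (\<lambda>y. c)"
  by (auto simp: unit_periodic_def)

lemma periodic_add_mult:
  fixes f :: "int \<Rightarrow> 'a"
  assumes "\<And>y. f (y + M) = f y"
  shows "f (y + k * M) = f y"
proof (induction k rule: int_induct[of _ 0])
  case base then show ?case by simp
next
  case (step1 i)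
  then show ?case using assms[of "y + i * M"] by (simp add: algebra_simps)
next
  case (step2 i)
  then show ?case using assms[of "y + (i - 1) * M"] by (simp add: algebra_simps)
qed

lemma periodic_mod:
  fixes f :: "int \<Rightarrow> 'a"
  assumes "\<And>y. f (y + M) = f y"
  shows "f (y mod M) = f y"
  using periodic_add_mult[of f M "y mod M" "y div M"] assms by simp

lemma periodic_sum_shift:
  fixes f :: "int \<Rightarrow> 'a::comm_monoid_add"
  assumes "\<And>y. f (y + M) = f y" "M > 0"
  shows "(\<Sum>y\<in>{0..<M}. f (y + a)) = (\<Sum>y\<in>{0..<M}. f y)"
proof (rule sum.reindex_bij_witness[of _ "\<lambda>y. (y - a) mod M" "\<lambda>y. (y + a) mod M"])
  fix y assume y: "y \<in> {0..<M}"
  show "((y + a) mod M - a) mod M = y" using y by (simp add: mod_simps)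
  show "((y - a) mod M + a) mod M = y" using y by (simp add: mod_simps)
  show "f ((y + a) mod M) = f (y + a)" using assms(1) by (rule periodic_mod)
qed (use assms(2) in auto)

lemma unit_periodic_sum_shift:
  "unit_periodic M f \<Longrightarrow> M > 0 \<Longrightarrow> (\<Sum>y\<in>{0..<M}. f (y + a)) = (\<Sum>y\<in>{0..<M}. f y)"
  by (rule periodic_sum_shift) (auto simp: unit_periodic_def)

definition zchar :: "int \<Rightarrow> int \<Rightarrow> complex" where
  "zchar M k = add_char (of_int k / of_int M)"

lemma zchar_add: "zchar M (a + b) = zchar M a * zchar M b"
  by (simp add: zchar_def add_divide_distrib add_char_add)

lemma zchar_0 [simp]: "zchar M 0 = 1"
  by (simp add: zchar_def)

lemma norm_zchar [simp]: "norm (zchar M k) = 1"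
  by (simp add: zchar_def)

lemma cnj_zchar: "cnj (zchar M k) = zchar M (- k)"
  by (simp add: zchar_def cnj_add_char)

lemma zchar_diff: "zchar M (a - b) = zchar M a * cnj (zchar M b)"
  by (simp add: cnj_zchar flip: zchar_add)

lemma zchar_mult_M [simp]: "M > 0 \<Longrightarrow> zchar M (k * M) = 1" "M > 0 \<Longrightarrow> zchar M (M * k) = 1"
  by (simp_all add: zchar_def)

lemma zchar_eq_1_iff: "M > 0 \<Longrightarrow> zchar M a = 1 \<longleftrightarrow> M dvd a"
proof
  assume M: "M > 0" and 1: "zchar M a = 1"
  have "dist_circle (of_int a / of_int M) = 0"
    using norm_add_char_minus_1_ge[of "of_int a / of_int M"] 1
    by (intro order_antisym) (simp_all add: zchar_def)
  then obtain n :: int where "of_int a / of_int M = (of_int n :: real)"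
    using dist_circle_attained[of "of_int a / of_int M"] by auto
  then have "real_of_int a = of_int (n * M)" using M by (simp add: field_simps)
  then show "M dvd a" by (metis dvd_triv_right of_int_eq_iff)
qed auto

lemma unit_periodic_zchar: "M > 0 \<Longrightarrow> unit_periodic M (\<lambda>y. zchar M (k * y))"
  by (auto simp: unit_periodic_def zchar_add distrib_left)

lemma sum_zchar:
  assumes "M > 0"
  shows "(\<Sum>\<xi>\<in>{0..<M}. zchar M (\<xi> * a)) = (if M dvd a then of_int M else 0)"
proof (cases "M dvd a")
  case True
  then have "zchar M (\<xi> * a) = 1" for \<xi> using assms by (simp add: zchar_eq_1_iff)
  then show ?thesis using True assms by simp
next
  case False
  have "(\<Sum>\<xi>\<in>{0..<M}. zchar M (a * (\<xi> + 1))) = (\<Sum>\<xi>\<in>{0..<M}. zchar M (a * \<xi>))"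
    using unit_periodic_zchar[OF assms] assms by (rule unit_periodic_sum_shift)
  then have "zchar M a * (\<Sum>\<xi>\<in>{0..<M}. zchar M (\<xi> * a)) = (\<Sum>\<xi>\<in>{0..<M}. zchar M (\<xi> * a))"
    by (simp add: distrib_left zchar_add sum_distrib_left mult.commute)
  moreover have "zchar M a \<noteq> 1" using False assms by (simp add: zchar_eq_1_iff)
  ultimately show ?thesis using False by simp
qed

definition zft :: "int \<Rightarrow> (int \<Rightarrow> complex) \<Rightarrow> int \<Rightarrow> complex" where
  "zft M f \<xi> = (\<Sum>y\<in>{0..<M}. f y * zchar M (- (\<xi> * y)))"

text \<open>Fourier inversion for a cross-correlation, with the transform unnormalised.
  Orthogonality of the characters selects the representative of \<open>y + t\<close> modulo
  \<open>M\<close>. The case \<open>t = 0\<close> with equal functions is Parseval's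
  identity.\<close>

lemma correlation_eq_zft:
  assumes M: "M > 0" and Q: "\<And>y. Q (y + M) = Q y"
  shows "(\<Sum>y\<in>{0..<M}. cnj (P y) * Q (y + t))
    = (\<Sum>\<xi>\<in>{0..<M}. cnj (zft M P \<xi>) * zft M Q \<xi> / of_int M * zchar M (\<xi> * t))"
proof -
  have inner: "(\<Sum>z\<in>{0..<M}. Q z * (if M dvd (y + t - z) then of_int M else 0)) = of_int M * Q (y + t)" for y
  proof -
    have "(\<Sum>z\<in>{0..<M}. Q z * (if M dvd (y + t - z) then of_int M else 0))
      = (\<Sum>z\<in>{0..<M}. if z = (y + t) mod M then Q z * of_int M else 0)"
    proof (rule sum.cong)
      fix z assume "z \<in> {0..<M}"
      then have "M dvd (y + t - z) \<longleftrightarrow> z = (y + t) mod M"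
        by (metis atLeastLessThan_iff mod_eq_dvd_iff mod_pos_pos_trivial)
      then show "Q z * (if M dvd (y + t - z) then of_int M else 0) = (if z = (y + t) mod M then Q z * of_int M else 0)"
        by simp
    qed simp
    also have "\<dots> = Q ((y + t) mod M) * of_int M" using M by simp
    also have "Q ((y + t) mod M) = Q (y + t)" using Q by (rule periodic_mod)
    finally show ?thesis by (simp add: mult.commute)
  qed
  have "(\<Sum>\<xi>\<in>{0..<M}. cnj (zft M P \<xi>) * zft M Q \<xi> * zchar M (\<xi> * t))
     = (\<Sum>\<xi>\<in>{0..<M}. \<Sum>y\<in>{0..<M}. \<Sum>z\<in>{0..<M}. cnj (P y) * (Q z * zchar M (\<xi> * (y + t - z))))"
    unfolding zft_def cnj_sum sum_product unfolding sum_distrib_right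
  proof (intro sum.cong refl)
    fix \<xi> y z
    have "\<xi> * (y + t - z) = - (- (\<xi> * y)) + - (\<xi> * z) + \<xi> * t" by (simp add: algebra_simps)
    then show "cnj (P y * zchar M (- (\<xi> * y))) * (Q z * zchar M (- (\<xi> * z))) * zchar M (\<xi> * t) =
       cnj (P y) * (Q z * zchar M (\<xi> * (y + t - z)))"
      by (simp only: zchar_add complex_cnj_mult cnj_zchar) (simp add: mult_ac)
  qed
  also have "\<dots> = (\<Sum>y\<in>{0..<M}. \<Sum>z\<in>{0..<M}. \<Sum>\<xi>\<in>{0..<M}. cnj (P y) * (Q z * zchar M (\<xi> * (y + t - z))))"
    by (rule sum_swap3[where f = "\<lambda>\<xi> y z. cnj (P y) * (Q z * zchar M (\<xi> * (y + t - z)))"])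
  also have "\<dots> = (\<Sum>y\<in>{0..<M}. cnj (P y) * (\<Sum>z\<in>{0..<M}. Q z * (if M dvd (y + t - z) then of_int M else 0)))"
    by (simp only: sum_distrib_left[symmetric] sum_zchar[OF M])
  also have "\<dots> = of_int M * (\<Sum>y\<in>{0..<M}. cnj (P y) * Q (y + t))"
    unfolding inner by (simp add: sum_distrib_left mult_ac)
  finally show ?thesis using M
    by (simp add: field_simps flip: sum_divide_distrib)
qed

lemma zft_parseval:
  assumes M: "M > 0" and P: "\<And>y. P (y + M) = P y"
  shows "(\<Sum>\<xi>\<in>{0..<M}. (norm (zft M P \<xi>))\<^sup>2) = of_int M * (\<Sum>y\<in>{0..<M}. (norm (P y))\<^sup>2)"
proof -
  have "complex_of_real (\<Sum>y\<in>{0..<M}. (norm (P y))\<^sup>2) = (\<Sum>y\<in>{0..<M}. cnj (P y) * P (y + 0))"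
    unfolding of_real_sum complex_norm_square by (simp add: mult.commute)
  also have "\<dots> = (\<Sum>\<xi>\<in>{0..<M}. cnj (zft M P \<xi>) * zft M P \<xi> / of_int M * zchar M (\<xi> * 0))"
    by (rule correlation_eq_zft[where P = P and Q = P and t = 0]) (use M P in auto)
  also have "\<dots> = complex_of_real ((\<Sum>\<xi>\<in>{0..<M}. (norm (zft M P \<xi>))\<^sup>2) / of_int M)"
    unfolding of_real_divide of_real_sum complex_norm_square by (simp add: mult.commute sum_divide_distrib)
  finally have "(\<Sum>y\<in>{0..<M}. (norm (P y))\<^sup>2) = (\<Sum>\<xi>\<in>{0..<M}. (norm (zft M P \<xi>))\<^sup>2) / of_int M"
    by (simp only: of_real_eq_iff)
  then show ?thesis using M by (simp add: field_simps)
qed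

lemma zft_square_sum_le:
  assumes M: "M > 0" and P: "unit_periodic M P"
  shows "(\<Sum>\<xi>\<in>{0..<M}. (norm (zft M P \<xi>))\<^sup>2) \<le> (of_int M)\<^sup>2"
proof -
  have "(\<Sum>y\<in>{0..<M}. (norm (P y))\<^sup>2) \<le> (\<Sum>y\<in>{0..<M}. 1)"
    using P by (intro sum_mono) (auto simp: unit_periodic_def power_le_one)
  then have "of_int M * (\<Sum>y\<in>{0..<M}. (norm (P y))\<^sup>2) \<le> of_int M * of_int M"
    using M by (intro mult_left_mono) auto
  then show ?thesis using zft_parseval[OF M, of P] P by (simp add: unit_periodic_def power2_eq_square)
qed

lemma norm_zft_le:
  assumes M: "M > 0" and P: "\<And>y. norm (P y) \<le> 1"
  shows "norm (zft M P \<xi>) \<le> of_int M"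
proof -
  have "norm (zft M P \<xi>) \<le> real (card {0..<M}) * 1"
    unfolding zft_def using P by (intro sum_norm_bound) (simp add: norm_mult)
  then show ?thesis using M by simp
qed

text \<open>Arithmetic-geometric mean followed by Parseval: the Fourier coefficients of a
  correlation of 1-bounded functions have total mass at most \<open>M\<close>.\<close>

lemma zft_product_sum_le:
  assumes M: "M > 0" and P: "unit_periodic M P" and Q: "unit_periodic M Q"
  shows "(\<Sum>\<xi>\<in>{0..<M}. norm (cnj (zft M P \<xi>) * zft M Q \<xi> / of_int M)) \<le> of_int M"
proof -
  have "norm (cnj (zft M P \<xi>) * zft M Q \<xi> / of_int M)
      \<le> ((norm (zft M P \<xi>))\<^sup>2 + (norm (zft M Q \<xi>))\<^sup>2) / (2 * of_int M)" for \<xi>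
  proof -
    have "2 * (norm (zft M P \<xi>) * norm (zft M Q \<xi>)) \<le> (norm (zft M P \<xi>))\<^sup>2 + (norm (zft M Q \<xi>))\<^sup>2"
      using sum_squares_bound[of "norm (zft M P \<xi>)" "norm (zft M Q \<xi>)"] by (simp add: mult.assoc)
    then show ?thesis using M by (simp add: norm_mult norm_divide field_simps)
  qed
  then have "(\<Sum>\<xi>\<in>{0..<M}. norm (cnj (zft M P \<xi>) * zft M Q \<xi> / of_int M))
      \<le> (\<Sum>\<xi>\<in>{0..<M}. ((norm (zft M P \<xi>))\<^sup>2 + (norm (zft M Q \<xi>))\<^sup>2) / (2 * of_int M))"
    by (rule sum_mono)
  also have "\<dots> = ((\<Sum>\<xi>\<in>{0..<M}. (norm (zft M P \<xi>))\<^sup>2) + (\<Sum>\<xi>\<in>{0..<M}. (norm (zft M Q \<xi>))\<^sup>2)) / (2 * of_int M)"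
    by (simp add: sum.distrib flip: sum_divide_distrib)
  also have "\<dots> \<le> ((of_int M)\<^sup>2 + (of_int M)\<^sup>2) / (2 * of_int M)"
    using zft_square_sum_le[OF M P] zft_square_sum_le[OF M Q] M by (intro divide_right_mono add_mono) auto
  also have "\<dots> = of_int M" using M by (simp add: power2_eq_square)
  finally show ?thesis .
qed

section \<open>Major frequencies and exponential sums over a box of steps\<close>

text \<open>A major frequency \<open>\<xi>\<close> is determined by its denominator
  \<open>q\<close>, the nearest integer \<open>i\<close> to \<open>q * \<xi> / M\<close>, and the
  integer \<open>q * \<xi> - M * i\<close>. The last is at most \<open>2 * Q\<close> in modulus
  precisely because \<open>M = 2 * N^2\<close>, so each of the three coordinates has only
  \<open>O(Q)\<close> values.\<close>

lemma card_major_le: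
  assumes N: "N > 0" and Q: "Q \<ge> 1" and QN: "Q \<le> of_int N" and M: "M = 2 * N\<^sup>2"
  shows "real (card {\<xi>\<in>{0..<M}. major Q N (of_int \<xi> / of_int M)}) \<le> 60 * Q ^ 3"
proof -
  define n where "n = real_of_int N"
  have n: "n > 0" "n \<ge> 1" "Q \<le> n" using N QN by (auto simp: n_def)
  have M0: "M > 0" using M N by simp
  have Mn: "real_of_int M = 2 * n\<^sup>2" using M by (simp add: n_def)
  define S where "S = {\<xi>\<in>{0..<M}. major Q N (of_int \<xi> / of_int M)}"
  have "\<exists>q i. 0 < q \<and> of_int q \<le> Q \<and> \<bar>of_int q * (of_int \<xi> / of_int M) - of_int i\<bar> \<le> Q / n\<^sup>2" if "\<xi> \<in> S" for \<xi>
  proof -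
    obtain q :: int where q: "0 < q" "of_int q \<le> Q" "dist_circle (of_int q * (of_int \<xi> / of_int M)) \<le> Q / n\<^sup>2"
      using \<open>\<xi> \<in> S\<close> unfolding S_def major_def n_def by blast
    moreover obtain i :: int where "dist_circle (of_int q * (of_int \<xi> / of_int M)) = \<bar>of_int q * (of_int \<xi> / of_int M) - of_int i\<bar>"
      using dist_circle_attained by blast
    ultimately show ?thesis by auto
  qed
  then obtain q i where qi: "\<And>\<xi>. \<xi> \<in> S \<Longrightarrow> 0 < q \<xi> \<and> real_of_int (q \<xi>) \<le> Q \<and>
     \<bar>of_int (q \<xi>) * (of_int \<xi> / of_int M) - of_int (i \<xi>)\<bar> \<le> Q / n\<^sup>2" by metis
  define f where "f = (\<lambda>\<xi>. (q \<xi>, i \<xi>, q \<xi> * \<xi> - M * i \<xi>))"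
  define C where "C = {1..\<lfloor>Q\<rfloor>} \<times> {-1..\<lfloor>Q\<rfloor> + 1} \<times> {-\<lfloor>2 * Q\<rfloor>..\<lfloor>2 * Q\<rfloor>}"
  have finC: "finite C" unfolding C_def by simp
  have Q1: "Q / n\<^sup>2 \<le> 1"
  proof -
    have "n * 1 \<le> n * n" using n by (intro mult_left_mono) auto
    then have "Q \<le> n * n" using n by linarith
    then show ?thesis using n by (simp add: power2_eq_square)
  qed
  have inC: "f \<xi> \<in> C" if xi: "\<xi> \<in> S" for \<xi>
  proof -
    note q = qi[OF xi]
    define z where "z = real_of_int \<xi> / of_int M"
    have z: "0 \<le> z" "z \<le> 1" using xi M0 unfolding S_def z_def by auto
    have "of_int (q \<xi>) * z \<ge> 0" "of_int (q \<xi>) * z \<le> of_int (q \<xi>) * 1"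
      using q z by (auto intro!: mult_left_mono mult_nonneg_nonneg)
    then have "real_of_int (i \<xi>) \<ge> -1" "real_of_int (i \<xi>) \<le> of_int (q \<xi>) + 1"
      using q Q1 unfolding z_def[symmetric] by linarith+
    then have "-1 \<le> i \<xi>" "i \<xi> \<le> q \<xi> + 1" by linarith+
    moreover have "q \<xi> \<le> \<lfloor>Q\<rfloor>" using q by (simp add: le_floor_iff)
    moreover have "\<bar>q \<xi> * \<xi> - M * i \<xi>\<bar> \<le> \<lfloor>2 * Q\<rfloor>"
    proof -
      have "\<bar>of_int (q \<xi> * \<xi> - M * i \<xi>)\<bar> = real_of_int M * \<bar>of_int (q \<xi>) * (of_int \<xi> / of_int M) - of_int (i \<xi>)\<bar>"
      proof -
        have "of_int (q \<xi> * \<xi> - M * i \<xi>) = real_of_int M * (of_int (q \<xi>) * (of_int \<xi> / of_int M) - of_int (i \<xi>))"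
          using M0 by (simp add: algebra_simps)
        then show ?thesis using M0 by (simp add: abs_mult)
      qed
      also have "\<dots> \<le> real_of_int M * (Q / n\<^sup>2)" using q M0 by (intro mult_left_mono) auto
      also have "\<dots> = 2 * Q" using Mn n by simp
      finally show ?thesis by (simp add: le_floor_iff)
    qed
    ultimately show ?thesis using q unfolding f_def C_def by auto
  qed
  have "inj_on f S"
  proof (rule inj_onI)
    fix x y assume "x \<in> S" "y \<in> S" "f x = f y"
    then have "q x * x = q x * y" "q x > 0" using qi unfolding f_def by auto
    then show "x = y" by simp
  qed
  then have "card S \<le> card C"
    using inC finC by (intro card_inj_on_le[of f]) auto
  also have "real (card C) \<le> Q * (3 * Q + 1) * (5 * Q)"
  proof -
    have fQ: "1 \<le> \<lfloor>Q\<rfloor>" "1 \<le> \<lfloor>2 * Q\<rfloor>" using Q by (auto simp: le_floor_iff)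
    have "real (card C) = of_int \<lfloor>Q\<rfloor> * ((of_int \<lfloor>Q\<rfloor> + 3) * (2 * of_int \<lfloor>2 * Q\<rfloor> + 1))"
      using fQ unfolding C_def by (simp add: card_cartesian_product)
    also have "\<dots> \<le> Q * ((3 * Q + 1) * (5 * Q))"
    proof (intro mult_mono)
      show "real_of_int \<lfloor>Q\<rfloor> \<le> Q" by simp
      then show "real_of_int \<lfloor>Q\<rfloor> + 3 \<le> 3 * Q + 1" using Q by linarith
      have "real_of_int \<lfloor>2 * Q\<rfloor> \<le> 2 * Q" by simp
      then show "2 * real_of_int \<lfloor>2 * Q\<rfloor> + 1 \<le> 5 * Q" using Q by linarith
    qed (use fQ Q in auto)
    finally show ?thesis by (simp add: mult.assoc)
  qed
  also have "\<dots> \<le> Q * (4 * Q) * (5 * Q)" using Q by (intro mult_mono) auto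
  also have "\<dots> \<le> 60 * Q ^ 3" using Q by (simp add: power3_eq_cube)
  finally show ?thesis unfolding S_def by simp
qed

text \<open>Expanding the squared correlations in frequencies \<open>\<xi>\<close>,
  \<open>\<eta>\<close> and summing over \<open>b\<close> first produces the kernel
  \<open>\<kappa> (\<xi> - \<eta>)\<close>. Where the kernel is below \<open>v\<close>, the total
  mass \<open>M\<close> of the coefficients gives the first term. Where it is large, each
  \<open>\<xi>\<close> has at most \<open>m\<close> partners \<open>\<eta>\<close>, and for these
  the supremum \<open>s\<close> of a single coefficient is used. The bound thus converts many
  correlations into one large coefficient of \<open>Q\<close>.\<close>

lemma unit_periodic_kernel_split:
  fixes \<tau> :: "'t \<Rightarrow> int"
  assumes M: "M > 0" and fin: "finite B" and cB: "real (card B) \<le> c" and v: "v \<ge> 0" and m: "m \<ge> 0"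
    and count: "real (card {\<eta>\<in>{0..<M}. v \<le> norm (\<Sum>b\<in>B. zchar M (\<eta> * \<tau> b))}) \<le> m"
    and P: "unit_periodic M P" and Q: "unit_periodic M Q" and s: "s \<ge> 0" "\<And>\<xi>. norm (zft M Q \<xi>) \<le> s"
  shows "(\<Sum>b\<in>B. (norm (\<Sum>y\<in>{0..<M}. cnj (P y) * Q (y + \<tau> b)))\<^sup>2) \<le> v * (of_int M)\<^sup>2 + of_int M * m * s * c"
proof -
  define a where "a = (\<lambda>\<xi>. cnj (zft M P \<xi>) * zft M Q \<xi> / of_int M)"
  define \<kappa> where "\<kappa> = (\<lambda>\<eta>. \<Sum>b\<in>B. zchar M (\<eta> * \<tau> b))"
  have c0: "c \<ge> 0" using cB by linarith
  have \<kappa>per: "\<kappa> (\<eta> mod M) = \<kappa> \<eta>" for \<eta>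
  proof (rule periodic_mod)
    show "\<kappa> (y + M) = \<kappa> y" for y
      using M unfolding \<kappa>_def by (simp add: distrib_right zchar_add)
  qed
  have \<kappa>c: "norm (\<kappa> \<eta>) \<le> c" for \<eta>
  proof -
    have "norm (\<kappa> \<eta>) \<le> real (card B) * 1" unfolding \<kappa>_def by (intro sum_norm_bound) simp
    then show ?thesis using cB by simp
  qed
  have as: "norm (a \<xi>) \<le> s" for \<xi>
  proof -
    have "norm (zft M P \<xi>) * norm (zft M Q \<xi>) \<le> of_int M * s"
      using norm_zft_le[OF M] P s M by (intro mult_mono) (auto simp: unit_periodic_def)
    then show ?thesis using M unfolding a_def by (simp add: norm_mult norm_divide field_simps)
  qed
  have asum: "(\<Sum>\<xi>\<in>{0..<M}. norm (a \<xi>)) \<le> of_int M"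
    unfolding a_def by (rule zft_product_sum_le[OF M P Q])
  have corr: "(\<Sum>y\<in>{0..<M}. cnj (P y) * Q (y + t)) = (\<Sum>\<xi>\<in>{0..<M}. a \<xi> * zchar M (\<xi> * t))" for t
    unfolding a_def by (rule correlation_eq_zft[OF M]) (use Q in \<open>simp add: unit_periodic_def\<close>)
  have "complex_of_real (\<Sum>b\<in>B. (norm (\<Sum>y\<in>{0..<M}. cnj (P y) * Q (y + \<tau> b)))\<^sup>2)
     = (\<Sum>b\<in>B. \<Sum>\<xi>\<in>{0..<M}. \<Sum>\<eta>\<in>{0..<M}. a \<xi> * cnj (a \<eta>) * zchar M ((\<xi> - \<eta>) * \<tau> b))"
    unfolding of_real_sum corr norm_sum_squared
  proof (intro sum.cong refl)
    fix b \<xi> \<eta>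
    have "zchar M ((\<xi> - \<eta>) * \<tau> b) = zchar M (\<xi> * \<tau> b) * cnj (zchar M (\<eta> * \<tau> b))"
      by (simp add: left_diff_distrib zchar_diff)
    then show "a \<xi> * zchar M (\<xi> * \<tau> b) * cnj (a \<eta> * zchar M (\<eta> * \<tau> b)) = a \<xi> * cnj (a \<eta>) * zchar M ((\<xi> - \<eta>) * \<tau> b)"
      by (simp add: mult_ac)
  qed
  also have "\<dots> = (\<Sum>\<xi>\<in>{0..<M}. \<Sum>\<eta>\<in>{0..<M}. \<Sum>b\<in>B. a \<xi> * cnj (a \<eta>) * zchar M ((\<xi> - \<eta>) * \<tau> b))"
    by (rule sum_swap3)
  also have "\<dots> = (\<Sum>\<xi>\<in>{0..<M}. \<Sum>\<eta>\<in>{0..<M}. a \<xi> * cnj (a \<eta>) * \<kappa> (\<xi> - \<eta>))"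
    unfolding \<kappa>_def by (simp add: sum_distrib_left)
  finally have "norm (complex_of_real (\<Sum>b\<in>B. (norm (\<Sum>y\<in>{0..<M}. cnj (P y) * Q (y + \<tau> b)))\<^sup>2))
     = norm (\<Sum>\<xi>\<in>{0..<M}. \<Sum>\<eta>\<in>{0..<M}. a \<xi> * cnj (a \<eta>) * \<kappa> (\<xi> - \<eta>))" by simp
  then have "(\<Sum>b\<in>B. (norm (\<Sum>y\<in>{0..<M}. cnj (P y) * Q (y + \<tau> b)))\<^sup>2)
     = norm (\<Sum>\<xi>\<in>{0..<M}. \<Sum>\<eta>\<in>{0..<M}. a \<xi> * cnj (a \<eta>) * \<kappa> (\<xi> - \<eta>))"
    by (simp add: sum_nonneg del: of_real_sum)
  also have "\<dots> \<le> (\<Sum>\<xi>\<in>{0..<M}. \<Sum>\<eta>\<in>{0..<M}. norm (a \<xi>) * norm (a \<eta>) * norm (\<kappa> (\<xi> - \<eta>)))"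
    by (intro sum_norm_le) (simp add: norm_mult)
  also have "\<dots> \<le> (\<Sum>\<xi>\<in>{0..<M}. norm (a \<xi>) * (of_int M * v + m * (s * c)))"
  proof (rule sum_mono)
    fix \<xi> :: int
    define W where "W = {\<eta>\<in>{0..<M}. v \<le> norm (\<kappa> (\<xi> - \<eta>))}"
    have cW: "real (card W) \<le> m"
    proof -
      have "card W \<le> card {\<eta>\<in>{0..<M}. v \<le> norm (\<kappa> \<eta>)}"
      proof (rule card_inj_on_le[of "\<lambda>\<eta>. (\<xi> - \<eta>) mod M"])
        show "inj_on (\<lambda>\<eta>. (\<xi> - \<eta>) mod M) W"
        proof (rule inj_onI)
          fix x y assume xy: "x \<in> W" "y \<in> W" "(\<xi> - x) mod M = (\<xi> - y) mod M"
          then have "M dvd (\<xi> - x) - (\<xi> - y)" by (simp add: mod_eq_dvd_iff)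
          then have "M dvd y - x" by simp
          then have "y mod M = x mod M" by (simp add: mod_eq_dvd_iff)
          then show "x = y" using xy unfolding W_def by simp
        qed
      qed (use M in \<open>auto simp: W_def \<kappa>per intro: finite_subset[of _ "{0..<M}"]\<close>)
      then show ?thesis using count unfolding \<kappa>_def by linarith
    qed
    have "(\<Sum>\<eta>\<in>{0..<M}. norm (a \<eta>) * norm (\<kappa> (\<xi> - \<eta>)))
        \<le> (\<Sum>\<eta>\<in>{0..<M}. norm (a \<eta>) * v + (if v \<le> norm (\<kappa> (\<xi> - \<eta>)) then s * c else 0))"
    proof (rule sum_mono)
      fix \<eta>
      have "norm (a \<eta>) * norm (\<kappa> (\<xi> - \<eta>)) \<le> s * c" using as \<kappa>c s c0 by (intro mult_mono) auto
      moreover have "norm (a \<eta>) * norm (\<kappa> (\<xi> - \<eta>)) \<le> norm (a \<eta>) * v" if "\<not> v \<le> norm (\<kappa> (\<xi> - \<eta>))"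
        using that by (intro mult_left_mono) auto
      moreover have "0 \<le> norm (a \<eta>) * v" using v by simp
      ultimately show "norm (a \<eta>) * norm (\<kappa> (\<xi> - \<eta>)) \<le> norm (a \<eta>) * v + (if v \<le> norm (\<kappa> (\<xi> - \<eta>)) then s * c else 0)"
        by auto
    qed
    also have "\<dots> = (\<Sum>\<eta>\<in>{0..<M}. norm (a \<eta>)) * v + real (card W) * (s * c)"
      unfolding W_def by (simp add: sum.distrib sum.If_cases Int_def flip: sum_distrib_right)
    also have "\<dots> \<le> of_int M * v + m * (s * c)"
      using asum cW v s c0 by (intro add_mono mult_right_mono) auto
    finally show "(\<Sum>\<eta>\<in>{0..<M}. norm (a \<xi>) * norm (a \<eta>) * norm (\<kappa> (\<xi> - \<eta>))) \<le> norm (a \<xi>) * (of_int M * v + m * (s * c))"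
      by (simp add: mult.assoc mult_left_mono flip: sum_distrib_left)
  qed
  also have "\<dots> = (\<Sum>\<xi>\<in>{0..<M}. norm (a \<xi>)) * (of_int M * v + m * (s * c))"
    by (simp add: sum_distrib_right)
  also have "\<dots> \<le> of_int M * (of_int M * v + m * (s * c))"
    using asum M v m s c0 by (intro mult_right_mono) auto
  also have "\<dots> = v * (of_int M)\<^sup>2 + of_int M * m * s * c"
    by (simp add: power2_eq_square algebra_simps)
  finally show ?thesis .
qed

text \<open>The side \<open>4 * N\<close> leaves room for all steps that concatenation produces:
  differences \<open>lf i - k\<close> with \<open>\<bar>lf i\<bar> \<le> N\<close> and
  \<open>\<bar>k\<bar> \<le> 3 * N\<close> in one coordinate, and differences of two points of
  \<open>{-N..2 * N}\<close> in the other.\<close>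

definition gbox :: "int \<Rightarrow> (int \<times> int) set" where
  "gbox N = {-(4*N)..4*N} \<times> {-(4*N)..4*N}"

text \<open>Differencing in \<open>d\<close> turns the shift by \<open>d\<^sup>2\<close> into shifts by \<open>2ab\<close>.\<close>

definition bstep :: "int \<times> int \<Rightarrow> int" where
  "bstep \<tau> = 2 * fst \<tau> * snd \<tau>"

lemma finite_gbox [simp]: "finite (gbox N)"
  by (simp add: gbox_def)

lemma card_gbox_le:
  assumes "N > 0" shows "real (card (gbox N)) \<le> 81 * (of_int N)\<^sup>2"
proof -
  have "real (card (gbox N)) = (8 * of_int N + 1) * (8 * of_int N + 1)"
    using assms by (simp add: gbox_def card_cartesian_product)
  also have "\<dots> \<le> (9 * of_int N) * (9 * of_int N)" using assms by (intro mult_mono) auto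
  finally show ?thesis by (simp add: power2_eq_square)
qed

text \<open>For fixed \<open>a\<close> the sum over \<open>b\<close> is geometric in
  \<open>2 * a * \<eta> / M\<close>. If the kernel is large at \<open>\<eta>\<close>, many
  \<open>a\<close> bring this close to an integer, so recurrence places \<open>\<eta> / M\<close> on
  a major arc, and \<open>card_major_le\<close> counts such frequencies.\<close>

lemma card_large_box_kernel:
  assumes K: "K \<ge> 2" and N: "of_int N \<ge> K ^ 40" and M: "M = 2 * N\<^sup>2"
  shows "real (card {\<eta>\<in>{0..<M}. (of_int N)\<^sup>2 / (8 * K) \<le> norm (\<Sum>b\<in>gbox N. zchar M (\<eta> * bstep b))}) \<le> K ^ 114"
proof -
  define n where "n = real_of_int N"
  have "0 < K ^ 40" using K by simp
  then have n: "n \<ge> K ^ 40" "n > 0" using N unfolding n_def by linarith+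
  have N0: "N > 0" using n n_def by simp
  have Kp: "0 < K" "1 \<le> K" using K by auto
  have "major (K ^ 36) N (of_int \<eta> / of_int M)"
    if eta: "n\<^sup>2 / (8 * K) \<le> norm (\<Sum>b\<in>gbox N. zchar M (\<eta> * bstep b))" for \<eta>
  proof -
    define h where "h = 2 * (of_int \<eta> / real_of_int M)"
    define E where "E = (\<lambda>a. norm (\<Sum>b\<in>{-(4*N)..4*N}. add_char (of_int b * (h * of_int a))))"
    have "(\<Sum>b\<in>gbox N. zchar M (\<eta> * bstep b)) = (\<Sum>a\<in>{-(4*N)..4*N}. \<Sum>b\<in>{-(4*N)..4*N}. zchar M (\<eta> * bstep (a, b)))"
      unfolding gbox_def by (simp add: sum.cartesian_product)
    also have "norm \<dots> \<le> (\<Sum>a\<in>{-(4*N)..4*N}. E a)"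
      unfolding E_def zchar_def bstep_def h_def
      by (intro sum_norm_le) (simp add: mult_ac)
    finally have sE: "n\<^sup>2 / (8 * K) \<le> (\<Sum>a\<in>{-(4*N)..4*N}. E a)" using eta by linarith
    have Eu: "E a \<le> 9 * n" for a
    proof -
      have "E a \<le> real (card {-(4*N)..4*N}) * 1" unfolding E_def by (rule sum_norm_bound) simp
      then show ?thesis using N0 unfolding n_def by simp
    qed
    define R where "R = {a\<in>{-(4*N)..4*N}. n / (160 * K) \<le> E a}"
    have "n\<^sup>2 / (8 * K) / 2 \<le> 9 * n * real (card R)"
      unfolding R_def
    proof (rule card_large_terms[OF _ Eu _ _ _ sE])
      have "real (card {-(4*N)..4*N}) \<le> 9 * n" using N0 unfolding n_def by simp
      then have "2 * (n / (160 * K)) * real (card {-(4*N)..4*N}) \<le> 2 * (n / (160 * K)) * (9 * n)"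
        using n Kp by (intro mult_left_mono) auto
      also have "\<dots> \<le> n\<^sup>2 / (8 * K)" using n Kp by (simp add: field_simps power2_eq_square)
      finally show "2 * (n / (160 * K)) * real (card {-(4*N)..4*N}) \<le> n\<^sup>2 / (8 * K)" .
    qed (use n Kp in auto)
    then have cR: "n / (144 * K) \<le> real (card R)" using n Kp by (simp add: field_simps power2_eq_square)
    have dR: "dist_circle (h * of_int a) \<le> 160 * K / n" if "a \<in> R" for a
    proof -
      have "n / (160 * K) * dist_circle (h * of_int a) \<le> E a * dist_circle (h * of_int a)"
        using that R_def by (intro mult_right_mono) auto
      also have "\<dots> \<le> 1" unfolding E_def by (rule norm_sum_add_char_le)
      finally show ?thesis using n Kp by (simp add: field_simps)
    qed
    define K' where "K' = K ^ 11"
    have K': "K' \<ge> 2" using self_le_power[of K 11] K unfolding K'_def by simp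
    have "\<exists>q::int. 0 < q \<and> of_int q \<le> 5 * K' \<and> dist_circle (of_int q * h) \<le> 160 * K'\<^sup>2 * (160 * K / n) / of_int (4 * N)"
    proof (rule recurrence_major[OF K' _ _ _ dR])
      have "8 * K' \<le> K ^ 40" unfolding K'_def by (rule const_le_power[OF K, of _ 3]) auto
      also have "\<dots> < real_of_int (4 * N)" using n unfolding n_def by simp
      finally show "8 * K' < real_of_int (4 * N)" .
      show "R \<subseteq> {-(4*N)..4*N}" unfolding R_def by auto
      have "576 * K ^ 1 \<le> K'" unfolding K'_def by (rule const_le_power[OF K, of _ 10]) auto
      then have "of_int (4*N) / K' \<le> 4 * n / (576 * K)"
        using n Kp K' divide_left_mono[of "576 * K" K' "4 * n"] unfolding n_def by simp
      then show "of_int (4*N) / K' \<le> real (card R)" using cR by simp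
      have "160 * K * (128 * K') = 20480 * K ^ 12" unfolding K'_def by (simp flip: power_Suc)
      also have "\<dots> \<le> K ^ 39" by (rule const_le_power[OF K, of _ 15]) auto
      also have "\<dots> < K ^ 40" using K by simp
      finally show "160 * K / n < 1 / (128 * K')" using n K' by (simp add: field_simps)
    qed
    then obtain q :: int where q: "0 < q" "of_int q \<le> 5 * K'"
      "dist_circle (of_int q * h) \<le> 160 * K'\<^sup>2 * (160 * K / n) / of_int (4 * N)" by blast
    show ?thesis unfolding major_def
    proof (intro exI[of _ "2 * q"] conjI)
      show "0 < 2 * q" using q by simp
      have "10 * K' \<le> K ^ 36" unfolding K'_def by (rule const_le_power[OF K, of _ 4]) auto
      then show "real_of_int (2 * q) \<le> K ^ 36" using q by simp
      have "160 * K'\<^sup>2 * (160 * K / n) / of_int (4 * N) = 6400 * (K'\<^sup>2 * K) / n\<^sup>2"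
        using n by (simp add: power2_eq_square field_simps flip: n_def)
      also have "K'\<^sup>2 * K = K ^ 23" unfolding K'_def by (simp flip: power_mult power_Suc2)
      also have "6400 * K ^ 23 / n\<^sup>2 \<le> K ^ 36 / n\<^sup>2"
        by (intro divide_right_mono const_le_power[OF K, of _ 13]) auto
      finally show "dist_circle (of_int (2 * q) * (of_int \<eta> / of_int M)) \<le> K ^ 36 / (of_int N)\<^sup>2"
        using q(3) unfolding h_def n_def by (simp add: mult.assoc mult.left_commute)
    qed
  qed
  then have "card {\<eta>\<in>{0..<M}. n\<^sup>2 / (8 * K) \<le> norm (\<Sum>b\<in>gbox N. zchar M (\<eta> * bstep b))}
     \<le> card {\<eta>\<in>{0..<M}. major (K ^ 36) N (of_int \<eta> / of_int M)}"
    by (intro card_mono finite_subset[of "{\<eta>\<in>{0..<M}. _ \<eta>}" "{0..<M}"]) auto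
  also have "real \<dots> \<le> 60 * (K ^ 36) ^ 3"
  proof (rule card_major_le[OF N0 _ _ M])
    have "K ^ 36 \<le> K ^ 40" using Kp by (intro power_increasing) auto
    then show "K ^ 36 \<le> of_int N" using N by linarith
  qed (use Kp in simp)
  also have "\<dots> = 60 * K ^ 108" by (simp flip: power_mult)
  also have "\<dots> \<le> K ^ 114" by (rule const_le_power[OF K, of _ 6]) auto
  finally show ?thesis unfolding n_def by simp
qed

text \<open>The steps \<open>2ab\<close> are equidistributed outside major arcs, so correlations along them
  detect a large Fourier coefficient.\<close>

lemma large_zft_of_box_correlations:
  assumes K: "K \<ge> 2" and N: "of_int N \<ge> K ^ 40" and M: "M = 2 * N\<^sup>2"
    and P: "unit_periodic M P" and Q: "unit_periodic M Q"
    and big: "(of_int N) ^ 6 / K \<le> (\<Sum>b\<in>gbox N. (norm (\<Sum>y\<in>{0..<M}. cnj (P y) * Q (y + bstep b)))\<^sup>2)"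
  shows "\<exists>\<xi>. norm (zft M Q \<xi>) \<ge> (of_int N)\<^sup>2 / K ^ 124"
proof (rule ccontr)
  define n where "n = real_of_int N"
  have "0 < K ^ 40" using K by simp
  then have n: "n > 0" using N unfolding n_def by linarith+
  have N0: "N > 0" using n n_def by simp
  have Kp: "0 < K" using K by auto
  have Mn: "real_of_int M = 2 * n\<^sup>2" using M by (simp add: n_def)
  have M0: "M > 0" using M N0 by simp
  assume "\<not> ?thesis"
  then have s: "norm (zft M Q \<xi>) \<le> n\<^sup>2 / K ^ 124" for \<xi> unfolding n_def by (meson linear)
  \<comment> \<open>With kernel threshold \<open>n^2 / (8 * K)\<close> and
    \<open>M = 2 * n^2\<close> the minor contribution is exactly half of the assumed lower bound.
    The major contribution is \<open>162 * n^6 / K^10\<close>, where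
    \<open>K^10 = K^124 / K^114\<close>; this is too small for the other half.\<close>
  have "n ^ 6 / K \<le> n\<^sup>2 / (8 * K) * (of_int M)\<^sup>2 + of_int M * K ^ 114 * (n\<^sup>2 / K ^ 124) * (81 * n\<^sup>2)"
    using big unit_periodic_kernel_split[OF M0 finite_gbox card_gbox_le[OF N0] _ _ card_large_box_kernel[OF K N M] P Q _ s]
      n Kp unfolding n_def by simp
  also have "\<dots> = n ^ 6 / (2 * K) + n ^ 6 * (162 / K ^ 10)"
  proof -
    have e: "K ^ 124 = K ^ 114 * K ^ 10" by (simp flip: power_add)
    have "of_int M * K ^ 114 * (n\<^sup>2 / K ^ 124) * (81 * n\<^sup>2) = n ^ 6 * (162 / K ^ 10)"
      unfolding Mn e using Kp by (simp add: eval_nat_numeral)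
    moreover have "n\<^sup>2 / (8 * K) * (of_int M)\<^sup>2 = n ^ 6 / (2 * K)"
      unfolding Mn using Kp by (simp add: eval_nat_numeral)
    ultimately show ?thesis by simp
  qed
  finally have "n ^ 6 * (1 / (2 * K)) \<le> n ^ 6 * (162 / K ^ 10)" by (simp add: field_simps)
  then have "1 / (2 * K) \<le> 162 / K ^ 10" by (rule mult_left_le_imp_le) (use n in simp)
  then have "K ^ 10 \<le> 324 * K" using Kp by (simp add: field_simps)
  moreover have "324 * K ^ 1 < K ^ 10"
  proof -
    have "324 * K ^ 1 < 512 * K ^ 1" using Kp by simp
    also have "\<dots> \<le> K ^ 10" by (rule const_le_power[OF K, of _ 9]) auto
    finally show ?thesis .
  qed
  ultimately show False by simp
qed

section \<open>Van der Corput differencing\<close>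

text \<open>The van der Corput step: remove the factor \<open>u\<close> and duplicate the variable \<open>w\<close>.\<close>

lemma cauchy_schwarz_shift:
  fixes J :: "'p \<Rightarrow> 'w set"
  assumes P: "finite P" and M: "M > 0" and u: "\<And>p. p \<in> P \<Longrightarrow> unit_periodic M (u p)"
    and v: "\<And>p w. p \<in> P \<Longrightarrow> w \<in> J p \<Longrightarrow> unit_periodic M (v p w)"
  shows "(norm (\<Sum>p\<in>P. \<Sum>w\<in>J p. \<Sum>y\<in>{0..<M}. u p (y + s p w) * v p w y))\<^sup>2
    \<le> real (card P) * of_int M *
      norm (\<Sum>p\<in>P. \<Sum>w\<in>J p. \<Sum>w'\<in>J p. \<Sum>y\<in>{0..<M}. v p w y * cnj (v p w' (y + s p w - s p w')))"
proof -
  define b where "b = (\<lambda>(p, z). \<Sum>w\<in>J p. v p w (z - s p w))"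
  have "(\<Sum>p\<in>P. \<Sum>w\<in>J p. \<Sum>y\<in>{0..<M}. u p (y + s p w) * v p w y)
      = (\<Sum>p\<in>P. \<Sum>w\<in>J p. \<Sum>z\<in>{0..<M}. u p z * v p w (z - s p w))"
  proof (rule sum.cong[OF refl], rule sum.cong[OF refl])
    fix p w assume pw: "p \<in> P" "w \<in> J p"
    have "unit_periodic M (\<lambda>z. u p z * v p w (z - s p w))"
      using u[OF pw(1)] v[OF pw] by (intro unit_periodic_mult unit_periodic_comp[OF v[OF pw]]) auto
    from unit_periodic_sum_shift[OF this M, of "s p w"]
    show "(\<Sum>y\<in>{0..<M}. u p (y + s p w) * v p w y) = (\<Sum>z\<in>{0..<M}. u p z * v p w (z - s p w))" by simp
  qed
  also have "\<dots> = (\<Sum>p\<in>P. \<Sum>z\<in>{0..<M}. u p z * b (p, z))"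
    unfolding b_def prod.case sum_distrib_left by (rule sum.cong[OF refl]) (rule sum.swap)
  also have "\<dots> = (\<Sum>i\<in>P \<times> {0..<M}. u (fst i) (snd i) * b i)"
    by (simp add: sum.cartesian_product case_prod_beta)
  finally have "(norm (\<Sum>p\<in>P. \<Sum>w\<in>J p. \<Sum>y\<in>{0..<M}. u p (y + s p w) * v p w y))\<^sup>2
      \<le> real (card (P \<times> {0..<M})) * (\<Sum>i\<in>P \<times> {0..<M}. (norm (b i))\<^sup>2)"
    using u by (auto intro!: norm_sum_squared_le_card simp: unit_periodic_def)
  moreover have "(\<Sum>i\<in>P \<times> {0..<M}. (norm (b i))\<^sup>2)
      = norm (\<Sum>p\<in>P. \<Sum>w\<in>J p. \<Sum>w'\<in>J p. \<Sum>y\<in>{0..<M}. v p w y * cnj (v p w' (y + s p w - s p w')))"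
  proof -
    have "complex_of_real (\<Sum>i\<in>P \<times> {0..<M}. (norm (b i))\<^sup>2)
        = (\<Sum>p\<in>P. \<Sum>z\<in>{0..<M}. complex_of_real ((norm (b (p, z)))\<^sup>2))"
      by (simp add: sum.cartesian_product case_prod_beta)
    also have "\<dots> = (\<Sum>p\<in>P. \<Sum>z\<in>{0..<M}. \<Sum>w\<in>J p. \<Sum>w'\<in>J p. v p w (z - s p w) * cnj (v p w' (z - s p w')))"
      unfolding b_def prod.case norm_sum_squared ..
    also have "\<dots> = (\<Sum>p\<in>P. \<Sum>w\<in>J p. \<Sum>w'\<in>J p. \<Sum>z\<in>{0..<M}. v p w (z - s p w) * cnj (v p w' (z - s p w')))"
      by (rule sum.cong[OF refl]) (rule sum_swap3)
    also have "\<dots> = (\<Sum>p\<in>P. \<Sum>w\<in>J p. \<Sum>w'\<in>J p. \<Sum>y\<in>{0..<M}. v p w y * cnj (v p w' (y + s p w - s p w')))"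
    proof (rule sum.cong[OF refl], rule sum.cong[OF refl], rule sum.cong[OF refl])
      fix p w w' assume pw: "p \<in> P" "w \<in> J p" "w' \<in> J p"
      have "unit_periodic M (\<lambda>z. v p w (z - s p w) * cnj (v p w' (z - s p w')))"
        by (intro unit_periodic_mult unit_periodic_cnj unit_periodic_comp[OF v[OF pw(1,2)]] unit_periodic_comp[OF v[OF pw(1,3)]]) auto
      from unit_periodic_sum_shift[OF this M, of "s p w"]
      show "(\<Sum>z\<in>{0..<M}. v p w (z - s p w) * cnj (v p w' (z - s p w'))) =
        (\<Sum>y\<in>{0..<M}. v p w y * cnj (v p w' (y + s p w - s p w')))" by simp
    qed
    finally have "norm (complex_of_real (\<Sum>i\<in>P \<times> {0..<M}. (norm (b i))\<^sup>2)) =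
      norm (\<Sum>p\<in>P. \<Sum>w\<in>J p. \<Sum>w'\<in>J p. \<Sum>y\<in>{0..<M}. v p w y * cnj (v p w' (y + s p w - s p w')))" by simp
    then show ?thesis by (simp add: sum_nonneg del: of_real_sum)
  qed
  moreover have "real (card (P \<times> {0..<M})) = real (card P) * of_int M"
    using M by (simp add: card_cartesian_product)
  ultimately show ?thesis by simp
qed

lemma sum_pairs_by_difference:
  fixes g :: "int \<Rightarrow> int \<Rightarrow> 'a::comm_monoid_add"
  assumes "finite J" "finite D" "\<And>w w'. w \<in> J \<Longrightarrow> w' \<in> J \<Longrightarrow> w' - w \<in> D"
  shows "(\<Sum>w\<in>J. \<Sum>w'\<in>J. g w w') = (\<Sum>k\<in>D. \<Sum>w\<in>{w\<in>J. w + k \<in> J}. g w (w + k))"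
proof -
  have "(\<Sum>w\<in>J. \<Sum>w'\<in>J. g w w') = (\<Sum>(w, w')\<in>J \<times> J. g w w')" by (rule sum.cartesian_product)
  also have "\<dots> = (\<Sum>(k, w)\<in>Sigma D (\<lambda>k. {w\<in>J. w + k \<in> J}). g w (w + k))"
    by (rule sum.reindex_bij_witness[of _ "\<lambda>(k, w). (w, w + k)" "\<lambda>(w, w'). (w' - w, w)"]) (use assms in auto)
  also have "\<dots> = (\<Sum>k\<in>D. \<Sum>w\<in>{w\<in>J. w + k \<in> J}. g w (w + k))"
    using assms by (intro sum.Sigma[symmetric]) auto
  finally show ?thesis .
qed

lemma sum_pairs_fibre:
  fixes g :: "'w \<Rightarrow> 'x \<Rightarrow> 'x \<Rightarrow> 'a::comm_monoid_add"
  assumes "finite W" "finite X"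
  shows "(\<Sum>w\<in>W. \<Sum>x\<in>{x\<in>X. R w x}. \<Sum>x'\<in>{x\<in>X. R w x}. g w x x')
    = (\<Sum>x\<in>X. \<Sum>x'\<in>X. \<Sum>w\<in>{w\<in>W. R w x \<and> R w x'}. g w x x')"
proof -
  have "(\<Sum>w\<in>W. \<Sum>x\<in>{x\<in>X. R w x}. \<Sum>x'\<in>{x\<in>X. R w x}. g w x x')
     = (\<Sum>w\<in>W. \<Sum>x\<in>X. \<Sum>x'\<in>X. if R w x \<and> R w x' then g w x x' else 0)"
    using assms(2) by (simp only: sum.inter_filter) (auto intro!: sum.cong)
  also have "\<dots> = (\<Sum>x\<in>X. \<Sum>x'\<in>X. \<Sum>w\<in>W. if R w x \<and> R w x' then g w x x' else 0)"
    by (rule sum_swap3)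
  finally show ?thesis using assms(1) by (simp only: sum.inter_filter)
qed

section \<open>Pairs of integers with a small entry or a large gcd\<close>

lemma sum_interval_square_le:
  assumes "G \<ge> 1"
  shows "(\<Sum>g\<in>{Suc G..G + m}. 1 / (real g)\<^sup>2) \<le> 1 / real G - 1 / real (G + m)"
proof (induction m)
  case 0 then show ?case by simp
next
  case (Suc m)
  have "1 / (real (Suc (G + m)))\<^sup>2 \<le> 1 / real (G + m) - 1 / real (Suc (G + m))"
  proof -
    have "1 / real (G + m) - 1 / real (Suc (G + m)) = 1 / (real (G + m) * real (Suc (G + m)))"
      using assms by (simp add: field_simps)
    moreover have "1 / (real (Suc (G + m)))\<^sup>2 \<le> 1 / (real (G + m) * real (Suc (G + m)))"
      unfolding power2_eq_square using assms by (intro divide_left_mono mult_right_mono mult_pos_pos) auto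
    ultimately show ?thesis by simp
  qed
  then show ?case using Suc by simp
qed

lemma card_multiples_le:
  fixes g :: nat and L :: int
  assumes "g > 0" "L \<ge> 0"
  shows "real (card {a\<in>{-L..L}. a \<noteq> 0 \<and> int g dvd a}) \<le> 2 * of_int L / real g"
proof -
  define m where "m = L div int g"
  have m0: "m \<ge> 0" using assms unfolding m_def by (simp add: pos_imp_zdiv_nonneg_iff)
  have "{a\<in>{-L..L}. a \<noteq> 0 \<and> int g dvd a} \<subseteq> (\<lambda>t. int g * t) ` ({-m..-1} \<union> {1..m})"
  proof
    fix a assume "a \<in> {a\<in>{-L..L}. a \<noteq> 0 \<and> int g dvd a}"
    then obtain t where t: "a = int g * t" "\<bar>int g * t\<bar> \<le> L" "t \<noteq> 0" by auto
    have "int g * \<bar>t\<bar> \<le> L" using t(2) assms by (simp add: abs_mult)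
    then have "(int g * \<bar>t\<bar>) div int g \<le> L div int g" using assms by (intro zdiv_mono1) auto
    then have "\<bar>t\<bar> \<le> m" using assms unfolding m_def by simp
    then have "t \<in> {-m..-1} \<union> {1..m}" using t(3) by auto
    then show "a \<in> (\<lambda>t. int g * t) ` ({-m..-1} \<union> {1..m})" using t(1) by blast
  qed
  then have "card {a\<in>{-L..L}. a \<noteq> 0 \<and> int g dvd a} \<le> card ((\<lambda>t. int g * t) ` ({-m..-1} \<union> {1..m}))"
    by (intro card_mono) auto
  also have "\<dots> \<le> card ({-m..-1} \<union> {1..m})" by (rule card_image_le) auto
  also have "\<dots> \<le> card {-m..-1} + card {1..m}" by (rule card_Un_le)
  finally have "real (card {a\<in>{-L..L}. a \<noteq> 0 \<and> int g dvd a}) \<le> 2 * of_int m" using m0 by simp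
  also have "of_int m \<le> of_int L / real g" using real_of_int_div4[of L "int g"] unfolding m_def by simp
  finally show ?thesis by simp
qed

text \<open>A pair of nonzero integers with gcd \<open>g > G\<close> consists of two multiples of
  \<open>g\<close>. There are at most \<open>(2 * L / g)^2\<close> such pairs, and the tail of the
  series of inverse squares beyond \<open>G\<close> is at most \<open>1 / G\<close>. Pairs with a
  small entry, in particular those with a zero entry, are counted separately.\<close>

lemma card_bad_pairs_le:
  fixes L :: int and G :: nat
  assumes L: "L \<ge> 1" and h: "h > 0" and G: "G \<ge> 1"
  shows "real (card {(a, b)\<in>{-L..L} \<times> {-L..L}. \<bar>of_int a\<bar> < h \<or> \<bar>of_int b\<bar> < h \<or> gcd a b > int G})
    \<le> 6 * of_int L * (2 * h + 1) + 4 * (of_int L)\<^sup>2 / real G"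
proof -
  define A where "A = {a\<in>{-L..L}. \<bar>real_of_int a\<bar> < h}"
  define D where "D = (\<lambda>g. {a\<in>{-L..L}. a \<noteq> 0 \<and> int g dvd a})"
  define U where "U = (\<Union>g\<in>{Suc G..G + nat L}. D g \<times> D g)"
  have cA: "real (card A) \<le> 2 * h + 1"
  proof (cases "A = {}")
    case False
    have "finite A" by (rule finite_subset[of _ "{-L..L}"]) (auto simp: A_def)
    then show ?thesis using False by (rule card_le_diameter) (auto simp: A_def)
  qed (use h in simp)
  have cL: "real (card {-L..L}) \<le> 3 * of_int L" using L by simp
  have cD: "real (card (D g)) \<le> 2 * of_int L / real g" if "g \<in> {Suc G..G + nat L}" for g
    unfolding D_def using that L by (intro card_multiples_le) auto
  have cU: "real (card U) \<le> 4 * (of_int L)\<^sup>2 / real G"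
  proof -
    have "card U \<le> (\<Sum>g\<in>{Suc G..G + nat L}. card (D g \<times> D g))"
      unfolding U_def by (rule card_UN_le) simp
    then have "real (card U) \<le> (\<Sum>g\<in>{Suc G..G + nat L}. real (card (D g)) * real (card (D g)))"
      by (simp add: card_cartesian_product flip: of_nat_mult of_nat_sum)
    also have "\<dots> \<le> (\<Sum>g\<in>{Suc G..G + nat L}. (2 * of_int L / real g) * (2 * of_int L / real g))"
      using cD L by (intro sum_mono mult_mono) auto
    also have "\<dots> = 4 * (of_int L)\<^sup>2 * (\<Sum>g\<in>{Suc G..G + nat L}. 1 / (real g)\<^sup>2)"
      by (simp add: sum_distrib_left power2_eq_square)
    also have "\<dots> \<le> 4 * (of_int L)\<^sup>2 * (1 / real G)"
    proof (rule mult_left_mono)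
      have "0 \<le> 1 / real (G + nat L)" by simp
      then show "(\<Sum>g\<in>{Suc G..G + nat L}. 1 / (real g)\<^sup>2) \<le> 1 / real G"
        using sum_interval_square_le[OF G, of "nat L"] by linarith
    qed simp
    finally show ?thesis by simp
  qed
  have "{(a, b)\<in>{-L..L} \<times> {-L..L}. \<bar>of_int a\<bar> < h \<or> \<bar>of_int b\<bar> < h \<or> gcd a b > int G}
      \<subseteq> (A \<times> {-L..L} \<union> {-L..L} \<times> A) \<union> U"
  proof (rule subsetI)
    fix z assume z: "z \<in> {(a, b)\<in>{-L..L} \<times> {-L..L}. \<bar>of_int a\<bar> < h \<or> \<bar>of_int b\<bar> < h \<or> gcd a b > int G}"
    obtain a b where ab: "z = (a, b)" "a \<in> {-L..L}" "b \<in> {-L..L}" "\<bar>real_of_int a\<bar> < h \<or> \<bar>real_of_int b\<bar> < h \<or> gcd a b > int G"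
      using z by auto
    show "z \<in> (A \<times> {-L..L} \<union> {-L..L} \<times> A) \<union> U"
    proof (cases "\<bar>real_of_int a\<bar> < h \<or> \<bar>real_of_int b\<bar> < h")
      case True then show ?thesis using ab unfolding A_def by auto
    next
      case False
      then have ne: "a \<noteq> 0" "b \<noteq> 0" using h by auto
      have gG: "gcd a b > int G" using ab False by auto
      have "gcd a b \<le> \<bar>a\<bar>" using dvd_imp_le_int[OF ne(1), of "gcd a b"] by simp
      then have "gcd a b \<le> L" using ab by auto
      moreover have "gcd a b = int (nat (gcd a b))" by simp
      ultimately have "nat (gcd a b) \<in> {Suc G..G + nat L}" using gG by auto
      moreover have "a \<in> D (nat (gcd a b))" "b \<in> D (nat (gcd a b))" using ab ne unfolding D_def by auto
      ultimately have "(a, b) \<in> U" unfolding U_def by blast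
      then show ?thesis using ab by simp
    qed
  qed
  moreover have "finite A" by (rule finite_subset[of _ "{-L..L}"]) (auto simp: A_def)
  moreover have "finite (D g)" for g by (rule finite_subset[of _ "{-L..L}"]) (auto simp: D_def)
  then have "finite U" unfolding U_def by simp
  ultimately have "card {(a, b)\<in>{-L..L} \<times> {-L..L}. \<bar>of_int a\<bar> < h \<or> \<bar>of_int b\<bar> < h \<or> gcd a b > int G}
     \<le> card ((A \<times> {-L..L} \<union> {-L..L} \<times> A) \<union> U)"
    by (intro card_mono) auto
  also have "\<dots> \<le> card (A \<times> {-L..L}) + card ({-L..L} \<times> A) + card U"
    by (intro order_trans[OF card_Un_le] add_mono card_Un_le order_refl)
  also have "real \<dots> \<le> 2 * ((2 * h + 1) * (3 * of_int L)) + 4 * (of_int L)\<^sup>2 / real G"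
  proof -
    have "real (card A) * real (card {-L..L}) \<le> (2 * h + 1) * (3 * of_int L)"
      using cA cL h by (intro mult_mono) auto
    then show ?thesis using cU by (simp only: of_nat_add card_cartesian_product of_nat_mult) (simp only: mult.commute[of "real (card {-L..L})"])
  qed
  finally show ?thesis by (simp add: algebra_simps)
qed

section \<open>Three differencings of the form\<close>

text \<open>Three applications of Cauchy--Schwarz. With \<open>w = x + d\<close> as outer variable
  the first removes \<open>f1\<close> and doubles \<open>x\<close> into \<open>x\<close>,
  \<open>x'\<close>. The second removes both copies of \<open>f0\<close> and doubles
  \<open>w\<close>, with difference \<open>k\<close>. The third removes one copy of
  \<open>f x\<close> and doubles \<open>w\<close> again, with difference \<open>m\<close>. The
  surviving factors of \<open>f x\<close> form a difference of step \<open>2 * k * m\<close> that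
  does not involve \<open>w\<close>. The factors of \<open>f x'\<close> depend on \<open>w\<close>
  only through the linear shifts by \<open>2 * (x - x' - k) * w\<close> and
  \<open>2 * (x - x') * w\<close>, as concatenation requires.\<close>

lemma pet_van_der_corput:
  fixes f0 f1 f :: "int \<Rightarrow> int \<Rightarrow> complex" and N L j s :: int
  assumes N: "N > 0" and M: "M = 2 * N\<^sup>2" and X: "X \<subseteq> {1..N}" "real (card X) \<le> l" and j: "1 \<le> j" "j \<le> N"
    and K: "K > 0" and l: "l > 0"
    and f0: "\<And>x. unit_periodic M (f0 x)" and f1: "\<And>x. unit_periodic M (f1 x)" and f: "\<And>x. unit_periodic M (f x)"
    and big: "l * (of_int N) ^ 3 / K \<le> norm (\<Sum>x\<in>X. \<Sum>d\<in>{-j<..<j}. \<Sum>y\<in>{0..<M}. f0 x y * f1 (x + d) y * f x (y + d\<^sup>2))"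
  shows "l\<^sup>2 * (of_int N) ^ 5 / (720000 * K ^ 8) \<le> norm (\<Sum>x\<in>X. \<Sum>k\<in>{-(3*N)..3*N}. \<Sum>m\<in>{-(3*N)..3*N}. \<Sum>x'\<in>X.
     \<Sum>w\<in>{w. \<bar>w - x\<bar> < j \<and> \<bar>w - x'\<bar> < j \<and> \<bar>w + k - x\<bar> < j \<and> \<bar>w + k - x'\<bar> < j \<and>
            \<bar>w + m - x\<bar> < j \<and> \<bar>w + m - x'\<bar> < j \<and> \<bar>w + m + k - x\<bar> < j \<and> \<bar>w + m + k - x'\<bar> < j}. \<Sum>y\<in>{0..<M}.
       (cnj (f x y) * f x (y + 2 * k * m)) *
       (\<lambda>z. cnj (f x' (z + ((x-x')\<^sup>2 - k\<^sup>2 - 2*(x-x'-k)*x))) * f x' (z + ((x-x')\<^sup>2 - k\<^sup>2 - 2*(x-x'-k)*x) + 2*(x-x')*m)) (y + 2 * (x - x' - k) * w) *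
       (\<lambda>z. f x' (z + ((k+(x-x'))\<^sup>2 - k\<^sup>2 - 2*(x-x')*x)) * cnj (f x' (z + ((k+(x-x'))\<^sup>2 - k\<^sup>2 - 2*(x-x')*x) + 2*(k+(x-x'))*m))) (y + 2 * (x - x') * w))"
proof -
  define n where "n = real_of_int N"
  have n: "n > 0" "n \<ge> 1" using N by (auto simp: n_def)
  have M0: "M > 0" using M N by simp
  have Mn: "real_of_int M = 2 * n\<^sup>2" using M by (simp add: n_def)
  have finX: "finite X" using X finite_subset by blast
  define W where "W = {-N..2*N}"
  have finW: "finite W" unfolding W_def by simp
  have cW: "real (card W) \<le> 4 * n" using N unfolding W_def n_def by simp
  define Kr where "Kr = {-(3*N)..3*N}"
  have cKr: "real (card Kr) \<le> 7 * n" using N unfolding Kr_def n_def by simp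
  define R where "R = (\<lambda>w x. \<bar>w - x\<bar> < j)"
  define v1 where "v1 = (\<lambda>w x y. f0 x y * f x (y + (w - x)\<^sup>2))"
  have fsh: "unit_periodic M (\<lambda>y. f x (y + t))" for x t by (rule unit_periodic_comp[OF f]) auto
  have v1p: "unit_periodic M (v1 w x)" for w x
    unfolding v1_def by (intro unit_periodic_mult f0 fsh)
  have re1: "(\<Sum>x\<in>X. \<Sum>d\<in>{-j<..<j}. \<Sum>y\<in>{0..<M}. f0 x y * f1 (x + d) y * f x (y + d\<^sup>2))
     = (\<Sum>w\<in>W. \<Sum>x\<in>{x\<in>X. R w x}. \<Sum>y\<in>{0..<M}. f1 w (y + 0) * v1 w x y)"
  proof -
    have "(\<Sum>x\<in>X. \<Sum>d\<in>{-j<..<j}. \<Sum>y\<in>{0..<M}. f0 x y * f1 (x + d) y * f x (y + d\<^sup>2))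
       = (\<Sum>(x, d)\<in>X \<times> {-j<..<j}. \<Sum>y\<in>{0..<M}. f0 x y * f1 (x + d) y * f x (y + d\<^sup>2))"
      by (rule sum.cartesian_product)
    also have "\<dots> = (\<Sum>(w, x)\<in>Sigma W (\<lambda>w. {x\<in>X. R w x}). \<Sum>y\<in>{0..<M}. f1 w (y + 0) * v1 w x y)"
      by (rule sum.reindex_bij_witness[of _ "\<lambda>(w, x). (x, w - x)" "\<lambda>(x, d). (x + d, x)"])
        (use X j in \<open>auto simp: R_def W_def v1_def mult_ac\<close>)
    also have "\<dots> = (\<Sum>w\<in>W. \<Sum>x\<in>{x\<in>X. R w x}. \<Sum>y\<in>{0..<M}. f1 w (y + 0) * v1 w x y)"
      using finX finW by (intro sum.Sigma[symmetric]) auto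
    finally show ?thesis .
  qed
  define D where "D = (\<lambda>p. {w\<in>W. R w (fst p) \<and> R w (snd p)})"
  define v2 where "v2 = (\<lambda>p w y. f (fst p) (y + (w - fst p)\<^sup>2) * cnj (f (snd p) (y + (w - snd p)\<^sup>2)))"
  have v2p: "unit_periodic M (v2 p w)" for p w
    unfolding v2_def by (intro unit_periodic_mult unit_periodic_cnj fsh)
  define R1 where "R1 = (\<Sum>p\<in>X \<times> X. \<Sum>w\<in>D p. \<Sum>y\<in>{0..<M}. (f0 (fst p) (y + 0) * cnj (f0 (snd p) (y + 0))) * v2 p w y)"
  have b1: "(l * n ^ 3 / K)\<^sup>2 \<le> 4 * n * (2 * n\<^sup>2) * norm R1"
  proof -
    have "(l * n ^ 3 / K)\<^sup>2 \<le> (norm (\<Sum>w\<in>W. \<Sum>x\<in>{x\<in>X. R w x}. \<Sum>y\<in>{0..<M}. f1 w (y + 0) * v1 w x y))\<^sup>2"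
      using big K l n unfolding re1 n_def by (intro power_mono) auto
    also have "\<dots> \<le> real (card W) * of_int M * norm (\<Sum>w\<in>W. \<Sum>x\<in>{x\<in>X. R w x}. \<Sum>x'\<in>{x\<in>X. R w x}. \<Sum>y\<in>{0..<M}. v1 w x y * cnj (v1 w x' (y + 0 - 0)))"
      by (rule cauchy_schwarz_shift[OF finW M0 f1 v1p])
    also have "(\<Sum>w\<in>W. \<Sum>x\<in>{x\<in>X. R w x}. \<Sum>x'\<in>{x\<in>X. R w x}. \<Sum>y\<in>{0..<M}. v1 w x y * cnj (v1 w x' (y + 0 - 0))) = R1"
      unfolding sum_pairs_fibre[OF finW finX] R1_def D_def v1_def v2_def
      by (simp add: sum.cartesian_product case_prod_beta mult_ac)
    also have "real (card W) * of_int M * norm R1 \<le> 4 * n * (2 * n\<^sup>2) * norm R1"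
      using cW n unfolding Mn by (intro mult_right_mono) auto
    finally show ?thesis .
  qed
  define R2 where "R2 = (\<Sum>p\<in>X \<times> X. \<Sum>w\<in>D p. \<Sum>w'\<in>D p. \<Sum>y\<in>{0..<M}. v2 p w y * cnj (v2 p w' (y + 0 - 0)))"
  have cXX: "real (card (X \<times> X)) \<le> l\<^sup>2"
    using X(2) l by (simp add: card_cartesian_product power2_eq_square mult_mono)
  have b2: "(norm R1)\<^sup>2 \<le> l\<^sup>2 * (2 * n\<^sup>2) * norm R2"
  proof -
    have "(norm R1)\<^sup>2 \<le> real (card (X \<times> X)) * of_int M * norm R2"
      unfolding R1_def R2_def
      by (rule cauchy_schwarz_shift[where u = "\<lambda>p y. f0 (fst p) y * cnj (f0 (snd p) y)" and s = "\<lambda>_ _. 0"])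
        (use finX M0 v2p in \<open>auto intro!: unit_periodic_mult unit_periodic_cnj f0\<close>)
    also have "\<dots> \<le> l\<^sup>2 * (2 * n\<^sup>2) * norm R2"
      using cXX n unfolding Mn by (intro mult_right_mono) auto
    finally show ?thesis .
  qed
  define P3 where "P3 = (X \<times> X) \<times> Kr"
  define D3 where "D3 = (\<lambda>(p, k). {w\<in>D p. w + k \<in> D p})"
  define v3 where "v3 = (\<lambda>(p, k) w y. cnj (f (snd p) (y + (w - snd p)\<^sup>2)) *
     (cnj (f (fst p) (y + (w + k - fst p)\<^sup>2)) * f (snd p) (y + (w + k - snd p)\<^sup>2)))"
  have v3p: "unit_periodic M (v3 q w)" for q w
    unfolding v3_def by (cases q) (auto intro!: unit_periodic_mult unit_periodic_cnj fsh)
  have finD: "finite (D p)" for p unfolding D_def using finW by simp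
  have re2: "R2 = (\<Sum>q\<in>P3. \<Sum>w\<in>D3 q. \<Sum>y\<in>{0..<M}. f (fst (fst q)) (y + (w - fst (fst q))\<^sup>2) * v3 q w y)"
  proof -
    have "R2 = (\<Sum>p\<in>X \<times> X. \<Sum>k\<in>Kr. \<Sum>w\<in>{w\<in>D p. w + k \<in> D p}. \<Sum>y\<in>{0..<M}. v2 p w y * cnj (v2 p (w + k) (y + 0 - 0)))"
      unfolding R2_def
      by (rule sum.cong[OF refl], rule sum_pairs_by_difference[OF finD]) (auto simp: Kr_def D_def W_def)
    also have "\<dots> = (\<Sum>(p,k)\<in>P3. \<Sum>w\<in>{w\<in>D p. w + k \<in> D p}. \<Sum>y\<in>{0..<M}. v2 p w y * cnj (v2 p (w + k) (y + 0 - 0)))"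
      unfolding P3_def by (rule sum.cartesian_product)
    also have "\<dots> = (\<Sum>q\<in>P3. \<Sum>w\<in>D3 q. \<Sum>y\<in>{0..<M}. f (fst (fst q)) (y + (w - fst (fst q))\<^sup>2) * v3 q w y)"
      unfolding D3_def v3_def v2_def case_prod_beta by (simp add: mult_ac)
    finally show ?thesis .
  qed
  define R3 where "R3 = (\<Sum>q\<in>P3. \<Sum>w\<in>D3 q. \<Sum>w'\<in>D3 q. \<Sum>y\<in>{0..<M}. v3 q w y * cnj (v3 q w' (y + (w - fst (fst q))\<^sup>2 - (w' - fst (fst q))\<^sup>2)))"
  have b3: "(norm R2)\<^sup>2 \<le> l\<^sup>2 * (7 * n) * (2 * n\<^sup>2) * norm R3"
  proof -
    have "(norm R2)\<^sup>2 \<le> real (card P3) * of_int M * norm R3"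
      unfolding re2 R3_def
      by (rule cauchy_schwarz_shift) (use finX M0 v3p f in \<open>auto simp: P3_def Kr_def\<close>)
    also have "real (card P3) \<le> l\<^sup>2 * (7 * n)"
      unfolding P3_def card_cartesian_product[of "X \<times> X"] of_nat_mult using cXX cKr n by (intro mult_mono) auto
    then have "real (card P3) * of_int M * norm R3 \<le> l\<^sup>2 * (7 * n) * (2 * n\<^sup>2) * norm R3"
      using n unfolding Mn by (intro mult_right_mono) auto
    finally show ?thesis .
  qed
  have lower: "l\<^sup>2 * n ^ 5 / (720000 * K ^ 8) \<le> norm R3"
  proof -
    have c1: "l\<^sup>2 * n ^ 3 / (8 * K\<^sup>2) \<le> norm R1"
    proof -
      have "(l * n ^ 3 / K)\<^sup>2 = 8 * n ^ 3 * (l\<^sup>2 * n ^ 3 / (8 * K\<^sup>2))"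
        using K by (simp add: field_simps eval_nat_numeral)
      moreover have "4 * n * (2 * n\<^sup>2) * norm R1 = 8 * n ^ 3 * norm R1" by (simp add: eval_nat_numeral)
      ultimately have "8 * n ^ 3 * (l\<^sup>2 * n ^ 3 / (8 * K\<^sup>2)) \<le> 8 * n ^ 3 * norm R1" using b1 by linarith
      then show ?thesis by (rule mult_left_le_imp_le) (use n in simp)
    qed
    have c2: "l\<^sup>2 * n ^ 4 / (128 * K ^ 4) \<le> norm R2"
    proof -
      have "(l\<^sup>2 * n ^ 3 / (8 * K\<^sup>2))\<^sup>2 \<le> (norm R1)\<^sup>2" using c1 l n K by (intro power_mono) auto
      also note b2
      also have "(l\<^sup>2 * n ^ 3 / (8 * K\<^sup>2))\<^sup>2 = l\<^sup>2 * (2 * n\<^sup>2) * (l\<^sup>2 * n ^ 4 / (128 * K ^ 4))"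
        using K by (simp add: field_simps eval_nat_numeral)
      finally show ?thesis by (rule mult_left_le_imp_le) (use n l in simp)
    qed
    \<comment> \<open>The computed constant is \<open>14 * 128^2 = 229376\<close>; the stated one is
      larger.\<close>
    have "(l\<^sup>2 * n ^ 4 / (128 * K ^ 4))\<^sup>2 \<le> (norm R2)\<^sup>2" using c2 l n K by (intro power_mono) auto
    also note b3
    also have "(l\<^sup>2 * n ^ 4 / (128 * K ^ 4))\<^sup>2 = l\<^sup>2 * (7 * n) * (2 * n\<^sup>2) * (l\<^sup>2 * n ^ 5 / (229376 * K ^ 8))"
      using K by (simp add: field_simps eval_nat_numeral)
    finally have "l\<^sup>2 * n ^ 5 / (229376 * K ^ 8) \<le> norm R3" by (rule mult_left_le_imp_le) (use n l in simp)
    moreover have "l\<^sup>2 * n ^ 5 / (720000 * K ^ 8) \<le> l\<^sup>2 * n ^ 5 / (229376 * K ^ 8)"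
      using K l n by (intro divide_left_mono) auto
    ultimately show ?thesis by linarith
  qed
  define J where "J = (\<lambda>x x' k m. {w. \<bar>w - x\<bar> < j \<and> \<bar>w - x'\<bar> < j \<and> \<bar>w + k - x\<bar> < j \<and> \<bar>w + k - x'\<bar> < j \<and>
            \<bar>w + m - x\<bar> < j \<and> \<bar>w + m - x'\<bar> < j \<and> \<bar>w + m + k - x\<bar> < j \<and> \<bar>w + m + k - x'\<bar> < j})"
  have RW: "w \<in> W" if "R w x" "x \<in> X" for w x
  proof -
    have "1 \<le> x" "x \<le> N" using that X by auto
    then show ?thesis using that(1) j unfolding R_def W_def by auto
  qed
  have DR: "D (x, x') = {w. R w x \<and> R w x'}" if "x \<in> X" for x x'
    unfolding D_def using RW that by auto
  have JD: "{w\<in>D3 ((x,x'),k). w + m \<in> D3 ((x,x'),k)} = J x x' k m" if "x \<in> X" "x' \<in> X" for x x' k m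
    unfolding J_def D3_def prod.case DR[OF that(1)] R_def mem_Collect_eq by (rule Collect_cong) metis
  define A where "A = (\<lambda>x k m y. cnj (f x y) * f x (y + 2 * k * m))"
  define B where "B = (\<lambda>x x' k m z. cnj (f x' (z + ((x-x')\<^sup>2 - k\<^sup>2 - 2*(x-x'-k)*x))) * f x' (z + ((x-x')\<^sup>2 - k\<^sup>2 - 2*(x-x'-k)*x) + 2*(x-x')*m))"
  define C where "C = (\<lambda>x x' k m z. f x' (z + ((k+(x-x'))\<^sup>2 - k\<^sup>2 - 2*(x-x')*x)) * cnj (f x' (z + ((k+(x-x'))\<^sup>2 - k\<^sup>2 - 2*(x-x')*x) + 2*(k+(x-x'))*m)))"
  have re3: "(\<Sum>y\<in>{0..<M}. v3 ((x,x'),k) w y * cnj (v3 ((x,x'),k) (w + m) (y + (w - x)\<^sup>2 - (w + m - x)\<^sup>2)))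
      = (\<Sum>y\<in>{0..<M}. A x k m y * B x x' k m (y + 2 * (x - x' - k) * w) * C x x' k m (y + 2 * (x - x') * w))" (is "?l = ?r")
    for x x' k m w
  proof -
    let ?g = "\<lambda>y. v3 ((x,x'),k) w y * cnj (v3 ((x,x'),k) (w + m) (y + (w - x)\<^sup>2 - (w + m - x)\<^sup>2))"
    have gp: "unit_periodic M ?g"
      by (intro unit_periodic_mult unit_periodic_cnj unit_periodic_comp[OF v3p] v3p) auto
    \<comment> \<open>This translation of \<open>y\<close> cancels every term quadratic in
      \<open>w\<close>: the two arguments of \<open>f x\<close> become \<open>y\<close> and
      \<open>y + 2 * k * m\<close>, and all arguments of \<open>f x'\<close> become linear in
      \<open>w\<close>.\<close>
    have "?l = (\<Sum>y\<in>{0..<M}. ?g (y + - ((w + k - x)\<^sup>2)))"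
      by (rule unit_periodic_sum_shift[OF gp M0, symmetric])
    also have "\<dots> = ?r"
    proof (rule sum.cong[OF refl])
      fix y
      have fe: "f x a = f x b" if "a = b" for x a b using that by simp
      have i: "f x (y + - ((w + k - x)\<^sup>2) + (w + k - x)\<^sup>2) = f x y"
        "f x (y + - ((w + k - x)\<^sup>2) + (w - x)\<^sup>2 - (w + m - x)\<^sup>2 + (w + m + k - x)\<^sup>2) = f x (y + 2 * k * m)"
        "f x' (y + - ((w + k - x)\<^sup>2) + (w - x')\<^sup>2) = f x' (y + 2 * (x - x' - k) * w + ((x-x')\<^sup>2 - k\<^sup>2 - 2*(x-x'-k)*x))"
        "f x' (y + - ((w + k - x)\<^sup>2) + (w - x)\<^sup>2 - (w + m - x)\<^sup>2 + (w + m - x')\<^sup>2) = f x' (y + 2 * (x - x' - k) * w + ((x-x')\<^sup>2 - k\<^sup>2 - 2*(x-x'-k)*x) + 2*(x-x')*m)"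
        "f x' (y + - ((w + k - x)\<^sup>2) + (w + k - x')\<^sup>2) = f x' (y + 2 * (x - x') * w + ((k+(x-x'))\<^sup>2 - k\<^sup>2 - 2*(x-x')*x))"
        "f x' (y + - ((w + k - x)\<^sup>2) + (w - x)\<^sup>2 - (w + m - x)\<^sup>2 + (w + m + k - x')\<^sup>2) = f x' (y + 2 * (x - x') * w + ((k+(x-x'))\<^sup>2 - k\<^sup>2 - 2*(x-x')*x) + 2*(k+(x-x'))*m)"
        by (rule fe, simp add: power2_eq_square algebra_simps)+
      show "?g (y + - ((w + k - x)\<^sup>2)) = A x k m y * B x x' k m (y + 2 * (x - x' - k) * w) * C x x' k m (y + 2 * (x - x') * w)"
        unfolding v3_def A_def B_def C_def prod.case fst_conv snd_conv i by (simp add: mult_ac)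
    qed
    finally show ?thesis .
  qed
  have finD3: "finite (D3 q)" for q unfolding D3_def using finD by (cases q) auto
  have "R3 = (\<Sum>x\<in>X. \<Sum>x'\<in>X. \<Sum>k\<in>Kr. \<Sum>w\<in>D3 ((x,x'),k). \<Sum>w'\<in>D3 ((x,x'),k). \<Sum>y\<in>{0..<M}. v3 ((x,x'),k) w y * cnj (v3 ((x,x'),k) w' (y + (w - x)\<^sup>2 - (w' - x)\<^sup>2)))"
    unfolding R3_def P3_def sum.cartesian_product' by simp
  also have "\<dots> = (\<Sum>x\<in>X. \<Sum>x'\<in>X. \<Sum>k\<in>Kr. \<Sum>m\<in>Kr. \<Sum>w\<in>{w\<in>D3 ((x,x'),k). w + m \<in> D3 ((x,x'),k)}. \<Sum>y\<in>{0..<M}. v3 ((x,x'),k) w y * cnj (v3 ((x,x'),k) (w + m) (y + (w - x)\<^sup>2 - (w + m - x)\<^sup>2)))"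
    by (intro sum.cong[OF refl] sum_pairs_by_difference[OF finD3]) (auto simp: Kr_def D3_def D_def W_def)
  also have "\<dots> = (\<Sum>x\<in>X. \<Sum>x'\<in>X. \<Sum>k\<in>Kr. \<Sum>m\<in>Kr. \<Sum>w\<in>J x x' k m. \<Sum>y\<in>{0..<M}. A x k m y * B x x' k m (y + 2 * (x - x' - k) * w) * C x x' k m (y + 2 * (x - x') * w))"
    unfolding re3 using JD by (intro sum.cong refl) auto
  also have "\<dots> = (\<Sum>x\<in>X. \<Sum>k\<in>Kr. \<Sum>m\<in>Kr. \<Sum>x'\<in>X. \<Sum>w\<in>J x x' k m. \<Sum>y\<in>{0..<M}. A x k m y * B x x' k m (y + 2 * (x - x' - k) * w) * C x x' k m (y + 2 * (x - x') * w))"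
    by (rule sum.cong[OF refl]) (rule sum_swap3)
  finally show ?thesis using lower unfolding A_def B_def C_def J_def Kr_def n_def by simp
qed

section \<open>Concatenation\<close>

text \<open>If \<open>a\<close> and \<open>a'\<close> are the integers nearest to
  \<open>l * t\<close> and \<open>l' * t\<close>, then \<open>l' * a - l * a'\<close> is an integer
  of modulus at most \<open>2 * \<kappa> * L < 1\<close>, hence zero. So \<open>a / l\<close> and
  \<open>a' / l'\<close> are the same fraction, whose reduced denominator divides the gcd; dividing
  the error for \<open>l * t\<close> by \<open>l / gcd l l'\<close> gives the bound. This rigidity
  dictates that the steps be short compared with \<open>1 / \<kappa>\<close>.\<close>

lemma dist_circle_gcd_le:
  fixes l l' :: int
  assumes l: "l \<noteq> 0" and h: "dist_circle (of_int l * t) \<le> \<kappa>" "dist_circle (of_int l' * t) \<le> \<kappa>"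
    and L: "\<bar>l\<bar> \<le> L" "\<bar>l'\<bar> \<le> L" and small: "2 * \<kappa> * of_int L < 1"
  shows "dist_circle (of_int (gcd l l') * t) \<le> \<kappa> * of_int (gcd l l') / \<bar>of_int l\<bar>"
proof -
  obtain a :: int where a: "dist_circle (of_int l * t) = \<bar>of_int l * t - of_int a\<bar>" using dist_circle_attained by blast
  obtain a' :: int where a': "dist_circle (of_int l' * t) = \<bar>of_int l' * t - of_int a'\<bar>" using dist_circle_attained by blast
  define s where "s = of_int l * t - of_int a"
  define s' where "s' = of_int l' * t - of_int a'"
  have ss: "\<bar>s\<bar> \<le> \<kappa>" "\<bar>s'\<bar> \<le> \<kappa>" using a a' h unfolding s_def s'_def by auto
  have "\<bar>real_of_int (l' * a - l * a')\<bar> = \<bar>of_int l * s' - of_int l' * s\<bar>"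
    unfolding s_def s'_def by (simp add: algebra_simps)
  also have "\<dots> \<le> \<bar>of_int l\<bar> * \<bar>s'\<bar> + \<bar>of_int l'\<bar> * \<bar>s\<bar>"
    using abs_triangle_ineq4[of "of_int l * s'" "of_int l' * s"] by (simp add: abs_mult)
  also have "\<dots> \<le> of_int L * \<kappa> + of_int L * \<kappa>"
    using ss L by (intro add_mono mult_mono) auto
  also have "\<dots> < 1" using small by simp
  finally have "l' * a = l * a'" by linarith
  define g where "g = gcd l l'"
  have g: "g > 0" using l unfolding g_def by simp
  obtain l1 l1' where l1: "l = g * l1" "l' = g * l1'" "coprime l1 l1'"
    using gcd_coprime_exists[of l l'] g unfolding g_def by (metis mult.commute less_irrefl)
  have "g * (l1' * a) = g * (l1 * a')" using \<open>l' * a = l * a'\<close> l1 by (simp add: mult_ac)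
  then have "l1' * a = l1 * a'" using g by simp
  then have "l1 dvd a * l1'" by (metis dvd_triv_left mult.commute)
  then have "l1 dvd a" using l1(3) by (simp add: coprime_dvd_mult_left_iff)
  then obtain b where b: "a = l1 * b" by blast
  have l10: "l1 \<noteq> 0" using l l1 by auto
  have "of_int l1 * (of_int g * t - of_int b) = s"
    unfolding s_def l1(1) b by (simp add: algebra_simps)
  then have "of_int g * t - of_int b = s / of_int l1" using l10 by (simp add: field_simps)
  then have "dist_circle (of_int g * t) \<le> \<bar>s\<bar> / \<bar>of_int l1\<bar>"
    using dist_circle_le[of "of_int g * t" b] by (simp add: abs_divide)
  also have "\<dots> \<le> \<kappa> / \<bar>of_int l1\<bar>" using ss by (intro divide_right_mono) auto
  also have "\<dots> = \<kappa> * of_int g / \<bar>of_int l\<bar>" using l1(1) g by (simp add: abs_mult)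
  finally show ?thesis unfolding g_def .
qed

definition mixed_diff :: "(int \<Rightarrow> complex) \<Rightarrow> int \<Rightarrow> int \<Rightarrow> int \<Rightarrow> complex" where
  "mixed_diff A a b y = A y * cnj (A (y + b)) * cnj (A (y + a)) * A (y + a + b)"

lemma unit_periodic_mixed_diff: "unit_periodic M A \<Longrightarrow> unit_periodic M (mixed_diff A a b)"
  unfolding mixed_diff_def[abs_def]
  by (intro unit_periodic_mult unit_periodic_cnj) (auto elim!: unit_periodic_comp)

text \<open>Four applications of Cauchy--Schwarz. The first removes \<open>C\<close> and doubles
  \<open>w\<close> with difference \<open>n\<close>, pairing the copies of \<open>B\<close> into the
  function \<open>D\<close>. The second removes \<open>A\<close> and doubles all remaining
  variables, which brings in a second index \<open>i'\<close>. The last two remove the function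
  \<open>D\<close> of \<open>i'\<close> and then that of \<open>i\<close>, each at the price of a
  difference of \<open>A\<close> along a multiple of \<open>2 * (lf i' - k)\<close> or
  \<open>2 * (lf i - k)\<close>. Only mixed differences of \<open>A\<close> survive, and the free
  variables \<open>n\<close>, \<open>n'\<close> sample them along multiples of
  \<open>2 * lf i\<close> and \<open>2 * lf i'\<close>.\<close>

lemma concatenation_van_der_corput:
  fixes A :: "int \<Rightarrow> complex" and B C :: "int \<Rightarrow> int \<Rightarrow> complex" and X :: "int set" and lf :: "int \<Rightarrow> int"
  assumes K: "K \<ge> 2" and N: "N > 0" and M: "M = 2 * N\<^sup>2" and X: "finite X" "real (card X) \<le> l" and l: "l > 0"
    and J: "\<And>i. J i \<subseteq> {-N..2*N}"
    and A: "unit_periodic M A" and B: "\<And>i. unit_periodic M (B i)" and C: "\<And>i. unit_periodic M (C i)"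
    and big: "l * (of_int N) ^ 3 / K \<le> norm (\<Sum>i\<in>X. \<Sum>w\<in>J i. \<Sum>y\<in>{0..<M}. A y * B i (y + 2 * (lf i - k) * w) * C i (y + 2 * lf i * w))"
  shows "l\<^sup>2 * (of_int N) ^ 8 / K ^ 57 \<le> (\<Sum>i\<in>X. \<Sum>i'\<in>X. \<Sum>w1\<in>{-N..2*N}. \<Sum>w2\<in>{-N..2*N}. \<Sum>w1'\<in>{-N..2*N}. \<Sum>w2'\<in>{-N..2*N}.
     norm (\<Sum>n\<in>{n\<in>{-(3*N)..3*N}. w1 \<in> J i \<and> w2 \<in> J i \<and> w1 + n \<in> J i \<and> w2 + n \<in> J i}.
       \<Sum>n'\<in>{n\<in>{-(3*N)..3*N}. w1' \<in> J i' \<and> w2' \<in> J i' \<and> w1' + n \<in> J i' \<and> w2' + n \<in> J i'}. \<Sum>y\<in>{0..<M}.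
       cnj (mixed_diff A (2 * (lf i - k) * (w1 - w2)) (2 * (lf i' - k) * (w1' - w2')) (y - 2 * lf i * n)) *
       mixed_diff A (2 * (lf i - k) * (w1 - w2)) (2 * (lf i' - k) * (w1' - w2')) (y - 2 * lf i' * n')))"
proof -
  define n where "n = real_of_int N"
  have n: "n > 0" "n \<ge> 1" using N by (auto simp: n_def)
  have Kp: "K > 0" using K by simp
  have M0: "M > 0" using M N by simp
  have Mn: "real_of_int M = 2 * n\<^sup>2" using M by (simp add: n_def)
  define W where "W = {-N..2*N}"
  have finW: "finite W" unfolding W_def by simp
  have cW: "real (card W) \<le> 4 * n" using N unfolding W_def n_def by simp
  define Nr where "Nr = {-(3*N)..3*N}"
  have finNr: "finite Nr" unfolding Nr_def by simp
  have cNr: "real (card Nr) \<le> 7 * n" using N unfolding Nr_def n_def by simp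
  have JW: "J i \<subseteq> W" for i using J unfolding W_def .
  have finJ: "finite (J i)" for i using JW finW finite_subset by blast
  define p where "p = (\<lambda>i. lf i - k)"
  define J2 where "J2 = (\<lambda>(i, n). {w\<in>J i. w + n \<in> J i})"
  have finJ2: "finite (J2 q)" for q unfolding J2_def using finJ by (cases q) auto
  have cJ2: "real (card (J2 q)) \<le> 4 * n" for q
  proof -
    have "card (J2 q) \<le> card W" using JW finW unfolding J2_def by (cases q) (auto intro!: card_mono)
    then show ?thesis using cW by linarith
  qed
  have Ash: "unit_periodic M (\<lambda>y. A (y + t))" "unit_periodic M (\<lambda>y. A (y - t))" for t
    by (rule unit_periodic_comp[OF A], simp)+
  have Bsh: "unit_periodic M (\<lambda>y. B i (y + t))" "unit_periodic M (\<lambda>y. B i (y - t))" for i t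
    by (rule unit_periodic_comp[OF B], simp)+
  \<comment> \<open>After the shift by \<open>2 * lf i * n\<close> the second copy of
    \<open>B\<close> is displaced by \<open>- 2 * k * n\<close>, independent of \<open>w\<close>.
    Both copies therefore combine into one function evaluated at a shift linear in
    \<open>w\<close>.\<close>
  define D where "D = (\<lambda>(i, n) z. B i z * cnj (B i (z - 2 * k * n)))"
  have Dp: "unit_periodic M (D q)" for q
    unfolding D_def by (cases q) (auto intro!: unit_periodic_mult unit_periodic_cnj B Bsh)
  have Dsh: "unit_periodic M (\<lambda>y. D q (y + t))" for q t
    by (rule unit_periodic_comp[OF Dp], simp)
  define Q where "Q = X \<times> Nr"
  have finQ: "finite Q" unfolding Q_def using X finNr by simp
  have cQ: "real (card Q) \<le> l * (7 * n)"
    unfolding Q_def card_cartesian_product of_nat_mult using X cNr l by (intro mult_mono) auto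
  define \<Omega> where "\<Omega> = Sigma Q J2"
  have fin\<Omega>: "finite \<Omega>" unfolding \<Omega>_def using finQ finJ2 by blast
  have c\<Omega>: "real (card \<Omega>) \<le> l * (7 * n) * (4 * n)"
  proof -
    have "real (card \<Omega>) = (\<Sum>q\<in>Q. real (card (J2 q)))"
      unfolding \<Omega>_def using finQ finJ2 by (simp add: card_SigmaI)
    also have "\<dots> \<le> (\<Sum>q\<in>Q. 4 * n)" using cJ2 by (rule sum_mono)
    also have "\<dots> = real (card Q) * (4 * n)" by simp
    also have "\<dots> \<le> l * (7 * n) * (4 * n)" using cQ n by (intro mult_right_mono) auto
    finally show ?thesis .
  qed
  define v1 where "v1 = (\<lambda>i w y. A y * B i (y + 2 * p i * w))"
  have v1p: "unit_periodic M (v1 i w)" for i w unfolding v1_def by (intro unit_periodic_mult A Bsh)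
  define v2 where "v2 = (\<lambda>\<omega> y. cnj (A (y - 2 * lf (fst (fst \<omega>)) * snd (fst \<omega>))) * D (fst \<omega>) (y + 2 * p (fst (fst \<omega>)) * snd \<omega>))"
  have v2p: "unit_periodic M (v2 \<omega>)" for \<omega> unfolding v2_def by (intro unit_periodic_mult unit_periodic_cnj Ash Dsh)
  define R1 where "R1 = (\<Sum>\<omega>\<in>\<Omega>. \<Sum>y\<in>{0..<M}. A (y + 0) * v2 \<omega> y)"
  have b1: "(l * n ^ 3 / K)\<^sup>2 \<le> l * (2 * n\<^sup>2) * norm R1"
  proof -
    have "(\<Sum>i\<in>X. \<Sum>w\<in>J i. \<Sum>y\<in>{0..<M}. A y * B i (y + 2 * (lf i - k) * w) * C i (y + 2 * lf i * w))
       = (\<Sum>i\<in>X. \<Sum>w\<in>J i. \<Sum>y\<in>{0..<M}. C i (y + 2 * lf i * w) * v1 i w y)"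
      unfolding v1_def p_def by (simp add: mult_ac)
    then have "(l * n ^ 3 / K)\<^sup>2 \<le> (norm (\<Sum>i\<in>X. \<Sum>w\<in>J i. \<Sum>y\<in>{0..<M}. C i (y + 2 * lf i * w) * v1 i w y))\<^sup>2"
      using big Kp l n unfolding n_def by (intro power_mono) auto
    also have "\<dots> \<le> real (card X) * of_int M * norm (\<Sum>i\<in>X. \<Sum>w\<in>J i. \<Sum>w'\<in>J i. \<Sum>y\<in>{0..<M}. v1 i w y * cnj (v1 i w' (y + 2 * lf i * w - 2 * lf i * w')))"
      by (rule cauchy_schwarz_shift[OF X(1) M0 C v1p])
    also have "(\<Sum>i\<in>X. \<Sum>w\<in>J i. \<Sum>w'\<in>J i. \<Sum>y\<in>{0..<M}. v1 i w y * cnj (v1 i w' (y + 2 * lf i * w - 2 * lf i * w'))) = R1"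
    proof -
      have "(\<Sum>i\<in>X. \<Sum>w\<in>J i. \<Sum>w'\<in>J i. \<Sum>y\<in>{0..<M}. v1 i w y * cnj (v1 i w' (y + 2 * lf i * w - 2 * lf i * w')))
         = (\<Sum>i\<in>X. \<Sum>n\<in>Nr. \<Sum>w\<in>{w\<in>J i. w + n \<in> J i}. \<Sum>y\<in>{0..<M}. v1 i w y * cnj (v1 i (w + n) (y + 2 * lf i * w - 2 * lf i * (w + n))))"
      proof (rule sum.cong[OF refl], rule sum_pairs_by_difference[OF finJ finNr])
        fix i w w' assume "w \<in> J i" "w' \<in> J i"
        then have "w \<in> {-N..2*N}" "w' \<in> {-N..2*N}" using J by blast+
        then show "w' - w \<in> Nr" unfolding Nr_def by auto
      qed
      also have "\<dots> = (\<Sum>q\<in>Q. \<Sum>w\<in>J2 q. \<Sum>y\<in>{0..<M}. A (y + 0) * v2 (q, w) y)"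
        unfolding Q_def sum.cartesian_product'
      proof (rule sum.cong[OF refl], rule sum.cong[OF refl], rule sum.cong)
        fix i n w
        show "(\<Sum>y\<in>{0..<M}. v1 i w y * cnj (v1 i (w + n) (y + 2 * lf i * w - 2 * lf i * (w + n)))) = (\<Sum>y\<in>{0..<M}. A (y + 0) * v2 ((i, n), w) y)"
        proof (rule sum.cong[OF refl])
          fix y
          have e: "y + 2 * lf i * w - 2 * lf i * (w + n) = y - 2 * lf i * n"
            "y + 2 * lf i * w - 2 * lf i * (w + n) + 2 * p i * (w + n) = y + 2 * p i * w - 2 * k * n"
            unfolding p_def by (simp_all add: algebra_simps)
          show "v1 i w y * cnj (v1 i (w + n) (y + 2 * lf i * w - 2 * lf i * (w + n))) = A (y + 0) * v2 ((i, n), w) y"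
            unfolding v1_def v2_def D_def prod.case fst_conv snd_conv e(2) unfolding e(1) complex_cnj_mult add_0_right by (simp only: mult_ac complex_cnj_cnj)
        qed
      qed (simp add: J2_def)
      also have "\<dots> = R1" unfolding R1_def \<Omega>_def using finQ finJ2 by (subst sum.Sigma) (auto simp: case_prod_beta)
      finally show ?thesis .
    qed
    also have "real (card X) * of_int M * norm R1 \<le> l * (2 * n\<^sup>2) * norm R1"
      using X n unfolding Mn by (intro mult_right_mono) auto
    finally show ?thesis .
  qed
  define R2 where "R2 = (\<Sum>\<omega>\<in>\<Omega>. \<Sum>\<omega>'\<in>\<Omega>. \<Sum>y\<in>{0..<M}. v2 \<omega> y * cnj (v2 \<omega>' (y + 0 - 0)))"
  have b2: "(norm R1)\<^sup>2 \<le> 2 * n\<^sup>2 * norm R2"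
    using cauchy_schwarz_shift[of "{()}" M "\<lambda>_. A" "\<lambda>_. \<Omega>" "\<lambda>_. v2" "\<lambda>_ _. 0"] M0 A v2p
    unfolding R1_def R2_def Mn[symmetric] by simp
  define U where "U = (\<lambda>q q' y. cnj (A (y - 2 * lf (fst q) * snd q)) * A (y - 2 * lf (fst q') * snd q'))"
  have Up: "unit_periodic M (U q q')" for q q' unfolding U_def by (intro unit_periodic_mult unit_periodic_cnj Ash)
  have Ush: "unit_periodic M (\<lambda>y. U q q' (y + t))" for q q' t by (rule unit_periodic_comp[OF Up], simp)
  define v3 where "v3 = (\<lambda>(\<omega>, q') (w'::int) y. U (fst \<omega>) q' y * D (fst \<omega>) (y + 2 * p (fst (fst \<omega>)) * snd \<omega>))"
  have v3p: "unit_periodic M (v3 P w')" for P and w' :: int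
    unfolding v3_def by (cases P) (auto intro!: unit_periodic_mult Up Dsh)
  define R3 where "R3 = (\<Sum>P\<in>\<Omega> \<times> Q. \<Sum>w\<in>J2 (snd P). \<Sum>w'\<in>J2 (snd P). \<Sum>y\<in>{0..<M}. v3 P w y * cnj (v3 P w' (y + 2 * p (fst (snd P)) * w - 2 * p (fst (snd P)) * w')))"
  have b3: "(norm R2)\<^sup>2 \<le> (l * (7 * n) * (4 * n)) * (l * (7 * n)) * (2 * n\<^sup>2) * norm R3"
  proof -
    have S: "(\<Sum>\<omega>'\<in>\<Omega>. h \<omega>') = (\<Sum>q'\<in>Q. \<Sum>w'\<in>J2 q'. h (q', w'))" for h :: "_ \<Rightarrow> complex"
      unfolding \<Omega>_def using finQ finJ2 by (subst sum.Sigma) (auto simp: case_prod_beta)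
    have "R2 = (\<Sum>\<omega>\<in>\<Omega>. \<Sum>q'\<in>Q. \<Sum>w'\<in>J2 q'. \<Sum>y\<in>{0..<M}. v2 \<omega> y * cnj (v2 (q', w') y))"
      unfolding R2_def using S by (intro sum.cong refl) simp
    also have "\<dots> = (\<Sum>P\<in>\<Omega> \<times> Q. \<Sum>w'\<in>J2 (snd P). \<Sum>y\<in>{0..<M}. cnj (D (snd P) (y + 2 * p (fst (snd P)) * w')) * v3 P w' y)"
      unfolding v2_def v3_def U_def by (simp add: sum.cartesian_product case_prod_beta mult_ac)
    finally have e: "R2 = (\<Sum>P\<in>\<Omega> \<times> Q. \<Sum>w'\<in>J2 (snd P). \<Sum>y\<in>{0..<M}. cnj (D (snd P) (y + 2 * p (fst (snd P)) * w')) * v3 P w' y)" .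
    have "(norm R2)\<^sup>2 \<le> real (card (\<Omega> \<times> Q)) * of_int M * norm R3"
      unfolding e R3_def
      by (rule cauchy_schwarz_shift[where u = "\<lambda>P y. cnj (D (snd P) y)"])
        (use fin\<Omega> finQ M0 v3p in \<open>auto intro!: unit_periodic_cnj Dp\<close>)
    also have "real (card (\<Omega> \<times> Q)) \<le> (l * (7 * n) * (4 * n)) * (l * (7 * n))"
      unfolding card_cartesian_product of_nat_mult using c\<Omega> cQ l n by (intro mult_mono) auto
    then have "real (card (\<Omega> \<times> Q)) * of_int M * norm R3 \<le> (l * (7 * n) * (4 * n)) * (l * (7 * n)) * (2 * n\<^sup>2) * norm R3"
      using n unfolding Mn by (intro mult_right_mono) auto
    finally show ?thesis .
  qed
  define \<Omega>2 where "\<Omega>2 = Sigma Q (\<lambda>q'. J2 q' \<times> J2 q')"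
  have fin\<Omega>2: "finite \<Omega>2" unfolding \<Omega>2_def using finQ finJ2 by blast
  have c\<Omega>2: "real (card \<Omega>2) \<le> l * (7 * n) * ((4 * n) * (4 * n))"
  proof -
    have "real (card \<Omega>2) = (\<Sum>q\<in>Q. real (card (J2 q)) * real (card (J2 q)))"
      unfolding \<Omega>2_def using finQ finJ2 by (simp add: card_SigmaI card_cartesian_product)
    also have "\<dots> \<le> (\<Sum>q\<in>Q. (4 * n) * (4 * n))" using cJ2 n by (intro sum_mono mult_mono) auto
    also have "\<dots> = real (card Q) * ((4 * n) * (4 * n))" by simp
    also have "\<dots> \<le> l * (7 * n) * ((4 * n) * (4 * n))" using cQ n by (intro mult_right_mono) auto
    finally show ?thesis .
  qed
  define bb :: "(int \<times> int) \<times> int \<times> int \<Rightarrow> int" where "bb = (\<lambda>\<omega>. 2 * p (fst (fst \<omega>)) * (fst (snd \<omega>) - snd (snd \<omega>)))"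
  define v4 where "v4 = (\<lambda>P (w::int) y. U (fst P) (fst (snd P)) y * cnj (U (fst P) (fst (snd P)) (y + bb (snd P))))"
  have v4p: "unit_periodic M (v4 P w)" for P and w :: int
    unfolding v4_def by (auto intro!: unit_periodic_mult unit_periodic_cnj Up Ush)
  define R4 where "R4 = (\<Sum>P\<in>Q \<times> \<Omega>2. \<Sum>w\<in>J2 (fst P). \<Sum>w'\<in>J2 (fst P). \<Sum>y\<in>{0..<M}. v4 P w y * cnj (v4 P w' (y + 2 * p (fst (fst P)) * w - 2 * p (fst (fst P)) * w')))"
  have b4: "(norm R3)\<^sup>2 \<le> (l * (7 * n)) * (l * (7 * n) * ((4 * n) * (4 * n))) * (2 * n\<^sup>2) * norm R4"
  proof -
    define uu where "uu = (\<lambda>P z. D (fst P) z * cnj (D (fst P) (z + bb (snd P))))"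
    have uup: "unit_periodic M (uu P)" for P
      unfolding uu_def by (intro unit_periodic_mult unit_periodic_cnj Dp Dsh)
    define g where "g = (\<lambda>q w q' w1 w2. \<Sum>y\<in>{0..<M}. uu (q, (q', (w1, w2))) (y + 2 * p (fst q) * w) * v4 (q, (q', (w1, w2))) w y)"
    have "R3 = (\<Sum>P\<in>\<Omega> \<times> Q. \<Sum>w1\<in>J2 (snd P). \<Sum>w2\<in>J2 (snd P). g (fst (fst P)) (snd (fst P)) (snd P) w1 w2)"
      unfolding R3_def
    proof (rule sum.cong[OF refl], rule sum.cong[OF refl], rule sum.cong[OF refl])
      fix P :: "((int \<times> int) \<times> int) \<times> int \<times> int" and w1 w2 :: int
      show "(\<Sum>y\<in>{0..<M}. v3 P w1 y * cnj (v3 P w2 (y + 2 * p (fst (snd P)) * w1 - 2 * p (fst (snd P)) * w2))) = g (fst (fst P)) (snd (fst P)) (snd P) w1 w2"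
        unfolding g_def
      proof (rule sum.cong[OF refl])
        fix y
        obtain q w q' where P: "P = ((q, w), q')" by (metis surj_pair)
        have e1: "y + 2 * p (fst q') * w1 - 2 * p (fst q') * w2 = y + bb (q', (w1, w2))"
          unfolding bb_def by (simp add: algebra_simps)
        have e2: "y + bb (q', (w1, w2)) + 2 * p (fst q) * w = y + 2 * p (fst q) * w + bb (q', (w1, w2))" by simp
        show "v3 P w1 y * cnj (v3 P w2 (y + 2 * p (fst (snd P)) * w1 - 2 * p (fst (snd P)) * w2)) =
            uu (fst (fst P), (snd P, (w1, w2))) (y + 2 * p (fst (fst (fst P))) * snd (fst P)) * v4 (fst (fst P), (snd P, (w1, w2))) (snd (fst P)) y"
          unfolding P v3_def v4_def uu_def prod.case fst_conv snd_conv e1 e2 by (simp add: mult_ac)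
      qed
    qed
    also have "\<dots> = (\<Sum>P\<in>\<Omega> \<times> Q. \<Sum>z\<in>J2 (snd P) \<times> J2 (snd P). g (fst (fst P)) (snd (fst P)) (snd P) (fst z) (snd z))"
      by (simp add: sum.cartesian_product case_prod_beta)
    also have "\<dots> = (\<Sum>(P, z)\<in>Sigma (\<Omega> \<times> Q) (\<lambda>P. J2 (snd P) \<times> J2 (snd P)). g (fst (fst P)) (snd (fst P)) (snd P) (fst z) (snd z))"
      using fin\<Omega> finQ finJ2 by (intro sum.Sigma) auto
    \<comment> \<open>Regrouping makes the variable \<open>w\<close> of the first index innermost,
      so that the last application of Cauchy--Schwarz can double it.\<close>
    also have "\<dots> = (\<Sum>(P, w)\<in>Sigma (Q \<times> \<Omega>2) (\<lambda>P. J2 (fst P)). g (fst P) w (fst (snd P)) (fst (snd (snd P))) (snd (snd (snd P))))"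
      by (rule sum.reindex_bij_witness[of _ "\<lambda>((q, (q', z)), w). (((q, w), q'), z)" "\<lambda>(((q, w), q'), z). ((q, (q', z)), w)"])
        (auto simp: \<Omega>_def \<Omega>2_def)
    also have "\<dots> = (\<Sum>P\<in>Q \<times> \<Omega>2. \<Sum>w\<in>J2 (fst P). g (fst P) w (fst (snd P)) (fst (snd (snd P))) (snd (snd (snd P))))"
      using fin\<Omega>2 finQ finJ2 by (intro sum.Sigma[symmetric]) auto
    finally have e: "R3 = (\<Sum>P\<in>Q \<times> \<Omega>2. \<Sum>w\<in>J2 (fst P). \<Sum>y\<in>{0..<M}. uu P (y + 2 * p (fst (fst P)) * w) * v4 P w y)"
      unfolding g_def by simp
    have "(norm R3)\<^sup>2 \<le> real (card (Q \<times> \<Omega>2)) * of_int M * norm R4"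
      unfolding e R4_def
      by (rule cauchy_schwarz_shift) (use fin\<Omega>2 finQ M0 v4p uup in auto)
    also have "real (card (Q \<times> \<Omega>2)) \<le> (l * (7 * n)) * (l * (7 * n) * ((4 * n) * (4 * n)))"
      unfolding card_cartesian_product of_nat_mult using c\<Omega>2 cQ l n by (intro mult_mono) auto
    then have "real (card (Q \<times> \<Omega>2)) * of_int M * norm R4 \<le> (l * (7 * n)) * (l * (7 * n) * ((4 * n) * (4 * n))) * (2 * n\<^sup>2) * norm R4"
      using n unfolding Mn by (intro mult_right_mono) auto
    finally show ?thesis .
  qed
  have lower: "l\<^sup>2 * n ^ 8 / K ^ 57 \<le> norm R4"
  proof -
    have c1: "l * n ^ 4 / (2 * K\<^sup>2) \<le> norm R1"
    proof -
      have "(l * n ^ 3 / K)\<^sup>2 = l * (2 * n\<^sup>2) * (l * n ^ 4 / (2 * K\<^sup>2))"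
        using Kp by (simp add: field_simps eval_nat_numeral)
      then have "l * (2 * n\<^sup>2) * (l * n ^ 4 / (2 * K\<^sup>2)) \<le> l * (2 * n\<^sup>2) * norm R1" using b1 by linarith
      then show ?thesis by (rule mult_left_le_imp_le) (use n l in simp)
    qed
    have c2: "l\<^sup>2 * n ^ 6 / (8 * K ^ 4) \<le> norm R2"
    proof -
      have "(l * n ^ 4 / (2 * K\<^sup>2))\<^sup>2 \<le> (norm R1)\<^sup>2" using c1 l n Kp by (intro power_mono) auto
      also note b2
      also have "(l * n ^ 4 / (2 * K\<^sup>2))\<^sup>2 = 2 * n\<^sup>2 * (l\<^sup>2 * n ^ 6 / (8 * K ^ 4))"
        using Kp by (simp add: field_simps eval_nat_numeral)
      finally show ?thesis by (rule mult_left_le_imp_le) (use n l in simp)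
    qed
    have c3: "l\<^sup>2 * n ^ 7 / (25088 * K ^ 8) \<le> norm R3"
    proof -
      have "(l\<^sup>2 * n ^ 6 / (8 * K ^ 4))\<^sup>2 \<le> (norm R2)\<^sup>2" using c2 l n Kp by (intro power_mono) auto
      also note b3
      also have "(l\<^sup>2 * n ^ 6 / (8 * K ^ 4))\<^sup>2 = (l * (7 * n) * (4 * n)) * (l * (7 * n)) * (2 * n\<^sup>2) * (l\<^sup>2 * n ^ 7 / (25088 * K ^ 8))"
        using Kp by (simp add: field_simps eval_nat_numeral)
      finally show ?thesis by (rule mult_left_le_imp_le) (use n l in simp)
    qed
    have "(l\<^sup>2 * n ^ 7 / (25088 * K ^ 8))\<^sup>2 \<le> (norm R3)\<^sup>2" using c3 l n Kp by (intro power_mono) auto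
    also note b4
    also have "(l\<^sup>2 * n ^ 7 / (25088 * K ^ 8))\<^sup>2 = (l * (7 * n)) * (l * (7 * n) * ((4 * n) * (4 * n))) * (2 * n\<^sup>2) * (l\<^sup>2 * n ^ 8 / (1568 * 25088\<^sup>2 * K ^ 16))"
      using Kp by (simp add: field_simps eval_nat_numeral)
    finally have "l\<^sup>2 * n ^ 8 / (1568 * 25088\<^sup>2 * K ^ 16) \<le> norm R4" by (rule mult_left_le_imp_le) (use n l in simp)
    moreover have "l\<^sup>2 * n ^ 8 / K ^ 57 \<le> l\<^sup>2 * n ^ 8 / (1568 * 25088\<^sup>2 * K ^ 16)"
    proof (rule divide_left_mono)
      show "1568 * 25088\<^sup>2 * K ^ 16 \<le> K ^ 57" by (rule const_le_power[OF K, of _ 41]) auto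
    qed (use Kp n l in auto)
    ultimately show ?thesis by linarith
  qed
  define NN where "NN = (\<lambda>i w1 w2. {n\<in>Nr. w1 \<in> J i \<and> w2 \<in> J i \<and> w1 + n \<in> J i \<and> w2 + n \<in> J i})"
  have finNN: "finite (NN i w1 w2)" for i w1 w2 unfolding NN_def using finNr by simp
  define \<Psi> where "\<Psi> = (\<lambda>i i' w1 w2 w1' w2'. mixed_diff A (2 * (lf i - k) * (w1 - w2)) (2 * (lf i' - k) * (w1' - w2')))"
  define G where "G = (\<lambda>(i, i', w1, w2, w1', w2') (n, n'). \<Sum>y\<in>{0..<M}. cnj (\<Psi> i i' w1 w2 w1' w2' (y - 2 * lf i * n)) * \<Psi> i i' w1 w2 w1' w2' (y - 2 * lf i' * n'))"
  have "R4 = (\<Sum>P\<in>Q \<times> \<Omega>2. \<Sum>z\<in>J2 (fst P) \<times> J2 (fst P). G (fst (fst P), fst (fst (snd P)), fst z, snd z, fst (snd (snd P)), snd (snd (snd P))) (snd (fst P), snd (fst (snd P))))"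
    unfolding R4_def sum.cartesian_product'[of _ "J2 _"]
  proof (rule sum.cong[OF refl], rule sum.cong[OF refl], rule sum.cong[OF refl])
    fix P :: "(int \<times> int) \<times> (int \<times> int) \<times> int \<times> int" and w w' :: int
    obtain i n i' n' w1' w2' where P: "P = ((i, n), ((i', n'), (w1', w2')))" by (metis surj_pair)
    have e: "y + 2 * p i * w - 2 * p i * w' = y + 2 * (lf i - k) * (w - w')" for y unfolding p_def by (simp add: algebra_simps)
    have Ae: "A a = A b" if "a = b" for a b using that by simp
    show "(\<Sum>y\<in>{0..<M}. v4 P w y * cnj (v4 P w' (y + 2 * p (fst (fst P)) * w - 2 * p (fst (fst P)) * w'))) =
      G (fst (fst P), fst (fst (snd P)), fst (w, w'), snd (w, w'), fst (snd (snd P)), snd (snd (snd P))) (snd (fst P), snd (fst (snd P)))"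
      unfolding P G_def \<Psi>_def prod.case fst_conv snd_conv mixed_diff_def
    proof (rule sum.cong[OF refl])
      fix y
      have i: "A (y + bb ((i', n'), (w1', w2')) - t) = A (y - t + 2 * (lf i' - k) * (w1' - w2'))"
        "A (y + 2 * (lf i - k) * (w - w') - t) = A (y - t + 2 * (lf i - k) * (w - w'))"
        "A (y + 2 * (lf i - k) * (w - w') + bb ((i', n'), (w1', w2')) - t) = A (y - t + 2 * (lf i - k) * (w - w') + 2 * (lf i' - k) * (w1' - w2'))" for t
        by (rule Ae, simp add: bb_def p_def)+
      show "v4 ((i, n), (i', n'), w1', w2') w y * cnj (v4 ((i, n), (i', n'), w1', w2') w' (y + 2 * p i * w - 2 * p i * w')) =
         cnj (A (y - 2 * lf i * n) * cnj (A (y - 2 * lf i * n + 2 * (lf i' - k) * (w1' - w2'))) * cnj (A (y - 2 * lf i * n + 2 * (lf i - k) * (w - w'))) * A (y - 2 * lf i * n + 2 * (lf i - k) * (w - w') + 2 * (lf i' - k) * (w1' - w2'))) *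
         (A (y - 2 * lf i' * n') * cnj (A (y - 2 * lf i' * n' + 2 * (lf i' - k) * (w1' - w2'))) * cnj (A (y - 2 * lf i' * n' + 2 * (lf i - k) * (w - w'))) * A (y - 2 * lf i' * n' + 2 * (lf i - k) * (w - w') + 2 * (lf i' - k) * (w1' - w2')))"
        unfolding e unfolding v4_def U_def fst_conv snd_conv i by (simp add: mult_ac)
    qed
  qed
  also have "\<dots> = (\<Sum>(P, z)\<in>Sigma (Q \<times> \<Omega>2) (\<lambda>P. J2 (fst P) \<times> J2 (fst P)). G (fst (fst P), fst (fst (snd P)), fst z, snd z, fst (snd (snd P)), snd (snd (snd P))) (snd (fst P), snd (fst (snd P))))"
    using fin\<Omega>2 finQ finJ2 by (intro sum.Sigma) auto
  also have "\<dots> = (\<Sum>(t, z)\<in>Sigma (X \<times> X \<times> W \<times> W \<times> W \<times> W) (\<lambda>(i, i', w1, w2, w1', w2'). NN i w1 w2 \<times> NN i' w1' w2'). G t z)"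
    by (rule sum.reindex_bij_witness[of _ "\<lambda>((i, i', w1, w2, w1', w2'), (n, n')). (((i, n), ((i', n'), (w1', w2'))), (w1, w2))"
       "\<lambda>(((i, n), ((i', n'), (w1', w2'))), (w1, w2)). ((i, i', w1, w2, w1', w2'), (n, n'))"])
      (use JW in \<open>auto simp: Q_def \<Omega>2_def J2_def NN_def\<close>)
  also have "\<dots> = (\<Sum>t\<in>X \<times> X \<times> W \<times> W \<times> W \<times> W. \<Sum>z\<in>(\<lambda>(i, i', w1, w2, w1', w2'). NN i w1 w2 \<times> NN i' w1' w2') t. G t z)"
    using X finW finNN by (intro sum.Sigma[symmetric]) (auto simp: case_prod_beta)
  finally have "norm R4 \<le> (\<Sum>t\<in>X \<times> X \<times> W \<times> W \<times> W \<times> W. norm (\<Sum>z\<in>(\<lambda>(i, i', w1, w2, w1', w2'). NN i w1 w2 \<times> NN i' w1' w2') t. G t z))"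
    by (simp add: norm_sum)
  also have "\<dots> = (\<Sum>i\<in>X. \<Sum>i'\<in>X. \<Sum>w1\<in>W. \<Sum>w2\<in>W. \<Sum>w1'\<in>W. \<Sum>w2'\<in>W. norm (\<Sum>n\<in>NN i w1 w2. \<Sum>n'\<in>NN i' w1' w2'. G (i, i', w1, w2, w1', w2') (n, n')))"
    by (simp add: sum.cartesian_product')
  finally show ?thesis using lower unfolding G_def \<Psi>_def NN_def Nr_def W_def n_def by simp
qed

text \<open>In Fourier space the sums over \<open>n\<close> and \<open>n'\<close> decouple: the
  coefficient \<open>\<bar>zft M \<Psi> \<xi>\<bar>^2 / M\<close> is multiplied by one exponential
  sum for each. Outside \<open>\<Xi>\<close> their product is small and Parseval bounds the rest;
  inside \<open>\<Xi>\<close> both are bounded trivially by \<open>c\<close>. The mixed differences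
  must therefore have mass on \<open>\<Xi>\<close>.\<close>

lemma norm_pair_correlation_le:
  assumes M: "M > 0" and \<Psi>: "unit_periodic M \<Psi>" and \<Xi>: "\<Xi> \<subseteq> {0..<M}" and c: "c \<ge> 0" and v: "v \<ge> 0"
    and E: "\<And>\<xi>. norm (\<Sum>n\<in>S. zchar M (\<xi> * (2 * l * n))) \<le> c" "\<And>\<xi>. norm (\<Sum>n\<in>S'. zchar M (\<xi> * (2 * l' * n))) \<le> c"
    and small: "\<And>\<xi>. \<xi> \<in> {0..<M} - \<Xi> \<Longrightarrow> norm (\<Sum>n\<in>S. zchar M (\<xi> * (2 * l * n))) * norm (\<Sum>n\<in>S'. zchar M (\<xi> * (2 * l' * n))) \<le> v"
  shows "norm (\<Sum>n\<in>S. \<Sum>n'\<in>S'. \<Sum>y\<in>{0..<M}. cnj (\<Psi> (y - 2 * l * n)) * \<Psi> (y - 2 * l' * n'))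
    \<le> v * of_int M + c\<^sup>2 / of_int M * (\<Sum>\<xi>\<in>\<Xi>. (norm (zft M \<Psi> \<xi>))\<^sup>2)"
proof -
  define E1 where "E1 = (\<lambda>\<xi>. \<Sum>n\<in>S. zchar M (\<xi> * (2 * l * n)))"
  define E2 where "E2 = (\<lambda>\<xi>. \<Sum>n\<in>S'. zchar M (\<xi> * (2 * l' * n)))"
  define a where "a = (\<lambda>\<xi>. cnj (zft M \<Psi> \<xi>) * zft M \<Psi> \<xi> / of_int M)"
  have one: "(\<Sum>y\<in>{0..<M}. cnj (\<Psi> (y - 2 * l * n)) * \<Psi> (y - 2 * l' * n'))
     = (\<Sum>\<xi>\<in>{0..<M}. a \<xi> * (zchar M (\<xi> * (2 * l * n)) * cnj (zchar M (\<xi> * (2 * l' * n')))))" for n n'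
  proof -
    have "unit_periodic M (\<lambda>y. cnj (\<Psi> (y - 2 * l * n)) * \<Psi> (y - 2 * l' * n'))"
      by (intro unit_periodic_mult unit_periodic_cnj unit_periodic_comp[OF \<Psi>]) auto
    from unit_periodic_sum_shift[OF this M, of "2 * l * n"]
    have "(\<Sum>y\<in>{0..<M}. cnj (\<Psi> (y - 2 * l * n)) * \<Psi> (y - 2 * l' * n')) = (\<Sum>y\<in>{0..<M}. cnj (\<Psi> y) * \<Psi> (y + (2 * l * n - 2 * l' * n')))"
      by (simp add: algebra_simps)
    also have "\<dots> = (\<Sum>\<xi>\<in>{0..<M}. cnj (zft M \<Psi> \<xi>) * zft M \<Psi> \<xi> / of_int M * zchar M (\<xi> * (2 * l * n - 2 * l' * n')))"
      by (rule correlation_eq_zft[OF M]) (use \<Psi> in \<open>simp add: unit_periodic_def\<close>)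
    finally show ?thesis unfolding a_def right_diff_distrib zchar_diff .
  qed
  have "(\<Sum>n\<in>S. \<Sum>n'\<in>S'. \<Sum>y\<in>{0..<M}. cnj (\<Psi> (y - 2 * l * n)) * \<Psi> (y - 2 * l' * n')) = (\<Sum>\<xi>\<in>{0..<M}. a \<xi> * (E1 \<xi> * cnj (E2 \<xi>)))"
    unfolding one E1_def E2_def cnj_sum sum_product unfolding sum_distrib_left
    by (rule sum_swap3[where f = "\<lambda>\<xi> n n'. a \<xi> * (zchar M (\<xi> * (2 * l * n)) * cnj (zchar M (\<xi> * (2 * l' * n'))))", symmetric])
  then have "norm (\<Sum>n\<in>S. \<Sum>n'\<in>S'. \<Sum>y\<in>{0..<M}. cnj (\<Psi> (y - 2 * l * n)) * \<Psi> (y - 2 * l' * n'))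
     \<le> (\<Sum>\<xi>\<in>{0..<M}. norm (a \<xi>) * (norm (E1 \<xi>) * norm (E2 \<xi>)))"
    by (simp only:) (rule sum_norm_le, simp add: norm_mult)
  also have "\<dots> \<le> (\<Sum>\<xi>\<in>{0..<M}. norm (a \<xi>) * v + (if \<xi> \<in> \<Xi> then norm (a \<xi>) * c\<^sup>2 else 0))"
  proof (rule sum_mono)
    fix \<xi> assume x: "\<xi> \<in> {0..<M}"
    have nn: "0 \<le> norm (a \<xi>) * v" using v by simp
    show "norm (a \<xi>) * (norm (E1 \<xi>) * norm (E2 \<xi>)) \<le> norm (a \<xi>) * v + (if \<xi> \<in> \<Xi> then norm (a \<xi>) * c\<^sup>2 else 0)"
    proof (cases "\<xi> \<in> \<Xi>")
      case True
      have "norm (E1 \<xi>) * norm (E2 \<xi>) \<le> c * c" using E c unfolding E1_def E2_def by (intro mult_mono) auto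
      then have "norm (a \<xi>) * (norm (E1 \<xi>) * norm (E2 \<xi>)) \<le> norm (a \<xi>) * (c * c)" by (intro mult_left_mono) auto
      then show ?thesis using True nn by (simp add: power2_eq_square)
    next
      case False
      then have "norm (E1 \<xi>) * norm (E2 \<xi>) \<le> v" using small x unfolding E1_def E2_def by blast
      then show ?thesis using False by (simp add: mult_left_mono)
    qed
  qed
  also have "\<dots> = (\<Sum>\<xi>\<in>{0..<M}. norm (a \<xi>)) * v + (\<Sum>\<xi>\<in>\<Xi>. norm (a \<xi>)) * c\<^sup>2"
  proof -
    have "{0..<M} \<inter> \<Xi> = \<Xi>" using \<Xi> by auto
    then show ?thesis by (simp add: sum.distrib sum.If_cases sum_distrib_right)
  qed
  also have "(\<Sum>\<xi>\<in>{0..<M}. norm (a \<xi>)) * v \<le> of_int M * v"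
    using zft_product_sum_le[OF M \<Psi> \<Psi>] v unfolding a_def by (intro mult_right_mono) auto
  also have "(\<Sum>\<xi>\<in>\<Xi>. norm (a \<xi>)) * c\<^sup>2 = c\<^sup>2 / of_int M * (\<Sum>\<xi>\<in>\<Xi>. (norm (zft M \<Psi> \<xi>))\<^sup>2)"
    using M unfolding a_def by (simp add: norm_mult norm_divide sum_distrib_left sum_distrib_right power2_eq_square mult_ac)
  finally show ?thesis by (simp add: mult.commute)
qed

text \<open>For fixed \<open>w2\<close> the map \<open>(i, w1) \<mapsto> (lf i - k, w1 - w2)\<close>
  is injective into the box. The factor \<open>4 * N\<close> pays for the choice of
  \<open>w2\<close>.\<close>

lemma sum_le_gbox:
  fixes g :: "int \<Rightarrow> real"
  assumes N: "N > 0" and X: "finite X" "inj_on lf X" "lf ` X \<subseteq> {-N..N}" and k: "k \<in> {-(3*N)..3*N}" and g: "\<And>t. g t \<ge> 0"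
  shows "(\<Sum>i\<in>X. \<Sum>w1\<in>{-N..2*N}. \<Sum>w2\<in>{-N..2*N}. g (2 * (lf i - k) * (w1 - w2))) \<le> 4 * of_int N * (\<Sum>b\<in>gbox N. g (bstep b))"
proof -
  define W where "W = {-N..2*N}"
  have one: "(\<Sum>z\<in>X \<times> W. g (2 * (lf (fst z) - k) * (snd z - w2))) \<le> (\<Sum>b\<in>gbox N. g (bstep b))" if w2: "w2 \<in> W" for w2
  proof -
    define \<phi> where "\<phi> = (\<lambda>z. (lf (fst z) - k, snd z - w2))"
    have inj: "inj_on \<phi> (X \<times> W)" using X(2) unfolding \<phi>_def by (auto simp: inj_on_def)
    have im: "\<phi> ` (X \<times> W) \<subseteq> gbox N"
    proof
      fix u assume "u \<in> \<phi> ` (X \<times> W)"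
      then obtain i w where "i \<in> X" "w \<in> W" "u = (lf i - k, w - w2)" unfolding \<phi>_def by auto
      moreover have "lf i \<in> {-N..N}" using X(3) \<open>i \<in> X\<close> by blast
      ultimately show "u \<in> gbox N" using k w2 N unfolding gbox_def W_def by auto
    qed
    have "(\<Sum>z\<in>X \<times> W. g (2 * (lf (fst z) - k) * (snd z - w2))) = (\<Sum>b\<in>\<phi> ` (X \<times> W). g (bstep b))"
      using inj by (simp add: sum.reindex bstep_def \<phi>_def)
    also have "\<dots> \<le> (\<Sum>b\<in>gbox N. g (bstep b))" using im g by (intro sum_mono2) auto
    finally show ?thesis .
  qed
  have "(\<Sum>i\<in>X. \<Sum>w1\<in>W. \<Sum>w2\<in>W. g (2 * (lf i - k) * (w1 - w2))) = (\<Sum>z\<in>X \<times> W. \<Sum>w2\<in>W. g (2 * (lf (fst z) - k) * (snd z - w2)))"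
    by (simp add: sum.cartesian_product')
  also have "\<dots> = (\<Sum>w2\<in>W. \<Sum>z\<in>X \<times> W. g (2 * (lf (fst z) - k) * (snd z - w2)))" by (rule sum.swap)
  also have "\<dots> \<le> (\<Sum>w2\<in>W. \<Sum>b\<in>gbox N. g (bstep b))" using one by (rule sum_mono)
  also have "\<dots> = real (card W) * (\<Sum>b\<in>gbox N. g (bstep b))" by simp
  also have "\<dots> \<le> 4 * of_int N * (\<Sum>b\<in>gbox N. g (bstep b))"
    using N g by (intro mult_right_mono sum_nonneg) (auto simp: W_def)
  finally show ?thesis unfolding W_def .
qed

lemma zft_cnj: "zft M (\<lambda>y. cnj (f y)) \<xi> = cnj (zft M f (- \<xi>))"
  by (simp add: zft_def cnj_zchar)

lemma sum_zchar_interval: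
  assumes S: "S = {a..b} \<or> S = {}"
  shows "norm (\<Sum>n\<in>S. zchar M (\<xi> * (2 * l * n))) * dist_circle (of_int l * (2 * (of_int \<xi> / of_int M))) \<le> 1"
proof -
  have "zchar M (\<xi> * (2 * l * n)) = add_char (of_int n * (of_int l * (2 * (of_int \<xi> / of_int M))))" for n
    unfolding zchar_def by (simp add: mult_ac)
  then show ?thesis using S norm_sum_add_char_le[of "of_int l * (2 * (of_int \<xi> / of_int M))" a b] by auto
qed

lemma quarter_bound:
  fixes z s q :: real
  shows "z \<le> q + q + 49 / 2 * s \<Longrightarrow> q = z / 4 \<Longrightarrow> z / 49 \<le> s"
  by simp

text \<open>The two exponential sums in \<open>norm_pair_correlation_le\<close> are both large only
  if \<open>lf i\<close> and \<open>lf i'\<close> times \<open>2 * \<xi> / M\<close> are near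
  integers. By \<open>dist_circle_gcd_le\<close> the same then holds for their gcd, so unless the
  pair is exceptional, \<open>\<xi>\<close> is major. The set \<open>\<Xi>\<close> of major
  frequencies is small and does not depend on \<open>(i, i')\<close>, hence one frequency
  \<open>\<xi>0\<close> carries much of the mass of all mixed differences. For many first steps the
  mixed differences at \<open>\<xi>0\<close> are correlations along the second step, and the
  equidistribution of the box steps turns them into a large coefficient of the first
  difference.\<close>

lemma concatenation:
  fixes A :: "int \<Rightarrow> complex" and B C :: "int \<Rightarrow> int \<Rightarrow> complex" and X :: "int set" and lf :: "int \<Rightarrow> int" and c :: nat
  assumes K: "K \<ge> 2" and N: "of_int N \<ge> K ^ (40 * (774 + 5 * c))" and M: "M = 2 * N\<^sup>2"
    and L: "of_int L * K ^ 73 \<le> of_int N" "of_int N \<le> of_int L * K ^ c" "of_int L \<ge> K ^ 80"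
    and X: "finite X" "real (card X) \<le> of_int L" "inj_on lf X" "lf ` X \<subseteq> {-L..L}"
    and k: "k \<in> {-(3*N)..3*N}"
    and J: "\<And>i. J i \<subseteq> {-N..2*N}" "\<And>i. \<exists>a b. J i = {a..b}"
    and A: "unit_periodic M A" and B: "\<And>i. unit_periodic M (B i)" and C: "\<And>i. unit_periodic M (C i)"
    and big: "of_int L * (of_int N) ^ 3 / K \<le> norm (\<Sum>i\<in>X. \<Sum>w\<in>J i. \<Sum>y\<in>{0..<M}. A y * B i (y + 2 * (lf i - k) * w) * C i (y + 2 * lf i * w))"
  shows "(of_int N)\<^sup>2 / K ^ (776 + 5 * c) \<le> real (card {b\<in>gbox N. \<exists>\<xi>. norm (zft M (\<lambda>y. A y * cnj (A (y + bstep b))) \<xi>) \<ge> (of_int N)\<^sup>2 / K ^ (124 * (774 + 5 * c))})"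
proof -
  define n where "n = real_of_int N"
  define l where "l = real_of_int L"
  have Kp: "K > 0" "K \<ge> 1" using K by auto
  have "0 < K ^ (40 * (774 + 5 * c))" using K by simp
  then have n: "n > 0" "n \<ge> K ^ (40 * (774 + 5 * c))" using N unfolding n_def by linarith+
  have N0: "N > 0" using n n_def by simp
  have "0 < K ^ 80" using K by simp
  then have l: "l > 0" "l * K ^ 73 \<le> n" "n \<le> l * K ^ c" "l \<ge> K ^ 80" using L unfolding l_def n_def by linarith+
  have L1: "L \<ge> 1" using l l_def by simp
  have ln: "l \<le> n"
  proof -
    have "l * 1 \<le> l * K ^ 73" using Kp l by (intro mult_left_mono) auto
    then show ?thesis using l by linarith
  qed
  have LN: "L \<le> N" using ln unfolding l_def n_def by simp
  have M0: "M > 0" using M N0 by simp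
  have Mn: "real_of_int M = 2 * n\<^sup>2" using M by (simp add: n_def)
  define W where "W = {-N..2*N}"
  have cW: "real (card W) \<le> 4 * n" using N0 unfolding W_def n_def by simp
  define NN where "NN = (\<lambda>i w1 w2. {n\<in>{-(3*N)..3*N}. w1 \<in> J i \<and> w2 \<in> J i \<and> w1 + n \<in> J i \<and> w2 + n \<in> J i})"
  have NNint: "\<exists>a b. NN i w1 w2 = {a..b} \<or> NN i w1 w2 = {}" for i w1 w2
  proof -
    obtain a b where ab: "J i = {a..b}" using J by blast
    show ?thesis
    proof (cases "w1 \<in> J i \<and> w2 \<in> J i")
      case True
      have sub: "{a..b} \<subseteq> {-N..2*N}" using J(1)[of i] ab by simp
      have w: "w1 \<in> {-N..2*N}" "a \<le> w1" "w1 \<le> b" using True ab J(1)[of i] by auto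
      then have "-N \<le> a" "b \<le> 2*N" using sub by auto
      then have "NN i w1 w2 = {max (a - w1) (a - w2)..min (b - w1) (b - w2)}"
        using True w unfolding NN_def ab by auto
      then show ?thesis by blast
    qed (auto simp: NN_def)
  qed
  have cNN: "real (card (NN i w1 w2)) \<le> 7 * n" for i w1 w2
  proof -
    have "card (NN i w1 w2) \<le> card {-(3*N)..3*N}" unfolding NN_def by (intro card_mono) auto
    then show ?thesis using N0 unfolding n_def by simp
  qed
  define E where "E = (\<lambda>i w1 w2 \<xi>. norm (\<Sum>m\<in>NN i w1 w2. zchar M (\<xi> * (2 * lf i * m))))"
  have Eu: "E i w1 w2 \<xi> \<le> 7 * n" for i w1 w2 \<xi>
  proof -
    have "E i w1 w2 \<xi> \<le> real (card (NN i w1 w2)) * 1" unfolding E_def by (rule sum_norm_bound) simp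
    then show ?thesis using cNN[of i w1 w2] by linarith
  qed
  have Ed: "E i w1 w2 \<xi> * dist_circle (of_int (lf i) * (2 * (of_int \<xi> / of_int M))) \<le> 1" for i w1 w2 \<xi>
    unfolding E_def using NNint[of i w1 w2] sum_zchar_interval by blast
  define \<Psi> where "\<Psi> = (\<lambda>i i' w1 w2 w1' w2'. mixed_diff A (2 * (lf i - k) * (w1 - w2)) (2 * (lf i' - k) * (w1' - w2')))"
  have \<Psi>p: "unit_periodic M (\<Psi> i i' w1 w2 w1' w2')" for i i' w1 w2 w1' w2'
    unfolding \<Psi>_def by (rule unit_periodic_mixed_diff[OF A])
  define T where "T = (\<lambda>i i' w1 w2 w1' w2'. norm (\<Sum>m\<in>NN i w1 w2. \<Sum>m'\<in>NN i' w1' w2'. \<Sum>y\<in>{0..<M}.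
      cnj (\<Psi> i i' w1 w2 w1' w2' (y - 2 * lf i * m)) * \<Psi> i i' w1 w2 w1' w2' (y - 2 * lf i' * m')))"
  have lower: "l\<^sup>2 * n ^ 8 / K ^ 57 \<le> (\<Sum>i\<in>X. \<Sum>i'\<in>X. \<Sum>w1\<in>W. \<Sum>w2\<in>W. \<Sum>w1'\<in>W. \<Sum>w2'\<in>W. T i i' w1 w2 w1' w2')"
    using concatenation_van_der_corput[OF K N0 M X(1,2) _ J(1) A B C big] l
    unfolding T_def \<Psi>_def NN_def W_def l_def n_def by simp
  \<comment> \<open>A pair is exceptional if an entry is below \<open>l / K^80\<close> or the gcd
    exceeds about \<open>K^80\<close>. This keeps the exceptional pairs below
    \<open>l^2 / K^75\<close>, small enough against the loss \<open>K^57\<close> in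
    \<open>lower\<close>.\<close>
  define h where "h = l / K ^ 80"
  define G where "G = nat \<lfloor>K ^ 80\<rfloor>"
  have "1 \<le> K ^ 80" using Kp by simp
  then have f1: "1 \<le> \<lfloor>K ^ 80\<rfloor>" by (simp add: le_floor_iff)
  then have rG: "real G = of_int \<lfloor>K ^ 80\<rfloor>" unfolding G_def by (intro of_nat_nat) linarith
  have "real_of_int \<lfloor>K ^ 80\<rfloor> \<ge> 1" using f1 by linarith
  moreover have "K ^ 80 < of_int \<lfloor>K ^ 80\<rfloor> + 1" "of_int \<lfloor>K ^ 80\<rfloor> \<le> K ^ 80" by linarith+
  ultimately have "real G \<ge> 1" "real G \<le> K ^ 80" "real G \<ge> K ^ 80 / 2" using rG by linarith+
  then have G: "G \<ge> 1" "real G \<le> K ^ 80" "real G \<ge> K ^ 80 / 2" by auto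
  have h0: "h > 0" unfolding h_def using l Kp by simp
  define bad where "bad = (\<lambda>i i'. \<bar>of_int (lf i)\<bar> < h \<or> \<bar>of_int (lf i')\<bar> < h \<or> gcd (lf i) (lf i') > int G)"
  define BP where "BP = {z\<in>X \<times> X. bad (fst z) (snd z)}"
  have cBP: "real (card BP) \<le> l\<^sup>2 / K ^ 75"
  proof -
    have "card BP \<le> card {(a, b)\<in>{-L..L} \<times> {-L..L}. \<bar>of_int a\<bar> < h \<or> \<bar>of_int b\<bar> < h \<or> gcd a b > int G}"
    proof (rule card_inj_on_le[of "\<lambda>z. (lf (fst z), lf (snd z))"])
      show "inj_on (\<lambda>z. (lf (fst z), lf (snd z))) BP" using X(3) unfolding BP_def by (auto simp: inj_on_def)
      show "(\<lambda>z. (lf (fst z), lf (snd z))) ` BP \<subseteq> {(a, b)\<in>{-L..L} \<times> {-L..L}. \<bar>of_int a\<bar> < h \<or> \<bar>of_int b\<bar> < h \<or> gcd a b > int G}"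
      proof
        fix u assume "u \<in> (\<lambda>z. (lf (fst z), lf (snd z))) ` BP"
        then obtain i i' where u: "u = (lf i, lf i')" "i \<in> X" "i' \<in> X" "bad i i'" unfolding BP_def by auto
        then have "lf i \<in> {-L..L}" "lf i' \<in> {-L..L}" using X(4) by blast+
        then show "u \<in> {(a, b)\<in>{-L..L} \<times> {-L..L}. \<bar>of_int a\<bar> < h \<or> \<bar>of_int b\<bar> < h \<or> gcd a b > int G}"
          using u unfolding bad_def by simp
      qed
      show "finite {(a, b)\<in>{-L..L} \<times> {-L..L}. \<bar>of_int a\<bar> < h \<or> \<bar>of_int b\<bar> < h \<or> gcd a b > int G}"
        by (rule finite_subset[of _ "{-L..L} \<times> {-L..L}"]) auto
    qed
    then have "real (card BP) \<le> 6 * l * (2 * h + 1) + 4 * l\<^sup>2 / real G"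
      using card_bad_pairs_le[OF L1 h0 G(1)] unfolding l_def by linarith
    also have "4 * l\<^sup>2 / real G \<le> 4 * l\<^sup>2 / (K ^ 80 / 2)" using G Kp by (intro divide_left_mono) auto
    also have "6 * l * (2 * h + 1) \<le> 18 * l\<^sup>2 / K ^ 80"
    proof -
      have "1 \<le> h" using l(4) Kp unfolding h_def by simp
      then have "6 * l * (2 * h + 1) \<le> 6 * l * (3 * h)" using l by (intro mult_left_mono) auto
      then show ?thesis unfolding h_def by (simp add: power2_eq_square)
    qed
    also have "18 * l\<^sup>2 / K ^ 80 + 4 * l\<^sup>2 / (K ^ 80 / 2) = 26 * l\<^sup>2 / K ^ 80" using Kp by (simp add: field_simps)
    also have "\<dots> \<le> l\<^sup>2 / K ^ 75"
    proof -
      have "26 * K ^ 75 \<le> K ^ 80" by (rule const_le_power[OF K, of _ 5]) auto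
      then have "26 * K ^ 75 * l\<^sup>2 \<le> K ^ 80 * l\<^sup>2" by (intro mult_right_mono) auto
      then show ?thesis using Kp by (simp add: field_simps)
    qed
    finally show ?thesis by simp
  qed
  \<comment> \<open>The exponent \<open>231 = 71 + 80 + 80\<close> collects the error
    \<open>K^71 / n\<close>, the gcd bound \<open>K^80\<close> and the lower bound
    \<open>l / K^80\<close> for the step; \<open>c\<close> pays for replacing \<open>l\<close> by
    \<open>n\<close>.\<close>
  define Qm where "Qm = K ^ (231 + c)"
  have Qm1: "Qm \<ge> 1" unfolding Qm_def using Kp by simp
  define \<Xi> where "\<Xi> = {\<xi>\<in>{0..<M}. major Qm N (of_int \<xi> / of_int M)}"
  have fin\<Xi>: "finite \<Xi>" by (rule finite_subset[of _ "{0..<M}"]) (auto simp: \<Xi>_def)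
  have c\<Xi>: "real (card \<Xi>) \<le> K ^ (699 + 3 * c)"
  proof -
    have "Qm \<le> of_int N"
    proof -
      have "Qm \<le> K ^ (40 * (774 + 5 * c))" unfolding Qm_def using Kp by (intro power_increasing) auto
      then show ?thesis using N by linarith
    qed
    then have "real (card \<Xi>) \<le> 60 * Qm ^ 3" unfolding \<Xi>_def by (rule card_major_le[OF N0 Qm1 _ M])
    also have "\<dots> = 60 * K ^ ((231 + c) * 3)" unfolding Qm_def by (simp flip: power_mult)
    also have "\<dots> \<le> K ^ (699 + 3 * c)" by (rule const_le_power[OF K, of _ 6]) auto
    finally show ?thesis .
  qed
  define \<Phi> where "\<Phi> = (\<lambda>i i' w1 w2 w1' w2'. \<Sum>\<xi>\<in>\<Xi>. (norm (zft M (\<Psi> i i' w1 w2 w1' w2') \<xi>))\<^sup>2)"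
  have \<Phi>0: "\<Phi> i i' w1 w2 w1' w2' \<ge> 0" for i i' w1 w2 w1' w2' unfolding \<Phi>_def by (intro sum_nonneg) auto
  define v where "v = n\<^sup>2 / K ^ 68"
  have v0: "v > 0" unfolding v_def using n Kp by simp
  have good: "T i i' w1 w2 w1' w2' \<le> v * of_int M + (7 * n)\<^sup>2 / of_int M * \<Phi> i i' w1 w2 w1' w2'"
    if ii: "i \<in> X" "i' \<in> X" and nb: "\<not> bad i i'" for i i' w1 w2 w1' w2'
    unfolding T_def \<Phi>_def
  proof (rule norm_pair_correlation_le[OF M0 \<Psi>p])
    fix \<xi> assume xi: "\<xi> \<in> {0..<M} - \<Xi>"
    show "norm (\<Sum>m\<in>NN i w1 w2. zchar M (\<xi> * (2 * lf i * m))) * norm (\<Sum>m\<in>NN i' w1' w2'. zchar M (\<xi> * (2 * lf i' * m))) \<le> v"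
    proof (rule ccontr)
      \<comment> \<open>If the product of two factors, each at most \<open>7 * n\<close>, exceeds
        \<open>v = n^2 / K^68\<close>, then each exceeds \<open>n / (7 * K^68)\<close>. The
        geometric series bound gives distance at most \<open>7 * K^68 / n\<close>, which is below
        \<open>\<kappa>\<close>.\<close>
      define \<kappa> where "\<kappa> = K ^ 71 / n"
      have cl: "dist_circle (of_int (lf a) * (2 * (of_int \<xi> / of_int M))) \<le> \<kappa>"
        if "v < E a u1 u2 \<xi> * e" "e \<le> 7 * n" "0 \<le> e" for a u1 u2 e
      proof -
        have "v \<le> E a u1 u2 \<xi> * (7 * n)"
          using that mult_left_mono[of e "7 * n" "E a u1 u2 \<xi>"] unfolding E_def by auto
        then have "n / (7 * K ^ 68) \<le> E a u1 u2 \<xi>" unfolding v_def using n Kp by (simp add: field_simps power2_eq_square)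
        then have "n / (7 * K ^ 68) * dist_circle (of_int (lf a) * (2 * (of_int \<xi> / of_int M))) \<le> 1"
          using Ed[of a u1 u2 \<xi>] mult_right_mono[of "n / (7 * K ^ 68)" "E a u1 u2 \<xi>" "dist_circle (of_int (lf a) * (2 * (of_int \<xi> / of_int M)))"]
          by auto
        then have "dist_circle (of_int (lf a) * (2 * (of_int \<xi> / of_int M))) \<le> 7 * K ^ 68 / n" using n Kp by (simp add: field_simps)
        also have "\<dots> \<le> K ^ 71 / n" using n by (intro divide_right_mono const_le_power[OF K, of _ 3]) auto
        finally show ?thesis unfolding \<kappa>_def .
      qed
      assume "\<not> ?thesis"
      then have gt: "v < E i w1 w2 \<xi> * E i' w1' w2' \<xi>" unfolding E_def by simp
      have d1: "dist_circle (of_int (lf i) * (2 * (of_int \<xi> / of_int M))) \<le> \<kappa>"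
        by (rule cl[OF gt Eu]) (simp add: E_def)
      have d2: "dist_circle (of_int (lf i') * (2 * (of_int \<xi> / of_int M))) \<le> \<kappa>"
        by (rule cl[of i' w1' w2' "E i w1 w2 \<xi>"]) (use gt Eu in \<open>auto simp: E_def mult.commute\<close>)
      have "lf i \<in> {-L..L}" "lf i' \<in> {-L..L}" using X(4) ii by blast+
      then have li: "\<bar>lf i\<bar> \<le> L" "\<bar>lf i'\<bar> \<le> L" by auto
      have hi: "\<bar>real_of_int (lf i)\<bar> \<ge> h" "gcd (lf i) (lf i') \<le> int G" using nb unfolding bad_def by auto
      then have li0: "lf i \<noteq> 0" using h0 by auto
      \<comment> \<open>Here the shortness of the block enters: \<open>l * K^73 \<le> n\<close>,
        against an error of \<open>K^71 / n\<close>.\<close>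
      have "2 * \<kappa> * of_int L < 1"
      proof -
        have "4 * (K ^ 71 * l) \<le> K\<^sup>2 * (K ^ 71 * l)" using K l power_mono[of 2 K 2] by (intro mult_right_mono) auto
        also have "\<dots> = l * K ^ 73" by (simp flip: power_add)
        finally have "4 * (K ^ 71 * l) \<le> n" using l by linarith
        then have "2 * (K ^ 71 * l) < n" using n by linarith
        then show ?thesis unfolding \<kappa>_def using n by (simp add: field_simps flip: l_def)
      qed
      from dist_circle_gcd_le[OF li0 d1 d2 li this]
      have dg: "dist_circle (of_int (gcd (lf i) (lf i')) * (2 * (of_int \<xi> / of_int M))) \<le> \<kappa> * of_int (gcd (lf i) (lf i')) / \<bar>of_int (lf i)\<bar>" .
      have gp: "gcd (lf i) (lf i') > 0" using li0 by simp
      have gK: "real_of_int (gcd (lf i) (lf i')) \<le> K ^ 80" using hi(2) G(2) by linarith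
      have "major Qm N (of_int \<xi> / of_int M)" unfolding major_def
      proof (intro exI[of _ "2 * gcd (lf i) (lf i')"] conjI)
        show "0 < 2 * gcd (lf i) (lf i')" using gp by simp
        have "2 * K ^ 80 \<le> Qm" unfolding Qm_def by (rule const_le_power[OF K, of _ 1]) auto
        then show "real_of_int (2 * gcd (lf i) (lf i')) \<le> Qm" using gK by simp
        have "\<kappa> * of_int (gcd (lf i) (lf i')) / \<bar>of_int (lf i)\<bar> \<le> \<kappa> * K ^ 80 / h"
          using gK hi h0 n Kp gp unfolding \<kappa>_def by (intro frac_le mult_left_mono) auto
        also have "\<dots> = K ^ 231 / (n * l)" unfolding \<kappa>_def h_def by (simp flip: power_add)
        also have "\<dots> \<le> Qm / n\<^sup>2"
        proof -
          have "K ^ 231 * n * n \<le> K ^ 231 * n * (l * K ^ c)" using l n Kp by (intro mult_left_mono) auto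
          then have "K ^ 231 * n\<^sup>2 \<le> Qm * (n * l)" unfolding Qm_def by (simp add: power_add power2_eq_square mult_ac)
          then show ?thesis using n l by (simp add: divide_le_eq le_divide_eq mult_ac)
        qed
        finally show "dist_circle (of_int (2 * gcd (lf i) (lf i')) * (of_int \<xi> / of_int M)) \<le> Qm / (of_int N)\<^sup>2"
          using dg unfolding n_def by (simp add: mult_ac)
      qed
      then show False using xi unfolding \<Xi>_def by auto
    qed
  qed (use n v0 Eu in \<open>auto simp: \<Xi>_def E_def\<close>)
  have triv: "T i i' w1 w2 w1' w2' \<le> (7 * n)\<^sup>2 * of_int M" for i i' w1 w2 w1' w2'
  proof -
    have "T i i' w1 w2 w1' w2' \<le> (\<Sum>m\<in>NN i w1 w2. \<Sum>m'\<in>NN i' w1' w2'. \<Sum>y\<in>{0..<M}. 1)"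
      unfolding T_def using \<Psi>p by (intro sum_norm_le) (auto simp: norm_mult unit_periodic_def intro!: mult_le_one)
    also have "\<dots> = real (card (NN i w1 w2)) * real (card (NN i' w1' w2')) * of_int M" using M0 by simp
    also have "\<dots> \<le> (7 * n) * (7 * n) * of_int M"
      using cNN n M0 by (intro mult_right_mono mult_mono) auto
    finally show ?thesis by (simp add: power2_eq_square)
  qed
  have all: "T i i' w1 w2 w1' w2' \<le> (v * of_int M + (if bad i i' then (7 * n)\<^sup>2 * of_int M else 0)) + (7 * n)\<^sup>2 / of_int M * \<Phi> i i' w1 w2 w1' w2'"
    if ii: "i \<in> X" "i' \<in> X" for i i' w1 w2 w1' w2'
  proof (cases "bad i i'")
    case True
    have "0 \<le> v * of_int M" "0 \<le> (7 * n)\<^sup>2 / of_int M * \<Phi> i i' w1 w2 w1' w2'" using v0 M0 \<Phi>0 by simp_all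
    then show ?thesis using triv[of i i' w1 w2 w1' w2'] True by simp
  qed (use good[OF ii] in auto)
  define S\<Phi> where "S\<Phi> = (\<Sum>i\<in>X. \<Sum>i'\<in>X. \<Sum>w1\<in>W. \<Sum>w2\<in>W. \<Sum>w1'\<in>W. \<Sum>w2'\<in>W. \<Phi> i i' w1 w2 w1' w2')"
  have S\<Phi>: "l\<^sup>2 * n ^ 8 / K ^ 63 \<le> S\<Phi>"
  proof -
    have "l\<^sup>2 * n ^ 8 / K ^ 57 \<le> (\<Sum>i\<in>X. \<Sum>i'\<in>X. \<Sum>w1\<in>W. \<Sum>w2\<in>W. \<Sum>w1'\<in>W. \<Sum>w2'\<in>W. T i i' w1 w2 w1' w2')" by (rule lower)
    also have "\<dots> \<le> (\<Sum>i\<in>X. \<Sum>i'\<in>X. \<Sum>w1\<in>W. \<Sum>w2\<in>W. \<Sum>w1'\<in>W. \<Sum>w2'\<in>W.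
       (v * of_int M + (if bad i i' then (7 * n)\<^sup>2 * of_int M else 0)) + (7 * n)\<^sup>2 / of_int M * \<Phi> i i' w1 w2 w1' w2')"
      using all by (intro sum_mono)
    also have "\<dots> = (\<Sum>i\<in>X. \<Sum>i'\<in>X. real (card W) ^ 4 * (v * of_int M + (if bad i i' then (7 * n)\<^sup>2 * of_int M else 0))) + (7 * n)\<^sup>2 / of_int M * S\<Phi>"
      unfolding S\<Phi>_def by (simp add: sum.distrib sum_distrib_left eval_nat_numeral mult.assoc)
    also have "(\<Sum>i\<in>X. \<Sum>i'\<in>X. real (card W) ^ 4 * (v * of_int M + (if bad i i' then (7 * n)\<^sup>2 * of_int M else 0)))
       = real (card W) ^ 4 * (real (card (X \<times> X)) * (v * of_int M) + real (card BP) * ((7 * n)\<^sup>2 * of_int M))"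
    proof -
      have "(\<Sum>i\<in>X. \<Sum>i'\<in>X. v * of_int M + (if bad i i' then (7 * n)\<^sup>2 * of_int M else 0)) = (\<Sum>z\<in>X \<times> X. v * of_int M + (if bad (fst z) (snd z) then (7 * n)\<^sup>2 * of_int M else 0))"
        by (simp add: sum.cartesian_product')
      also have "\<dots> = real (card (X \<times> X)) * (v * of_int M) + real (card BP) * ((7 * n)\<^sup>2 * of_int M)"
        using X(1) unfolding BP_def by (simp add: sum.distrib sum.If_cases Int_def)
      finally show ?thesis by (simp flip: sum_distrib_left)
    qed
    also have "\<dots> \<le> (4 * n) ^ 4 * (l\<^sup>2 * (v * of_int M) + l\<^sup>2 / K ^ 75 * ((7 * n)\<^sup>2 * of_int M))"
    proof (intro mult_mono add_mono power_mono)
      show "real (card (X \<times> X)) \<le> l\<^sup>2" using X(2) l unfolding l_def by (simp add: card_cartesian_product power2_eq_square mult_mono)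
    qed (use cW cBP v0 M0 n l Kp in auto)
    also have "\<dots> = 512 * l\<^sup>2 * n ^ 8 / K ^ 68 + 25088 * l\<^sup>2 * n ^ 8 / K ^ 75"
      unfolding v_def Mn using Kp by (simp add: field_simps eval_nat_numeral)
    also have "512 * l\<^sup>2 * n ^ 8 / K ^ 68 \<le> l\<^sup>2 * n ^ 8 / (4 * K ^ 57)"
    proof -
      have "2048 * K ^ 57 \<le> K ^ 68" by (rule const_le_power[OF K, of _ 11]) auto
      then have "2048 * K ^ 57 * (l\<^sup>2 * n ^ 8) \<le> K ^ 68 * (l\<^sup>2 * n ^ 8)" using n l by (intro mult_right_mono) auto
      then show ?thesis using Kp by (simp add: divide_le_eq le_divide_eq mult_ac)
    qed
    also have "25088 * l\<^sup>2 * n ^ 8 / K ^ 75 \<le> l\<^sup>2 * n ^ 8 / (4 * K ^ 57)"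
    proof -
      have "100352 * K ^ 57 \<le> K ^ 75" by (rule const_le_power[OF K, of _ 17]) auto
      then have "100352 * K ^ 57 * (l\<^sup>2 * n ^ 8) \<le> K ^ 75 * (l\<^sup>2 * n ^ 8)" using n l by (intro mult_right_mono) auto
      then show ?thesis using Kp by (simp add: divide_le_eq le_divide_eq mult_ac)
    qed
    also have "(7 * n)\<^sup>2 / of_int M * S\<Phi> = 49 / 2 * S\<Phi>" unfolding Mn using n by (simp add: power2_eq_square)
    finally have "l\<^sup>2 * n ^ 8 / K ^ 57 \<le> l\<^sup>2 * n ^ 8 / (4 * K ^ 57) + l\<^sup>2 * n ^ 8 / (4 * K ^ 57) + 49 / 2 * S\<Phi>" by simp
    moreover have "l\<^sup>2 * n ^ 8 / (4 * K ^ 57) = l\<^sup>2 * n ^ 8 / K ^ 57 / 4" by simp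
    ultimately have "l\<^sup>2 * n ^ 8 / K ^ 57 / 49 \<le> S\<Phi>"
      by (rule quarter_bound)
    moreover have "l\<^sup>2 * n ^ 8 / K ^ 63 \<le> l\<^sup>2 * n ^ 8 / (49 * K ^ 57)"
      using n l Kp by (intro divide_left_mono const_le_power[OF K, of _ 6]) auto
    ultimately show ?thesis by (simp add: mult.commute)
  qed
  define g where "g = (\<lambda>\<xi> a b. (norm (zft M (mixed_diff A a b) \<xi>))\<^sup>2)"
  have g0: "g \<xi> a b \<ge> 0" for \<xi> a b unfolding g_def by simp
  have Lf: "lf ` X \<subseteq> {-N..N}" using X(4) LN by auto
  have S\<Phi>2: "S\<Phi> \<le> (\<Sum>\<xi>\<in>\<Xi>. (4 * n) * (4 * n) * (\<Sum>b\<in>gbox N. \<Sum>b'\<in>gbox N. g \<xi> (bstep b) (bstep b')))"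
  proof -
    have "S\<Phi> = (\<Sum>z\<in>X \<times> X \<times> W \<times> W \<times> W \<times> W. \<Sum>\<xi>\<in>\<Xi>. g \<xi> (2 * (lf (fst z) - k) * (fst (snd (snd z)) - fst (snd (snd (snd z))))) (2 * (lf (fst (snd z)) - k) * (fst (snd (snd (snd (snd z)))) - snd (snd (snd (snd (snd z)))))))"
      unfolding S\<Phi>_def \<Phi>_def \<Psi>_def g_def by (simp add: sum.cartesian_product')
    also have "\<dots> = (\<Sum>\<xi>\<in>\<Xi>. \<Sum>i\<in>X. \<Sum>i'\<in>X. \<Sum>w1\<in>W. \<Sum>w2\<in>W. \<Sum>w1'\<in>W. \<Sum>w2'\<in>W. g \<xi> (2 * (lf i - k) * (w1 - w2)) (2 * (lf i' - k) * (w1' - w2')))"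
      by (subst sum.swap) (simp add: sum.cartesian_product')
    also have "\<dots> = (\<Sum>\<xi>\<in>\<Xi>. \<Sum>i\<in>X. \<Sum>w1\<in>W. \<Sum>w2\<in>W. \<Sum>i'\<in>X. \<Sum>w1'\<in>W. \<Sum>w2'\<in>W. g \<xi> (2 * (lf i - k) * (w1 - w2)) (2 * (lf i' - k) * (w1' - w2')))"
      by (rule sum.cong[OF refl], rule sum.cong[OF refl], rule sum_swap3)
    also have "\<dots> \<le> (\<Sum>\<xi>\<in>\<Xi>. \<Sum>i\<in>X. \<Sum>w1\<in>W. \<Sum>w2\<in>W. 4 * n * (\<Sum>b'\<in>gbox N. g \<xi> (2 * (lf i - k) * (w1 - w2)) (bstep b')))"
      unfolding W_def n_def by (intro sum_mono sum_le_gbox[OF N0 X(1,3) Lf k] g0)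
    also have "\<dots> \<le> (\<Sum>\<xi>\<in>\<Xi>. 4 * n * (\<Sum>b\<in>gbox N. 4 * n * (\<Sum>b'\<in>gbox N. g \<xi> (bstep b) (bstep b'))))"
      unfolding W_def n_def using g0 N0
      by (intro sum_mono sum_le_gbox[OF N0 X(1,3) Lf k] mult_nonneg_nonneg sum_nonneg) auto
    finally show ?thesis by (simp add: mult.assoc flip: sum_distrib_left)
  qed
  \<comment> \<open>\<open>766 + 5 * c = (63 + 699 + 3 * c) + 2 * c + 4\<close>: the losses of mass
    and of choosing a frequency, the replacement of \<open>l^2\<close> by \<open>n^2\<close>, and
    the factor \<open>16\<close>.\<close>
  define e where "e = 766 + 5 * c"
  \<comment> \<open>One frequency is fixed for all pairs of steps at once. This is possible since
    \<open>\<Xi>\<close> does not depend on the pair and has size a power of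
    \<open>K\<close>.\<close>
  have "\<exists>\<xi>\<in>\<Xi>. (l\<^sup>2 * n ^ 8 / K ^ 63) / K ^ (699 + 3 * c) \<le> (4 * n) * (4 * n) * (\<Sum>b\<in>gbox N. \<Sum>b'\<in>gbox N. g \<xi> (bstep b) (bstep b'))"
    by (rule exists_ge_average[OF fin\<Xi> order_trans[OF S\<Phi> S\<Phi>2] c\<Xi>]) (use n l Kp in auto)
  then obtain \<xi>0 where xi0: "(l\<^sup>2 * n ^ 8 / K ^ 63) / K ^ (699 + 3 * c) \<le> (4 * n) * (4 * n) * (\<Sum>b\<in>gbox N. \<Sum>b'\<in>gbox N. g \<xi>0 (bstep b) (bstep b'))"
    by blast
  have gsum: "n ^ 8 / K ^ e \<le> (\<Sum>b\<in>gbox N. \<Sum>b'\<in>gbox N. g \<xi>0 (bstep b) (bstep b'))"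
  proof -
    have "16 * n\<^sup>2 * (n ^ 8 / K ^ e) \<le> (l\<^sup>2 * n ^ 8 / K ^ 63) / K ^ (699 + 3 * c)"
    proof -
      have "16 * n\<^sup>2 * K ^ (762 + 3 * c) \<le> 16 * (l * K ^ c)\<^sup>2 * K ^ (762 + 3 * c)"
        using l n Kp by (intro mult_right_mono mult_left_mono power_mono) auto
      also have "\<dots> = l\<^sup>2 * (16 * K ^ (c * 2 + (762 + 3 * c)))"
        by (simp only: power_mult_distrib power_add power_mult mult_ac)
      also have "\<dots> \<le> l\<^sup>2 * K ^ e"
        unfolding e_def by (intro mult_left_mono const_le_power[OF K, of _ 4]) auto
      finally have i1: "16 * n\<^sup>2 * K ^ (762 + 3 * c) \<le> l\<^sup>2 * K ^ e" .
      have "16 * n\<^sup>2 * (n ^ 8 / K ^ e) = n ^ 8 * (16 * n\<^sup>2 / K ^ e)" by simp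
      also have "16 * n\<^sup>2 / K ^ e \<le> l\<^sup>2 / K ^ (762 + 3 * c)"
        using i1 Kp by (simp add: divide_le_eq le_divide_eq mult_ac)
      then have "n ^ 8 * (16 * n\<^sup>2 / K ^ e) \<le> n ^ 8 * (l\<^sup>2 / K ^ (762 + 3 * c))" using n by (intro mult_left_mono) auto
      also have "\<dots> = (l\<^sup>2 * n ^ 8 / K ^ 63) / K ^ (699 + 3 * c)" by (simp add: mult.commute flip: power_add)
      finally show ?thesis .
    qed
    also note xi0
    finally have "16 * n\<^sup>2 * (n ^ 8 / K ^ e) \<le> 16 * n\<^sup>2 * (\<Sum>b\<in>gbox N. \<Sum>b'\<in>gbox N. g \<xi>0 (bstep b) (bstep b'))"
      by (simp add: power2_eq_square)
    then show ?thesis by (rule mult_left_le_imp_le) (use n in simp)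
  qed
  have cg: "real (card (gbox N)) \<le> 81 * n\<^sup>2" using card_gbox_le[OF N0] unfolding n_def .
  have gu: "(\<Sum>b'\<in>gbox N. g \<xi>0 a (bstep b')) \<le> 324 * n ^ 6" for a
  proof -
    have "g \<xi>0 a b \<le> (of_int M)\<^sup>2" for b
      unfolding g_def using norm_zft_le[OF M0, of "mixed_diff A a b" \<xi>0] unit_periodic_mixed_diff[OF A]
      by (intro power_mono) (auto simp: unit_periodic_def)
    then have "(\<Sum>b'\<in>gbox N. g \<xi>0 a (bstep b')) \<le> (\<Sum>b'\<in>gbox N. (of_int M)\<^sup>2)" by (intro sum_mono)
    also have "\<dots> = real (card (gbox N)) * (of_int M)\<^sup>2" by simp
    also have "\<dots> \<le> 81 * n\<^sup>2 * (of_int M)\<^sup>2" using cg by (intro mult_right_mono) auto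
    also have "\<dots> = 324 * n ^ 6" unfolding Mn by (simp add: eval_nat_numeral)
    finally show ?thesis .
  qed
  define R where "R = {b\<in>gbox N. n ^ 6 / (162 * K ^ e) \<le> (\<Sum>b'\<in>gbox N. g \<xi>0 (bstep b) (bstep b'))}"
  have "n ^ 8 / K ^ e / 2 \<le> 324 * n ^ 6 * real (card R)"
    unfolding R_def
  proof (rule card_large_terms[OF finite_gbox gu _ _ _ gsum])
    have "2 * (n ^ 6 / (162 * K ^ e)) * real (card (gbox N)) \<le> 2 * (n ^ 6 / (162 * K ^ e)) * (81 * n\<^sup>2)"
      using cg n Kp by (intro mult_left_mono) auto
    also have "\<dots> = n ^ 8 / K ^ e" using Kp by (simp add: eval_nat_numeral)
    finally show "2 * (n ^ 6 / (162 * K ^ e)) * real (card (gbox N)) \<le> n ^ 8 / K ^ e" .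
  qed (use n Kp in auto)
  also have "n ^ 8 / K ^ e / 2 = 324 * n ^ 6 * (n\<^sup>2 / (648 * K ^ e))" using Kp by (simp add: eval_nat_numeral)
  finally have "n\<^sup>2 / (648 * K ^ e) \<le> real (card R)" by (rule mult_left_le_imp_le) (use n in simp)
  moreover have "n\<^sup>2 / K ^ (776 + 5 * c) \<le> n\<^sup>2 / (648 * K ^ e)"
    unfolding e_def using Kp n by (intro divide_left_mono const_le_power[OF K, of _ 10]) auto
  ultimately have cR: "n\<^sup>2 / K ^ (776 + 5 * c) \<le> real (card R)" by linarith
  have "\<exists>\<xi>. norm (zft M (\<lambda>y. A y * cnj (A (y + bstep b))) \<xi>) \<ge> n\<^sup>2 / K ^ (124 * (774 + 5 * c))" if b: "b \<in> R" for b
  proof -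
    define H where "H = (\<lambda>y. A y * cnj (A (y + bstep b)))"
    have Hp: "unit_periodic M H" unfolding H_def by (intro unit_periodic_mult unit_periodic_cnj A unit_periodic_comp[OF A]) auto
    \<comment> \<open>The character of frequency \<open>\<xi>0\<close> is moved into
      \<open>P\<close>, so that the coefficient of the mixed difference at \<open>\<xi>0\<close>
      becomes a correlation of \<open>P\<close> with the conjugate of \<open>H\<close> along the
      second step.\<close>
    define P where "P = (\<lambda>y. cnj (H y) * zchar M (\<xi>0 * y))"
    define K' where "K' = K ^ (774 + 5 * c)"
    have K': "K' \<ge> 2" using self_le_power[of K "774 + 5 * c"] K unfolding K'_def by simp
    have eq: "cnj (P y) * cnj (H (y + t)) = mixed_diff A (bstep b) t y * zchar M (- (\<xi>0 * y))" for y t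
      unfolding P_def H_def mixed_diff_def by (simp add: cnj_zchar add_ac mult_ac)
    have "\<exists>\<xi>. norm (zft M (\<lambda>y. cnj (H y)) \<xi>) \<ge> (of_int N)\<^sup>2 / K' ^ 124"
    proof (rule large_zft_of_box_correlations[OF K' _ M])
      show "K' ^ 40 \<le> of_int N" using N unfolding K'_def by (simp add: mult.commute flip: power_mult)
      show "unit_periodic M P" unfolding P_def by (intro unit_periodic_mult unit_periodic_cnj Hp unit_periodic_zchar M0)
      show "unit_periodic M (\<lambda>y. cnj (H y))" by (intro unit_periodic_cnj Hp)
      have "n ^ 6 / K' \<le> n ^ 6 / (162 * K ^ e)"
        unfolding K'_def e_def using Kp n by (intro divide_left_mono const_le_power[OF K, of _ 8]) auto
      also have "\<dots> \<le> (\<Sum>b'\<in>gbox N. g \<xi>0 (bstep b) (bstep b'))" using b unfolding R_def by simp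
      finally show "(of_int N) ^ 6 / K' \<le> (\<Sum>b'\<in>gbox N. (norm (\<Sum>y\<in>{0..<M}. cnj (P y) * cnj (H (y + bstep b'))))\<^sup>2)"
        unfolding eq g_def zft_def n_def .
    qed
    then obtain \<xi> where "norm (zft M (\<lambda>y. cnj (H y)) \<xi>) \<ge> (of_int N)\<^sup>2 / K' ^ 124" by blast
    then have "norm (zft M H (- \<xi>)) \<ge> n\<^sup>2 / K ^ (124 * (774 + 5 * c))"
      unfolding zft_cnj K'_def n_def by (simp add: mult.commute flip: power_mult)
    then show ?thesis unfolding H_def by blast
  qed
  then have "R \<subseteq> {b\<in>gbox N. \<exists>\<xi>. norm (zft M (\<lambda>y. A y * cnj (A (y + bstep b))) \<xi>) \<ge> n\<^sup>2 / K ^ (124 * (774 + 5 * c))}"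
    unfolding R_def by blast
  then have "card R \<le> card {b\<in>gbox N. \<exists>\<xi>. norm (zft M (\<lambda>y. A y * cnj (A (y + bstep b))) \<xi>) \<ge> n\<^sup>2 / K ^ (124 * (774 + 5 * c))}"
    by (intro card_mono) auto
  then show ?thesis using cR unfolding n_def by linarith
qed

text \<open>After \<open>pet_van_der_corput\<close> the factor \<open>A x k m\<close> is itself a
  difference of \<open>f x\<close>, with step \<open>bstep (k, m)\<close>. For each popular triple
  \<open>(x, k, m)\<close>, \<open>concatenation\<close> with \<open>lf x' = x - x'\<close>
  differences it once more along a second box step. With \<open>c = 75\<close> its exponent is
  \<open>124 * (774 + 5 * 75) = 142476\<close>, which also dominates the loss \<open>K1^1152\<close>
  in the number of triples. The power \<open>K1 = K^35\<close> absorbs the loss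
  \<open>98 * K^28\<close> of the three differencings.\<close>

lemma mixed_differences_of_large_form:
  fixes f0 f1 f :: "int \<Rightarrow> int \<Rightarrow> complex" and N L j s :: int
  assumes K: "K \<ge> 2" and K1: "K1 = K ^ 35" and N: "of_int N \<ge> K1 ^ 142476" and M: "M = 2 * N\<^sup>2"
    and L: "of_int L * K1 ^ 73 \<le> of_int N" "of_int N \<le> of_int L * K1 ^ 75"
    and X: "X \<subseteq> {1..N}" "X \<subseteq> {s..<s+L}" and j: "1 \<le> j" "j \<le> N"
    and f0: "\<And>x. unit_periodic M (f0 x)" and f1: "\<And>x. unit_periodic M (f1 x)" and f: "\<And>x. unit_periodic M (f x)"
    and big: "of_int L * (of_int N) ^ 3 / K \<le> norm (\<Sum>x\<in>X. \<Sum>d\<in>{-j<..<j}. \<Sum>y\<in>{0..<M}. f0 x y * f1 (x + d) y * f x (y + d\<^sup>2))"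
  shows "of_int L * (of_int N) ^ 4 / K1 ^ 142476 \<le> real (card {(x, \<tau>1, \<tau>2)\<in>X \<times> gbox N \<times> gbox N.
     \<exists>\<xi>. (of_int N)\<^sup>2 / K1 ^ 142476 \<le> norm (\<Sum>y\<in>{0..<M}. cnj (f x y) * f x (y + bstep \<tau>1) * f x (y + bstep \<tau>2) * cnj (f x (y + bstep \<tau>1 + bstep \<tau>2)) * zchar M (- (\<xi> * y)))})"
proof -
  define n where "n = real_of_int N"
  define l where "l = real_of_int L"
  have Kp: "K > 0" "K \<ge> 1" using K by auto
  have K12: "K1 \<ge> 2" using self_le_power[of K 35] K unfolding K1 by simp
  have K1p: "K1 > 0" "K1 \<ge> 1" using K12 by auto
  have "0 < K1 ^ 142476" using K1p by simp
  then have n: "n > 0" "n \<ge> K1 ^ 142476" using N unfolding n_def by linarith+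
  have N0: "N > 0" using n n_def by simp
  have M0: "M > 0" using M N0 by simp
  have Mn: "real_of_int M = 2 * n\<^sup>2" using M by (simp add: n_def)
  have l80: "l \<ge> K1 ^ 80"
  proof -
    have "K1 ^ 80 * K1 ^ 75 = K1 ^ 155" by (simp flip: power_add)
    also have "\<dots> \<le> K1 ^ 142476" using K1p by (intro power_increasing) auto
    also have "\<dots> \<le> l * K1 ^ 75" using n L unfolding l_def n_def by linarith
    finally show ?thesis by (rule mult_right_le_imp_le) (use K1p in simp)
  qed
  moreover have "0 < K1 ^ 80" using K1p by simp
  ultimately have l: "l > 0" by linarith
  have finX: "finite X" using X finite_subset by blast
  have cX: "real (card X) \<le> l"
  proof -
    have "card X \<le> card {s..<s+L}" using X by (intro card_mono) auto
    then show ?thesis using l unfolding l_def by simp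
  qed
  define Kr where "Kr = {-(3*N)..3*N}"
  have cKr: "real (card Kr) \<le> 7 * n" using N0 unfolding Kr_def n_def by simp
  define J where "J = (\<lambda>x k m x'. {w. \<bar>w - x\<bar> < j \<and> \<bar>w - x'\<bar> < j \<and> \<bar>w + k - x\<bar> < j \<and> \<bar>w + k - x'\<bar> < j \<and>
            \<bar>w + m - x\<bar> < j \<and> \<bar>w + m - x'\<bar> < j \<and> \<bar>w + m + k - x\<bar> < j \<and> \<bar>w + m + k - x'\<bar> < j})"
  define A where "A = (\<lambda>x k m y. cnj (f x y) * f x (y + 2 * k * m))"
  define B where "B = (\<lambda>x k m x' z. cnj (f x' (z + ((x-x')\<^sup>2 - k\<^sup>2 - 2*(x-x'-k)*x))) * f x' (z + ((x-x')\<^sup>2 - k\<^sup>2 - 2*(x-x'-k)*x) + 2*(x-x')*m))"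
  define C where "C = (\<lambda>x k m x' z. f x' (z + ((k+(x-x'))\<^sup>2 - k\<^sup>2 - 2*(x-x')*x)) * cnj (f x' (z + ((k+(x-x'))\<^sup>2 - k\<^sup>2 - 2*(x-x')*x) + 2*(k+(x-x'))*m)))"
  have fsh: "unit_periodic M (\<lambda>y. f x (y + t))" "unit_periodic M (\<lambda>y. f x (y + t + t'))" for x t t'
    by (rule unit_periodic_comp[OF f], simp)+
  have Ap: "unit_periodic M (A x k m)" for x k m unfolding A_def by (intro unit_periodic_mult unit_periodic_cnj f fsh)
  have Bp: "unit_periodic M (B x k m x')" for x k m x' unfolding B_def by (intro unit_periodic_mult unit_periodic_cnj f fsh)
  have Cp: "unit_periodic M (C x k m x')" for x k m x' unfolding C_def by (intro unit_periodic_mult unit_periodic_cnj f fsh)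
  define T where "T = (\<lambda>x k m. norm (\<Sum>x'\<in>X. \<Sum>w\<in>J x k m x'. \<Sum>y\<in>{0..<M}. A x k m y * B x k m x' (y + 2 * (x - x' - k) * w) * C x k m x' (y + 2 * (x - x') * w)))"
  have Jsub: "J x k m x' \<subseteq> {x-j<..<x+j}" for x k m x' unfolding J_def by auto
  have Jint: "\<exists>a b. J x k m x' = {a..b}" for x k m x'
  proof -
    have i: "{w. \<bar>w - c\<bar> < j} = {c-j+1..c+j-1}" for c by auto
    have "J x k m x' = {w. \<bar>w - x\<bar> < j} \<inter> {w. \<bar>w - x'\<bar> < j} \<inter> {w. \<bar>w - (x - k)\<bar> < j} \<inter> {w. \<bar>w - (x' - k)\<bar> < j}
       \<inter> {w. \<bar>w - (x - m)\<bar> < j} \<inter> {w. \<bar>w - (x' - m)\<bar> < j} \<inter> {w. \<bar>w - (x - m - k)\<bar> < j} \<inter> {w. \<bar>w - (x' - m - k)\<bar> < j}"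
      unfolding J_def by (simp add: algebra_simps Collect_conj_eq Int_assoc)
    then show ?thesis unfolding i Int_atLeastAtMost by blast
  qed
  have JN: "J x k m x' \<subseteq> {-N..2*N}" if "x \<in> X" for x k m x'
    using Jsub[of x k m x'] that X j by fastforce
  have PET: "l\<^sup>2 * n ^ 5 / K ^ 28 \<le> (\<Sum>z\<in>X \<times> Kr \<times> Kr. T (fst z) (fst (snd z)) (snd (snd z)))"
  proof -
    have "l\<^sup>2 * n ^ 5 / K ^ 28 \<le> l\<^sup>2 * n ^ 5 / (720000 * K ^ 8)"
      using n l Kp by (intro divide_left_mono const_le_power[OF K, of _ 20]) auto
    also have "\<dots> \<le> norm (\<Sum>x\<in>X. \<Sum>k\<in>Kr. \<Sum>m\<in>Kr. \<Sum>x'\<in>X. \<Sum>w\<in>J x k m x'. \<Sum>y\<in>{0..<M}. A x k m y * B x k m x' (y + 2 * (x - x' - k) * w) * C x k m x' (y + 2 * (x - x') * w))"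
      using pet_van_der_corput[OF N0 M X(1) cX j Kp(1) l f0 f1 f] big
      unfolding J_def A_def B_def C_def Kr_def n_def l_def by simp
    also have "\<dots> \<le> (\<Sum>x\<in>X. \<Sum>k\<in>Kr. \<Sum>m\<in>Kr. T x k m)"
      unfolding T_def by (intro sum_norm_le order_refl)
    finally show ?thesis by (simp add: sum.cartesian_product')
  qed
  have Tu: "T (fst z) (fst (snd z)) (snd (snd z)) \<le> 4 * l * n ^ 3" for z
  proof -
    define x k m where "x = fst z" and "k = fst (snd z)" and "m = snd (snd z)"
    have cJ: "real (card (J x k m x')) \<le> 2 * n" for x'
    proof -
      have "card (J x k m x') \<le> card {x-j<..<x+j}" by (intro card_mono Jsub) auto
      then show ?thesis using j unfolding n_def by simp
    qed
    have b: "norm (A x k m y * B x k m x' u * C x k m x' v) \<le> 1" for x' y u v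
      unfolding norm_mult by (intro mult_le_one unit_periodic_norm[OF Ap] unit_periodic_norm[OF Bp] unit_periodic_norm[OF Cp]) auto
    have "T x k m \<le> (\<Sum>x'\<in>X. \<Sum>w\<in>J x k m x'. \<Sum>y\<in>{0..<M}. 1)"
      unfolding T_def
      by (intro sum_norm_le b)
    also have "\<dots> = (\<Sum>x'\<in>X. real (card (J x k m x')) * of_int M)" using M0 by simp
    also have "\<dots> \<le> (\<Sum>x'\<in>X. 2 * n * of_int M)" using cJ M0 by (intro sum_mono mult_right_mono) auto
    also have "\<dots> = real (card X) * (2 * n * of_int M)" by simp
    also have "\<dots> \<le> l * (2 * n * of_int M)" using cX n M0 by (intro mult_right_mono) auto
    finally show ?thesis unfolding Mn x_def k_def m_def by (simp add: eval_nat_numeral mult_ac)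
  qed
  define R where "R = {z\<in>X \<times> Kr \<times> Kr. l * n ^ 3 / (98 * K ^ 28) \<le> T (fst z) (fst (snd z)) (snd (snd z))}"
  have "l\<^sup>2 * n ^ 5 / K ^ 28 / 2 \<le> 4 * l * n ^ 3 * real (card R)"
    unfolding R_def
  proof (rule card_large_terms[OF _ Tu _ _ _ PET])
    have "real (card (X \<times> Kr \<times> Kr)) \<le> l * ((7 * n) * (7 * n))"
      unfolding card_cartesian_product of_nat_mult using cX cKr l n by (intro mult_mono) auto
    then have "2 * (l * n ^ 3 / (98 * K ^ 28)) * real (card (X \<times> Kr \<times> Kr)) \<le> 2 * (l * n ^ 3 / (98 * K ^ 28)) * (l * ((7 * n) * (7 * n)))"
      using l n Kp by (intro mult_left_mono) auto
    also have "\<dots> = l\<^sup>2 * n ^ 5 / K ^ 28" using Kp by (simp add: eval_nat_numeral)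
    finally show "2 * (l * n ^ 3 / (98 * K ^ 28)) * real (card (X \<times> Kr \<times> Kr)) \<le> l\<^sup>2 * n ^ 5 / K ^ 28" .
  qed (use finX l n Kp in \<open>auto simp: Kr_def\<close>)
  also have "l\<^sup>2 * n ^ 5 / K ^ 28 / 2 = 4 * l * n ^ 3 * (l * n\<^sup>2 / (8 * K ^ 28))" using Kp by (simp add: eval_nat_numeral)
  finally have "l * n\<^sup>2 / (8 * K ^ 28) \<le> real (card R)" by (rule mult_left_le_imp_le) (use l n in simp)
  moreover have "l * n\<^sup>2 / K1 \<le> l * n\<^sup>2 / (8 * K ^ 28)"
    unfolding K1 using Kp n l by (intro divide_left_mono const_le_power[OF K, of _ 3]) auto
  ultimately have cR: "l * n\<^sup>2 / K1 \<le> real (card R)" by linarith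
  define H where "H = (\<lambda>x \<tau>1 \<tau>2 y. cnj (f x y) * f x (y + bstep \<tau>1) * f x (y + bstep \<tau>2) * cnj (f x (y + bstep \<tau>1 + bstep \<tau>2)))"
  define \<theta> where "\<theta> = n\<^sup>2 / K1 ^ 142476"
  define S where "S = (\<lambda>x \<tau>1. {\<tau>2\<in>gbox N. \<exists>\<xi>. \<theta> \<le> norm (\<Sum>y\<in>{0..<M}. H x \<tau>1 \<tau>2 y * zchar M (- (\<xi> * y)))})"
  have cS: "n\<^sup>2 / K1 ^ 1151 \<le> real (card (S x (k, m)))" if z: "(x, k, m) \<in> R" for x k m
  proof -
    have x: "x \<in> X" and k: "k \<in> {-(3*N)..3*N}" using z unfolding R_def Kr_def by auto
    have "card {b\<in>gbox N. \<exists>\<xi>. norm (zft M (\<lambda>y. A x k m y * cnj (A x k m (y + bstep b))) \<xi>) \<ge> n\<^sup>2 / K1 ^ (124 * (774 + 5 * 75))} \<le> card (S x (k, m))"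
    proof (rule card_mono)
      have "A x k m y * cnj (A x k m (y + bstep b)) = H x (k, m) b y" for b y
        unfolding A_def H_def bstep_def by (simp add: add_ac mult_ac)
      then show "{b\<in>gbox N. \<exists>\<xi>. norm (zft M (\<lambda>y. A x k m y * cnj (A x k m (y + bstep b))) \<xi>) \<ge> n\<^sup>2 / K1 ^ (124 * (774 + 5 * 75))} \<subseteq> S x (k, m)"
        unfolding S_def zft_def \<theta>_def by auto
    qed (simp add: S_def)
    moreover have "n\<^sup>2 / K1 ^ (776 + 5 * 75) \<le> real (card {b\<in>gbox N. \<exists>\<xi>. norm (zft M (\<lambda>y. A x k m y * cnj (A x k m (y + bstep b))) \<xi>) \<ge> n\<^sup>2 / K1 ^ (124 * (774 + 5 * 75))})"
      unfolding n_def
    proof (rule concatenation[OF K12 _ M _ _ _ finX _ _ _ k, where lf = "\<lambda>x'. x - x'" and J = "J x k m" and B = "B x k m" and C = "C x k m" and L = L])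
      have "K1 ^ (40 * (774 + 5 * 75)) \<le> K1 ^ 142476" using K1p by (intro power_increasing) auto
      then show "K1 ^ (40 * (774 + 5 * 75)) \<le> of_int N" using N by linarith
      show "(\<lambda>x'. x - x') ` X \<subseteq> {-L..L}"
      proof
        fix u assume "u \<in> (\<lambda>x'. x - x') ` X"
        then obtain x' where "x' \<in> X" "u = x - x'" by blast
        moreover have "x \<in> {s..<s+L}" "x' \<in> {s..<s+L}" using X(2) x \<open>x' \<in> X\<close> by blast+
        ultimately show "u \<in> {-L..L}" by auto
      qed
      have "l * n ^ 3 / K1 \<le> l * n ^ 3 / (98 * K ^ 28)"
        unfolding K1 using Kp n l by (intro divide_left_mono const_le_power[OF K, of _ 7]) auto
      then show "of_int L * (of_int N) ^ 3 / K1 \<le> norm (\<Sum>x'\<in>X. \<Sum>w\<in>J x k m x'. \<Sum>y\<in>{0..<M}. A x k m y * B x k m x' (y + 2 * (x - x' - k) * w) * C x k m x' (y + 2 * (x - x') * w))"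
        using z unfolding R_def T_def l_def n_def by auto
    qed (use L l80 cX Jint JN[OF x] Ap Bp Cp in \<open>auto simp: l_def inj_on_def\<close>)
    ultimately show ?thesis by simp
  qed
  define Big where "Big = {(x, \<tau>1, \<tau>2)\<in>X \<times> gbox N \<times> gbox N. \<exists>\<xi>. \<theta> \<le> norm (\<Sum>y\<in>{0..<M}. H x \<tau>1 \<tau>2 y * zchar M (- (\<xi> * y)))}"
  have finBig: "finite Big" by (rule finite_subset[of _ "X \<times> gbox N \<times> gbox N"]) (use finX in \<open>auto simp: Big_def\<close>)
  have finR: "finite R" unfolding R_def using finX by (simp add: Kr_def)
  have "(\<lambda>(z, \<tau>2). (fst z, (fst (snd z), snd (snd z)), \<tau>2)) ` Sigma R (\<lambda>z. S (fst z) (snd z)) \<subseteq> Big"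
    using N0 unfolding Big_def R_def S_def Kr_def gbox_def by auto
  moreover have "inj_on (\<lambda>(z, \<tau>2). (fst z, (fst (snd z), snd (snd z)), \<tau>2)) (Sigma R (\<lambda>z. S (fst z) (snd z)))"
    by (auto simp: inj_on_def prod_eq_iff)
  ultimately have "card (Sigma R (\<lambda>z. S (fst z) (snd z))) \<le> card Big"
    using finBig by (intro card_inj_on_le)
  moreover have "real (card (Sigma R (\<lambda>z. S (fst z) (snd z)))) = (\<Sum>z\<in>R. real (card (S (fst z) (snd z))))"
    using finR by (simp add: S_def)
  moreover have "(\<Sum>z\<in>R. real (card (S (fst z) (snd z)))) \<ge> (\<Sum>z\<in>R. n\<^sup>2 / K1 ^ 1151)"
    using cS by (intro sum_mono) auto
  moreover have "(\<Sum>z\<in>R. n\<^sup>2 / K1 ^ 1151) = real (card R) * (n\<^sup>2 / K1 ^ 1151)" by simp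
  moreover have "real (card R) * (n\<^sup>2 / K1 ^ 1151) \<ge> l * n\<^sup>2 / K1 * (n\<^sup>2 / K1 ^ 1151)"
    using cR K1p by (intro mult_right_mono) auto
  moreover have "l * n\<^sup>2 / K1 * (n\<^sup>2 / K1 ^ 1151) = l * n ^ 4 / K1 ^ 1152"
  proof -
    have "K1 ^ 1152 = K1 * K1 ^ 1151" by (simp flip: power_Suc)
    then show ?thesis by (simp add: eval_nat_numeral(2,3) power_add[of n 2 2, simplified])
  qed
  moreover have "l * n ^ 4 / K1 ^ 142476 \<le> l * n ^ 4 / K1 ^ 1152"
    using K1p l n by (intro divide_left_mono power_increasing) auto
  ultimately have "l * n ^ 4 / K1 ^ 142476 \<le> real (card Big)" by linarith
  then show ?thesis unfolding Big_def H_def \<theta>_def l_def n_def .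
qed

section \<open>Phase sums and alignment of phases\<close>

lemma major_minus [simp]: "major Q N (- t) = major Q N t"
  by (simp add: major_def)

text \<open>The points with a nonzero weight and a major frequency are bounded trivially, each by
  \<open>4 * N^3\<close>. On the other points, for each fixed \<open>y\<close>, a large sum over
  \<open>x\<close> and \<open>d\<close> would by \<open>major_of_large_phase_sum\<close> exhibit a
  major frequency among them. A lower bound for such a phase sum therefore counts major
  frequencies.\<close>

lemma phase_sum_le_major_count:
  fixes N L j s :: int and g0 g1 :: "int \<Rightarrow> int \<Rightarrow> complex" and \<theta> :: "int \<Rightarrow> int" and W :: "int \<Rightarrow> complex"
  assumes K: "K \<ge> 2" and N: "of_int N \<ge> K ^ 300" and L: "1 \<le> L" "L \<le> N" "of_int N \<le> of_int L * K"
    and j: "1 \<le> j" "j \<le> N" and X: "X \<subseteq> {s..<s+L}" and M: "M = 2 * N\<^sup>2"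
    and g0: "\<And>x. unit_periodic M (g0 x)" and g1: "\<And>x. unit_periodic M (g1 x)" and W: "\<And>x. norm (W x) \<le> 1"
  shows "norm (\<Sum>x\<in>X. \<Sum>d\<in>{-j<..<j}. \<Sum>y\<in>{0..<M}. W x * (g0 x (y - d\<^sup>2) * g1 (x + d) (y - d\<^sup>2) * zchar M (- (\<theta> x * y))))
    \<le> 2 * of_int L * (of_int N) ^ 3 / K + 4 * (of_int N) ^ 3 * real (card {x\<in>X. W x \<noteq> 0 \<and> major (K ^ 400) N (of_int (\<theta> x) / of_int M)})"
proof -
  define n where "n = real_of_int N"
  have "0 < K ^ 300" using K by simp
  then have n: "n > 0" using N unfolding n_def by linarith
  have N0: "N > 0" using n n_def by simp
  have M0: "M > 0" using M N0 by simp
  have Mn: "real_of_int M = 2 * n\<^sup>2" using M by (simp add: n_def)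
  have finX: "finite X" using X finite_subset by blast
  define X1 where "X1 = {x\<in>X. W x \<noteq> 0 \<and> major (K ^ 400) N (of_int (\<theta> x) / of_int M)}"
  define X3 where "X3 = {x\<in>X. W x \<noteq> 0 \<and> \<not> major (K ^ 400) N (of_int (\<theta> x) / of_int M)}"
  define t where "t = (\<lambda>x d y. W x * (g0 x (y - d\<^sup>2) * g1 (x + d) (y - d\<^sup>2) * zchar M (- (\<theta> x * y))))"
  have "(\<Sum>x\<in>X. \<Sum>d\<in>{-j<..<j}. \<Sum>y\<in>{0..<M}. t x d y) = (\<Sum>x\<in>X1 \<union> X3. \<Sum>d\<in>{-j<..<j}. \<Sum>y\<in>{0..<M}. t x d y)"
    by (rule sum.mono_neutral_right[OF finX]) (auto simp: X1_def X3_def t_def)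
  also have "\<dots> = (\<Sum>x\<in>X1. \<Sum>d\<in>{-j<..<j}. \<Sum>y\<in>{0..<M}. t x d y) + (\<Sum>x\<in>X3. \<Sum>d\<in>{-j<..<j}. \<Sum>y\<in>{0..<M}. t x d y)"
    using finX by (intro sum.union_disjoint) (auto simp: X1_def X3_def)
  finally have split: "norm (\<Sum>x\<in>X. \<Sum>d\<in>{-j<..<j}. \<Sum>y\<in>{0..<M}. t x d y) \<le>
      norm (\<Sum>x\<in>X1. \<Sum>d\<in>{-j<..<j}. \<Sum>y\<in>{0..<M}. t x d y) + norm (\<Sum>x\<in>X3. \<Sum>d\<in>{-j<..<j}. \<Sum>y\<in>{0..<M}. t x d y)"
    by (simp add: norm_triangle_ineq)
  have tb: "norm (t x d y) \<le> 1" for x d y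
    unfolding t_def using W[of x] unit_periodic_norm[OF g0, of x "y - d\<^sup>2"] unit_periodic_norm[OF g1, of "x + d" "y - d\<^sup>2"]
    by (simp add: norm_mult mult_le_one)
  have p1: "norm (\<Sum>x\<in>X1. \<Sum>d\<in>{-j<..<j}. \<Sum>y\<in>{0..<M}. t x d y) \<le> 4 * n ^ 3 * real (card X1)"
  proof -
    have "norm (\<Sum>x\<in>X1. \<Sum>d\<in>{-j<..<j}. \<Sum>y\<in>{0..<M}. t x d y) \<le> (\<Sum>x\<in>X1. \<Sum>d\<in>{-j<..<j}. \<Sum>y\<in>{0..<M}. 1)"
      by (intro sum_norm_le tb)
    also have "\<dots> = real (card X1) * (real (card {-j<..<j}) * of_int M)" using M0 by simp
    also have "\<dots> \<le> real (card X1) * (2 * n * of_int M)"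
      using j M0 unfolding n_def by (intro mult_left_mono mult_right_mono) auto
    finally show ?thesis unfolding Mn by (simp add: eval_nat_numeral mult_ac)
  qed
  have p3: "norm (\<Sum>x\<in>X3. \<Sum>d\<in>{-j<..<j}. \<Sum>y\<in>{0..<M}. t x d y) \<le> 2 * of_int L * n ^ 3 / K"
  proof -
    define h0 where "h0 = (\<lambda>y x. W x * g0 x y * zchar M (- (\<theta> x * y)))"
    \<comment> \<open>Translating \<open>y\<close> by \<open>d^2\<close> turns the linear phase in
      \<open>y\<close> into a quadratic phase in \<open>d\<close>, while \<open>g0\<close> and
      \<open>g1\<close> lose their shift.\<close>
    have sh: "(\<Sum>y\<in>{0..<M}. t x d y) = (\<Sum>y\<in>{0..<M}. h0 y x * g1 (x + d) y * add_char (- (of_int (\<theta> x) / of_int M) * (of_int d)\<^sup>2))" for x d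
    proof -
      have z: "unit_periodic M (\<lambda>y. zchar M (- (\<theta> x * y)))"
        using unit_periodic_zchar[OF M0, of "- \<theta> x"] by simp
      have "unit_periodic M (t x d)"
        unfolding t_def using W[of x]
        by (intro unit_periodic_mult unit_periodic_const z unit_periodic_comp[OF g0] unit_periodic_comp[OF g1]) auto
      from unit_periodic_sum_shift[OF this M0, of "d\<^sup>2"]
      have "(\<Sum>y\<in>{0..<M}. t x d y) = (\<Sum>y\<in>{0..<M}. t x d (y + d\<^sup>2))" by simp
      also have "\<dots> = (\<Sum>y\<in>{0..<M}. h0 y x * g1 (x + d) y * add_char (- (of_int (\<theta> x) / of_int M) * (of_int d)\<^sup>2))"
      proof (rule sum.cong[OF refl])
        fix y
        have "- (\<theta> x * (y + d\<^sup>2)) = - (\<theta> x * y) + - (\<theta> x * d\<^sup>2)" by (simp add: algebra_simps)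
        moreover have "zchar M (- (\<theta> x * d\<^sup>2)) = add_char (- (of_int (\<theta> x) / of_int M) * (of_int d)\<^sup>2)"
          unfolding zchar_def by simp
        ultimately have "zchar M (- (\<theta> x * (y + d\<^sup>2))) = zchar M (- (\<theta> x * y)) * add_char (- (of_int (\<theta> x) / of_int M) * (of_int d)\<^sup>2)"
          by (simp only: zchar_add)
        then show "t x d (y + d\<^sup>2) = h0 y x * g1 (x + d) y * add_char (- (of_int (\<theta> x) / of_int M) * (of_int d)\<^sup>2)"
          unfolding t_def h0_def by (simp only: add_diff_cancel mult_ac)
      qed
      finally show ?thesis .
    qed
    have "(\<Sum>x\<in>X3. \<Sum>d\<in>{-j<..<j}. \<Sum>y\<in>{0..<M}. t x d y)
       = (\<Sum>y\<in>{0..<M}. \<Sum>x\<in>X3. \<Sum>d\<in>{-j<..<j}. h0 y x * g1 (x + d) y * add_char (- (of_int (\<theta> x) / of_int M) * (of_int d)\<^sup>2))"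
      unfolding sh by (rule sum_swap3[symmetric])
    also have "norm \<dots> \<le> (\<Sum>y\<in>{0..<M}. of_int L * n / K)"
    proof (rule sum_norm_le)
      fix y
      show "norm (\<Sum>x\<in>X3. \<Sum>d\<in>{-j<..<j}. h0 y x * g1 (x + d) y * add_char (- (of_int (\<theta> x) / of_int M) * (of_int d)\<^sup>2)) \<le> of_int L * n / K"
      proof (rule ccontr)
        assume "\<not> ?thesis"
        then have "of_int L * of_int N / K \<le> norm (\<Sum>x\<in>X3. \<Sum>d\<in>{-j<..<j}. h0 y x * g1 (x + d) y * add_char (- (of_int (\<theta> x) / of_int M) * (of_int d)\<^sup>2))"
          unfolding n_def by simp
        moreover have "norm (h0 y x) \<le> 1" for x
          unfolding h0_def using W[of x] unit_periodic_norm[OF g0, of x y] by (simp add: norm_mult mult_le_one)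
        moreover have "X3 \<subseteq> {s..<s+L}" using X unfolding X3_def by auto
        ultimately have "\<exists>x\<in>X3. major (K ^ 400) N (- (of_int (\<theta> x) / of_int M))"
          using major_of_large_phase_sum[OF K N L j, of X3 s "h0 y" "\<lambda>x. g1 x y" "\<lambda>x. - (of_int (\<theta> x) / of_int M)"]
            unit_periodic_norm[OF g1] by blast
        then show False unfolding X3_def by auto
      qed
    qed
    also have "\<dots> = of_int M * (of_int L * n / K)" using M0 by simp
    finally show ?thesis unfolding Mn by (simp add: eval_nat_numeral mult_ac)
  qed
  show ?thesis using split p1 p3 unfolding X1_def t_def n_def by linarith
qed

lemma unimodular_align: "\<exists>w. norm w \<le> 1 \<and> w * z = complex_of_real (norm z)"
proof (cases "z = 0")
  case False
  have "cnj z / of_real (norm z) * z = complex_of_real (norm z)"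
    using False complex_norm_square[of z] by (simp add: field_simps power2_eq_square)
  then show ?thesis using False by (intro exI[of _ "cnj z / of_real (norm z)"]) (simp add: norm_divide)
qed (auto intro: exI[of _ 0])

section \<open>Dual functions and degree lowering\<close>

lemma exists_ge_mean:
  fixes E :: "'a \<Rightarrow> real"
  assumes "finite A" "A \<noteq> {}"
  shows "\<exists>i\<in>A. (\<Sum>i\<in>A. E i) \<le> real (card A) * E i"
proof -
  obtain i where i: "i \<in> A" "\<And>j. j \<in> A \<Longrightarrow> E j \<le> E i"
    using assms ex_is_arg_min_if_finite[of A "\<lambda>i. - E i"] by (force simp: is_arg_min_linorder)
  then show ?thesis using sum_bounded_above[of A E "E i"] by auto
qed

lemma real_card_eq_sum: "finite A \<Longrightarrow> real (card {z\<in>A. P z}) = (\<Sum>z\<in>A. of_bool (P z))"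
  by (simp add: of_bool_def sum.If_cases Int_def)

text \<open>The average over \<open>a\<close> is taken separately for each \<open>x\<close>, so the
  chosen element \<open>\<sigma> x\<close> depends on \<open>x\<close>. Later the frequencies may
  vary with \<open>x\<close>, and no uniform choice would be available.\<close>

lemma choose_slice:
  assumes "finite X" "finite A" "finite B" "A \<noteq> {}"
  shows "\<exists>\<sigma>. (\<forall>x. \<sigma> x \<in> A) \<and> real (card {(x, a, b)\<in>X \<times> A \<times> B. P x a b})
     \<le> real (card A) * real (card {(x, b)\<in>X \<times> B. P x (\<sigma> x) b})"
proof -
  have "\<exists>a\<in>A. (\<Sum>a\<in>A. \<Sum>b\<in>B. of_bool (P x a b)) \<le> real (card A) * (\<Sum>b\<in>B. of_bool (P x a b))" for x
    using assms by (intro exists_ge_mean)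
  then obtain \<sigma> where \<sigma>: "\<And>x. \<sigma> x \<in> A" "\<And>x. (\<Sum>a\<in>A. \<Sum>b\<in>B. of_bool (P x a b)) \<le> real (card A) * (\<Sum>b\<in>B. of_bool (P x (\<sigma> x) b))"
    by metis
  have e: "{(x, a, b)\<in>X \<times> A \<times> B. P x a b} = {z\<in>X \<times> A \<times> B. P (fst z) (fst (snd z)) (snd (snd z))}"
    "{(x, b)\<in>X \<times> B. P x (\<sigma> x) b} = {z\<in>X \<times> B. P (fst z) (\<sigma> (fst z)) (snd z)}" by auto
  have "real (card {(x, a, b)\<in>X \<times> A \<times> B. P x a b}) = (\<Sum>x\<in>X. \<Sum>a\<in>A. \<Sum>b\<in>B. of_bool (P x a b))"
    unfolding e using assms by (subst real_card_eq_sum) (auto simp: sum.cartesian_product')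
  also have "\<dots> \<le> (\<Sum>x\<in>X. real (card A) * (\<Sum>b\<in>B. of_bool (P x (\<sigma> x) b)))" using \<sigma>(2) by (rule sum_mono)
  also have "\<dots> = real (card A) * real (card {(x, b)\<in>X \<times> B. P x (\<sigma> x) b})"
    unfolding e using assms by (subst real_card_eq_sum) (auto simp: sum.cartesian_product' sum_distrib_left)
  finally show ?thesis using \<sigma>(1) by blast
qed

lemma half_absorb:
  fixes z r t u v :: real
  shows "z \<le> r \<Longrightarrow> r \<le> t \<Longrightarrow> t = u + v \<Longrightarrow> u \<le> z / 2 \<Longrightarrow> z / 2 \<le> v"
  by linarith

lemma major_mod:
  assumes "M > 0"
  shows "major Q N (of_int (a mod M) / of_int M) = major Q N (of_int a / of_int M)"
proof -
  have "real_of_int a = of_int (a mod M) + of_int (a div M) * of_int M"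
    using mod_mult_div_eq[of a M] by (metis add.commute mult.commute of_int_add of_int_mult)
  then have e: "of_int a / real_of_int M = of_int (a mod M) / of_int M + of_int (a div M)"
    using assms by (simp add: field_simps)
  have "of_int q * (of_int a / real_of_int M) = of_int q * (of_int (a mod M) / of_int M) + of_int (q * (a div M))" for q
    unfolding e by (simp add: distrib_left)
  then have "dist_circle (of_int q * (of_int a / real_of_int M)) = dist_circle (of_int q * (of_int (a mod M) / of_int M))" for q
    by (simp only: dist_circle_add_int)
  then show ?thesis unfolding major_def by simp
qed

lemma zchar_dvd_cong:
  assumes "M > 0" "M dvd a - b"
  shows "zchar M a = zchar M b"
proof -
  have "zchar M a = zchar M (a - b) * zchar M b" by (simp flip: zchar_add)
  then show ?thesis using assms by (simp add: zchar_eq_1_iff)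
qed

text \<open>The block \<open>X\<close> and its length \<open>L\<close> are parameters because the
  setup is used twice with the same \<open>f0\<close>, \<open>f1\<close>: for the whole interval,
  where \<open>f2\<close> is exchanged for the dual function, and for a short block, where the
  degree is lowered. The functions \<open>G\<close> and \<open>F\<close> do not depend on the block,
  so the two uses share them.\<close>

locale dual_setup =
  fixes N L j s M :: int and X :: "int set" and f0 f1 :: "int \<Rightarrow> int \<Rightarrow> complex"
  assumes N0: "N > 0" and M: "M = 2 * N\<^sup>2" and L: "1 \<le> L" "L \<le> N" and j: "1 \<le> j" "j \<le> N"
    and X: "X \<subseteq> {s..<s+L}"
    and f0: "\<And>x. unit_periodic M (f0 x)" and f1: "\<And>x. unit_periodic M (f1 x)"
begin

definition G :: "int \<Rightarrow> int \<Rightarrow> int \<Rightarrow> complex" where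
  "G d x y = f0 x (y - d\<^sup>2) * f1 (x + d) (y - d\<^sup>2)"

text \<open>The dual function, divided by \<open>2 * N\<close> rather than by the number
  \<open>2 * j - 1\<close> of summands: it stays 1-bounded and the factor in \<open>F_expand\<close>
  is the same for all \<open>j\<close>.\<close>

definition F :: "int \<Rightarrow> int \<Rightarrow> complex" where
  "F x y = (\<Sum>d\<in>{-j<..<j}. G d x y) / (2 * of_int N)"

abbreviation "n \<equiv> real_of_int N"
abbreviation "l \<equiv> real_of_int L"

lemma n0: "n > 0" "l > 0" "l \<le> n" using N0 L by auto

lemma M0: "M > 0" using M N0 by simp

lemma Mn: "real_of_int M = 2 * n\<^sup>2" using M by simp

lemma finX: "finite X" using X finite_subset by blast

lemma cX: "real (card X) \<le> l"
proof -
  have "card X \<le> card {s..<s+L}" using X by (intro card_mono) auto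
  then show ?thesis using L by simp
qed

lemma cI: "real (card {-j<..<j}) \<le> 2 * n" using j by simp

lemma cg: "real (card (gbox N)) \<le> 81 * n\<^sup>2" using card_gbox_le[OF N0] .

lemma Gp: "unit_periodic M (G d x)"
  unfolding G_def[abs_def] by (intro unit_periodic_mult unit_periodic_comp[OF f0] unit_periodic_comp[OF f1]) auto

lemma Gsh: "unit_periodic M (\<lambda>y. G d x (y + t))" "unit_periodic M (\<lambda>y. G d x (y + t + t'))"
  by (rule unit_periodic_comp[OF Gp], simp)+

lemma Fp: "unit_periodic M (F x)"
proof (rule unit_periodicI)
  fix y
  have "norm (\<Sum>d\<in>{-j<..<j}. G d x y) \<le> real (card {-j<..<j}) * 1"
    using unit_periodic_norm[OF Gp] by (intro sum_norm_bound) auto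
  then have "norm (\<Sum>d\<in>{-j<..<j}. G d x y) \<le> 2 * n" using cI by linarith
  then show "norm (F x y) \<le> 1" unfolding F_def using n0 by (simp add: norm_divide)
  show "F x (y + M) = F x y" unfolding F_def using unit_periodic_add[OF Gp] by simp
qed

lemma Fsh: "unit_periodic M (\<lambda>y. F x (y + t))" "unit_periodic M (\<lambda>y. F x (y + t + t'))"
  by (rule unit_periodic_comp[OF Fp], simp)+

lemma F_expand: "2 * of_int N * F x y = (\<Sum>d\<in>{-j<..<j}. G d x y)"
  unfolding F_def using N0 by simp

lemma zch: "unit_periodic M (\<lambda>y. zchar M (- (k * y)))"
  using unit_periodic_zchar[OF M0, of "- k"] by simp

text \<open>A product of shifts of \<open>G d x\<close> splits into the same product for
  \<open>f0 x\<close> and for \<open>f1 (x + d)\<close>, both evaluated at \<open>y - d^2\<close>.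
  It thus has the shape treated by \<open>phase_sum_le_major_count\<close>, with new periodic
  functions.\<close>

lemma phase_sum_G4:
  assumes K: "K \<ge> 2" and N: "n \<ge> K ^ 300" "n \<le> l * K" and W: "\<And>x. norm (W x) \<le> 1"
  shows "norm (\<Sum>x\<in>X. \<Sum>d\<in>{-j<..<j}. \<Sum>y\<in>{0..<M}. W x * (G d x (y + a) * cnj (G d x (y + b)) * cnj (G d x (y + a')) * G d x (y + b')) * zchar M (- (\<theta> x * y)))
    \<le> 2 * l * n ^ 3 / K + 4 * n ^ 3 * real (card {x\<in>X. W x \<noteq> 0 \<and> major (K ^ 400) N (of_int (\<theta> x) / of_int M)})"
proof -
  define g :: "(int \<Rightarrow> int \<Rightarrow> complex) \<Rightarrow> int \<Rightarrow> int \<Rightarrow> complex" where "g = (\<lambda>f x y. f x (y + a) * cnj (f x (y + b)) * cnj (f x (y + a')) * (f x (y + b') :: complex))"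
  have gp: "unit_periodic M (g f x)" if "\<And>x. unit_periodic M (f x)" for f :: "int \<Rightarrow> int \<Rightarrow> complex" and x
    unfolding g_def using that by (intro unit_periodic_mult unit_periodic_cnj unit_periodic_comp[OF that]) auto
  have e: "W x * (G d x (y + a) * cnj (G d x (y + b)) * cnj (G d x (y + a')) * G d x (y + b')) * zchar M (- (\<theta> x * y))
     = W x * (g f0 x (y - d\<^sup>2) * g f1 (x + d) (y - d\<^sup>2) * zchar M (- (\<theta> x * y)))" for x d y
  proof -
    have "y + t - d\<^sup>2 = y - d\<^sup>2 + t" for t by simp
    then show ?thesis unfolding g_def G_def complex_cnj_mult by (simp only: mult_ac)
  qed
  have gp0: "unit_periodic M (g f0 x)" and gp1: "unit_periodic M (g f1 x)" for x
    using f0 f1 by (auto intro: gp)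
  show ?thesis unfolding e
    by (rule phase_sum_le_major_count[OF K N(1) L N(2) j X M gp0 gp1 W])
qed

lemma phase_sum_G2:
  assumes K: "K \<ge> 2" and N: "n \<ge> K ^ 300" "n \<le> l * K" and W: "\<And>x. norm (W x) \<le> 1"
  shows "norm (\<Sum>x\<in>X. \<Sum>d\<in>{-j<..<j}. \<Sum>y\<in>{0..<M}. W x * (G d x (y + a) * cnj (G d x (y + b))) * zchar M (- (\<theta> x * y)))
    \<le> 2 * l * n ^ 3 / K + 4 * n ^ 3 * real (card {x\<in>X. W x \<noteq> 0 \<and> major (K ^ 400) N (of_int (\<theta> x) / of_int M)})"
proof -
  define g :: "(int \<Rightarrow> int \<Rightarrow> complex) \<Rightarrow> int \<Rightarrow> int \<Rightarrow> complex" where "g = (\<lambda>f x y. f x (y + a) * cnj (f x (y + b) :: complex))"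
  have gp: "unit_periodic M (g f x)" if "\<And>x. unit_periodic M (f x)" for f :: "int \<Rightarrow> int \<Rightarrow> complex" and x
    unfolding g_def using that by (intro unit_periodic_mult unit_periodic_cnj unit_periodic_comp[OF that]) auto
  have e: "W x * (G d x (y + a) * cnj (G d x (y + b))) * zchar M (- (\<theta> x * y))
     = W x * (g f0 x (y - d\<^sup>2) * g f1 (x + d) (y - d\<^sup>2) * zchar M (- (\<theta> x * y)))" for x d y
  proof -
    have "y + t - d\<^sup>2 = y - d\<^sup>2 + t" for t by simp
    then show ?thesis unfolding g_def G_def complex_cnj_mult by (simp only: mult_ac)
  qed
  have gp0: "unit_periodic M (g f0 x)" and gp1: "unit_periodic M (g f1 x)" for x
    using f0 f1 by (auto intro: gp)
  show ?thesis unfolding e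
    by (rule phase_sum_le_major_count[OF K N(1) L N(2) j X M gp0 gp1 W])
qed

text \<open>Both Cauchy--Schwarz steps keep \<open>d\<close> outside, so that the four copies of the dual
  function collapse to a single configuration weighted by the mixed second difference of \<open>\<phi>\<close>.\<close>

lemma dual_interchange:
  assumes K: "K \<ge> 2" and K': "K' = K ^ 64" and N: "n \<ge> K' ^ 300" "n \<le> l * K'"
    and E: "E \<subseteq> X \<times> gbox N \<times> gbox N" "l * n ^ 4 / K \<le> real (card E)"
    and big: "\<And>x \<tau>1 \<tau>2. (x, \<tau>1, \<tau>2) \<in> E \<Longrightarrow> n\<^sup>2 / K \<le> norm (\<Sum>y\<in>{0..<M}. F x y * cnj (F x (y + bstep \<tau>1)) * cnj (F x (y + bstep \<tau>2)) * F x (y + bstep \<tau>1 + bstep \<tau>2) * zchar M (- (\<phi> x \<tau>1 \<tau>2 * y)))"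
  shows "l * n ^ 8 / K ^ 39 \<le> real (card {(x, (\<tau>1', \<tau>2'), (\<tau>1, \<tau>2))\<in>X \<times> (gbox N \<times> gbox N) \<times> (gbox N \<times> gbox N).
     (x, \<tau>1, \<tau>2) \<in> E \<and> major (K' ^ 400) N (of_int (\<phi> x \<tau>1 \<tau>2 - \<phi> x \<tau>1' \<tau>2 - \<phi> x \<tau>1 \<tau>2' + \<phi> x \<tau>1' \<tau>2') / of_int M)})"
proof -
  have Kp: "K > 0" "K \<ge> 1" using K by auto
  define B where "B = gbox N"
  have finB: "finite B" unfolding B_def by simp
  have cB: "real (card B) \<le> 81 * n\<^sup>2" unfolding B_def by (rule cg)
  define I where "I = {-j<..<j}"
  define Z where "Z = (\<lambda>x \<tau>1 \<tau>2. \<Sum>y\<in>{0..<M}. F x y * cnj (F x (y + bstep \<tau>1)) * cnj (F x (y + bstep \<tau>2)) * F x (y + bstep \<tau>1 + bstep \<tau>2) * zchar M (- (\<phi> x \<tau>1 \<tau>2 * y)))"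
  obtain al where al: "norm (al z) \<le> 1" "al z * z = complex_of_real (norm z)" for z
    using unimodular_align by metis
  define w0 where "w0 = (\<lambda>x \<tau>1 \<tau>2. al (Z x \<tau>1 \<tau>2))"
  have w0: "norm (w0 x \<tau>1 \<tau>2) \<le> 1" "w0 x \<tau>1 \<tau>2 * Z x \<tau>1 \<tau>2 = complex_of_real (norm (Z x \<tau>1 \<tau>2))" for x \<tau>1 \<tau>2
    unfolding w0_def using al by auto
  \<comment> \<open>The weights vanish off \<open>E\<close>, so a nonvanishing product of weights
    still records membership in \<open>E\<close> after the doublings; the conclusion needs
    this.\<close>
  define w where "w = (\<lambda>x \<tau>1 \<tau>2. if (x, \<tau>1, \<tau>2) \<in> E then w0 x \<tau>1 \<tau>2 else 0)"
  have w1: "norm (w x \<tau>1 \<tau>2) \<le> 1" for x \<tau>1 \<tau>2 unfolding w_def using w0 by simp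
  have ww: "norm (w x a b * cnj (w x a' b')) \<le> 1" for x a b a' b'
    by (simp add: norm_mult mult_le_one w1)
  \<comment> \<open>Only the factor of the dual function that carries both steps is opened. The
    factors without \<open>\<tau>1\<close> form \<open>u1\<close> and disappear first; those without
    \<open>\<tau>2\<close> form \<open>u2\<close> below and disappear next.\<close>
  define u1 where "u1 = (\<lambda>(x, \<tau>2, d::int) y. F x y * cnj (F x (y + bstep \<tau>2)))"
  define v1 where "v1 = (\<lambda>(x, \<tau>2, d) \<tau>1 y. w x \<tau>1 \<tau>2 * cnj (F x (y + bstep \<tau>1)) * G d x (y + bstep \<tau>1 + bstep \<tau>2) * zchar M (- (\<phi> x \<tau>1 \<tau>2 * y)))"
  define P1 where "P1 = X \<times> B \<times> I"
  have u1p: "unit_periodic M (u1 p)" for p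
    unfolding u1_def by (cases p) (auto intro!: unit_periodic_mult unit_periodic_cnj Fp Fsh)
  have v1p: "unit_periodic M (v1 p \<tau>)" for p \<tau>
    unfolding v1_def by (cases p) (auto intro!: unit_periodic_mult unit_periodic_cnj unit_periodic_const w1 Fsh Gsh zch)
  have S0: "2 * l * n ^ 7 / K\<^sup>2 \<le> norm (\<Sum>p\<in>P1. \<Sum>\<tau>1\<in>B. \<Sum>y\<in>{0..<M}. u1 p (y + 0) * v1 p \<tau>1 y)"
  proof -
    have "(\<Sum>p\<in>P1. \<Sum>\<tau>1\<in>B. \<Sum>y\<in>{0..<M}. u1 p (y + 0) * v1 p \<tau>1 y) = (\<Sum>x\<in>X. \<Sum>\<tau>2\<in>B. \<Sum>d\<in>I. \<Sum>\<tau>1\<in>B. \<Sum>y\<in>{0..<M}. u1 (x, \<tau>2, d) y * v1 (x, \<tau>2, d) \<tau>1 y)"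
      unfolding P1_def by (simp add: sum.cartesian_product')
    also have "\<dots> = (\<Sum>x\<in>X. \<Sum>\<tau>2\<in>B. \<Sum>\<tau>1\<in>B. \<Sum>y\<in>{0..<M}. \<Sum>d\<in>I. u1 (x, \<tau>2, d) y * v1 (x, \<tau>2, d) \<tau>1 y)"
      by (rule sum.cong[OF refl], rule sum.cong[OF refl], rule sum_swap3)
    also have "\<dots> = (\<Sum>x\<in>X. \<Sum>\<tau>2\<in>B. \<Sum>\<tau>1\<in>B. 2 * of_int N * (w x \<tau>1 \<tau>2 * Z x \<tau>1 \<tau>2))"
    proof (rule sum.cong[OF refl], rule sum.cong[OF refl], rule sum.cong[OF refl])
      fix x \<tau>2 \<tau>1
      have "(\<Sum>d\<in>I. u1 (x, \<tau>2, d) y * v1 (x, \<tau>2, d) \<tau>1 y) = 2 * of_int N * (w x \<tau>1 \<tau>2 * (F x y * cnj (F x (y + bstep \<tau>1)) * cnj (F x (y + bstep \<tau>2)) * F x (y + bstep \<tau>1 + bstep \<tau>2) * zchar M (- (\<phi> x \<tau>1 \<tau>2 * y))))" for y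
      proof -
        have "(\<Sum>d\<in>I. u1 (x, \<tau>2, d) y * v1 (x, \<tau>2, d) \<tau>1 y) = (F x y * cnj (F x (y + bstep \<tau>2)) * w x \<tau>1 \<tau>2 * cnj (F x (y + bstep \<tau>1)) * zchar M (- (\<phi> x \<tau>1 \<tau>2 * y))) * (\<Sum>d\<in>I. G d x (y + bstep \<tau>1 + bstep \<tau>2))"
          unfolding u1_def v1_def prod.case sum_distrib_left by (simp add: mult_ac)
        then show ?thesis unfolding I_def F_expand[symmetric] by (simp add: mult_ac)
      qed
      then show "(\<Sum>y\<in>{0..<M}. \<Sum>d\<in>I. u1 (x, \<tau>2, d) y * v1 (x, \<tau>2, d) \<tau>1 y) = 2 * of_int N * (w x \<tau>1 \<tau>2 * Z x \<tau>1 \<tau>2)"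
        unfolding Z_def by (simp only: sum_distrib_left)
    qed
    also have "\<dots> = (\<Sum>x\<in>X. \<Sum>\<tau>1\<in>B. \<Sum>\<tau>2\<in>B. 2 * of_int N * (w x \<tau>1 \<tau>2 * Z x \<tau>1 \<tau>2))"
      by (rule sum.cong[OF refl], rule sum.swap)
    also have "\<dots> = (\<Sum>z\<in>X \<times> B \<times> B. 2 * of_int N * (w (fst z) (fst (snd z)) (snd (snd z)) * Z (fst z) (fst (snd z)) (snd (snd z))))"
      by (simp add: sum.cartesian_product')
    also have "\<dots> = (\<Sum>z\<in>E. 2 * of_int N * (w (fst z) (fst (snd z)) (snd (snd z)) * Z (fst z) (fst (snd z)) (snd (snd z))))"
      by (rule sum.mono_neutral_right) (use E finX finB in \<open>auto simp: w_def B_def\<close>)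
    also have "\<dots> = complex_of_real (\<Sum>z\<in>E. 2 * n * norm (Z (fst z) (fst (snd z)) (snd (snd z))))"
      unfolding of_real_sum by (rule sum.cong[OF refl]) (auto simp: w_def w0)
    finally have e: "(\<Sum>p\<in>P1. \<Sum>\<tau>1\<in>B. \<Sum>y\<in>{0..<M}. u1 p (y + 0) * v1 p \<tau>1 y) = complex_of_real (\<Sum>z\<in>E. 2 * n * norm (Z (fst z) (fst (snd z)) (snd (snd z))))" .
    have "2 * l * n ^ 7 / K\<^sup>2 = l * n ^ 4 / K * (2 * n * (n\<^sup>2 / K))" by (simp add: eval_nat_numeral)
    also have "\<dots> \<le> real (card E) * (2 * n * (n\<^sup>2 / K))" using E(2) n0 Kp by (intro mult_right_mono) auto
    also have "\<dots> = (\<Sum>z\<in>E. 2 * n * (n\<^sup>2 / K))" by simp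
    also have "\<dots> \<le> (\<Sum>z\<in>E. 2 * n * norm (Z (fst z) (fst (snd z)) (snd (snd z))))"
      using big n0 unfolding Z_def by (intro sum_mono mult_left_mono) auto
    finally show ?thesis unfolding e norm_of_real by linarith
  qed
  define R1 where "R1 = (\<Sum>p\<in>P1. \<Sum>\<tau>1\<in>B. \<Sum>\<tau>1'\<in>B. \<Sum>y\<in>{0..<M}. v1 p \<tau>1 y * cnj (v1 p \<tau>1' (y + 0 - 0)))"
  have b1: "(2 * l * n ^ 7 / K\<^sup>2)\<^sup>2 \<le> l * (81 * n\<^sup>2 * (2 * n)) * (2 * n\<^sup>2) * norm R1"
  proof -
    have "(2 * l * n ^ 7 / K\<^sup>2)\<^sup>2 \<le> (norm (\<Sum>p\<in>P1. \<Sum>\<tau>1\<in>B. \<Sum>y\<in>{0..<M}. u1 p (y + 0) * v1 p \<tau>1 y))\<^sup>2"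
      using S0 n0 Kp by (intro power_mono) auto
    also have "\<dots> \<le> real (card P1) * of_int M * norm R1"
      unfolding R1_def by (rule cauchy_schwarz_shift) (use finX finB M0 u1p v1p in \<open>auto simp: P1_def I_def\<close>)
    also have "real (card P1) \<le> l * (81 * n\<^sup>2 * (2 * n))"
      unfolding P1_def I_def card_cartesian_product of_nat_mult using cX cB cI n0 by (intro mult_mono) auto
    then have "real (card P1) * of_int M * norm R1 \<le> l * (81 * n\<^sup>2 * (2 * n)) * (2 * n\<^sup>2) * norm R1"
      unfolding Mn by (intro mult_right_mono) auto
    finally show ?thesis .
  qed
  define u2 where "u2 = (\<lambda>(x, d::int, \<tau>1, \<tau>1') y. cnj (F x (y + bstep \<tau>1)) * F x (y + bstep \<tau>1'))"
  define v2 where "v2 = (\<lambda>(x, d, \<tau>1, \<tau>1') \<tau>2 y. w x \<tau>1 \<tau>2 * cnj (w x \<tau>1' \<tau>2) * G d x (y + bstep \<tau>1 + bstep \<tau>2) * cnj (G d x (y + bstep \<tau>1' + bstep \<tau>2))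
     * zchar M (- ((\<phi> x \<tau>1 \<tau>2 - \<phi> x \<tau>1' \<tau>2) * y)))"
  define P2 where "P2 = X \<times> I \<times> B \<times> B"
  have u2p: "unit_periodic M (u2 p)" for p
    unfolding u2_def by (cases p) (auto intro!: unit_periodic_mult unit_periodic_cnj Fsh)
  have v2p: "unit_periodic M (v2 p \<tau>)" for p \<tau>
    unfolding v2_def by (cases p) (auto intro!: unit_periodic_mult unit_periodic_cnj unit_periodic_const ww Gsh zch)
  have e1: "R1 = (\<Sum>p\<in>P2. \<Sum>\<tau>2\<in>B. \<Sum>y\<in>{0..<M}. u2 p (y + 0) * v2 p \<tau>2 y)"
  proof -
    have "R1 = (\<Sum>x\<in>X. \<Sum>\<tau>2\<in>B. \<Sum>d\<in>I. \<Sum>\<tau>1\<in>B. \<Sum>\<tau>1'\<in>B. \<Sum>y\<in>{0..<M}. v1 (x, \<tau>2, d) \<tau>1 y * cnj (v1 (x, \<tau>2, d) \<tau>1' y))"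
      unfolding R1_def P1_def by (simp add: sum.cartesian_product')
    also have "\<dots> = (\<Sum>x\<in>X. \<Sum>d\<in>I. \<Sum>\<tau>1\<in>B. \<Sum>\<tau>2\<in>B. \<Sum>\<tau>1'\<in>B. \<Sum>y\<in>{0..<M}. v1 (x, \<tau>2, d) \<tau>1 y * cnj (v1 (x, \<tau>2, d) \<tau>1' y))"
      by (rule sum.cong[OF refl], rule sum_swap3)
    also have "\<dots> = (\<Sum>x\<in>X. \<Sum>d\<in>I. \<Sum>\<tau>1\<in>B. \<Sum>\<tau>1'\<in>B. \<Sum>\<tau>2\<in>B. \<Sum>y\<in>{0..<M}. v1 (x, \<tau>2, d) \<tau>1 y * cnj (v1 (x, \<tau>2, d) \<tau>1' y))"
      by (rule sum.cong[OF refl], rule sum.cong[OF refl], rule sum.cong[OF refl], rule sum.swap)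
    also have "\<dots> = (\<Sum>x\<in>X. \<Sum>d\<in>I. \<Sum>\<tau>1\<in>B. \<Sum>\<tau>1'\<in>B. \<Sum>\<tau>2\<in>B. \<Sum>y\<in>{0..<M}. u2 (x, d, \<tau>1, \<tau>1') (y + 0) * v2 (x, d, \<tau>1, \<tau>1') \<tau>2 y)"
    proof -
      have "v1 (x, \<tau>2, d) \<tau>1 y * cnj (v1 (x, \<tau>2, d) \<tau>1' y) = u2 (x, d, \<tau>1, \<tau>1') (y + 0) * v2 (x, d, \<tau>1, \<tau>1') \<tau>2 y" for x d \<tau>1 \<tau>1' \<tau>2 y
      proof -
        have z: "zchar M (- ((\<phi> x \<tau>1 \<tau>2 - \<phi> x \<tau>1' \<tau>2) * y)) = zchar M (- (\<phi> x \<tau>1 \<tau>2 * y)) * cnj (zchar M (- (\<phi> x \<tau>1' \<tau>2 * y)))"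
          unfolding zchar_diff[symmetric] by (simp add: algebra_simps)
        show ?thesis unfolding v1_def u2_def v2_def prod.case z by (simp add: mult_ac)
      qed
      then show ?thesis by simp
    qed
    finally show ?thesis unfolding P2_def by (simp add: sum.cartesian_product')
  qed
  define R2 where "R2 = (\<Sum>p\<in>P2. \<Sum>\<tau>2\<in>B. \<Sum>\<tau>2'\<in>B. \<Sum>y\<in>{0..<M}. v2 p \<tau>2 y * cnj (v2 p \<tau>2' (y + 0 - 0)))"
  have b2: "(norm R1)\<^sup>2 \<le> l * (2 * n * (81 * n\<^sup>2 * (81 * n\<^sup>2))) * (2 * n\<^sup>2) * norm R2"
  proof -
    have "(norm R1)\<^sup>2 \<le> real (card P2) * of_int M * norm R2"
      unfolding e1 R2_def by (rule cauchy_schwarz_shift) (use finX finB M0 u2p v2p in \<open>auto simp: P2_def I_def\<close>)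
    also have "real (card P2) \<le> l * (2 * n * (81 * n\<^sup>2 * (81 * n\<^sup>2)))"
      unfolding P2_def I_def card_cartesian_product of_nat_mult using cX cB cI n0 by (intro mult_mono) auto
    then have "real (card P2) * of_int M * norm R2 \<le> l * (2 * n * (81 * n\<^sup>2 * (81 * n\<^sup>2))) * (2 * n\<^sup>2) * norm R2"
      unfolding Mn by (intro mult_right_mono) auto
    finally show ?thesis .
  qed
  have lower: "l * n ^ 11 / K ^ 36 \<le> norm R2"
  proof -
    have c1: "l * n ^ 9 / (81 * K ^ 4) \<le> norm R1"
    proof -
      have "(2 * l * n ^ 7 / K\<^sup>2)\<^sup>2 = l * (81 * n\<^sup>2 * (2 * n)) * (2 * n\<^sup>2) * (l * n ^ 9 / (81 * K ^ 4))"
        using Kp by (simp add: field_simps eval_nat_numeral)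
      then have "l * (81 * n\<^sup>2 * (2 * n)) * (2 * n\<^sup>2) * (l * n ^ 9 / (81 * K ^ 4)) \<le> l * (81 * n\<^sup>2 * (2 * n)) * (2 * n\<^sup>2) * norm R1"
        using b1 by linarith
      then show ?thesis by (rule mult_left_le_imp_le) (use n0 in simp)
    qed
    have "(l * n ^ 9 / (81 * K ^ 4))\<^sup>2 \<le> (norm R1)\<^sup>2" using c1 n0 Kp by (intro power_mono) auto
    also note b2
    also have "(l * n ^ 9 / (81 * K ^ 4))\<^sup>2 = l * (2 * n * (81 * n\<^sup>2 * (81 * n\<^sup>2))) * (2 * n\<^sup>2) * (l * n ^ 11 / (172186884 * K ^ 8))"
      using Kp by (simp add: field_simps eval_nat_numeral)
    finally have "l * n ^ 11 / (172186884 * K ^ 8) \<le> norm R2" by (rule mult_left_le_imp_le) (use n0 in simp)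
    moreover have "l * n ^ 11 / K ^ 36 \<le> l * n ^ 11 / (172186884 * K ^ 8)"
      using Kp n0 by (intro divide_left_mono const_le_power[OF K, of _ 28]) auto
    ultimately show ?thesis by linarith
  qed
  define \<theta> where "\<theta> = (\<lambda>(\<tau>1, \<tau>1', \<tau>2, \<tau>2') x. \<phi> x \<tau>1 \<tau>2 - \<phi> x \<tau>1' \<tau>2 - \<phi> x \<tau>1 \<tau>2' + \<phi> x \<tau>1' \<tau>2')"
  define W where "W = (\<lambda>(\<tau>1, \<tau>1', \<tau>2, \<tau>2') x. w x \<tau>1 \<tau>2 * cnj (w x \<tau>1' \<tau>2) * cnj (w x \<tau>1 \<tau>2') * w x \<tau>1' \<tau>2')"
  have Wn: "norm (W q x) \<le> 1" for q x
  proof -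
    obtain \<tau>1 \<tau>1' \<tau>2 \<tau>2' where q: "q = (\<tau>1, \<tau>1', \<tau>2, \<tau>2')" by (metis surj_pair)
    show ?thesis unfolding q W_def prod.case norm_mult complex_mod_cnj
      by (intro mult_le_one w1) auto
  qed
  define m where "m = (\<lambda>q. card {x\<in>X. W q x \<noteq> 0 \<and> major (K' ^ 400) N (of_int (\<theta> q x) / of_int M)})"
  define B4 where "B4 = B \<times> B \<times> B \<times> B"
  have cB4: "real (card B4) \<le> (81 * n\<^sup>2) ^ 4"
  proof -
    have "real (card B4) \<le> 81 * n\<^sup>2 * (81 * n\<^sup>2 * (81 * n\<^sup>2 * (81 * n\<^sup>2)))"
      unfolding B4_def card_cartesian_product of_nat_mult using cB n0 by (intro mult_mono) auto
    then show ?thesis by (simp add: eval_nat_numeral)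
  qed
  have K'2: "K' \<ge> 2" using self_le_power[of K 64] K unfolding K' by simp
  have upper: "norm R2 \<le> (\<Sum>q\<in>B4. 2 * l * n ^ 3 / K' + 4 * n ^ 3 * real (m q))"
  proof -
    define T where "T = (\<lambda>(\<tau>1, \<tau>1', \<tau>2, \<tau>2') x d. \<Sum>y\<in>{0..<M}. W (\<tau>1, \<tau>1', \<tau>2, \<tau>2') x * (G d x (y + (bstep \<tau>1 + bstep \<tau>2)) * cnj (G d x (y + (bstep \<tau>1' + bstep \<tau>2))) * cnj (G d x (y + (bstep \<tau>1 + bstep \<tau>2'))) * G d x (y + (bstep \<tau>1' + bstep \<tau>2'))) * zchar M (- (\<theta> (\<tau>1, \<tau>1', \<tau>2, \<tau>2') x * y)))"
    have "R2 = (\<Sum>x\<in>X. \<Sum>d\<in>I. \<Sum>\<tau>1\<in>B. \<Sum>\<tau>1'\<in>B. \<Sum>\<tau>2\<in>B. \<Sum>\<tau>2'\<in>B. \<Sum>y\<in>{0..<M}. v2 (x, d, \<tau>1, \<tau>1') \<tau>2 y * cnj (v2 (x, d, \<tau>1, \<tau>1') \<tau>2' y))"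
      unfolding R2_def P2_def by (simp add: sum.cartesian_product')
    also have "\<dots> = (\<Sum>x\<in>X. \<Sum>d\<in>I. \<Sum>\<tau>1\<in>B. \<Sum>\<tau>1'\<in>B. \<Sum>\<tau>2\<in>B. \<Sum>\<tau>2'\<in>B. T (\<tau>1, \<tau>1', \<tau>2, \<tau>2') x d)"
    proof -
      have "v2 (x, d, \<tau>1, \<tau>1') \<tau>2 y * cnj (v2 (x, d, \<tau>1, \<tau>1') \<tau>2' y) = W (\<tau>1, \<tau>1', \<tau>2, \<tau>2') x * (G d x (y + (bstep \<tau>1 + bstep \<tau>2)) * cnj (G d x (y + (bstep \<tau>1' + bstep \<tau>2))) * cnj (G d x (y + (bstep \<tau>1 + bstep \<tau>2'))) * G d x (y + (bstep \<tau>1' + bstep \<tau>2'))) * zchar M (- (\<theta> (\<tau>1, \<tau>1', \<tau>2, \<tau>2') x * y))" for x d \<tau>1 \<tau>1' \<tau>2 \<tau>2' y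
      proof -
        have z: "zchar M (- (\<theta> (\<tau>1, \<tau>1', \<tau>2, \<tau>2') x * y)) = zchar M (- ((\<phi> x \<tau>1 \<tau>2 - \<phi> x \<tau>1' \<tau>2) * y)) * cnj (zchar M (- ((\<phi> x \<tau>1 \<tau>2' - \<phi> x \<tau>1' \<tau>2') * y)))"
          unfolding zchar_diff[symmetric] \<theta>_def prod.case by (simp add: algebra_simps)
        show ?thesis unfolding v2_def W_def prod.case z add.assoc by (simp add: mult_ac)
      qed
      then show ?thesis unfolding T_def by simp
    qed
    also have "\<dots> = (\<Sum>x\<in>X. \<Sum>d\<in>I. \<Sum>q\<in>B4. T q x d)" unfolding B4_def by (simp add: sum.cartesian_product')
    also have "\<dots> = (\<Sum>q\<in>B4. \<Sum>x\<in>X. \<Sum>d\<in>I. T q x d)" by (rule sum_swap3[symmetric])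
    also have "norm \<dots> \<le> (\<Sum>q\<in>B4. 2 * l * n ^ 3 / K' + 4 * n ^ 3 * real (m q))"
    proof (rule sum_norm_le)
      fix q assume "q \<in> B4"
      obtain \<tau>1 \<tau>1' \<tau>2 \<tau>2' where q: "q = (\<tau>1, \<tau>1', \<tau>2, \<tau>2')" by (metis surj_pair)
      show "norm (\<Sum>x\<in>X. \<Sum>d\<in>I. T q x d) \<le> 2 * l * n ^ 3 / K' + 4 * n ^ 3 * real (m q)"
        unfolding T_def m_def q I_def prod.case by (rule phase_sum_G4[OF K'2 N Wn])
    qed
    finally show ?thesis .
  qed
  have "l * n ^ 8 / K ^ 39 \<le> (\<Sum>q\<in>B4. real (m q))"
  proof -
    \<comment> \<open>Over at most \<open>(81 * n^2)^4\<close> quadruples of steps the minor arc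
      error adds up to \<open>86093442 * l * n^11 / K'\<close>. The choice \<open>K' = K^64\<close>
      makes this at most half of the lower bound with \<open>K^36\<close>.\<close>
    have "real (card B4) * (2 * l * n ^ 3 / K') \<le> (81 * n\<^sup>2) ^ 4 * (2 * l * n ^ 3 / K')"
      using cB4 n0 K'2 by (intro mult_right_mono) auto
    also have "\<dots> = l * n ^ 11 * (86093442 / K')" by (simp add: eval_nat_numeral)
    also have "\<dots> \<le> l * n ^ 11 * (1 / (2 * K ^ 36))"
    proof (rule mult_left_mono)
      have "172186884 * K ^ 36 \<le> K'" unfolding K' by (rule const_le_power[OF K, of _ 28]) auto
      then show "86093442 / K' \<le> 1 / (2 * K ^ 36)" using K'2 Kp by (simp add: field_simps)
    qed (use n0 in auto)
    finally have u: "real (card B4) * (2 * l * n ^ 3 / K') \<le> l * n ^ 11 / K ^ 36 / 2" by simp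
    have t: "(\<Sum>q\<in>B4. 2 * l * n ^ 3 / K' + 4 * n ^ 3 * real (m q)) = real (card B4) * (2 * l * n ^ 3 / K') + 4 * n ^ 3 * (\<Sum>q\<in>B4. real (m q))"
      by (simp add: sum.distrib sum_distrib_left)
    have "l * n ^ 11 / K ^ 36 / 2 \<le> 4 * n ^ 3 * (\<Sum>q\<in>B4. real (m q))"
      by (rule half_absorb[OF lower upper t u])
    moreover have "l * n ^ 11 / K ^ 36 / 2 = 4 * n ^ 3 * (l * n ^ 8 / (8 * K ^ 36))" by (simp add: eval_nat_numeral)
    ultimately have "4 * n ^ 3 * (l * n ^ 8 / (8 * K ^ 36)) \<le> 4 * n ^ 3 * (\<Sum>q\<in>B4. real (m q))" by simp
    then have "l * n ^ 8 / (8 * K ^ 36) \<le> (\<Sum>q\<in>B4. real (m q))" by (rule mult_left_le_imp_le) (use n0 in simp)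
    moreover have "l * n ^ 8 / K ^ 39 \<le> l * n ^ 8 / (8 * K ^ 36)"
      using Kp n0 by (intro divide_left_mono const_le_power[OF K, of _ 3]) auto
    ultimately show ?thesis by linarith
  qed
  also have "\<dots> = real (card (Sigma B4 (\<lambda>q. {x\<in>X. W q x \<noteq> 0 \<and> major (K' ^ 400) N (of_int (\<theta> q x) / of_int M)})))"
    unfolding m_def using finX finB by (simp add: B4_def)
  also have "card (Sigma B4 (\<lambda>q. {x\<in>X. W q x \<noteq> 0 \<and> major (K' ^ 400) N (of_int (\<theta> q x) / of_int M)})) \<le>
     card {(x, (\<tau>1', \<tau>2'), (\<tau>1, \<tau>2))\<in>X \<times> (B \<times> B) \<times> (B \<times> B).
     (x, \<tau>1, \<tau>2) \<in> E \<and> major (K' ^ 400) N (of_int (\<phi> x \<tau>1 \<tau>2 - \<phi> x \<tau>1' \<tau>2 - \<phi> x \<tau>1 \<tau>2' + \<phi> x \<tau>1' \<tau>2') / of_int M)}"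
  proof (rule card_inj_on_le[of "\<lambda>((\<tau>1, \<tau>1', \<tau>2, \<tau>2'), x). (x, (\<tau>1', \<tau>2'), (\<tau>1, \<tau>2))"])
    show "inj_on (\<lambda>((\<tau>1, \<tau>1', \<tau>2, \<tau>2'), x). (x, (\<tau>1', \<tau>2'), (\<tau>1, \<tau>2))) (Sigma B4 (\<lambda>q. {x\<in>X. W q x \<noteq> 0 \<and> major (K' ^ 400) N (of_int (\<theta> q x) / of_int M)}))"
      by (auto simp: inj_on_def)
    show "(\<lambda>((\<tau>1, \<tau>1', \<tau>2, \<tau>2'), x). (x, (\<tau>1', \<tau>2'), (\<tau>1, \<tau>2))) ` Sigma B4 (\<lambda>q. {x\<in>X. W q x \<noteq> 0 \<and> major (K' ^ 400) N (of_int (\<theta> q x) / of_int M)}) \<subseteq>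
      {(x, (\<tau>1', \<tau>2'), (\<tau>1, \<tau>2))\<in>X \<times> (B \<times> B) \<times> (B \<times> B).
     (x, \<tau>1, \<tau>2) \<in> E \<and> major (K' ^ 400) N (of_int (\<phi> x \<tau>1 \<tau>2 - \<phi> x \<tau>1' \<tau>2 - \<phi> x \<tau>1 \<tau>2' + \<phi> x \<tau>1' \<tau>2') / of_int M)}"
      unfolding B4_def W_def \<theta>_def w_def by (auto split: if_splits)
    show "finite {(x, (\<tau>1', \<tau>2'), (\<tau>1, \<tau>2))\<in>X \<times> (B \<times> B) \<times> (B \<times> B).
     (x, \<tau>1, \<tau>2) \<in> E \<and> major (K' ^ 400) N (of_int (\<phi> x \<tau>1 \<tau>2 - \<phi> x \<tau>1' \<tau>2 - \<phi> x \<tau>1 \<tau>2' + \<phi> x \<tau>1' \<tau>2') / of_int M)}"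
      by (rule finite_subset[of _ "X \<times> (B \<times> B) \<times> (B \<times> B)"]) (use finX finB in auto)
  qed
  finally show ?thesis unfolding B_def by simp
qed

end

context dual_setup
begin

text \<open>Being major depends only on the residue modulo \<open>M\<close>, and only
  \<open>60 * Q^3\<close> residues are major, so a popular one can be fixed. Afterwards the
  frequency is known exactly as a residue instead of approximately.\<close>

lemma major_pigeonhole:
  fixes f :: "'a \<Rightarrow> int"
  assumes Q: "Q \<ge> 1" "Q \<le> n" and A: "finite A" "A \<noteq> {}" and f: "\<And>a. a \<in> A \<Longrightarrow> major Q N (of_int (f a) / of_int M)"
  shows "\<exists>\<mu>. real (card A) / (60 * Q ^ 3) \<le> real (card {a\<in>A. M dvd f a - \<mu>})"
proof -
  define \<Xi> where "\<Xi> = {\<xi>\<in>{0..<M}. major Q N (of_int \<xi> / of_int M)}"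
  have fin: "finite \<Xi>" by (rule finite_subset[of _ "{0..<M}"]) (auto simp: \<Xi>_def)
  have c: "real (card \<Xi>) \<le> 60 * Q ^ 3" unfolding \<Xi>_def by (rule card_major_le[OF N0 Q M])
  have im: "(\<lambda>a. f a mod M) ` A \<subseteq> \<Xi>" using f M0 unfolding \<Xi>_def by (auto simp: major_mod)
  obtain \<mu> where mu: "\<mu> \<in> \<Xi>" "real (card A) / real (card \<Xi>) \<le> real (card {a\<in>A. f a mod M = \<mu>})"
    using pigeonhole_real[OF A(1) fin im A(2)] by blast
  have "card \<Xi> > 0" using mu(1) fin by (auto simp: card_gt_0_iff)
  then have "real (card A) / (60 * Q ^ 3) \<le> real (card A) / real (card \<Xi>)"
    using c Q by (intro divide_left_mono mult_pos_pos) auto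
  also note mu(2)
  also have "{a\<in>A. f a mod M = \<mu>} \<subseteq> {a\<in>A. M dvd f a - \<mu>}"
    by (auto simp: minus_mod_eq_mult_div)
  then have "real (card {a\<in>A. f a mod M = \<mu>}) \<le> real (card {a\<in>A. M dvd f a - \<mu>})"
    using A by (intro of_nat_mono card_mono) auto
  finally show ?thesis by blast
qed

text \<open>The pair \<open>(\<tau>1', \<tau>2')\<close> is frozen to a value depending on
  \<open>x\<close>, and the mixed difference of \<open>\<phi>\<close> is frozen to one residue
  \<open>\<mu>\<close>. Solving the resulting congruence for \<open>\<phi> x \<tau>1 \<tau>2\<close>
  leaves a function of \<open>\<tau>1\<close> plus a function of \<open>\<tau>2\<close>.\<close>

lemma split_frequency:
  assumes Q: "Q \<ge> 1" "Q \<le> n" and Ka: "Ka > 0"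
    and D: "l * n ^ 8 / Ka \<le> real (card {(x, (\<tau>1', \<tau>2'), (\<tau>1, \<tau>2))\<in>X \<times> (gbox N \<times> gbox N) \<times> (gbox N \<times> gbox N).
     (x, \<tau>1, \<tau>2) \<in> E \<and> major Q N (of_int (\<phi> x \<tau>1 \<tau>2 - \<phi> x \<tau>1' \<tau>2 - \<phi> x \<tau>1 \<tau>2' + \<phi> x \<tau>1' \<tau>2') / of_int M)})"
  shows "\<exists>a b E'. E' \<subseteq> E \<and> E' \<subseteq> X \<times> gbox N \<times> gbox N \<and> l * n ^ 4 / (6561 * Ka * (60 * Q ^ 3)) \<le> real (card E')
     \<and> (\<forall>(x, \<tau>1, \<tau>2)\<in>E'. M dvd \<phi> x \<tau>1 \<tau>2 - (a x \<tau>1 + b x \<tau>2))"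
proof -
  define B where "B = gbox N"
  have finB: "finite B" unfolding B_def by simp
  have Bne: "(0, 0) \<in> B" using N0 unfolding B_def gbox_def by simp
  have cBB: "real (card (B \<times> B)) \<le> 6561 * n ^ 4"
  proof -
    have "real (card (B \<times> B)) \<le> (81 * n\<^sup>2) * (81 * n\<^sup>2)"
      unfolding card_cartesian_product of_nat_mult B_def using cg by (intro mult_mono) auto
    then show ?thesis by (simp add: eval_nat_numeral)
  qed
  define P where "P = (\<lambda>x a b. (x, fst b, snd b) \<in> E \<and> major Q N (of_int (\<phi> x (fst b) (snd b) - \<phi> x (fst a) (snd b) - \<phi> x (fst b) (snd a) + \<phi> x (fst a) (snd a)) / of_int M))"
  have "\<exists>\<sigma>. (\<forall>x. \<sigma> x \<in> B \<times> B) \<and> real (card {(x, a, b)\<in>X \<times> (B \<times> B) \<times> (B \<times> B). P x a b}) \<le> real (card (B \<times> B)) * real (card {(x, b)\<in>X \<times> (B \<times> B). P x (\<sigma> x) b})"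
    using finX finB Bne by (intro choose_slice) auto
  then obtain \<sigma> where \<sigma>: "real (card {(x, a, b)\<in>X \<times> (B \<times> B) \<times> (B \<times> B). P x a b}) \<le> real (card (B \<times> B)) * real (card {(x, b)\<in>X \<times> (B \<times> B). P x (\<sigma> x) b})"
    by blast
  define D' where "D' = {(x, b)\<in>X \<times> (B \<times> B). P x (\<sigma> x) b}"
  have finD': "finite D'" by (rule finite_subset[of _ "X \<times> (B \<times> B)"]) (use finX finB in \<open>auto simp: D'_def\<close>)
  have "l * n ^ 8 / Ka \<le> real (card {(x, a, b)\<in>X \<times> (B \<times> B) \<times> (B \<times> B). P x a b})"
  proof -
    have "{(x, (\<tau>1', \<tau>2'), (\<tau>1, \<tau>2))\<in>X \<times> (gbox N \<times> gbox N) \<times> (gbox N \<times> gbox N).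
     (x, \<tau>1, \<tau>2) \<in> E \<and> major Q N (of_int (\<phi> x \<tau>1 \<tau>2 - \<phi> x \<tau>1' \<tau>2 - \<phi> x \<tau>1 \<tau>2' + \<phi> x \<tau>1' \<tau>2') / of_int M)}
     = {(x, a, b)\<in>X \<times> (B \<times> B) \<times> (B \<times> B). P x a b}"
      unfolding P_def B_def by (auto simp: split_beta)
    then show ?thesis using D by simp
  qed
  also note \<sigma>
  also have "real (card (B \<times> B)) * real (card {(x, b)\<in>X \<times> (B \<times> B). P x (\<sigma> x) b}) \<le> 6561 * n ^ 4 * real (card D')"
    unfolding D'_def using cBB by (intro mult_right_mono) auto
  finally have "6561 * n ^ 4 * (l * n ^ 4 / (6561 * Ka)) \<le> 6561 * n ^ 4 * real (card D')"
    using Ka by (simp add: eval_nat_numeral mult_ac)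
  then have cD': "l * n ^ 4 / (6561 * Ka) \<le> real (card D')" by (rule mult_left_le_imp_le) (use n0 in simp)
  have "0 < l * n ^ 4 / (6561 * Ka)" using n0 Ka by simp
  then have D'ne: "D' \<noteq> {}" using cD' by auto
  define f where "f = (\<lambda>z. \<phi> (fst z) (fst (snd z)) (snd (snd z)) - \<phi> (fst z) (fst (\<sigma> (fst z))) (snd (snd z))
     - \<phi> (fst z) (fst (snd z)) (snd (\<sigma> (fst z))) + \<phi> (fst z) (fst (\<sigma> (fst z))) (snd (\<sigma> (fst z))))"
  have "major Q N (of_int (f z) / of_int M)" if "z \<in> D'" for z
    using that unfolding D'_def f_def P_def by auto
  then obtain \<mu> where mu: "real (card D') / (60 * Q ^ 3) \<le> real (card {z\<in>D'. M dvd f z - \<mu>})"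
    using major_pigeonhole[OF Q finD' D'ne, of f] by blast
  define E' where "E' = {z\<in>D'. M dvd f z - \<mu>}"
  define a where "a = (\<lambda>x \<tau>1. \<phi> x \<tau>1 (snd (\<sigma> x)))"
  define b where "b = (\<lambda>x \<tau>2. \<phi> x (fst (\<sigma> x)) \<tau>2 - \<phi> x (fst (\<sigma> x)) (snd (\<sigma> x)) + \<mu>)"
  have "l * n ^ 4 / (6561 * Ka * (60 * Q ^ 3)) = l * n ^ 4 / (6561 * Ka) / (60 * Q ^ 3)" by simp
  also have "\<dots> \<le> real (card D') / (60 * Q ^ 3)" using cD' Q by (intro divide_right_mono) auto
  also have "\<dots> \<le> real (card E')" using mu unfolding E'_def .
  finally have "l * n ^ 4 / (6561 * Ka * (60 * Q ^ 3)) \<le> real (card E')" .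
  moreover have "E' \<subseteq> E" "E' \<subseteq> X \<times> gbox N \<times> gbox N" unfolding E'_def D'_def P_def B_def by auto
  moreover have "\<forall>(x, \<tau>1, \<tau>2)\<in>E'. M dvd \<phi> x \<tau>1 \<tau>2 - (a x \<tau>1 + b x \<tau>2)"
  proof clarify
    fix x \<tau>11 \<tau>12 \<tau>21 \<tau>22 assume "(x, (\<tau>11, \<tau>12), (\<tau>21, \<tau>22)) \<in> E'"
    then have "M dvd f (x, (\<tau>11, \<tau>12), (\<tau>21, \<tau>22)) - \<mu>" unfolding E'_def by blast
    moreover have "f (x, (\<tau>11, \<tau>12), (\<tau>21, \<tau>22)) - \<mu> = \<phi> x (\<tau>11, \<tau>12) (\<tau>21, \<tau>22) - (a x (\<tau>11, \<tau>12) + b x (\<tau>21, \<tau>22))"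
      unfolding f_def a_def b_def fst_conv snd_conv by (simp only: algebra_simps)
    ultimately show "M dvd \<phi> x (\<tau>11, \<tau>12) (\<tau>21, \<tau>22) - (a x (\<tau>11, \<tau>12) + b x (\<tau>21, \<tau>22))" by (simp only:)
  qed
  ultimately show ?thesis by blast
qed

text \<open>Cauchy--Schwarz in \<open>\<tau>1\<close> removes every factor that depends on
  \<open>\<tau>2\<close> alone, including the phase \<open>b\<close>. The phase \<open>a\<close>
  survives only as a factor of \<open>Pf\<close>, while the box correlations of \<open>Pf\<close>
  and \<open>Qf\<close> yield a large coefficient of \<open>Qf\<close>, in which no phase occurs.
  The exponents are \<open>7192 = 58 * 124\<close> and \<open>2320 = 58 * 40\<close>, where
  \<open>K^58\<close> absorbs the constants and \<open>K^24\<close> of the last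
  Cauchy--Schwarz.\<close>

lemma remove_second_phase:
  assumes K: "K \<ge> 2" and N: "n \<ge> K ^ 2320"
    and E: "E \<subseteq> X \<times> gbox N \<times> gbox N" "l * n ^ 4 / K \<le> real (card E)"
    and big: "\<And>x \<tau>1 \<tau>2. (x, \<tau>1, \<tau>2) \<in> E \<Longrightarrow> n\<^sup>2 / K \<le> norm (\<Sum>y\<in>{0..<M}. F x y * cnj (F x (y + bstep \<tau>1)) * cnj (F x (y + bstep \<tau>2)) * F x (y + bstep \<tau>1 + bstep \<tau>2) * zchar M (- ((a x \<tau>1 + b x \<tau>2) * y)))"
  shows "l * n ^ 4 / K ^ 21 \<le> real (card {(x, \<tau>1, \<tau>1')\<in>X \<times> gbox N \<times> gbox N. \<exists>\<xi>. n\<^sup>2 / K ^ 7192 \<le> norm (zft M (\<lambda>y. F x (y + bstep \<tau>1) * cnj (F x (y + bstep \<tau>1'))) \<xi>)})"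
proof -
  have Kp: "K > 0" "K \<ge> 1" using K by auto
  define B where "B = gbox N"
  have finB: "finite B" unfolding B_def by simp
  have cB: "real (card B) \<le> 81 * n\<^sup>2" unfolding B_def by (rule cg)
  define Z where "Z = (\<lambda>x \<tau>1 \<tau>2. \<Sum>y\<in>{0..<M}. F x y * cnj (F x (y + bstep \<tau>1)) * cnj (F x (y + bstep \<tau>2)) * F x (y + bstep \<tau>1 + bstep \<tau>2) * zchar M (- ((a x \<tau>1 + b x \<tau>2) * y)))"
  obtain al where al: "norm (al z) \<le> 1" "al z * z = complex_of_real (norm z)" for z
    using unimodular_align by metis
  define w where "w = (\<lambda>x \<tau>1 \<tau>2. if (x, \<tau>1, \<tau>2) \<in> E then al (Z x \<tau>1 \<tau>2) else 0)"
  have w1: "norm (w x \<tau>1 \<tau>2) \<le> 1" for x \<tau>1 \<tau>2 unfolding w_def using al by simp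
  define u where "u = (\<lambda>(x, \<tau>2) y. F x y * cnj (F x (y + bstep \<tau>2)) * zchar M (- (b x \<tau>2 * y)))"
  define v where "v = (\<lambda>(x, \<tau>2) \<tau>1 y. w x \<tau>1 \<tau>2 * cnj (F x (y + bstep \<tau>1)) * F x (y + bstep \<tau>1 + bstep \<tau>2) * zchar M (- (a x \<tau>1 * y)))"
  have up: "unit_periodic M (u p)" for p
    unfolding u_def by (cases p) (auto intro!: unit_periodic_mult unit_periodic_cnj Fp Fsh zch)
  have vp: "unit_periodic M (v p \<tau>)" for p \<tau>
    unfolding v_def by (cases p) (auto intro!: unit_periodic_mult unit_periodic_cnj unit_periodic_const w1 Fsh zch)
  have S0: "l * n ^ 6 / K\<^sup>2 \<le> norm (\<Sum>p\<in>X \<times> B. \<Sum>\<tau>1\<in>B. \<Sum>y\<in>{0..<M}. u p (y + 0) * v p \<tau>1 y)"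
  proof -
    have uv: "u (x, \<tau>2) (y + 0) * v (x, \<tau>2) \<tau>1 y = w x \<tau>1 \<tau>2 * (F x y * cnj (F x (y + bstep \<tau>1)) * cnj (F x (y + bstep \<tau>2)) * F x (y + bstep \<tau>1 + bstep \<tau>2) * zchar M (- ((a x \<tau>1 + b x \<tau>2) * y)))" for x \<tau>1 \<tau>2 y
    proof -
      have z: "zchar M (- ((a x \<tau>1 + b x \<tau>2) * y)) = zchar M (- (a x \<tau>1 * y)) * zchar M (- (b x \<tau>2 * y))"
        unfolding zchar_add[symmetric] by (simp add: algebra_simps)
      show ?thesis unfolding u_def v_def prod.case z by (simp add: mult_ac)
    qed
    have "(\<Sum>p\<in>X \<times> B. \<Sum>\<tau>1\<in>B. \<Sum>y\<in>{0..<M}. u p (y + 0) * v p \<tau>1 y) = (\<Sum>x\<in>X. \<Sum>\<tau>2\<in>B. \<Sum>\<tau>1\<in>B. \<Sum>y\<in>{0..<M}. u (x, \<tau>2) (y + 0) * v (x, \<tau>2) \<tau>1 y)"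
      by (simp add: sum.cartesian_product')
    also have "\<dots> = (\<Sum>x\<in>X. \<Sum>\<tau>2\<in>B. \<Sum>\<tau>1\<in>B. w x \<tau>1 \<tau>2 * Z x \<tau>1 \<tau>2)"
      unfolding uv Z_def by (simp only: sum_distrib_left)
    also have "\<dots> = (\<Sum>x\<in>X. \<Sum>\<tau>1\<in>B. \<Sum>\<tau>2\<in>B. w x \<tau>1 \<tau>2 * Z x \<tau>1 \<tau>2)"
      by (rule sum.cong[OF refl], rule sum.swap)
    also have "\<dots> = (\<Sum>z\<in>X \<times> B \<times> B. w (fst z) (fst (snd z)) (snd (snd z)) * Z (fst z) (fst (snd z)) (snd (snd z)))"
      by (simp add: sum.cartesian_product')
    also have "\<dots> = (\<Sum>z\<in>E. w (fst z) (fst (snd z)) (snd (snd z)) * Z (fst z) (fst (snd z)) (snd (snd z)))"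
      by (rule sum.mono_neutral_right) (use E finX finB in \<open>auto simp: w_def B_def\<close>)
    also have "\<dots> = complex_of_real (\<Sum>z\<in>E. norm (Z (fst z) (fst (snd z)) (snd (snd z))))"
      unfolding of_real_sum by (rule sum.cong[OF refl]) (auto simp: w_def al)
    finally have e: "(\<Sum>p\<in>X \<times> B. \<Sum>\<tau>1\<in>B. \<Sum>y\<in>{0..<M}. u p (y + 0) * v p \<tau>1 y) = complex_of_real (\<Sum>z\<in>E. norm (Z (fst z) (fst (snd z)) (snd (snd z))))" .
    have "l * n ^ 6 / K\<^sup>2 = l * n ^ 4 / K * (n\<^sup>2 / K)" by (simp add: eval_nat_numeral)
    also have "\<dots> \<le> real (card E) * (n\<^sup>2 / K)" using E(2) n0 Kp by (intro mult_right_mono) auto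
    also have "\<dots> = (\<Sum>z\<in>E. n\<^sup>2 / K)" by simp
    also have "\<dots> \<le> (\<Sum>z\<in>E. norm (Z (fst z) (fst (snd z)) (snd (snd z))))"
      using big unfolding Z_def by (intro sum_mono) auto
    finally show ?thesis unfolding e norm_of_real by linarith
  qed
  define R where "R = (\<Sum>p\<in>X \<times> B. \<Sum>\<tau>1\<in>B. \<Sum>\<tau>1'\<in>B. \<Sum>y\<in>{0..<M}. v p \<tau>1 y * cnj (v p \<tau>1' (y + 0 - 0)))"
  have b1: "(l * n ^ 6 / K\<^sup>2)\<^sup>2 \<le> l * (81 * n\<^sup>2) * (2 * n\<^sup>2) * norm R"
  proof -
    have "(l * n ^ 6 / K\<^sup>2)\<^sup>2 \<le> (norm (\<Sum>p\<in>X \<times> B. \<Sum>\<tau>1\<in>B. \<Sum>y\<in>{0..<M}. u p (y + 0) * v p \<tau>1 y))\<^sup>2"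
      using S0 n0 Kp by (intro power_mono) auto
    also have "\<dots> \<le> real (card (X \<times> B)) * of_int M * norm R"
      unfolding R_def by (rule cauchy_schwarz_shift) (use finX finB M0 up vp in auto)
    also have "real (card (X \<times> B)) \<le> l * (81 * n\<^sup>2)"
      unfolding card_cartesian_product of_nat_mult using cX cB n0 by (intro mult_mono) auto
    then have "real (card (X \<times> B)) * of_int M * norm R \<le> l * (81 * n\<^sup>2) * (2 * n\<^sup>2) * norm R"
      unfolding Mn by (intro mult_right_mono) auto
    finally show ?thesis .
  qed
  define Pf where "Pf = (\<lambda>x \<tau>1 \<tau>1' y. F x (y + bstep \<tau>1) * cnj (F x (y + bstep \<tau>1')) * zchar M ((a x \<tau>1 - a x \<tau>1') * y))"
  define Qf where "Qf = (\<lambda>x \<tau>1 \<tau>1' y. F x (y + bstep \<tau>1) * cnj (F x (y + bstep \<tau>1')))"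
  have Pp: "unit_periodic M (Pf x \<tau>1 \<tau>1')" for x \<tau>1 \<tau>1'
    unfolding Pf_def by (intro unit_periodic_mult unit_periodic_cnj Fsh unit_periodic_zchar M0)
  have Qp: "unit_periodic M (Qf x \<tau>1 \<tau>1')" for x \<tau>1 \<tau>1'
    unfolding Qf_def by (intro unit_periodic_mult unit_periodic_cnj Fsh)
  define T where "T = (\<lambda>z \<tau>2. norm (\<Sum>y\<in>{0..<M}. cnj (Pf (fst z) (fst (snd z)) (snd (snd z)) y) * Qf (fst z) (fst (snd z)) (snd (snd z)) (y + bstep \<tau>2)))"
  have Rle: "norm R \<le> (\<Sum>z\<in>X \<times> B \<times> B. \<Sum>\<tau>2\<in>B. T z \<tau>2)"
  proof -
    have "R = (\<Sum>x\<in>X. \<Sum>\<tau>2\<in>B. \<Sum>\<tau>1\<in>B. \<Sum>\<tau>1'\<in>B. \<Sum>y\<in>{0..<M}. v (x, \<tau>2) \<tau>1 y * cnj (v (x, \<tau>2) \<tau>1' y))"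
      unfolding R_def by (simp add: sum.cartesian_product')
    also have "\<dots> = (\<Sum>x\<in>X. \<Sum>\<tau>1\<in>B. \<Sum>\<tau>1'\<in>B. \<Sum>\<tau>2\<in>B. \<Sum>y\<in>{0..<M}. v (x, \<tau>2) \<tau>1 y * cnj (v (x, \<tau>2) \<tau>1' y))"
      by (rule sum.cong[OF refl], rule sum_swap3)
    also have "norm \<dots> \<le> (\<Sum>x\<in>X. \<Sum>\<tau>1\<in>B. \<Sum>\<tau>1'\<in>B. \<Sum>\<tau>2\<in>B. T (x, \<tau>1, \<tau>1') \<tau>2)"
    proof (intro sum_norm_le)
      fix x \<tau>1 \<tau>1' \<tau>2
      have "v (x, \<tau>2) \<tau>1 y * cnj (v (x, \<tau>2) \<tau>1' y) = (w x \<tau>1 \<tau>2 * cnj (w x \<tau>1' \<tau>2)) * (cnj (Pf x \<tau>1 \<tau>1' y) * Qf x \<tau>1 \<tau>1' (y + bstep \<tau>2))" for y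
      proof -
        have z: "cnj (zchar M ((a x \<tau>1 - a x \<tau>1') * y)) = zchar M (- (a x \<tau>1 * y)) * cnj (zchar M (- (a x \<tau>1' * y)))"
        proof -
          have "- ((a x \<tau>1 - a x \<tau>1') * y) = - (a x \<tau>1 * y) - (- (a x \<tau>1' * y))" by (simp add: left_diff_distrib)
          then show ?thesis by (simp only: cnj_zchar[of M "(a x \<tau>1 - a x \<tau>1') * y"] zchar_diff)
        qed
        have e: "y + bstep \<tau>2 + bstep t = y + bstep t + bstep \<tau>2" for t by simp
        show ?thesis unfolding v_def Pf_def Qf_def prod.case complex_cnj_mult z e by (simp add: mult_ac)
      qed
      then have "norm (\<Sum>y\<in>{0..<M}. v (x, \<tau>2) \<tau>1 y * cnj (v (x, \<tau>2) \<tau>1' y)) = norm (w x \<tau>1 \<tau>2 * cnj (w x \<tau>1' \<tau>2)) * T (x, \<tau>1, \<tau>1') \<tau>2"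
        unfolding T_def by (simp only: sum_distrib_left[symmetric] norm_mult fst_conv snd_conv)
      also have "\<dots> \<le> 1 * T (x, \<tau>1, \<tau>1') \<tau>2"
        using w1 by (intro mult_right_mono) (auto simp: norm_mult mult_le_one T_def)
      finally show "norm (\<Sum>y\<in>{0..<M}. v (x, \<tau>2) \<tau>1 y * cnj (v (x, \<tau>2) \<tau>1' y)) \<le> T (x, \<tau>1, \<tau>1') \<tau>2" by simp
    qed
    finally show ?thesis by (simp add: sum.cartesian_product')
  qed
  have lower: "l * n ^ 8 / K ^ 12 \<le> (\<Sum>z\<in>X \<times> B \<times> B. \<Sum>\<tau>2\<in>B. T z \<tau>2)"
  proof -
    have "(l * n ^ 6 / K\<^sup>2)\<^sup>2 = l * (81 * n\<^sup>2) * (2 * n\<^sup>2) * (l * n ^ 8 / (162 * K ^ 4))"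
      using Kp by (simp add: field_simps eval_nat_numeral)
    then have "l * (81 * n\<^sup>2) * (2 * n\<^sup>2) * (l * n ^ 8 / (162 * K ^ 4)) \<le> l * (81 * n\<^sup>2) * (2 * n\<^sup>2) * norm R" using b1 by linarith
    then have "l * n ^ 8 / (162 * K ^ 4) \<le> norm R" by (rule mult_left_le_imp_le) (use n0 in simp)
    moreover have "l * n ^ 8 / K ^ 12 \<le> l * n ^ 8 / (162 * K ^ 4)"
      using Kp n0 by (intro divide_left_mono const_le_power[OF K, of _ 8]) auto
    ultimately show ?thesis using Rle by linarith
  qed
  have Tu: "(\<Sum>\<tau>2\<in>B. T z \<tau>2) \<le> 162 * n ^ 4" for z
  proof -
    have "T z \<tau>2 \<le> of_int M" for \<tau>2
    proof -
      have "T z \<tau>2 \<le> (\<Sum>y\<in>{0..<M}. 1)" unfolding T_def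
        using unit_periodic_norm[OF Pp] unit_periodic_norm[OF Qp] by (intro sum_norm_le) (simp add: norm_mult mult_le_one)
      then show ?thesis using M0 by simp
    qed
    then have "(\<Sum>\<tau>2\<in>B. T z \<tau>2) \<le> real (card B) * of_int M" using sum_bounded_above[of B "T z" "of_int M"] by simp
    also have "\<dots> \<le> 81 * n\<^sup>2 * of_int M" using cB M0 by (intro mult_right_mono) auto
    finally show ?thesis unfolding Mn by (simp add: eval_nat_numeral)
  qed
  define H where "H = {z\<in>X \<times> B \<times> B. n ^ 4 / (13122 * K ^ 12) \<le> (\<Sum>\<tau>2\<in>B. T z \<tau>2)}"
  have "l * n ^ 8 / K ^ 12 / 2 \<le> 162 * n ^ 4 * real (card H)"
    unfolding H_def
  proof (rule card_large_terms[OF _ Tu _ _ _ lower])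
    have "real (card (X \<times> B \<times> B)) \<le> l * ((81 * n\<^sup>2) * (81 * n\<^sup>2))"
      unfolding card_cartesian_product of_nat_mult using cX cB n0 by (intro mult_mono) auto
    then have "2 * (n ^ 4 / (13122 * K ^ 12)) * real (card (X \<times> B \<times> B)) \<le> 2 * (n ^ 4 / (13122 * K ^ 12)) * (l * ((81 * n\<^sup>2) * (81 * n\<^sup>2)))"
      using n0 Kp by (intro mult_left_mono) auto
    also have "\<dots> = l * n ^ 8 / K ^ 12" using Kp by (simp add: eval_nat_numeral)
    finally show "2 * (n ^ 4 / (13122 * K ^ 12)) * real (card (X \<times> B \<times> B)) \<le> l * n ^ 8 / K ^ 12" .
  qed (use finX finB n0 Kp in auto)
  also have "l * n ^ 8 / K ^ 12 / 2 = 162 * n ^ 4 * (l * n ^ 4 / (324 * K ^ 12))" by (simp add: eval_nat_numeral)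
  finally have "l * n ^ 4 / (324 * K ^ 12) \<le> real (card H)" by (rule mult_left_le_imp_le) (use n0 in simp)
  moreover have "l * n ^ 4 / K ^ 21 \<le> l * n ^ 4 / (324 * K ^ 12)"
    using Kp n0 by (intro divide_left_mono const_le_power[OF K, of _ 9]) auto
  ultimately have cH: "l * n ^ 4 / K ^ 21 \<le> real (card H)" by linarith
  define K' where "K' = K ^ 58"
  have K'2: "K' \<ge> 2" using self_le_power[of K 58] K unfolding K'_def by simp
  have "H \<subseteq> {(x, \<tau>1, \<tau>1')\<in>X \<times> gbox N \<times> gbox N. \<exists>\<xi>. n\<^sup>2 / K ^ 7192 \<le> norm (zft M (\<lambda>y. F x (y + bstep \<tau>1) * cnj (F x (y + bstep \<tau>1'))) \<xi>)}"
  proof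
    fix z assume z: "z \<in> H"
    obtain x \<tau>1 \<tau>1' where zz: "z = (x, \<tau>1, \<tau>1')" by (metis surj_pair)
    have "(n ^ 4 / (13122 * K ^ 12))\<^sup>2 \<le> (\<Sum>\<tau>2\<in>B. T z \<tau>2)\<^sup>2"
      using z n0 Kp unfolding H_def by (intro power_mono) auto
    also have "\<dots> \<le> (\<Sum>\<tau>2\<in>B. (T z \<tau>2)\<^sup>2) * real (card B)" by (rule sum_squared_le_sum_of_squares)
    also have "\<dots> \<le> (\<Sum>\<tau>2\<in>B. (T z \<tau>2)\<^sup>2) * (81 * n\<^sup>2)" using cB by (intro mult_left_mono sum_nonneg) auto
    finally have "81 * n\<^sup>2 * (n ^ 6 / (81 * 13122\<^sup>2 * K ^ 24)) \<le> 81 * n\<^sup>2 * (\<Sum>\<tau>2\<in>B. (T z \<tau>2)\<^sup>2)"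
      by (simp add: eval_nat_numeral mult_ac)
    then have "n ^ 6 / (81 * 13122\<^sup>2 * K ^ 24) \<le> (\<Sum>\<tau>2\<in>B. (T z \<tau>2)\<^sup>2)" by (rule mult_left_le_imp_le) (use n0 in simp)
    moreover have "n ^ 6 / K' \<le> n ^ 6 / (81 * 13122\<^sup>2 * K ^ 24)"
      unfolding K'_def using Kp n0 by (intro divide_left_mono const_le_power[OF K, of _ 34]) auto
    ultimately have "n ^ 6 / K' \<le> (\<Sum>b\<in>gbox N. (norm (\<Sum>y\<in>{0..<M}. cnj (Pf x \<tau>1 \<tau>1' y) * Qf x \<tau>1 \<tau>1' (y + bstep b)))\<^sup>2)"
      unfolding T_def zz B_def by simp
    moreover have "K' ^ 40 \<le> n" using N unfolding K'_def by (simp flip: power_mult)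
    ultimately obtain \<xi> where "n\<^sup>2 / K' ^ 124 \<le> norm (zft M (Qf x \<tau>1 \<tau>1') \<xi>)"
      using large_zft_of_box_correlations[OF K'2 _ M Pp Qp] by blast
    then have "n\<^sup>2 / K ^ 7192 \<le> norm (zft M (Qf x \<tau>1 \<tau>1') \<xi>)" unfolding K'_def by (simp flip: power_mult)
    then show "z \<in> {(x, \<tau>1, \<tau>1')\<in>X \<times> gbox N \<times> gbox N. \<exists>\<xi>. n\<^sup>2 / K ^ 7192 \<le> norm (zft M (\<lambda>y. F x (y + bstep \<tau>1) * cnj (F x (y + bstep \<tau>1'))) \<xi>)}"
      using z unfolding zz H_def B_def Qf_def by auto
  qed
  then have "card H \<le> card {(x, \<tau>1, \<tau>1')\<in>X \<times> gbox N \<times> gbox N. \<exists>\<xi>. n\<^sup>2 / K ^ 7192 \<le> norm (zft M (\<lambda>y. F x (y + bstep \<tau>1) * cnj (F x (y + bstep \<tau>1'))) \<xi>)}"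
    by (rule card_mono[rotated]) (rule finite_subset[of _ "X \<times> gbox N \<times> gbox N"], use finX in auto)
  then show ?thesis using cH by linarith
qed

text \<open>The scheme of the second differences, one degree lower. One step is frozen as
  \<open>\<sigma> x\<close>, and opening the remaining shifted dual function shows that differences
  of \<open>\<phi> x\<close> are major for many pairs of steps. Freezing a second step
  \<open>\<rho> x\<close> and a residue \<open>\<mu>\<close> makes \<open>\<phi> x \<tau>\<close>
  constant modulo \<open>M\<close> on a dense set of \<open>\<tau>\<close>. The phase then no longer
  depends on the step, and the correlations along the box give a large coefficient of
  \<open>F x\<close>.\<close>

lemma large_coefficient_of_differences:
  assumes K: "K \<ge> 2" and K': "K' = K ^ 33" and N: "n \<ge> K' ^ 50000" "n \<le> l * K'"
    and big: "l * n ^ 4 / K \<le> real (card {(x, \<tau>, \<tau>')\<in>X \<times> gbox N \<times> gbox N. \<exists>\<xi>. n\<^sup>2 / K \<le> norm (zft M (\<lambda>y. F x (y + bstep \<tau>) * cnj (F x (y + bstep \<tau>'))) \<xi>)})"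
  shows "l / K ^ 39642 \<le> real (card {x\<in>X. \<exists>\<xi>. n\<^sup>2 / K ^ 4914988 \<le> norm (zft M (F x) \<xi>)})"
proof -
  have Kp: "K > 0" "K \<ge> 1" using K by auto
  have K'2: "K' \<ge> 2" using self_le_power[of K 33] K unfolding K' by simp
  have K'p: "K' \<ge> 1" using K'2 by simp
  define B where "B = gbox N"
  have finB: "finite B" unfolding B_def by simp
  have Bne: "B \<noteq> {}" using N0 unfolding B_def gbox_def by auto
  have cB: "real (card B) \<le> 81 * n\<^sup>2" unfolding B_def by (rule cg)
  define I where "I = {-j<..<j}"
  define P where "P = (\<lambda>x \<tau>' \<tau>. \<exists>\<xi>. n\<^sup>2 / K \<le> norm (zft M (\<lambda>y. F x (y + bstep \<tau>) * cnj (F x (y + bstep \<tau>'))) \<xi>))"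
  obtain \<sigma> where \<sigma>: "real (card {(x, a, b)\<in>X \<times> B \<times> B. P x a b}) \<le> real (card B) * real (card {(x, b)\<in>X \<times> B. P x (\<sigma> x) b})"
    using choose_slice[OF finX finB finB Bne, of P] by blast
  define E where "E = {(x, b)\<in>X \<times> B. P x (\<sigma> x) b}"
  have cE: "l * n\<^sup>2 / K ^ 8 \<le> real (card E)"
  proof -
    have "card {(x, \<tau>, \<tau>')\<in>X \<times> gbox N \<times> gbox N. \<exists>\<xi>. n\<^sup>2 / K \<le> norm (zft M (\<lambda>y. F x (y + bstep \<tau>) * cnj (F x (y + bstep \<tau>'))) \<xi>)}
       = card {(x, a, b)\<in>X \<times> B \<times> B. P x a b}"
      by (rule bij_betw_same_card[of "\<lambda>(x, a, b). (x, b, a)"], rule bij_betw_byWitness[where f' = "\<lambda>(x, a, b). (x, b, a)"])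
        (auto simp: P_def B_def)
    then have "l * n ^ 4 / K \<le> real (card B) * real (card E)" using big \<sigma> unfolding E_def by linarith
    also have "\<dots> \<le> 81 * n\<^sup>2 * real (card E)" using cB by (intro mult_right_mono) auto
    finally have "81 * n\<^sup>2 * (l * n\<^sup>2 / (81 * K)) \<le> 81 * n\<^sup>2 * real (card E)" by (simp add: eval_nat_numeral mult_ac)
    then have "l * n\<^sup>2 / (81 * K) \<le> real (card E)" by (rule mult_left_le_imp_le) (use n0 in simp)
    moreover have "l * n\<^sup>2 / K ^ 8 \<le> l * n\<^sup>2 / (81 * K)"
      using const_le_power[OF K, of 81 7 1 8] Kp n0 by (intro divide_left_mono) auto
    ultimately show ?thesis by linarith
  qed
  have "\<forall>x \<tau>. \<exists>\<xi>. (x, \<tau>) \<in> E \<longrightarrow> n\<^sup>2 / K \<le> norm (zft M (\<lambda>y. F x (y + bstep \<tau>) * cnj (F x (y + bstep (\<sigma> x)))) \<xi>)"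
    unfolding E_def P_def by auto
  then obtain \<phi> where \<phi>: "\<And>x \<tau>. (x, \<tau>) \<in> E \<Longrightarrow> n\<^sup>2 / K \<le> norm (zft M (\<lambda>y. F x (y + bstep \<tau>) * cnj (F x (y + bstep (\<sigma> x)))) (\<phi> x \<tau>))"
    by metis
  define Pf where "Pf = (\<lambda>x y. cnj (F x (y + bstep (\<sigma> x))))"
  have Pp: "unit_periodic M (Pf x)" for x unfolding Pf_def by (intro unit_periodic_cnj Fsh)
  define Z where "Z = (\<lambda>x \<tau>. \<Sum>y\<in>{0..<M}. Pf x y * F x (y + bstep \<tau>) * zchar M (- (\<phi> x \<tau> * y)))"
  have Zb: "n\<^sup>2 / K \<le> norm (Z x \<tau>)" if "(x, \<tau>) \<in> E" for x \<tau>
    using \<phi>[OF that] unfolding Z_def Pf_def zft_def by (simp add: mult_ac)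
  obtain al where al: "norm (al z) \<le> 1" "al z * z = complex_of_real (norm z)" for z
    using unimodular_align by metis
  define w where "w = (\<lambda>x \<tau>. if (x, \<tau>) \<in> E then al (Z x \<tau>) else 0)"
  have w1: "norm (w x \<tau>) \<le> 1" for x \<tau> unfolding w_def using al by simp
  define v where "v = (\<lambda>(x, d) \<tau> y. w x \<tau> * G d x (y + bstep \<tau>) * zchar M (- (\<phi> x \<tau> * y)))"
  have vp: "unit_periodic M (v p \<tau>)" for p \<tau>
    unfolding v_def by (cases p) (auto intro!: unit_periodic_mult unit_periodic_const w1 Gsh zch)
  have S0: "2 * l * n ^ 5 / K ^ 9 \<le> norm (\<Sum>p\<in>X \<times> I. \<Sum>\<tau>\<in>B. \<Sum>y\<in>{0..<M}. Pf (fst p) (y + 0) * v p \<tau> y)"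
  proof -
    have "(\<Sum>p\<in>X \<times> I. \<Sum>\<tau>\<in>B. \<Sum>y\<in>{0..<M}. Pf (fst p) (y + 0) * v p \<tau> y) = (\<Sum>x\<in>X. \<Sum>d\<in>I. \<Sum>\<tau>\<in>B. \<Sum>y\<in>{0..<M}. Pf x y * v (x, d) \<tau> y)"
      by (simp add: sum.cartesian_product')
    also have "\<dots> = (\<Sum>x\<in>X. \<Sum>\<tau>\<in>B. \<Sum>y\<in>{0..<M}. \<Sum>d\<in>I. Pf x y * v (x, d) \<tau> y)"
      by (rule sum.cong[OF refl], rule sum_swap3)
    also have "\<dots> = (\<Sum>x\<in>X. \<Sum>\<tau>\<in>B. 2 * of_int N * (w x \<tau> * Z x \<tau>))"
    proof (rule sum.cong[OF refl], rule sum.cong[OF refl])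
      fix x \<tau>
      have "(\<Sum>d\<in>I. Pf x y * v (x, d) \<tau> y) = 2 * of_int N * (w x \<tau> * (Pf x y * F x (y + bstep \<tau>) * zchar M (- (\<phi> x \<tau> * y))))" for y
      proof -
        have "(\<Sum>d\<in>I. Pf x y * v (x, d) \<tau> y) = (Pf x y * w x \<tau> * zchar M (- (\<phi> x \<tau> * y))) * (\<Sum>d\<in>I. G d x (y + bstep \<tau>))"
          unfolding v_def prod.case sum_distrib_left by (simp add: mult_ac)
        then show ?thesis unfolding I_def F_expand[symmetric] by (simp add: mult_ac)
      qed
      then show "(\<Sum>y\<in>{0..<M}. \<Sum>d\<in>I. Pf x y * v (x, d) \<tau> y) = 2 * of_int N * (w x \<tau> * Z x \<tau>)"
        unfolding Z_def by (simp only: sum_distrib_left)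
    qed
    also have "\<dots> = (\<Sum>z\<in>X \<times> B. 2 * of_int N * (w (fst z) (snd z) * Z (fst z) (snd z)))"
      by (simp add: sum.cartesian_product')
    also have "\<dots> = (\<Sum>z\<in>E. 2 * of_int N * (w (fst z) (snd z) * Z (fst z) (snd z)))"
      by (rule sum.mono_neutral_right) (use finX finB in \<open>auto simp: w_def E_def\<close>)
    also have "\<dots> = complex_of_real (\<Sum>z\<in>E. 2 * n * norm (Z (fst z) (snd z)))"
      unfolding of_real_sum by (rule sum.cong[OF refl]) (auto simp: w_def al)
    finally have e: "(\<Sum>p\<in>X \<times> I. \<Sum>\<tau>\<in>B. \<Sum>y\<in>{0..<M}. Pf (fst p) (y + 0) * v p \<tau> y) = complex_of_real (\<Sum>z\<in>E. 2 * n * norm (Z (fst z) (snd z)))" .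
    have "2 * l * n ^ 5 / K ^ 9 = l * n\<^sup>2 / K ^ 8 * (2 * n * (n\<^sup>2 / K))" by (simp add: eval_nat_numeral mult_ac)
    also have "\<dots> \<le> real (card E) * (2 * n * (n\<^sup>2 / K))" using cE n0 Kp by (intro mult_right_mono) auto
    also have "\<dots> = (\<Sum>z\<in>E. 2 * n * (n\<^sup>2 / K))" by simp
    also have "\<dots> \<le> (\<Sum>z\<in>E. 2 * n * norm (Z (fst z) (snd z)))"
      using Zb n0 by (intro sum_mono mult_left_mono) auto
    finally show ?thesis unfolding e norm_of_real by linarith
  qed
  define R where "R = (\<Sum>p\<in>X \<times> I. \<Sum>\<tau>\<in>B. \<Sum>\<tau>'\<in>B. \<Sum>y\<in>{0..<M}. v p \<tau> y * cnj (v p \<tau>' (y + 0 - 0)))"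
  have b1: "(2 * l * n ^ 5 / K ^ 9)\<^sup>2 \<le> l * (2 * n) * (2 * n\<^sup>2) * norm R"
  proof -
    have "(2 * l * n ^ 5 / K ^ 9)\<^sup>2 \<le> (norm (\<Sum>p\<in>X \<times> I. \<Sum>\<tau>\<in>B. \<Sum>y\<in>{0..<M}. Pf (fst p) (y + 0) * v p \<tau> y))\<^sup>2"
      using S0 n0 Kp by (intro power_mono) auto
    also have "\<dots> \<le> real (card (X \<times> I)) * of_int M * norm R"
      unfolding R_def by (rule cauchy_schwarz_shift) (use finX M0 Pp vp in \<open>auto simp: I_def\<close>)
    also have "real (card (X \<times> I)) \<le> l * (2 * n)"
      unfolding I_def card_cartesian_product of_nat_mult using cX cI n0 by (intro mult_mono) auto
    then have "real (card (X \<times> I)) * of_int M * norm R \<le> l * (2 * n) * (2 * n\<^sup>2) * norm R"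
      unfolding Mn by (intro mult_right_mono) auto
    finally show ?thesis .
  qed
  have lower: "l * n ^ 7 / K ^ 18 \<le> norm R"
  proof -
    have "(2 * l * n ^ 5 / K ^ 9)\<^sup>2 = l * (2 * n) * (2 * n\<^sup>2) * (l * n ^ 7 / K ^ 18)"
      using Kp by (simp add: field_simps eval_nat_numeral)
    then have "l * (2 * n) * (2 * n\<^sup>2) * (l * n ^ 7 / K ^ 18) \<le> l * (2 * n) * (2 * n\<^sup>2) * norm R" using b1 by linarith
    then show ?thesis by (rule mult_left_le_imp_le) (use n0 in simp)
  qed
  define \<theta> where "\<theta> = (\<lambda>q x. \<phi> x (fst q) - \<phi> x (snd q))"
  define W where "W = (\<lambda>q x. w x (fst q) * cnj (w x (snd q)))"
  have Wn: "norm (W q x) \<le> 1" for q x unfolding W_def by (simp add: norm_mult mult_le_one w1)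
  define m where "m = (\<lambda>q. card {x\<in>X. W q x \<noteq> 0 \<and> major (K' ^ 400) N (of_int (\<theta> q x) / of_int M)})"
  have cBB: "real (card (B \<times> B)) \<le> (81 * n\<^sup>2) * (81 * n\<^sup>2)"
    unfolding card_cartesian_product of_nat_mult using cB by (intro mult_mono) auto
  have N300: "n \<ge> K' ^ 300"
  proof -
    have "K' ^ 300 \<le> K' ^ 50000" using K'p by (intro power_increasing) auto
    then show ?thesis using N by linarith
  qed
  have upper: "norm R \<le> (\<Sum>q\<in>B \<times> B. 2 * l * n ^ 3 / K' + 4 * n ^ 3 * real (m q))"
  proof -
    define T where "T = (\<lambda>q x d. \<Sum>y\<in>{0..<M}. W q x * (G d x (y + bstep (fst q)) * cnj (G d x (y + bstep (snd q)))) * zchar M (- (\<theta> q x * y)))"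
    have "R = (\<Sum>x\<in>X. \<Sum>d\<in>I. \<Sum>q\<in>B \<times> B. \<Sum>y\<in>{0..<M}. v (x, d) (fst q) y * cnj (v (x, d) (snd q) y))"
      unfolding R_def by (simp add: sum.cartesian_product')
    also have "\<dots> = (\<Sum>x\<in>X. \<Sum>d\<in>I. \<Sum>q\<in>B \<times> B. T q x d)"
    proof -
      have "v (x, d) (fst q) y * cnj (v (x, d) (snd q) y) = W q x * (G d x (y + bstep (fst q)) * cnj (G d x (y + bstep (snd q)))) * zchar M (- (\<theta> q x * y))" for x d q y
      proof -
        have z: "zchar M (- (\<theta> q x * y)) = zchar M (- (\<phi> x (fst q) * y)) * cnj (zchar M (- (\<phi> x (snd q) * y)))"
          unfolding zchar_diff[symmetric] \<theta>_def by (simp add: algebra_simps)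
        show ?thesis unfolding v_def W_def prod.case z by (simp add: mult_ac)
      qed
      then show ?thesis unfolding T_def by simp
    qed
    also have "\<dots> = (\<Sum>q\<in>B \<times> B. \<Sum>x\<in>X. \<Sum>d\<in>I. T q x d)" by (rule sum_swap3[symmetric])
    also have "norm \<dots> \<le> (\<Sum>q\<in>B \<times> B. 2 * l * n ^ 3 / K' + 4 * n ^ 3 * real (m q))"
      unfolding T_def m_def I_def by (intro sum_norm_le phase_sum_G2[OF K'2 N300 N(2) Wn])
    finally show ?thesis .
  qed
  define C where "C = {(x, \<tau>', \<tau>)\<in>X \<times> B \<times> B. (x, \<tau>) \<in> E \<and> major (K' ^ 400) N (of_int (\<phi> x \<tau> - \<phi> x \<tau>') / of_int M)}"
  have "l * n ^ 4 / K ^ 21 \<le> (\<Sum>q\<in>B \<times> B. real (m q))"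
  proof -
    have "real (card (B \<times> B)) * (2 * l * n ^ 3 / K') \<le> (81 * n\<^sup>2) * (81 * n\<^sup>2) * (2 * l * n ^ 3 / K')"
      using cBB n0 K'2 by (intro mult_right_mono) auto
    also have "\<dots> = l * n ^ 7 * (13122 / K')" by (simp add: eval_nat_numeral)
    also have "\<dots> \<le> l * n ^ 7 * (1 / (2 * K ^ 18))"
    proof (rule mult_left_mono)
      have "26244 * K ^ 18 \<le> K'" unfolding K' by (rule const_le_power[OF K, of _ 15]) auto
      then show "13122 / K' \<le> 1 / (2 * K ^ 18)" using K'2 Kp by (simp add: field_simps)
    qed (use n0 in auto)
    finally have u: "real (card (B \<times> B)) * (2 * l * n ^ 3 / K') \<le> l * n ^ 7 / K ^ 18 / 2" by simp
    have t: "(\<Sum>q\<in>B \<times> B. 2 * l * n ^ 3 / K' + 4 * n ^ 3 * real (m q)) = real (card (B \<times> B)) * (2 * l * n ^ 3 / K') + 4 * n ^ 3 * (\<Sum>q\<in>B \<times> B. real (m q))"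
      by (simp add: sum.distrib sum_distrib_left)
    have "l * n ^ 7 / K ^ 18 / 2 \<le> 4 * n ^ 3 * (\<Sum>q\<in>B \<times> B. real (m q))"
      by (rule half_absorb[OF lower upper t u])
    moreover have "l * n ^ 7 / K ^ 18 / 2 = 4 * n ^ 3 * (l * n ^ 4 / (8 * K ^ 18))" by (simp add: eval_nat_numeral)
    ultimately have "4 * n ^ 3 * (l * n ^ 4 / (8 * K ^ 18)) \<le> 4 * n ^ 3 * (\<Sum>q\<in>B \<times> B. real (m q))" by simp
    then have "l * n ^ 4 / (8 * K ^ 18) \<le> (\<Sum>q\<in>B \<times> B. real (m q))" by (rule mult_left_le_imp_le) (use n0 in simp)
    moreover have "l * n ^ 4 / K ^ 21 \<le> l * n ^ 4 / (8 * K ^ 18)"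
      using Kp n0 by (intro divide_left_mono const_le_power[OF K, of _ 3]) auto
    ultimately show ?thesis by linarith
  qed
  also have "\<dots> = real (card (Sigma (B \<times> B) (\<lambda>q. {x\<in>X. W q x \<noteq> 0 \<and> major (K' ^ 400) N (of_int (\<theta> q x) / of_int M)})))"
    unfolding m_def using finX finB by simp
  also have "card (Sigma (B \<times> B) (\<lambda>q. {x\<in>X. W q x \<noteq> 0 \<and> major (K' ^ 400) N (of_int (\<theta> q x) / of_int M)})) \<le> card C"
  proof (rule card_inj_on_le[of "\<lambda>(q, x). (x, snd q, fst q)"])
    show "inj_on (\<lambda>(q, x). (x, snd q, fst q)) (Sigma (B \<times> B) (\<lambda>q. {x\<in>X. W q x \<noteq> 0 \<and> major (K' ^ 400) N (of_int (\<theta> q x) / of_int M)}))"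
      by (auto simp: inj_on_def)
    show "(\<lambda>(q, x). (x, snd q, fst q)) ` Sigma (B \<times> B) (\<lambda>q. {x\<in>X. W q x \<noteq> 0 \<and> major (K' ^ 400) N (of_int (\<theta> q x) / of_int M)}) \<subseteq> C"
      unfolding C_def W_def \<theta>_def w_def by (auto split: if_splits)
    show "finite C" by (rule finite_subset[of _ "X \<times> B \<times> B"]) (use finX finB in \<open>auto simp: C_def\<close>)
  qed
  finally have cC: "l * n ^ 4 / K ^ 21 \<le> real (card C)" by simp
  obtain \<rho> where \<rho>: "real (card {(x, a, b)\<in>X \<times> B \<times> B. (x, b) \<in> E \<and> major (K' ^ 400) N (of_int (\<phi> x b - \<phi> x a) / of_int M)})
      \<le> real (card B) * real (card {(x, b)\<in>X \<times> B. (x, b) \<in> E \<and> major (K' ^ 400) N (of_int (\<phi> x b - \<phi> x (\<rho> x)) / of_int M)})"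
    using choose_slice[OF finX finB finB Bne, of "\<lambda>x a b. (x, b) \<in> E \<and> major (K' ^ 400) N (of_int (\<phi> x b - \<phi> x a) / of_int M)"] by blast
  define D where "D = {(x, b)\<in>X \<times> B. (x, b) \<in> E \<and> major (K' ^ 400) N (of_int (\<phi> x b - \<phi> x (\<rho> x)) / of_int M)}"
  have finD: "finite D" by (rule finite_subset[of _ "X \<times> B"]) (use finX finB in \<open>auto simp: D_def\<close>)
  have cD: "l * n\<^sup>2 / K ^ 28 \<le> real (card D)"
  proof -
    have "l * n ^ 4 / K ^ 21 \<le> real (card B) * real (card D)" using cC \<rho> unfolding C_def D_def by linarith
    also have "\<dots> \<le> 81 * n\<^sup>2 * real (card D)" using cB by (intro mult_right_mono) auto
    finally have "81 * n\<^sup>2 * (l * n\<^sup>2 / (81 * K ^ 21)) \<le> 81 * n\<^sup>2 * real (card D)" by (simp add: eval_nat_numeral mult_ac)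
    then have "l * n\<^sup>2 / (81 * K ^ 21) \<le> real (card D)" by (rule mult_left_le_imp_le) (use n0 in simp)
    moreover have "l * n\<^sup>2 / K ^ 28 \<le> l * n\<^sup>2 / (81 * K ^ 21)"
      using Kp n0 by (intro divide_left_mono const_le_power[OF K, of _ 7]) auto
    ultimately show ?thesis by linarith
  qed
  have "0 < l * n\<^sup>2 / K ^ 28" using n0 Kp by simp
  then have Dne: "D \<noteq> {}" using cD by auto
  define Q where "Q = K' ^ 400"
  have Q1: "Q \<ge> 1" unfolding Q_def using K'p by simp
  have Qn: "Q \<le> n"
  proof -
    have "Q \<le> K' ^ 50000" unfolding Q_def using K'p by (intro power_increasing) auto
    then show ?thesis using N by linarith
  qed
  have "major Q N (of_int (\<phi> (fst z) (snd z) - \<phi> (fst z) (\<rho> (fst z))) / of_int M)" if "z \<in> D" for z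
    using that unfolding D_def Q_def by auto
  then obtain \<mu> where mu: "real (card D) / (60 * Q ^ 3) \<le> real (card {z\<in>D. M dvd (\<phi> (fst z) (snd z) - \<phi> (fst z) (\<rho> (fst z))) - \<mu>})"
    using major_pigeonhole[OF Q1 Qn finD Dne, of "\<lambda>z. \<phi> (fst z) (snd z) - \<phi> (fst z) (\<rho> (fst z))"] by blast
  define E3 where "E3 = {z\<in>D. M dvd (\<phi> (fst z) (snd z) - \<phi> (fst z) (\<rho> (fst z))) - \<mu>}"
  define a where "a = (\<lambda>x. \<phi> x (\<rho> x) + \<mu>)"
  have cE3: "l * n\<^sup>2 / K ^ 39634 \<le> real (card E3)"
  proof -
    \<comment> \<open>The number of major residues costs \<open>Q^3 = K^39600\<close>, with
      \<open>Q = K'^400\<close> and \<open>K' = K^33\<close>; adding the loss \<open>K^28\<close> of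
      \<open>cD\<close> and six powers for the factor \<open>60\<close> gives
      \<open>39634\<close>.\<close>
    have "60 * Q ^ 3 * K ^ 28 = 60 * K ^ 39628" unfolding Q_def K' by (simp flip: power_mult power_add)
    also have "\<dots> \<le> K ^ 39634" by (rule const_le_power[OF K, of _ 6]) auto
    finally have "l * n\<^sup>2 / K ^ 39634 \<le> l * n\<^sup>2 / (60 * Q ^ 3 * K ^ 28)"
      using n0 Kp Q1 by (intro divide_left_mono) auto
    also have "\<dots> = l * n\<^sup>2 / K ^ 28 / (60 * Q ^ 3)" by (simp add: mult.commute)
    also have "\<dots> \<le> real (card D) / (60 * Q ^ 3)" using cD Q1 by (intro divide_right_mono) auto
    finally show ?thesis using mu unfolding E3_def by linarith
  qed
  define S where "S = (\<lambda>x. {\<tau>\<in>B. (x, \<tau>) \<in> E3})"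
  have finS: "finite (S x)" for x unfolding S_def using finB by simp
  have sumS: "l * n\<^sup>2 / K ^ 39634 \<le> (\<Sum>x\<in>X. real (card (S x)))"
  proof -
    have "E3 = Sigma X S" unfolding E3_def S_def D_def by auto
    then have "card E3 = (\<Sum>x\<in>X. card (S x))" using finX finS by simp
    then show ?thesis using cE3 by simp
  qed
  have Su: "real (card (S x)) \<le> 81 * n\<^sup>2" for x
  proof -
    have "card (S x) \<le> card B" unfolding S_def using finB by (intro card_mono) auto
    then show ?thesis using cB by linarith
  qed
  define Y where "Y = {x\<in>X. n\<^sup>2 / (2 * K ^ 39634) \<le> real (card (S x))}"
  have "l * n\<^sup>2 / K ^ 39634 / 2 \<le> 81 * n\<^sup>2 * real (card Y)"
    unfolding Y_def
  proof (rule card_large_terms[OF finX Su _ _ _ sumS])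
    have "2 * (n\<^sup>2 / (2 * K ^ 39634)) * real (card X) \<le> 2 * (n\<^sup>2 / (2 * K ^ 39634)) * l"
      using cX Kp by (intro mult_left_mono) auto
    then show "2 * (n\<^sup>2 / (2 * K ^ 39634)) * real (card X) \<le> l * n\<^sup>2 / K ^ 39634" by (simp add: mult.commute)
  qed (use n0 Kp in auto)
  also have "l * n\<^sup>2 / K ^ 39634 / 2 = 81 * n\<^sup>2 * (l / (162 * K ^ 39634))" by simp
  finally have "l / (162 * K ^ 39634) \<le> real (card Y)" by (rule mult_left_le_imp_le) (use n0 in simp)
  moreover have "l / K ^ 39642 \<le> l / (162 * K ^ 39634)"
    using Kp n0 by (intro divide_left_mono const_le_power[OF K, of _ 8]) auto
  ultimately have cY: "l / K ^ 39642 \<le> real (card Y)" by linarith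
  \<comment> \<open>\<open>39637 = 39634 + 2 + 1\<close>: the density of \<open>S x\<close>, the
    square of the coefficient bound and a factor \<open>2\<close>. The box correlation lemma raises
    this to \<open>39637 * 124 = 4914988\<close>.\<close>
  define K2 where "K2 = K ^ 39637"
  have K22: "K2 \<ge> 2" using self_le_power[of K 39637] K unfolding K2_def by simp
  have "Y \<subseteq> {x\<in>X. \<exists>\<xi>. n\<^sup>2 / K ^ 4914988 \<le> norm (zft M (F x) \<xi>)}"
  proof
    fix x assume x: "x \<in> Y"
    define Pc where "Pc = (\<lambda>y. cnj (Pf x y) * zchar M (a x * y))"
    have Pcp: "unit_periodic M Pc" unfolding Pc_def by (intro unit_periodic_mult unit_periodic_cnj Pp unit_periodic_zchar M0)
    have tm: "n\<^sup>2 / K \<le> norm (\<Sum>y\<in>{0..<M}. cnj (Pc y) * F x (y + bstep \<tau>))" if "\<tau> \<in> S x" for \<tau>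
    proof -
      have t: "(x, \<tau>) \<in> E" "M dvd (\<phi> x \<tau> - \<phi> x (\<rho> x)) - \<mu>" using that unfolding S_def E3_def D_def by auto
      have "zchar M (- (\<phi> x \<tau> * y)) = zchar M (- (a x * y))" for y
      proof (rule zchar_dvd_cong[OF M0])
        have "- (\<phi> x \<tau> * y) - - (a x * y) = ((\<phi> x \<tau> - \<phi> x (\<rho> x)) - \<mu>) * (- y)" unfolding a_def by (simp add: algebra_simps)
        then show "M dvd - (\<phi> x \<tau> * y) - - (a x * y)" using t(2) by simp
      qed
      then have "Z x \<tau> = (\<Sum>y\<in>{0..<M}. cnj (Pc y) * F x (y + bstep \<tau>))"
        unfolding Z_def Pc_def by (simp add: cnj_zchar mult_ac)
      then show ?thesis using Zb[OF t(1)] by simp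
    qed
    have "n ^ 6 / K2 \<le> n\<^sup>2 / (2 * K ^ 39634) * (n\<^sup>2 / K)\<^sup>2"
    proof -
      have "2 * K ^ 39636 \<le> K2" unfolding K2_def by (rule const_le_power[OF K, of _ 1]) auto
      then have "n ^ 6 / K2 \<le> n ^ 6 / (2 * K ^ 39636)" using n0 Kp K22 by (intro divide_left_mono mult_pos_pos) auto
      also have "\<dots> = n\<^sup>2 / (2 * K ^ 39634) * (n\<^sup>2 / K)\<^sup>2"
      proof -
        have e: "K ^ 39636 = K ^ 39634 * K\<^sup>2" "n ^ 6 = n\<^sup>2 * (n\<^sup>2)\<^sup>2" by (simp_all flip: power_add power_mult)
        show ?thesis unfolding e power_divide times_divide_times_eq by (simp only: mult.assoc)
      qed
      finally show ?thesis .
    qed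
    also have "\<dots> \<le> real (card (S x)) * (n\<^sup>2 / K)\<^sup>2" using x unfolding Y_def by (intro mult_right_mono) auto
    also have "\<dots> = (\<Sum>\<tau>\<in>S x. (n\<^sup>2 / K)\<^sup>2)" by simp
    also have "\<dots> \<le> (\<Sum>\<tau>\<in>S x. (norm (\<Sum>y\<in>{0..<M}. cnj (Pc y) * F x (y + bstep \<tau>)))\<^sup>2)"
      using tm n0 Kp by (intro sum_mono power_mono) auto
    also have "\<dots> \<le> (\<Sum>\<tau>\<in>gbox N. (norm (\<Sum>y\<in>{0..<M}. cnj (Pc y) * F x (y + bstep \<tau>)))\<^sup>2)"
      unfolding S_def B_def by (intro sum_mono2) auto
    finally have "n ^ 6 / K2 \<le> (\<Sum>\<tau>\<in>gbox N. (norm (\<Sum>y\<in>{0..<M}. cnj (Pc y) * F x (y + bstep \<tau>)))\<^sup>2)" .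
    moreover have "K2 ^ 40 \<le> n"
    proof -
      have "K2 ^ 40 = K ^ 1585480" unfolding K2_def by (simp flip: power_mult)
      also have "\<dots> \<le> K ^ 1650000" using Kp by (intro power_increasing) auto
      also have "\<dots> = K' ^ 50000" unfolding K' by (simp flip: power_mult)
      finally show ?thesis using N by linarith
    qed
    ultimately obtain \<xi> where "n\<^sup>2 / K2 ^ 124 \<le> norm (zft M (F x) \<xi>)"
      using large_zft_of_box_correlations[OF K22 _ M Pcp Fp] by blast
    then have "n\<^sup>2 / K ^ 4914988 \<le> norm (zft M (F x) \<xi>)" unfolding K2_def by (simp flip: power_mult)
    then show "x \<in> {x\<in>X. \<exists>\<xi>. n\<^sup>2 / K ^ 4914988 \<le> norm (zft M (F x) \<xi>)}" using x unfolding Y_def by blast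
  qed
  then have "card Y \<le> card {x\<in>X. \<exists>\<xi>. n\<^sup>2 / K ^ 4914988 \<le> norm (zft M (F x) \<xi>)}"
    using finX by (intro card_mono) auto
  then show ?thesis using cY by linarith
qed

text \<open>With weights aligned to one large coefficient per \<open>x\<close>, the phase sum is at
  least \<open>2 * l * n^3 / K^2\<close>. If none of these frequencies were major,
  \<open>phase_sum_le_major_count\<close> would leave at most
  \<open>2 * l * n^3 / K^3\<close>.\<close>

lemma major_large_coefficient:
  assumes K: "K \<ge> 2" and K': "K' = K ^ 3" and N: "n \<ge> K' ^ 300" "n \<le> l * K'"
    and big: "l / K \<le> real (card {x\<in>X. \<exists>\<xi>. n\<^sup>2 / K \<le> norm (zft M (F x) \<xi>)})"
  shows "\<exists>x\<in>X. \<exists>\<xi>. n\<^sup>2 / K \<le> norm (zft M (F x) \<xi>) \<and> major (K' ^ 400) N (of_int \<xi> / of_int M)"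
proof (rule ccontr)
  assume neg: "\<not> ?thesis"
  have Kp: "K > 0" "K \<ge> 1" using K by auto
  have K'2: "K' \<ge> 2" using self_le_power[of K 3] K unfolding K' by simp
  define Y where "Y = {x\<in>X. \<exists>\<xi>. n\<^sup>2 / K \<le> norm (zft M (F x) \<xi>)}"
  define I where "I = {-j<..<j}"
  have "\<forall>x. \<exists>\<xi>. x \<in> Y \<longrightarrow> n\<^sup>2 / K \<le> norm (zft M (F x) \<xi>)" unfolding Y_def by auto
  then obtain \<phi> where \<phi>: "\<And>x. x \<in> Y \<Longrightarrow> n\<^sup>2 / K \<le> norm (zft M (F x) (\<phi> x))" by metis
  obtain al where al: "norm (al z) \<le> 1" "al z * z = complex_of_real (norm z)" for z
    using unimodular_align by metis
  define w where "w = (\<lambda>x. if x \<in> Y then al (zft M (F x) (\<phi> x)) else 0)"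
  have w1: "norm (w x) \<le> 1" for x unfolding w_def using al by simp
  have "(\<Sum>x\<in>X. \<Sum>d\<in>I. \<Sum>y\<in>{0..<M}. w x * (f0 x (y - d\<^sup>2) * f1 (x + d) (y - d\<^sup>2) * zchar M (- (\<phi> x * y))))
      = (\<Sum>x\<in>X. 2 * of_int N * (w x * zft M (F x) (\<phi> x)))"
  proof (rule sum.cong[OF refl])
    fix x
    have "(\<Sum>d\<in>I. \<Sum>y\<in>{0..<M}. w x * (f0 x (y - d\<^sup>2) * f1 (x + d) (y - d\<^sup>2) * zchar M (- (\<phi> x * y))))
       = (\<Sum>y\<in>{0..<M}. \<Sum>d\<in>I. w x * (f0 x (y - d\<^sup>2) * f1 (x + d) (y - d\<^sup>2) * zchar M (- (\<phi> x * y))))"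
      by (rule sum.swap)
    also have "\<dots> = (\<Sum>y\<in>{0..<M}. w x * zchar M (- (\<phi> x * y)) * (\<Sum>d\<in>I. G d x y))"
      unfolding G_def sum_distrib_left by (simp add: mult_ac)
    also have "\<dots> = 2 * of_int N * (w x * zft M (F x) (\<phi> x))"
      unfolding I_def F_expand[symmetric] zft_def sum_distrib_left by (simp add: mult_ac)
    finally show "(\<Sum>d\<in>I. \<Sum>y\<in>{0..<M}. w x * (f0 x (y - d\<^sup>2) * f1 (x + d) (y - d\<^sup>2) * zchar M (- (\<phi> x * y)))) = 2 * of_int N * (w x * zft M (F x) (\<phi> x))" .
  qed
  also have "\<dots> = (\<Sum>x\<in>Y. 2 * of_int N * (w x * zft M (F x) (\<phi> x)))"
    by (rule sum.mono_neutral_right[OF finX]) (auto simp: Y_def w_def)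
  also have "\<dots> = complex_of_real (\<Sum>x\<in>Y. 2 * n * norm (zft M (F x) (\<phi> x)))"
    unfolding of_real_sum by (rule sum.cong[OF refl]) (auto simp: w_def al)
  finally have e: "(\<Sum>x\<in>X. \<Sum>d\<in>I. \<Sum>y\<in>{0..<M}. w x * (f0 x (y - d\<^sup>2) * f1 (x + d) (y - d\<^sup>2) * zchar M (- (\<phi> x * y)))) = complex_of_real (\<Sum>x\<in>Y. 2 * n * norm (zft M (F x) (\<phi> x)))" .
  have "2 * l * n ^ 3 / K\<^sup>2 = l / K * (2 * n * (n\<^sup>2 / K))" by (simp add: eval_nat_numeral)
  also have "\<dots> \<le> real (card Y) * (2 * n * (n\<^sup>2 / K))" using big n0 Kp unfolding Y_def by (intro mult_right_mono) auto
  also have "\<dots> = (\<Sum>x\<in>Y. 2 * n * (n\<^sup>2 / K))" by simp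
  also have "\<dots> \<le> (\<Sum>x\<in>Y. 2 * n * norm (zft M (F x) (\<phi> x)))" using \<phi> n0 by (intro sum_mono mult_left_mono) auto
  also have "\<dots> \<le> norm (\<Sum>x\<in>X. \<Sum>d\<in>I. \<Sum>y\<in>{0..<M}. w x * (f0 x (y - d\<^sup>2) * f1 (x + d) (y - d\<^sup>2) * zchar M (- (\<phi> x * y))))"
    unfolding e norm_of_real by linarith
  also have "\<dots> \<le> 2 * l * n ^ 3 / K' + 4 * n ^ 3 * real (card {x\<in>X. w x \<noteq> 0 \<and> major (K' ^ 400) N (of_int (\<phi> x) / of_int M)})"
    unfolding I_def by (rule phase_sum_le_major_count[OF K'2 N(1) L N(2) j X M f0 f1 w1])
  also have "{x\<in>X. w x \<noteq> 0 \<and> major (K' ^ 400) N (of_int (\<phi> x) / of_int M)} = {}"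
    using neg \<phi> unfolding w_def by auto
  finally have "2 * l * n ^ 3 * (1 / K\<^sup>2) \<le> 2 * l * n ^ 3 * (1 / K')" by simp
  then have "1 / K\<^sup>2 \<le> 1 / K'" by (rule mult_left_le_imp_le) (use n0 in simp)
  then have "K' \<le> K\<^sup>2" using Kp K'2 by (simp add: field_simps)
  moreover have "K\<^sup>2 < K ^ 3" using K by (intro power_strict_increasing) auto
  ultimately show False unfolding K' by simp
qed

end

context dual_setup
begin

text \<open>Translating \<open>y\<close> by \<open>d^2\<close> moves the shift from \<open>h\<close>
  to \<open>f0\<close> and \<open>f1\<close>. This is the defining duality of \<open>F\<close>, used
  with \<open>f2\<close>, with the conjugate of \<open>F\<close> itself and with a character in the
  place of \<open>h\<close>.\<close>

lemma form_eq_sum_F: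
  assumes h: "unit_periodic M h"
  shows "(\<Sum>d\<in>{-j<..<j}. \<Sum>y\<in>{0..<M}. f0 x y * f1 (x + d) y * h (y + d\<^sup>2)) = 2 * of_int N * (\<Sum>y\<in>{0..<M}. F x y * h y)"
proof -
  have "(\<Sum>y\<in>{0..<M}. f0 x y * f1 (x + d) y * h (y + d\<^sup>2)) = (\<Sum>y\<in>{0..<M}. G d x y * h y)" for d
  proof -
    have "(\<Sum>y\<in>{0..<M}. f0 x y * f1 (x + d) y * h (y + d\<^sup>2)) = (\<Sum>y\<in>{0..<M}. G d x (y + d\<^sup>2) * h (y + d\<^sup>2))"
      unfolding G_def by simp
    also have "\<dots> = (\<Sum>y\<in>{0..<M}. G d x y * h y)"
      by (rule unit_periodic_sum_shift[where f = "\<lambda>y. G d x y * h y"]) (use unit_periodic_mult[OF Gp h] M0 in auto)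
    finally show ?thesis .
  qed
  then have "(\<Sum>d\<in>{-j<..<j}. \<Sum>y\<in>{0..<M}. f0 x y * f1 (x + d) y * h (y + d\<^sup>2)) = (\<Sum>d\<in>{-j<..<j}. \<Sum>y\<in>{0..<M}. G d x y * h y)"
    by simp
  also have "\<dots> = (\<Sum>y\<in>{0..<M}. \<Sum>d\<in>{-j<..<j}. G d x y * h y)" by (rule sum.swap)
  also have "\<dots> = (\<Sum>y\<in>{0..<M}. 2 * of_int N * F x y * h y)"
    unfolding F_expand sum_distrib_right ..
  also have "\<dots> = 2 * of_int N * (\<Sum>y\<in>{0..<M}. F x y * h y)" unfolding sum_distrib_left by (simp only: mult.assoc)
  finally show ?thesis .
qed

text \<open>Each \<open>Ki\<close> is the parameter after one lowering stage, and its exponent is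
  the total loss of that stage. For \<open>K3\<close> this is
  \<open>76858 = 39 + 3 * 64 * 400 + 19\<close>: the loss of \<open>dual_interchange\<close>, the
  number of major residues, and the constant \<open>393660\<close>. Lower bounds on \<open>n\<close>
  required at earlier stages follow from the last one because each parameter is a large power of its
  predecessor.\<close>

lemma major_coefficient_of_large_dual_form:
  assumes K: "K \<ge> 2" and K1: "K1 = K ^ 35" and K2: "K2 = K1 ^ 142476" and K3: "K3 = K2 ^ 76858"
    and K4: "K4 = K3 ^ 7192" and K5: "K5 = K4 ^ 4914988" and N: "n \<ge> K5 ^ 1200"
    and Ll: "l * K1 ^ 73 \<le> n" "n \<le> l * K1 ^ 75" and XN: "X \<subseteq> {1..N}"
    and big: "l * n ^ 3 / K \<le> norm (\<Sum>x\<in>X. \<Sum>d\<in>{-j<..<j}. \<Sum>y\<in>{0..<M}. f0 x y * f1 (x + d) y * cnj (F x (y + d\<^sup>2)))"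
  shows "\<exists>x\<in>X. \<exists>\<xi>. n\<^sup>2 / K5 \<le> norm (zft M (F x) \<xi>) \<and> major (K5 ^ 1200) N (of_int \<xi> / of_int M)"
proof -
  have up: "a \<ge> 2 \<Longrightarrow> b = a ^ m \<Longrightarrow> m > 0 \<Longrightarrow> b \<ge> 2 \<and> a \<le> b" for a b :: real and m
    using self_le_power[of a m] by auto
  have g: "K1 \<ge> 2" "K1 \<le> K2" using up[OF K K1] up[OF _ K2] by auto
  then have g2: "K2 \<ge> 2" "K2 \<le> K3" using up[OF _ K3] by auto
  then have g3: "K3 \<ge> 2" "K3 \<le> K4" using up[OF _ K4] by auto
  then have g4: "K4 \<ge> 2" "K4 \<le> K5" using up[OF _ K5] by auto
  then have g5: "K5 \<ge> 2" by simp
  have le: "a \<ge> 2 \<Longrightarrow> c = a ^ k \<Longrightarrow> m \<le> k \<Longrightarrow> a ^ m \<le> c" for a c :: real and m k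
    using power_increasing[of m k a] by auto
  have K51: "K5 ^ m \<le> n" if "m \<le> 1200" for m using power_increasing[OF that, of K5] g5 N by linarith
  have n5: "K5 \<le> n" using K51[of 1] by simp
  have n4: "K4 ^ m \<le> n" if "m \<le> 4914988" for m using le[OF g4(1) K5 that] n5 by simp
  have n3: "K3 ^ m \<le> n" if "m \<le> 7192" for m using le[OF g3(1) K4 that] n4[of 1] by simp
  have n2: "K2 ^ m \<le> n" if "m \<le> 76858" for m using le[OF g2(1) K3 that] n3[of 1] by simp
  have n1: "K1 ^ m \<le> n" if "m \<le> 142476" for m using le[OF g(1) K2 that] n2[of 1] by simp
  have l75: "n \<le> l * b" if "K1 ^ 75 \<le> b" for b
    using Ll(2) mult_left_mono[OF that less_imp_le[OF n0(2)]] by linarith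
  have n7192: "(2320::nat) \<le> 7192" by simp
  define P where "P = (\<lambda>x \<tau>1 \<tau>2 \<xi>. norm (\<Sum>y\<in>{0..<M}. F x y * cnj (F x (y + bstep \<tau>1)) * cnj (F x (y + bstep \<tau>2)) * F x (y + bstep \<tau>1 + bstep \<tau>2) * zchar M (- (\<xi> * y))))"
  define E where "E = {(x, \<tau>1, \<tau>2)\<in>X \<times> gbox N \<times> gbox N. \<exists>\<xi>. n\<^sup>2 / K2 \<le> P x \<tau>1 \<tau>2 \<xi>}"
  have cE: "l * n ^ 4 / K2 \<le> real (card E)"
    using mixed_differences_of_large_form[OF K K1 n1[OF order_refl] M Ll XN X j f0 f1 unit_periodic_cnj[OF Fp] big, folded K2]
    unfolding E_def P_def complex_cnj_cnj .
  have Esub: "E \<subseteq> X \<times> gbox N \<times> gbox N" unfolding E_def by auto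
  have "\<forall>z. \<exists>\<xi>. z \<in> E \<longrightarrow> n\<^sup>2 / K2 \<le> P (fst z) (fst (snd z)) (snd (snd z)) \<xi>" unfolding E_def by auto
  then obtain \<phi>0 where \<phi>0: "\<And>z. z \<in> E \<Longrightarrow> n\<^sup>2 / K2 \<le> P (fst z) (fst (snd z)) (snd (snd z)) (\<phi>0 z)" by metis
  define \<phi> where "\<phi> = (\<lambda>x \<tau>1 \<tau>2. \<phi>0 (x, \<tau>1, \<tau>2))"
  have \<phi>: "n\<^sup>2 / K2 \<le> P x \<tau>1 \<tau>2 (\<phi> x \<tau>1 \<tau>2)" if "(x, \<tau>1, \<tau>2) \<in> E" for x \<tau>1 \<tau>2
    using \<phi>0[OF that] unfolding \<phi>_def by simp
  have e1: "(K2 ^ 64) ^ 300 \<le> n" using n2[of 19200] by simp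
  have "K1 ^ 75 \<le> K2" by (rule le[OF g(1) K2]) simp
  then have K175: "K1 ^ 75 \<le> K2" "K1 ^ 75 \<le> K4" "K1 ^ 75 \<le> K5" using g g2 g3 g4 by auto
  have pw: "K1 ^ 75 \<le> b ^ m" if "K1 ^ 75 \<le> b" "2 \<le> b" "m > 0" for b m
    using self_le_power[of b m] that by auto
  have e2: "n \<le> l * K2 ^ 64" by (rule l75, rule pw[OF K175(1) g2(1)]) simp
  have D: "l * n ^ 8 / K2 ^ 39 \<le> real (card {(x, (\<tau>1', \<tau>2'), (\<tau>1, \<tau>2))\<in>X \<times> (gbox N \<times> gbox N) \<times> (gbox N \<times> gbox N).
     (x, \<tau>1, \<tau>2) \<in> E \<and> major ((K2 ^ 64) ^ 400) N (of_int (\<phi> x \<tau>1 \<tau>2 - \<phi> x \<tau>1' \<tau>2 - \<phi> x \<tau>1 \<tau>2' + \<phi> x \<tau>1' \<tau>2') / of_int M)})"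
    by (rule dual_interchange[OF g2(1) refl e1 e2 Esub cE]) (rule \<phi>[unfolded P_def])
  have Q: "(K2 ^ 64) ^ 400 \<ge> 1" "(K2 ^ 64) ^ 400 \<le> n" using n2[of 25600] g2 by (auto intro!: one_le_power)
  have "K2 ^ 39 > 0" using g2 by simp
  from split_frequency[OF Q this D] obtain a b E' where E': "E' \<subseteq> E" "E' \<subseteq> X \<times> gbox N \<times> gbox N"
    and cE': "l * n ^ 4 / (6561 * K2 ^ 39 * (60 * ((K2 ^ 64) ^ 400) ^ 3)) \<le> real (card E')"
    and ab0: "\<forall>(x, \<tau>1, \<tau>2)\<in>E'. M dvd \<phi> x \<tau>1 \<tau>2 - (a x \<tau>1 + b x \<tau>2)" by (elim exE conjE)
  have ab: "M dvd \<phi> x \<tau>1 \<tau>2 - (a x \<tau>1 + b x \<tau>2)" if "(x, \<tau>1, \<tau>2) \<in> E'" for x \<tau>1 \<tau>2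
    using bspec[OF ab0 that] by simp
  have cE3: "l * n ^ 4 / K3 \<le> real (card E')"
  proof -
    have "6561 * K2 ^ 39 * (60 * ((K2 ^ 64) ^ 400) ^ 3) = 393660 * K2 ^ 76839" by (simp flip: power_mult power_add)
    also have "\<dots> \<le> K3" unfolding K3 by (rule const_le_power[OF g2(1), of _ 19]) auto
    finally have "l * n ^ 4 / K3 \<le> l * n ^ 4 / (6561 * K2 ^ 39 * (60 * ((K2 ^ 64) ^ 400) ^ 3))"
      using n0 g2 by (intro divide_left_mono mult_pos_pos) auto
    then show ?thesis using cE' by linarith
  qed
  have b3: "n\<^sup>2 / K3 \<le> norm (\<Sum>y\<in>{0..<M}. F x y * cnj (F x (y + bstep \<tau>1)) * cnj (F x (y + bstep \<tau>2)) * F x (y + bstep \<tau>1 + bstep \<tau>2) * zchar M (- ((a x \<tau>1 + b x \<tau>2) * y)))"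
    if z: "(x, \<tau>1, \<tau>2) \<in> E'" for x \<tau>1 \<tau>2
  proof -
    have z1: "zchar M (- (\<phi> x \<tau>1 \<tau>2 * y)) = zchar M (- ((a x \<tau>1 + b x \<tau>2) * y))" for y
    proof (rule zchar_dvd_cong[OF M0])
      have "- (\<phi> x \<tau>1 \<tau>2 * y) - - ((a x \<tau>1 + b x \<tau>2) * y) = (\<phi> x \<tau>1 \<tau>2 - (a x \<tau>1 + b x \<tau>2)) * (- y)" by (simp add: algebra_simps)
      then show "M dvd - (\<phi> x \<tau>1 \<tau>2 * y) - - ((a x \<tau>1 + b x \<tau>2) * y)" using ab[OF z] by simp
    qed
    have "n\<^sup>2 / K3 \<le> n\<^sup>2 / K2" using g2 by (intro divide_left_mono) auto
    also have "\<dots> \<le> P x \<tau>1 \<tau>2 (\<phi> x \<tau>1 \<tau>2)" using \<phi> z E' by blast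
    finally show ?thesis unfolding P_def z1 .
  qed
  have c4: "l * n ^ 4 / K4 \<le> real (card {(x, \<tau>, \<tau>')\<in>X \<times> gbox N \<times> gbox N. \<exists>\<xi>. n\<^sup>2 / K4 \<le> norm (zft M (\<lambda>y. F x (y + bstep \<tau>) * cnj (F x (y + bstep \<tau>'))) \<xi>)})"
  proof -
    have "K3 ^ 21 \<le> K4" by (rule le[OF g3(1) K4]) simp
    then have "l * n ^ 4 / K4 \<le> l * n ^ 4 / K3 ^ 21" using g3 n0 by (intro divide_left_mono) auto
    then show ?thesis using remove_second_phase[OF g3(1) n3[OF n7192] E'(2) cE3 b3, folded K4] by linarith
  qed
  have e4: "(K4 ^ 33) ^ 50000 \<le> n" using n4[of 1650000] by simp
  have e4': "n \<le> l * K4 ^ 33" by (rule l75, rule pw[OF K175(2) g4(1)]) simp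
  have c5: "l / K5 \<le> real (card {x\<in>X. \<exists>\<xi>. n\<^sup>2 / K5 \<le> norm (zft M (F x) \<xi>)})"
  proof -
    have "K4 ^ 39642 \<le> K5" by (rule le[OF g4(1) K5]) simp
    then have "l / K5 \<le> l / K4 ^ 39642" using g4 n0 by (intro divide_left_mono) auto
    then show ?thesis
      using large_coefficient_of_differences[OF g4(1) refl e4 e4' c4, folded K5] by linarith
  qed
  have e5: "(K5 ^ 3) ^ 300 \<le> n" using K51[of 900] by simp
  have e5': "n \<le> l * K5 ^ 3" by (rule l75, rule pw[OF K175(3) g5]) simp
  have "\<exists>x\<in>X. \<exists>\<xi>. n\<^sup>2 / K5 \<le> norm (zft M (F x) \<xi>) \<and> major ((K5 ^ 3) ^ 400) N (of_int \<xi> / of_int M)"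
    by (rule major_large_coefficient[OF g5 refl e5 e5' c5])
  then show ?thesis by simp
qed

end

text \<open>As \<open>f2\<close> is 1-bounded, the form is at most \<open>2 * N\<close> times the
  sum of \<open>\<bar>F x y\<bar>\<close>. Cauchy--Schwarz then bounds the second moment of
  \<open>F\<close> from below, and by duality this is the form with the conjugate of
  \<open>F\<close> in place of \<open>f2\<close>. The terms of the second moment are nonnegative, so
  some short block of \<open>x\<close> carries its share, and the argument for dual forms applies on
  that block.\<close>

lemma major_coefficient_of_large_form:
  fixes N j M :: int and f0 f1 f2 :: "int \<Rightarrow> int \<Rightarrow> complex"
  assumes N0: "N > 0" and M: "M = 2 * N\<^sup>2" and j: "1 \<le> j" "j \<le> N"
    and f0: "\<And>x. unit_periodic M (f0 x)" and f1: "\<And>x. unit_periodic M (f1 x)" and f2: "\<And>x. unit_periodic M (f2 x)"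
    and K: "K \<ge> 2" and K1: "K1 = (K ^ 5) ^ 35" and K2: "K2 = K1 ^ 142476" and K3: "K3 = K2 ^ 76858"
    and K4: "K4 = K3 ^ 7192" and K5: "K5 = K4 ^ 4914988" and N: "of_int N \<ge> K5 ^ 1200"
    and big: "of_int N ^ 4 / K \<le> norm (\<Sum>x\<in>{1..N}. \<Sum>d\<in>{-j<..<j}. \<Sum>y\<in>{0..<M}. f0 x y * f1 (x + d) y * f2 x (y + d\<^sup>2))"
  shows "\<exists>x\<in>{1..N}. \<exists>\<xi>. 2 * of_int N ^ 3 / K5 \<le> norm (\<Sum>d\<in>{-j<..<j}. \<Sum>y\<in>{0..<M}. f0 x y * f1 (x + d) y * zchar M (- (\<xi> * (y + d\<^sup>2))))
    \<and> major (K5 ^ 1200) N (of_int \<xi> / of_int M)"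
proof -
  interpret A: dual_setup N N j 1 M "{1..N}" f0 f1
    by unfold_locales (use N0 M j f0 f1 in auto)
  define n where "n = real_of_int N"
  have n0: "n > 0" using N0 n_def by simp
  have Kp: "K > 0" "K \<ge> 1" using K by auto
  have Mn: "real_of_int M = 2 * n\<^sup>2" using A.Mn n_def by simp
  define W where "W = (\<lambda>x. \<Sum>y\<in>{0..<M}. (norm (A.F x y))\<^sup>2)"
  have K02: "K ^ 5 \<ge> 2" using self_le_power[of K 5] K by simp
  have K12: "K1 \<ge> 2" using self_le_power[of "K ^ 5" 35] K02 unfolding K1 by simp
  have nK1: "K1 ^ 74 \<le> n"
  proof -
    have "K1 ^ 74 \<le> K2" unfolding K2 using K12 by (intro power_increasing) auto
    also have k2: "K2 \<ge> 1" unfolding K2 using K12 by (intro one_le_power) auto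
    have "K2 \<le> K3" unfolding K3 using k2 by (intro self_le_power) auto
    also have "K3 \<le> K4" unfolding K4 using k2 K3 by (intro self_le_power) auto
    also have "K4 \<le> K5" unfolding K5 using k2 K3 K4 by (intro self_le_power) auto
    also have "K5 \<le> K5 ^ 1200" using k2 K3 K4 K5 by (intro self_le_power) auto
    finally show ?thesis using N n_def by simp
  qed
  have total: "n ^ 3 / (8 * K\<^sup>2) \<le> (\<Sum>x\<in>{1..N}. W x)"
  proof -
    let ?S = "\<Sum>x\<in>{1..N}. \<Sum>y\<in>{0..<M}. norm (A.F x y)"
    have "n ^ 4 / K \<le> norm (\<Sum>x\<in>{1..N}. 2 * of_int N * (\<Sum>y\<in>{0..<M}. A.F x y * f2 x y))"
      using big unfolding A.form_eq_sum_F[OF f2] n_def .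
    also have "\<dots> \<le> (\<Sum>x\<in>{1..N}. 2 * n * (\<Sum>y\<in>{0..<M}. norm (A.F x y)))"
    proof (rule sum_norm_le)
      fix x
      have "norm (\<Sum>y\<in>{0..<M}. A.F x y * f2 x y) \<le> (\<Sum>y\<in>{0..<M}. norm (A.F x y))"
        using unit_periodic_norm[OF f2] by (intro sum_norm_le) (simp add: norm_mult mult_left_le)
      then show "norm (2 * of_int N * (\<Sum>y\<in>{0..<M}. A.F x y * f2 x y)) \<le> 2 * n * (\<Sum>y\<in>{0..<M}. norm (A.F x y))"
        using n0 by (simp add: norm_mult n_def)
    qed
    also have "\<dots> = 2 * n * ?S" unfolding sum_distrib_left ..
    finally have s: "n ^ 4 / K \<le> 2 * n * ?S" .
    have "?S = (\<Sum>p\<in>{1..N} \<times> {0..<M}. norm (A.F (fst p) (snd p)))" by (simp add: sum.cartesian_product')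
    then have "?S\<^sup>2 \<le> (\<Sum>p\<in>{1..N} \<times> {0..<M}. 1\<^sup>2) * (\<Sum>p\<in>{1..N} \<times> {0..<M}. (norm (A.F (fst p) (snd p)))\<^sup>2)"
      using Cauchy_Schwarz_ineq_sum[of "\<lambda>_. 1" "\<lambda>p. norm (A.F (fst p) (snd p))" "{1..N} \<times> {0..<M}"] by simp
    also have "\<dots> = n * (2 * n\<^sup>2) * (\<Sum>x\<in>{1..N}. W x)"
      using Mn n0 A.M0 unfolding W_def by (simp add: sum.cartesian_product' card_cartesian_product n_def)
    finally have s2: "?S\<^sup>2 \<le> n * (2 * n\<^sup>2) * (\<Sum>x\<in>{1..N}. W x)" .
    have "(n ^ 4 / K)\<^sup>2 \<le> (2 * n * ?S)\<^sup>2" using s n0 Kp by (intro power_mono) auto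
    also have "\<dots> = 4 * n\<^sup>2 * ?S\<^sup>2" by (simp add: power_mult_distrib)
    also have "\<dots> \<le> 4 * n\<^sup>2 * (n * (2 * n\<^sup>2) * (\<Sum>x\<in>{1..N}. W x))" using s2 by (intro mult_left_mono) auto
    finally have "8 * n ^ 5 * (n ^ 3 / (8 * K\<^sup>2)) \<le> 8 * n ^ 5 * (\<Sum>x\<in>{1..N}. W x)" by (simp add: eval_nat_numeral mult_ac)
    then show ?thesis by (rule mult_left_le_imp_le) (use n0 in simp)
  qed
  \<comment> \<open>Concatenation asks for \<open>L * K1^73 \<le> N \<le> L * K1^75\<close>; the
    exponent in the middle leaves a factor \<open>K1\<close> for rounding on one side.\<close>
  define L where "L = \<lfloor>n / K1 ^ 74\<rfloor>"
  define l where "l = real_of_int L"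
  have K1p: "K1 ^ 74 > 0" using K12 by simp
  have "n / K1 ^ 74 \<ge> 1" using nK1 K1p by simp
  then have L1: "L \<ge> 1" unfolding L_def by (simp add: le_floor_iff)
  have lle: "l \<le> n / K1 ^ 74" unfolding l_def L_def by simp
  have llt: "n / K1 ^ 74 < l + 1" unfolding l_def L_def by linarith
  have l1: "l \<ge> 1" using L1 l_def by simp
  have Ll: "l * K1 ^ 73 \<le> n" "n \<le> l * K1 ^ 75" "l \<le> n"
  proof -
    have "l * K1 ^ 74 \<le> n" using lle K1p by (simp add: field_simps)
    moreover have "l * K1 ^ 73 \<le> l * K1 ^ 74" "l * 1 \<le> l * K1 ^ 74" using l1 K12
      by (intro mult_left_mono power_increasing one_le_power; simp)+
    ultimately show "l * K1 ^ 73 \<le> n" "l \<le> n" by auto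
    have "n \<le> (l + 1) * K1 ^ 74" using llt K1p by (simp add: field_simps)
    also have "\<dots> \<le> (l * K1) * K1 ^ 74"
    proof (rule mult_right_mono)
      have "l * 2 \<le> l * K1" using l1 K12 by (intro mult_left_mono) auto
      then show "l + 1 \<le> l * K1" using l1 by linarith
    qed (use K1p in simp)
    also have "\<dots> = l * K1 ^ 75" by (simp add: mult.assoc flip: power_Suc)
    finally show "n \<le> l * K1 ^ 75" .
  qed
  then have LN: "L \<le> N" unfolding l_def n_def by simp
  define X where "X = (\<lambda>a. {x\<in>{1..N}. x div L = a})"
  have "\<exists>a\<in>{0..N div L}. n ^ 3 / (8 * K\<^sup>2) / (2 * n / l) \<le> (\<Sum>x\<in>X a. W x)"
  proof (rule exists_ge_average)
    have "(\<Sum>x\<in>{1..N}. W x) = (\<Sum>a\<in>{0..N div L}. \<Sum>x\<in>X a. W x)"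
      unfolding X_def by (rule sum.group[symmetric]) (use L1 in \<open>auto simp: zdiv_mono1 pos_imp_zdiv_nonneg_iff\<close>)
    then show "n ^ 3 / (8 * K\<^sup>2) \<le> (\<Sum>a\<in>{0..N div L}. \<Sum>x\<in>X a. W x)" using total by simp
    have "real_of_int (N div L) \<le> n / l" unfolding n_def l_def by (rule real_of_int_div4)
    moreover have "n / l \<ge> 1" using Ll(3) l1 by simp
    ultimately show "real (card {0..N div L}) \<le> 2 * n / l" using L1 N0 by (simp add: pos_imp_zdiv_nonneg_iff)
  qed (use n0 Kp l1 in auto)
  then obtain a where a: "n ^ 3 / (8 * K\<^sup>2) / (2 * n / l) \<le> (\<Sum>x\<in>X a. W x)" by blast
  have Xsub: "X a \<subseteq> {a * L..<a * L + L}"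
  proof
    fix x assume "x \<in> X a"
    then have "x div L = a" unfolding X_def by simp
    moreover have "x = x div L * L + x mod L" by simp
    moreover have "0 \<le> x mod L" "x mod L < L" using L1 by auto
    ultimately show "x \<in> {a * L..<a * L + L}" by auto
  qed
  \<comment> \<open>The second interpretation restricts \<open>x\<close> to the block, but its dual
    function is the same constant as that of the first one.\<close>
  interpret B: dual_setup N L j "a * L" M "X a" f0 f1
    by unfold_locales (use N0 M j f0 f1 L1 LN Xsub in auto)
  have big2: "l * n ^ 3 / K ^ 5 \<le> norm (\<Sum>x\<in>X a. \<Sum>d\<in>{-j<..<j}. \<Sum>y\<in>{0..<M}. f0 x y * f1 (x + d) y * cnj (A.F x (y + d\<^sup>2)))"
  proof -
    have "(\<Sum>d\<in>{-j<..<j}. \<Sum>y\<in>{0..<M}. f0 x y * f1 (x + d) y * cnj (A.F x (y + d\<^sup>2))) = of_real (2 * n * W x)" for x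
    proof -
      have "(\<Sum>d\<in>{-j<..<j}. \<Sum>y\<in>{0..<M}. f0 x y * f1 (x + d) y * cnj (A.F x (y + d\<^sup>2))) = 2 * of_int N * (\<Sum>y\<in>{0..<M}. A.F x y * cnj (A.F x y))"
        by (rule A.form_eq_sum_F[OF unit_periodic_cnj[OF A.Fp]])
      then show ?thesis unfolding W_def n_def of_real_mult of_real_sum complex_norm_square by simp
    qed
    then have "(\<Sum>x\<in>X a. \<Sum>d\<in>{-j<..<j}. \<Sum>y\<in>{0..<M}. f0 x y * f1 (x + d) y * cnj (A.F x (y + d\<^sup>2))) = of_real (2 * n * (\<Sum>x\<in>X a. W x))"
      by (simp add: sum_distrib_left)
    then have "norm (\<Sum>x\<in>X a. \<Sum>d\<in>{-j<..<j}. \<Sum>y\<in>{0..<M}. f0 x y * f1 (x + d) y * cnj (A.F x (y + d\<^sup>2))) = \<bar>2 * n * (\<Sum>x\<in>X a. W x)\<bar>"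
      by (simp only: norm_of_real)
    moreover have "l * n ^ 3 / K ^ 5 \<le> 2 * n * (\<Sum>x\<in>X a. W x)"
    proof -
      have "8 * K\<^sup>2 \<le> K ^ 5" by (rule const_le_power[OF K, of _ 3]) auto
      then have "l * n ^ 3 / K ^ 5 \<le> l * n ^ 3 / (8 * K\<^sup>2)" using l1 n0 Kp by (intro divide_left_mono mult_pos_pos) auto
      also have "\<dots> = 2 * n * (n ^ 3 / (8 * K\<^sup>2) / (2 * n / l))" using n0 l1 by (simp add: field_simps)
      also have "\<dots> \<le> 2 * n * (\<Sum>x\<in>X a. W x)" using a n0 by (intro mult_left_mono) auto
      finally show ?thesis .
    qed
    ultimately show ?thesis by linarith
  qed
  have XN: "X a \<subseteq> {1..N}" unfolding X_def by auto
  from B.major_coefficient_of_large_dual_form[OF K02 K1 K2 K3 K4 K5 N Ll(1,2)[unfolded l_def n_def] XN big2[unfolded l_def n_def]]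
  obtain x \<xi> where x: "x \<in> X a" and z: "n\<^sup>2 / K5 \<le> norm (zft M (A.F x) \<xi>)" and mj: "major (K5 ^ 1200) N (of_int \<xi> / of_int M)"
    unfolding n_def by blast
  have "(\<Sum>d\<in>{-j<..<j}. \<Sum>y\<in>{0..<M}. f0 x y * f1 (x + d) y * zchar M (- (\<xi> * (y + d\<^sup>2)))) = 2 * of_int N * zft M (A.F x) \<xi>"
    unfolding zft_def by (rule A.form_eq_sum_F[OF A.zch])
  then have "norm (\<Sum>d\<in>{-j<..<j}. \<Sum>y\<in>{0..<M}. f0 x y * f1 (x + d) y * zchar M (- (\<xi> * (y + d\<^sup>2)))) = 2 * n * norm (zft M (A.F x) \<xi>)"
    using n0 by (simp add: norm_mult n_def)
  moreover have "2 * n ^ 3 / K5 = 2 * n * (n\<^sup>2 / K5)" by (simp add: eval_nat_numeral)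
  moreover have "2 * n * (n\<^sup>2 / K5) \<le> 2 * n * norm (zft M (A.F x) \<xi>)" using z n0 by (intro mult_left_mono) auto
  ultimately show ?thesis using x XN mj unfolding n_def by (intro bexI[of _ x] exI[of _ \<xi>]) auto
qed

section \<open>From quadratic to linear phases\<close>

text \<open>Summation along a progression of step \<open>q\<close> multiplies the transform by
  \<open>P \<xi>\<close>, a geometric sum. By Parseval the large mean of these sums puts mass where
  \<open>P\<close> is large, which means that \<open>q * \<xi> / M\<close> is near an integer. The
  mean square of \<open>P\<close> bounds the number of such frequencies by a power of
  \<open>K\<close> times \<open>n / R\<close>, so one of them works on average over all
  \<open>y\<close> simultaneously.\<close>

lemma fourier_coefficient_of_progression_sums:
  fixes h :: "int \<Rightarrow> int \<Rightarrow> complex" and N q R :: int and K :: real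
  assumes N0: "N > 0" and q: "1 \<le> q" and R: "1 \<le> R" "q * R \<le> N" and Y: "finite Y" "real (card Y) \<le> (of_int N)\<^sup>2"
    and h: "\<And>y u. norm (h y u) \<le> 1" "\<And>y u. u \<notin> {-N..2*N} \<Longrightarrow> h y u = 0" and K: "K \<ge> 1"
    and big: "of_int R * of_int N ^ 3 / (2 * K) \<le> (\<Sum>y\<in>Y. \<Sum>u\<in>{-N..2*N}. norm (\<Sum>r\<in>{0..<R}. h y (u + q * r)))"
  shows "\<exists>\<beta>. dist_circle (of_int q * \<beta>) \<le> 16 * K / of_int R \<and>
    (of_int N)\<^sup>2 * of_int R / (51200 * K ^ 4) \<le> (\<Sum>y\<in>Y. norm (\<Sum>x\<in>{-N..2*N}. h y x * add_char (\<beta> * of_int x)))"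
proof -
  define n where "n = real_of_int N"
  define \<rho> where "\<rho> = real_of_int R"
  have n0: "n > 0" and \<rho>0: "\<rho> > 0" using N0 R n_def \<rho>_def by auto
  have Kp: "K > 0" using K by simp
  \<comment> \<open>The interval \<open>{-N..<4 * N}\<close> is a full period and contains
    \<open>u + q * r\<close> for \<open>u \<le> 2 * N\<close> and \<open>q * r < N\<close>.
    Periodising \<open>h\<close> therefore changes none of the sums in the hypothesis.\<close>
  define M where "M = 5 * N"
  have M0: "M > 0" and Mn: "real_of_int M = 5 * n" using N0 unfolding M_def n_def by auto
  define g where "g = (\<lambda>y u. h y ((u + N) mod M - N))"
  have gp: "unit_periodic M (g y)" for y
    unfolding unit_periodic_def g_def using h by (metis (no_types, opaque_lifting) add.commute add.left_commute mod_add_self2)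
  have gh: "g y u = h y u" if "u \<in> {-N..<4*N}" for y u
    using that unfolding g_def M_def by simp
  have period: "(\<Sum>u\<in>{0..<M}. p u) = (\<Sum>u\<in>{-N..<4*N}. p u)" if "\<And>u. p (u + M) = p u" for p :: "int \<Rightarrow> 'a :: comm_monoid_add"
  proof -
    have "(\<Sum>u\<in>{-N..<4*N}. p u) = (\<Sum>u\<in>{0..<M}. p (u + - N))"
      by (rule sum.reindex_bij_witness[of _ "\<lambda>u. u + - N" "\<lambda>u. u + N"]) (auto simp: M_def)
    then show ?thesis using periodic_sum_shift[of p M "- N"] that M0 by simp
  qed
  define P where "P = (\<lambda>\<xi>. \<Sum>r\<in>{0..<R}. zchar M (\<xi> * (q * r)))"
  define V where "V = (\<lambda>y u. \<Sum>r\<in>{0..<R}. g y (u + q * r))"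
  have Vp: "V y (u + M) = V y u" for y u
  proof -
    have "g y (u + M + q * r) = g y (u + q * r)" for r
      using unit_periodic_add[OF gp, of y "u + q * r"] by (simp add: ac_simps)
    then show ?thesis unfolding V_def by simp
  qed
  have zV: "zft M (V y) \<xi> = P \<xi> * zft M (g y) \<xi>" for y \<xi>
  proof -
    have t: "(\<Sum>u\<in>{0..<M}. g y (u + q * r) * zchar M (- (\<xi> * u))) = zchar M (\<xi> * (q * r)) * zft M (g y) \<xi>" for r
    proof -
      have p: "unit_periodic M (\<lambda>u. g y u * zchar M (- (\<xi> * u)))"
        using unit_periodic_mult[OF gp unit_periodic_zchar[OF M0, of "- \<xi>"]] by simp
      have z: "zchar M (- (\<xi> * u)) = zchar M (\<xi> * (q * r)) * zchar M (- (\<xi> * (u + q * r)))" for u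
        by (simp add: distrib_left flip: zchar_add)
      have "(\<Sum>u\<in>{0..<M}. g y (u + q * r) * zchar M (- (\<xi> * u))) = (\<Sum>u\<in>{0..<M}. zchar M (\<xi> * (q * r)) * (g y (u + q * r) * zchar M (- (\<xi> * (u + q * r)))))"
        by (rule sum.cong[OF refl], subst z) (simp only: mult_ac)
      also have "\<dots> = zchar M (\<xi> * (q * r)) * (\<Sum>u\<in>{0..<M}. g y u * zchar M (- (\<xi> * u)))"
        unfolding sum_distrib_left[symmetric] unit_periodic_sum_shift[OF p M0, of "q * r"] ..
      finally show ?thesis unfolding zft_def .
    qed
    have "zft M (V y) \<xi> = (\<Sum>u\<in>{0..<M}. \<Sum>r\<in>{0..<R}. g y (u + q * r) * zchar M (- (\<xi> * u)))"
      unfolding zft_def V_def sum_distrib_right ..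
    also have "\<dots> = (\<Sum>r\<in>{0..<R}. \<Sum>u\<in>{0..<M}. g y (u + q * r) * zchar M (- (\<xi> * u)))" by (rule sum.swap)
    finally show ?thesis unfolding t P_def sum_distrib_right .
  qed
  have PP: "(\<Sum>\<xi>\<in>{0..<M}. (norm (P \<xi>))\<^sup>2) = 5 * n * \<rho>"
  proof -
    have "complex_of_real (\<Sum>\<xi>\<in>{0..<M}. (norm (P \<xi>))\<^sup>2) = (\<Sum>\<xi>\<in>{0..<M}. \<Sum>r\<in>{0..<R}. \<Sum>r'\<in>{0..<R}. zchar M (\<xi> * (q * r - q * r')))"
      unfolding of_real_sum complex_norm_square P_def cnj_sum sum_product by (simp only: right_diff_distrib zchar_diff)
    also have "\<dots> = (\<Sum>r\<in>{0..<R}. \<Sum>r'\<in>{0..<R}. \<Sum>\<xi>\<in>{0..<M}. zchar M (\<xi> * (q * r - q * r')))"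
      by (rule sum_swap3)
    also have "\<dots> = (\<Sum>r\<in>{0..<R}. \<Sum>r'\<in>{0..<R}. if r = r' then of_int M else 0)"
    proof (rule sum.cong[OF refl], rule sum.cong[OF refl])
      fix r r' assume r: "r \<in> {0..<R}" "r' \<in> {0..<R}"
      \<comment> \<open>The hypothesis \<open>q * R \<le> N\<close> enters here: distinct points of
        the progression remain distinct modulo \<open>M\<close>, so only the diagonal
        survives.\<close>
      have "M dvd q * r - q * r' \<longleftrightarrow> r = r'"
      proof
        assume d: "M dvd q * r - q * r'"
        have "q * r < q * R" "q * r' < q * R" "0 \<le> q * r" "0 \<le> q * r'" using r q by auto
        then have "\<bar>q * r - q * r'\<bar> < M" using R M_def N0 by linarith
        then have "q * r - q * r' = 0" using d zdvd_not_zless[of "\<bar>q * r - q * r'\<bar>" M] by auto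
        then show "r = r'" using q by simp
      qed simp
      then show "(\<Sum>\<xi>\<in>{0..<M}. zchar M (\<xi> * (q * r - q * r'))) = (if r = r' then of_int M else 0)"
        unfolding sum_zchar[OF M0] by simp
    qed
    also have "\<dots> = (\<Sum>r\<in>{0..<R}. of_int M)" by (rule sum.cong[OF refl]) (simp add: sum.delta)
    also have "\<dots> = of_int R * of_int M" using R by simp
    also have "\<dots> = complex_of_real (5 * n * \<rho>)"
      unfolding \<rho>_def Mn[symmetric] of_real_mult of_real_of_int_eq by (rule mult.commute)
    finally show ?thesis unfolding of_real_eq_iff .
  qed
  have P1: "norm (P \<xi>) \<le> \<rho>" for \<xi>
  proof -
    have "norm (P \<xi>) \<le> (\<Sum>r\<in>{0..<R}. 1)" unfolding P_def by (rule sum_norm_le) (simp add: zchar_def)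
    then show ?thesis using R unfolding \<rho>_def by simp
  qed
  define S where "S = (\<lambda>\<xi>. \<Sum>y\<in>Y. (norm (zft M (g y) \<xi>))\<^sup>2)"
  have S0: "S \<xi> \<ge> 0" for \<xi> unfolding S_def by (intro sum_nonneg) simp
  have Ssum: "(\<Sum>\<xi>\<in>{0..<M}. S \<xi>) \<le> 25 * n ^ 4"
  proof -
    have "(\<Sum>\<xi>\<in>{0..<M}. S \<xi>) = (\<Sum>y\<in>Y. \<Sum>\<xi>\<in>{0..<M}. (norm (zft M (g y) \<xi>))\<^sup>2)" unfolding S_def by (rule sum.swap)
    also have "\<dots> \<le> (\<Sum>y\<in>Y. 25 * n\<^sup>2)"
    proof (rule sum_mono)
      fix y
      have "(\<Sum>u\<in>{0..<M}. (norm (g y u))\<^sup>2) \<le> (\<Sum>u\<in>{0..<M}. 1)"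
        using unit_periodic_norm[OF gp] by (intro sum_mono) (simp add: power_le_one)
      then have "(\<Sum>u\<in>{0..<M}. (norm (g y u))\<^sup>2) \<le> 5 * n" using Mn M0 by simp
      then have "5 * n * (\<Sum>u\<in>{0..<M}. (norm (g y u))\<^sup>2) \<le> 5 * n * (5 * n)" using n0 by (intro mult_left_mono) auto
      then show "(\<Sum>\<xi>\<in>{0..<M}. (norm (zft M (g y) \<xi>))\<^sup>2) \<le> 25 * n\<^sup>2"
        using zft_parseval[where P = "g y", OF M0 unit_periodic_add[OF gp]] Mn by (simp add: power2_eq_square)
    qed
    also have "\<dots> = real (card Y) * (25 * n\<^sup>2)" by simp
    also have "\<dots> \<le> n\<^sup>2 * (25 * n\<^sup>2)" using Y n_def by (intro mult_right_mono) auto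
    finally show ?thesis by (simp add: eval_nat_numeral mult_ac)
  qed
  have main: "\<rho>\<^sup>2 * n ^ 4 / (4 * K\<^sup>2) \<le> (\<Sum>\<xi>\<in>{0..<M}. (norm (P \<xi>))\<^sup>2 * S \<xi>)"
  proof -
    let ?T = "\<Sum>y\<in>Y. \<Sum>u\<in>{0..<M}. norm (V y u)"
    have "\<rho> * n ^ 3 / (2 * K) \<le> ?T"
    proof -
      have "(\<Sum>u\<in>{-N..2*N}. norm (\<Sum>r\<in>{0..<R}. h y (u + q * r))) \<le> (\<Sum>u\<in>{0..<M}. norm (V y u))" for y
      proof -
        have "(\<Sum>u\<in>{-N..2*N}. norm (\<Sum>r\<in>{0..<R}. h y (u + q * r))) = (\<Sum>u\<in>{-N..2*N}. norm (V y u))"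
        proof (rule sum.cong[OF refl])
          fix u assume u: "u \<in> {-N..2*N}"
          have "h y (u + q * r) = g y (u + q * r)" if "r \<in> {0..<R}" for r
          proof -
            have "0 \<le> q * r" "q * r < q * R" using that q by auto
            then show ?thesis using gh[of "u + q * r" y] u R by auto
          qed
          then show "norm (\<Sum>r\<in>{0..<R}. h y (u + q * r)) = norm (V y u)" unfolding V_def by simp
        qed
        also have "\<dots> \<le> (\<Sum>u\<in>{-N..<4*N}. norm (V y u))" using N0 by (intro sum_mono2) auto
        also have "\<dots> = (\<Sum>u\<in>{0..<M}. norm (V y u))" by (rule period[symmetric]) (simp add: Vp)
        finally show ?thesis .
      qed
      then have "(\<Sum>y\<in>Y. \<Sum>u\<in>{-N..2*N}. norm (\<Sum>r\<in>{0..<R}. h y (u + q * r))) \<le> ?T" by (intro sum_mono)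
      then show ?thesis using big unfolding n_def \<rho>_def by linarith
    qed
    then have "(\<rho> * n ^ 3 / (2 * K))\<^sup>2 \<le> ?T\<^sup>2" using \<rho>0 n0 Kp by (intro power_mono) auto
    also have "?T = (\<Sum>p\<in>Y \<times> {0..<M}. norm (V (fst p) (snd p)))" by (simp add: sum.cartesian_product')
    also have "\<dots>\<^sup>2 \<le> (\<Sum>p\<in>Y \<times> {0..<M}. 1\<^sup>2) * (\<Sum>p\<in>Y \<times> {0..<M}. (norm (V (fst p) (snd p)))\<^sup>2)"
      using Cauchy_Schwarz_ineq_sum[of "\<lambda>_. 1" "\<lambda>p. norm (V (fst p) (snd p))" "Y \<times> {0..<M}"] by simp
    also have "\<dots> = real (card Y) * ((5 * n) * (\<Sum>y\<in>Y. \<Sum>u\<in>{0..<M}. (norm (V y u))\<^sup>2))"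
      using Mn M0 by (simp add: sum.cartesian_product' card_cartesian_product)
    also have "(5 * n) * (\<Sum>y\<in>Y. \<Sum>u\<in>{0..<M}. (norm (V y u))\<^sup>2) = (\<Sum>y\<in>Y. \<Sum>\<xi>\<in>{0..<M}. (norm (zft M (V y) \<xi>))\<^sup>2)"
      unfolding sum_distrib_left[of "5 * n" _ Y] using zft_parseval[where P = "V y" for y, OF M0 Vp] Mn by simp
    also have "\<dots> = (\<Sum>\<xi>\<in>{0..<M}. \<Sum>y\<in>Y. (norm (zft M (V y) \<xi>))\<^sup>2)" by (rule sum.swap)
    also have "\<dots> = (\<Sum>\<xi>\<in>{0..<M}. (norm (P \<xi>))\<^sup>2 * S \<xi>)"
      unfolding zV S_def norm_mult power_mult_distrib sum_distrib_left ..
    also have "real (card Y) * \<dots> \<le> n\<^sup>2 * \<dots>" using Y S0 n_def by (intro mult_right_mono sum_nonneg) auto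
    finally have "(\<rho> * n ^ 3 / (2 * K))\<^sup>2 \<le> n\<^sup>2 * (\<Sum>\<xi>\<in>{0..<M}. (norm (P \<xi>))\<^sup>2 * S \<xi>)" .
    moreover have "(\<rho> * n ^ 3 / (2 * K))\<^sup>2 = n\<^sup>2 * (\<rho>\<^sup>2 * n ^ 4 / (4 * K\<^sup>2))" by (simp add: power_divide power_mult_distrib eval_nat_numeral mult_ac)
    ultimately have "n\<^sup>2 * (\<rho>\<^sup>2 * n ^ 4 / (4 * K\<^sup>2)) \<le> n\<^sup>2 * (\<Sum>\<xi>\<in>{0..<M}. (norm (P \<xi>))\<^sup>2 * S \<xi>)" by simp
    then show ?thesis by (rule mult_left_le_imp_le) (use n0 in simp)
  qed
  \<comment> \<open>Below this threshold the contribution is at most \<open>25 / 256\<close> of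
    \<open>\<rho>^2 * n^4 / K^2\<close>, against a total of at least \<open>1 / 4\<close> of
    it.\<close>
  define B where "B = {\<xi>\<in>{0..<M}. \<rho> / (16 * K) \<le> norm (P \<xi>)}"
  have finB: "finite B" by (rule finite_subset[of _ "{0..<M}"]) (auto simp: B_def)
  have Bbig: "n ^ 4 / (8 * K\<^sup>2) \<le> (\<Sum>\<xi>\<in>B. S \<xi>)"
  proof -
    have "(\<Sum>\<xi>\<in>{0..<M}. (norm (P \<xi>))\<^sup>2 * S \<xi>) \<le> (\<Sum>\<xi>\<in>{0..<M}. (\<rho> / (16 * K))\<^sup>2 * S \<xi> + \<rho>\<^sup>2 * (if \<xi> \<in> B then S \<xi> else 0))"
    proof (rule sum_mono)
      fix \<xi> assume x: "\<xi> \<in> {0..<M}"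
      show "(norm (P \<xi>))\<^sup>2 * S \<xi> \<le> (\<rho> / (16 * K))\<^sup>2 * S \<xi> + \<rho>\<^sup>2 * (if \<xi> \<in> B then S \<xi> else 0)"
      proof (cases "\<xi> \<in> B")
        case True
        have "(norm (P \<xi>))\<^sup>2 * S \<xi> \<le> \<rho>\<^sup>2 * S \<xi>" using P1 S0 by (intro mult_right_mono power_mono) auto
        moreover have "0 \<le> (\<rho> / (16 * K))\<^sup>2 * S \<xi>" using S0 by simp
        ultimately show ?thesis using True by simp
      next
        case False
        then have "norm (P \<xi>) \<le> \<rho> / (16 * K)" using x unfolding B_def by auto
        then have "(norm (P \<xi>))\<^sup>2 * S \<xi> \<le> (\<rho> / (16 * K))\<^sup>2 * S \<xi>" using S0 by (intro mult_right_mono power_mono) auto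
        then show ?thesis using False by simp
      qed
    qed
    also have "\<dots> = (\<rho> / (16 * K))\<^sup>2 * (\<Sum>\<xi>\<in>{0..<M}. S \<xi>) + \<rho>\<^sup>2 * (\<Sum>\<xi>\<in>{0..<M}. if \<xi> \<in> B then S \<xi> else 0)"
      unfolding sum.distrib sum_distrib_left ..
    also have "(\<Sum>\<xi>\<in>{0..<M}. if \<xi> \<in> B then S \<xi> else 0) = (\<Sum>\<xi>\<in>B. S \<xi>)"
      by (rule sum.mono_neutral_cong_right) (auto simp: B_def)
    also have "(\<rho> / (16 * K))\<^sup>2 * (\<Sum>\<xi>\<in>{0..<M}. S \<xi>) \<le> (\<rho> / (16 * K))\<^sup>2 * (25 * n ^ 4)"
      using Ssum by (intro mult_left_mono) auto
    also have "(\<rho> / (16 * K))\<^sup>2 * (25 * n ^ 4) = \<rho>\<^sup>2 * (25 / 256 * (n ^ 4 / K\<^sup>2))" by (simp add: power_divide power_mult_distrib)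
    finally have "\<rho>\<^sup>2 * n ^ 4 / (4 * K\<^sup>2) \<le> \<rho>\<^sup>2 * (25 / 256 * (n ^ 4 / K\<^sup>2)) + \<rho>\<^sup>2 * (\<Sum>\<xi>\<in>B. S \<xi>)" using main by linarith
    then have "\<rho>\<^sup>2 * (1 / 4 * (n ^ 4 / K\<^sup>2)) \<le> \<rho>\<^sup>2 * (25 / 256 * (n ^ 4 / K\<^sup>2) + (\<Sum>\<xi>\<in>B. S \<xi>))"
      unfolding distrib_left by simp
    then have "1 / 4 * (n ^ 4 / K\<^sup>2) \<le> 25 / 256 * (n ^ 4 / K\<^sup>2) + (\<Sum>\<xi>\<in>B. S \<xi>)"
      by (rule mult_left_le_imp_le) (use \<rho>0 in simp)
    moreover have "n ^ 4 / K\<^sup>2 \<ge> 0" by simp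
    moreover have "n ^ 4 / (8 * K\<^sup>2) = 1 / 8 * (n ^ 4 / K\<^sup>2)" by simp
    ultimately show ?thesis by linarith
  qed
  \<comment> \<open>The target involves absolute values rather than squares; the trivial bound
    \<open>5 * n\<close> on a coefficient passes from \<open>S\<close> to \<open>U\<close>.\<close>
  define U where "U = (\<lambda>\<xi>. \<Sum>y\<in>Y. norm (zft M (g y) \<xi>))"
  have SU: "S \<xi> \<le> 5 * n * U \<xi>" for \<xi>
    unfolding S_def U_def sum_distrib_left
  proof (rule sum_mono)
    fix y
    have "norm (zft M (g y) \<xi>) \<le> (\<Sum>u\<in>{0..<M}. 1)"
      unfolding zft_def using unit_periodic_norm[OF gp] by (intro sum_norm_le) (simp add: norm_mult zchar_def)
    then have "norm (zft M (g y) \<xi>) \<le> 5 * n" using Mn M0 by simp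
    then show "(norm (zft M (g y) \<xi>))\<^sup>2 \<le> 5 * n * norm (zft M (g y) \<xi>)"
      unfolding power2_eq_square by (intro mult_right_mono) auto
  qed
  have Ubig: "n ^ 3 / (40 * K\<^sup>2) \<le> (\<Sum>\<xi>\<in>B. U \<xi>)"
  proof -
    have "(\<Sum>\<xi>\<in>B. S \<xi>) \<le> 5 * n * (\<Sum>\<xi>\<in>B. U \<xi>)" unfolding sum_distrib_left using SU by (intro sum_mono)
    then have "5 * n * (n ^ 3 / (40 * K\<^sup>2)) \<le> 5 * n * (\<Sum>\<xi>\<in>B. U \<xi>)" using Bbig by (simp add: eval_nat_numeral)
    then show ?thesis by (rule mult_left_le_imp_le) (use n0 in simp)
  qed
  have cB: "real (card B) \<le> 1280 * n * K\<^sup>2 / \<rho>"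
  proof -
    have "real (card B) * (\<rho> / (16 * K))\<^sup>2 = (\<Sum>\<xi>\<in>B. (\<rho> / (16 * K))\<^sup>2)" by simp
    also have "\<dots> \<le> (\<Sum>\<xi>\<in>B. (norm (P \<xi>))\<^sup>2)" unfolding B_def using \<rho>0 Kp by (intro sum_mono power_mono) auto
    also have "\<dots> \<le> (\<Sum>\<xi>\<in>{0..<M}. (norm (P \<xi>))\<^sup>2)" unfolding B_def by (intro sum_mono2) auto
    finally have "real (card B) * (\<rho> / (16 * K))\<^sup>2 \<le> 5 * n * \<rho>" unfolding PP .
    also have "5 * n * \<rho> = 1280 * n * K\<^sup>2 / \<rho> * (\<rho> / (16 * K))\<^sup>2"
      using \<rho>0 Kp by (simp add: power2_eq_square)
    finally show ?thesis by (rule mult_right_le_imp_le) (use \<rho>0 Kp in simp)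
  qed
  have "\<exists>\<xi>\<in>B. n ^ 3 / (40 * K\<^sup>2) / (1280 * n * K\<^sup>2 / \<rho>) \<le> U \<xi>"
    by (rule exists_ge_average[OF finB Ubig cB]) (use n0 Kp \<rho>0 in auto)
  then obtain \<xi> where x: "\<xi> \<in> B" "n ^ 3 / (40 * K\<^sup>2) / (1280 * n * K\<^sup>2 / \<rho>) \<le> U \<xi>" by blast
  \<comment> \<open>The sign matches \<open>zft\<close>, which integrates against the conjugate
    character.\<close>
  define \<beta> where "\<beta> = - of_int \<xi> / real_of_int M"
  have "dist_circle (of_int q * \<beta>) \<le> 16 * K / \<rho>"
  proof -
    have "P \<xi> = (\<Sum>r\<in>{0..R - 1}. add_char (of_int r * (of_int q * (of_int \<xi> / of_int M))))"
      unfolding P_def zchar_def by (rule sum.cong) (auto simp: mult_ac)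
    then have "norm (P \<xi>) * dist_circle (of_int q * (of_int \<xi> / of_int M)) \<le> 1"
      by (simp only: norm_sum_add_char_le)
    moreover have "dist_circle (of_int q * \<beta>) = dist_circle (of_int q * (of_int \<xi> / of_int M))"
      using dist_circle_minus[of "of_int q * (of_int \<xi> / of_int M)"] unfolding \<beta>_def by simp
    moreover have "\<rho> / (16 * K) * dist_circle (of_int q * \<beta>) \<le> norm (P \<xi>) * dist_circle (of_int q * \<beta>)"
      using x unfolding B_def by (intro mult_right_mono) auto
    ultimately have "\<rho> / (16 * K) * dist_circle (of_int q * \<beta>) \<le> 1" by simp
    then show ?thesis using \<rho>0 Kp by (simp add: field_simps)
  qed
  moreover have "n\<^sup>2 * \<rho> / (51200 * K ^ 4) \<le> (\<Sum>y\<in>Y. norm (\<Sum>x\<in>{-N..2*N}. h y x * add_char (\<beta> * of_int x)))"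
  proof -
    have "zft M (g y) \<xi> = (\<Sum>x\<in>{-N..2*N}. h y x * add_char (\<beta> * of_int x))" for y
    proof -
      have "zft M (g y) \<xi> = (\<Sum>u\<in>{-N..<4*N}. g y u * zchar M (- (\<xi> * u)))" unfolding zft_def
        using unit_periodic_add[OF unit_periodic_mult[OF gp unit_periodic_zchar[OF M0, of "- \<xi>"]]] by (intro period) simp
      also have "\<dots> = (\<Sum>u\<in>{-N..<4*N}. h y u * zchar M (- (\<xi> * u)))" using gh by (intro sum.cong) auto
      also have "\<dots> = (\<Sum>u\<in>{-N..2*N}. h y u * zchar M (- (\<xi> * u)))"
        using N0 h(2) by (intro sum.mono_neutral_right) auto
      also have "\<dots> = (\<Sum>x\<in>{-N..2*N}. h y x * add_char (\<beta> * of_int x))"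
        unfolding zchar_def \<beta>_def by (intro sum.cong) auto
      finally show ?thesis .
    qed
    moreover have "n ^ 3 / (40 * K\<^sup>2) / (1280 * n * K\<^sup>2 / \<rho>) = n\<^sup>2 * \<rho> / (51200 * K ^ 4)"
    proof -
      have "n ^ 3 = n * n\<^sup>2" "K ^ 4 = K\<^sup>2 * K\<^sup>2" by (simp_all flip: power_Suc power_add)
      then show ?thesis using n0 by simp
    qed
    ultimately show ?thesis using x(2) unfolding U_def by simp
  qed
  ultimately show ?thesis unfolding n_def \<rho>_def by blast
qed

text \<open>The frequency \<open>\<alpha>\<close> and its denominator \<open>q\<close> do not depend
  on \<open>y\<close>, so \<open>quadratic_phase_shift\<close> applies uniformly and leaves sums of
  \<open>h y\<close> along progressions of one common step \<open>q\<close>.\<close>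

lemma fourier_coefficient_of_quadratic_sums:
  fixes h :: "int \<Rightarrow> int \<Rightarrow> complex" and N q j x :: int and K :: real
  assumes K: "K \<ge> 2" and N: "K ^ 13 \<le> of_int N" and j: "1 \<le> j" "j \<le> N" and x: "x \<in> {1..N}"
    and q: "1 \<le> q" "of_int q \<le> K" "dist_circle (of_int q * \<alpha>) \<le> K / (of_int N)\<^sup>2"
    and Y: "finite Y" "real (card Y) \<le> (of_int N)\<^sup>2"
    and h: "\<And>y u. norm (h y u) \<le> 1" "\<And>y u. u \<notin> {-N..2*N} \<Longrightarrow> h y u = 0"
    and big: "of_int N ^ 3 / K \<le> (\<Sum>y\<in>Y. norm (\<Sum>d\<in>{-j<..<j}. h y (x + d) * add_char (\<alpha> * (of_int d)\<^sup>2)))"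
  shows "\<exists>\<beta>. dist_circle (of_int q * \<beta>) \<le> K ^ 18 / of_int N \<and>
    of_int N ^ 3 / K ^ 33 \<le> (\<Sum>y\<in>Y. norm (\<Sum>x\<in>{-N..2*N}. h y x * add_char (\<beta> * of_int x)))"
proof -
  define n where "n = real_of_int N"
  have Kp: "K > 0" "K \<ge> 1" using K by auto
  have n13: "K ^ 13 \<le> n" using N n_def by simp
  have n1: "1 \<le> n" using n13 one_le_power[of K 13] Kp by linarith
  then have n0: "n > 0" and N0: "N > 0" unfolding n_def by auto
  \<comment> \<open>Boundary and phase errors amount to about \<open>74 * K * R\<close> and must
    stay below \<open>n / (2 * K)\<close>, half of the average lower bound; a factor
    \<open>K^2\<close> would do up to constants, and the remaining powers absorb these.\<close>
  define R where "R = \<lfloor>n / K ^ 12\<rfloor>"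
  define \<rho> where "\<rho> = real_of_int R"
  have "K ^ 12 \<le> K ^ 13" using Kp by (intro power_increasing) auto
  then have "1 \<le> n / K ^ 12" using n13 Kp by simp
  then have R1: "R \<ge> 1" unfolding R_def by (simp add: le_floor_iff)
  have \<rho>1: "\<rho> \<ge> 1" using R1 \<rho>_def by simp
  have \<rho>le: "\<rho> * K ^ 12 \<le> n"
  proof -
    have "\<rho> \<le> n / K ^ 12" unfolding \<rho>_def R_def by simp
    then show ?thesis using Kp by (simp add: field_simps)
  qed
  have \<rho>ge: "n \<le> 2 * \<rho> * K ^ 12"
  proof -
    have "n / K ^ 12 \<le> 2 * \<rho>" using R1 unfolding \<rho>_def R_def by linarith
    then show ?thesis using Kp by (simp add: field_simps)
  qed
  define qr where "qr = real_of_int q"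
  have qr: "1 \<le> qr" "qr \<le> K" using q unfolding qr_def by auto
  have k12: "1024 * K\<^sup>2 \<le> K ^ 12" by (rule const_le_power[OF K, of _ 10]) auto
  have e1: "1024 * K\<^sup>2 * \<rho> \<le> n" 
  proof -
    have "1024 * K\<^sup>2 * \<rho> \<le> K ^ 12 * \<rho>" using \<rho>1 by (intro mult_right_mono k12) auto
    then show ?thesis using \<rho>le by (simp only: mult.commute[of "K ^ 12"])
  qed
  have e2: "1024 * (K * \<rho>) \<le> n / K"
    using e1 Kp by (simp add: field_simps power2_eq_square)
  have qR: "q * R \<le> N"
  proof -
    have "qr * \<rho> \<le> K * \<rho>" using qr \<rho>1 by (intro mult_right_mono) auto
    moreover have "n / K \<le> n" using Kp n0 by (simp add: field_simps)
    moreover have "0 \<le> K * \<rho>" using Kp \<rho>1 by simp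
    ultimately have "qr * \<rho> \<le> n" using e2 by linarith
    then show ?thesis unfolding qr_def \<rho>_def n_def by (simp flip: of_int_mult)
  qed
  have err: "2 * of_int (q * R) + (2 * of_int N + 1) * (8 * (of_int (2 * R * N + q * R\<^sup>2) * (K / (of_int N)\<^sup>2))) \<le> n / (2 * K)"
  proof -
    have a1: "2 * (qr * \<rho>) \<le> 2 * (K * \<rho>)" using qr \<rho>1 by simp
    have a2: "(2 * n + 1) * (8 * ((2 * \<rho> * n + qr * \<rho>\<^sup>2) * (K / n\<^sup>2))) \<le> (3 * n) * (8 * ((2 * \<rho> * n + n * \<rho>) * (K / n\<^sup>2)))"
    proof (intro mult_mono)
      have "qr * \<rho>\<^sup>2 \<le> n * \<rho>"
      proof -
        have "qr * \<rho> \<le> n" using qR unfolding qr_def \<rho>_def n_def by (simp flip: of_int_mult)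
        then show ?thesis using \<rho>1 mult_right_mono[of "qr * \<rho>" n \<rho>] by (simp add: power2_eq_square mult.assoc)
      qed
      then show "2 * \<rho> * n + qr * \<rho>\<^sup>2 \<le> 2 * \<rho> * n + n * \<rho>" by (simp add: mult.commute)
    qed (use n1 \<rho>1 qr Kp in auto)
    have a3: "(3 * n) * (8 * ((2 * \<rho> * n + n * \<rho>) * (K / n\<^sup>2))) = 72 * (K * \<rho>)"
      using n0 by (simp add: field_simps power2_eq_square)
    have "n / (2 * K) = n / K / 2" by simp
    moreover have "0 \<le> K * \<rho>" using Kp \<rho>1 by simp
    ultimately have "2 * (qr * \<rho>) + (2 * n + 1) * (8 * ((2 * \<rho> * n + qr * \<rho>\<^sup>2) * (K / n\<^sup>2))) \<le> n / (2 * K)"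
      using a1 a2 a3 e2 by linarith
    then show ?thesis unfolding qr_def \<rho>_def n_def by simp
  qed
  have J: "{-j<..<j} = {-j+1..j-1}" by auto
  define T where "T = (\<lambda>y. \<Sum>u\<in>{-N..2*N}. norm (\<Sum>r\<in>{0..<R}. h y (u + q * r)))"
  have each: "norm (\<Sum>d\<in>{-j<..<j}. h y (x + d) * add_char (\<alpha> * (of_int d)\<^sup>2)) \<le> T y / \<rho> + n / (2 * K)" for y
  proof -
    have "norm (\<Sum>d\<in>{-j+1..j-1}. h y (x + d) * add_char (\<alpha> * (of_int d)\<^sup>2)) \<le>
      (\<Sum>d\<in>{-j+1..j-1}. norm (\<Sum>r\<in>{0..<R}. h y (x + (d + q * r)))) / of_int R + 2 * of_int (q * R)
      + (2 * of_int N + 1) * (8 * (of_int (2 * R * N + q * R\<^sup>2) * (K / (of_int N)\<^sup>2)))"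
      by (rule quadratic_phase_shift[where h = "\<lambda>d. h y (x + d)"]) (use h q R1 j N0 in auto)
    moreover have "(\<Sum>d\<in>{-j+1..j-1}. norm (\<Sum>r\<in>{0..<R}. h y (x + (d + q * r)))) \<le> T y"
    proof -
      have "(\<Sum>d\<in>{-j+1..j-1}. norm (\<Sum>r\<in>{0..<R}. h y (x + (d + q * r)))) = (\<Sum>u\<in>{x-j+1..x+j-1}. norm (\<Sum>r\<in>{0..<R}. h y (u + q * r)))"
        by (rule sum.reindex_bij_witness[of _ "\<lambda>u. u - x" "\<lambda>d. x + d"]) (auto simp: add.assoc)
      \<comment> \<open>Since \<open>1 \<le> x \<le> N\<close> and \<open>j \<le> N\<close>, the
        shifted window lies in \<open>{-N..2 * N}\<close>. Enlarging it frees the bound from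
        \<open>x\<close> and \<open>j\<close>.\<close>
      also have "\<dots> \<le> T y" unfolding T_def using x j by (intro sum_mono2) auto
      finally show ?thesis .
    qed
    then have "(\<Sum>d\<in>{-j+1..j-1}. norm (\<Sum>r\<in>{0..<R}. h y (x + (d + q * r)))) / of_int R \<le> T y / \<rho>"
      unfolding \<rho>_def using R1 by (intro divide_right_mono) auto
    ultimately show ?thesis unfolding J using err by linarith
  qed
  have "\<rho> * n ^ 3 / (2 * K) \<le> (\<Sum>y\<in>Y. T y)"
  proof -
    have "n ^ 3 / K \<le> (\<Sum>y\<in>Y. T y / \<rho> + n / (2 * K))" using order_trans[OF big sum_mono[OF each]] n_def by simp
    also have "\<dots> = (\<Sum>y\<in>Y. T y) / \<rho> + real (card Y) * (n / (2 * K))" by (simp add: sum.distrib sum_divide_distrib)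
    also have "real (card Y) * (n / (2 * K)) \<le> n\<^sup>2 * (n / (2 * K))" using Y n0 Kp unfolding n_def by (intro mult_right_mono) auto
    also have "n\<^sup>2 * (n / (2 * K)) = n ^ 3 / K / 2" by (simp add: eval_nat_numeral)
    finally have "n ^ 3 / K / 2 \<le> (\<Sum>y\<in>Y. T y) / \<rho>" by simp
    then show ?thesis using \<rho>1 Kp by (simp add: field_simps)
  qed
  from fourier_coefficient_of_progression_sums[OF N0 q(1) R1 qR Y h Kp(2) this[unfolded T_def \<rho>_def n_def]]
  obtain \<beta> where b: "dist_circle (of_int q * \<beta>) \<le> 16 * K / \<rho>"
    "n\<^sup>2 * \<rho> / (51200 * K ^ 4) \<le> (\<Sum>y\<in>Y. norm (\<Sum>x\<in>{-N..2*N}. h y x * add_char (\<beta> * of_int x)))"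
    unfolding n_def \<rho>_def by blast
  have "16 * K / \<rho> \<le> K ^ 18 / n"
  proof -
    have "16 * K * n \<le> 16 * K * (2 * \<rho> * K ^ 12)" using \<rho>ge Kp by (intro mult_left_mono) auto
    also have "\<dots> = 32 * K ^ 13 * \<rho>" by (simp add: eval_nat_numeral)
    also have "\<dots> \<le> K ^ 18 * \<rho>" using \<rho>1 by (intro mult_right_mono const_le_power[OF K, of _ 5]) auto
    finally show ?thesis using n0 \<rho>1 by (simp add: field_simps)
  qed
  moreover have "n ^ 3 / K ^ 33 \<le> n\<^sup>2 * \<rho> / (51200 * K ^ 4)"
  proof -
    have "51200 * K ^ 4 * n ^ 3 = 51200 * K ^ 4 * n\<^sup>2 * n" by (simp add: eval_nat_numeral)
    also have "\<dots> \<le> 51200 * K ^ 4 * n\<^sup>2 * (2 * \<rho> * K ^ 12)" using \<rho>ge Kp by (intro mult_left_mono) auto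
    also have "\<dots> = (102400 * K ^ 16) * (n\<^sup>2 * \<rho>)" by (simp add: eval_nat_numeral)
    also have "\<dots> \<le> K ^ 33 * (n\<^sup>2 * \<rho>)" using \<rho>1 by (intro mult_right_mono const_le_power[OF K, of _ 17]) auto
    finally show ?thesis using Kp by (simp add: field_simps)
  qed
  ultimately show ?thesis using b unfolding n_def by (intro exI[of _ \<beta>]) linarith
qed

text \<open>Transfer between the integers and the cyclic group of order \<open>2 * N^2\<close>. In
  the resulting large coefficient the factor \<open>f0\<close> and the linear character in
  \<open>y\<close> do not involve \<open>d\<close>, so taking absolute values for each
  \<open>y\<close> leaves \<open>f1\<close> alone against a quadratic phase.\<close>

lemma major_coefficient_of_large_box_form:
  fixes N j :: int and f0 f1 f2 :: "int \<times> int \<Rightarrow> complex" and K :: real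
  assumes N0: "N > 0" and j: "1 \<le> j" "j \<le> N"
    and f0: "\<And>p. norm (f0 p) \<le> 1" and f1: "\<And>p. norm (f1 p) \<le> 1" and f2: "\<And>p. norm (f2 p) \<le> 1"
    and K: "K \<ge> 2" and K1: "K1 = (K ^ 5) ^ 35" and K2: "K2 = K1 ^ 142476" and K3: "K3 = K2 ^ 76858"
    and K4: "K4 = K3 ^ 7192" and K5: "K5 = K4 ^ 4914988" and K6: "K6 = K5 ^ 1200" and N: "of_int N \<ge> K6"
    and big: "of_int N ^ 4 / K \<le> norm (\<Sum>x\<in>{1..N}. \<Sum>y\<in>{1..N\<^sup>2}. \<Sum>d\<in>{-j<..<j}. f0 (x, y) * f1 (x + d, y) * f2 (x, y + d\<^sup>2))"
  shows "\<exists>x\<in>{1..N}. \<exists>\<alpha> q. 1 \<le> q \<and> of_int q \<le> K6 \<and> dist_circle (of_int q * \<alpha>) \<le> K6 / (of_int N)\<^sup>2 \<and>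
    of_int N ^ 3 / K6 \<le> (\<Sum>y\<in>{1..N\<^sup>2}. norm (\<Sum>d\<in>{-j<..<j}. f1 (x + d, y) * add_char (\<alpha> * (of_int d)\<^sup>2)))"
proof -
  define n where "n = real_of_int N"
  have n0: "n > 0" using N0 n_def by simp
  define M where "M = 2 * N\<^sup>2"
  define I where "I = {-j<..<j}"
  \<comment> \<open>Cutting off \<open>f0\<close> alone restricts \<open>y\<close> to
    \<open>{1..N^2}\<close>. For such \<open>y\<close> the point \<open>y + d^2\<close> is below
    \<open>2 * N^2\<close>, so the other two functions can be extended periodically without a
    cutoff.\<close>
  define F0 where "F0 = (\<lambda>x y. if y mod M \<in> {1..N\<^sup>2} then f0 (x, y mod M) else 0)"
  define F1 where "F1 = (\<lambda>x y. f1 (x, y mod M))"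
  define F2 where "F2 = (\<lambda>x y. f2 (x, y mod M))"
  have p: "unit_periodic M (F0 x)" "unit_periodic M (F1 x)" "unit_periodic M (F2 x)" for x
    unfolding unit_periodic_def F0_def F1_def F2_def using f0 f1 f2 by auto
  have yM: "y mod M = y" if "y \<in> {1..N\<^sup>2}" for y
    using that N0 unfolding M_def by (intro mod_pos_pos_trivial) auto
  have sub: "{1..N\<^sup>2} \<subseteq> {0..<M}" using N0 unfolding M_def by auto
  have restrict: "(\<Sum>y\<in>{0..<M}. F0 x y * u y) = (\<Sum>y\<in>{1..N\<^sup>2}. f0 (x, y) * u y)" for x and u :: "int \<Rightarrow> complex"
    by (rule sum.mono_neutral_cong_right) (use sub yM in \<open>auto simp: F0_def\<close>)
  have eq: "(\<Sum>d\<in>I. \<Sum>y\<in>{0..<M}. F0 x y * F1 (x + d) y * F2 x (y + d\<^sup>2)) = (\<Sum>y\<in>{1..N\<^sup>2}. \<Sum>d\<in>I. f0 (x, y) * f1 (x + d, y) * f2 (x, y + d\<^sup>2))" for x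
  proof -
    have "(\<Sum>d\<in>I. \<Sum>y\<in>{0..<M}. F0 x y * F1 (x + d) y * F2 x (y + d\<^sup>2)) = (\<Sum>d\<in>I. \<Sum>y\<in>{1..N\<^sup>2}. f0 (x, y) * (F1 (x + d) y * F2 x (y + d\<^sup>2)))"
      unfolding restrict[symmetric] by (simp only: mult.assoc)
    also have "\<dots> = (\<Sum>d\<in>I. \<Sum>y\<in>{1..N\<^sup>2}. f0 (x, y) * f1 (x + d, y) * f2 (x, y + d\<^sup>2))"
    proof (rule sum.cong[OF refl], rule sum.cong[OF refl])
      fix d y assume d: "d \<in> I" and y: "y \<in> {1..N\<^sup>2}"
      have "\<bar>d\<bar> < N" using d j unfolding I_def by auto
      then have "d\<^sup>2 < N\<^sup>2" using power_strict_mono[of "\<bar>d\<bar>" N 2] by simp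
      then have "(y + d\<^sup>2) mod M = y + d\<^sup>2" using y unfolding M_def by (intro mod_pos_pos_trivial) auto
      then show "f0 (x, y) * (F1 (x + d) y * F2 x (y + d\<^sup>2)) = f0 (x, y) * f1 (x + d, y) * f2 (x, y + d\<^sup>2)"
        unfolding F1_def F2_def yM[OF y] by simp
    qed
    finally show ?thesis by (subst sum.swap)
  qed
  have big': "of_int N ^ 4 / K \<le> norm (\<Sum>x\<in>{1..N}. \<Sum>d\<in>{-j<..<j}. \<Sum>y\<in>{0..<M}. F0 x y * F1 (x + d) y * F2 x (y + d\<^sup>2))"
    using big unfolding eq[unfolded I_def] .
  from major_coefficient_of_large_form[OF N0 M_def j p K K1 K2 K3 K4 K5 N[unfolded K6] big']
  obtain x \<xi> where x: "x \<in> {1..N}" and mj: "major K6 N (of_int \<xi> / of_int M)"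
    and lg: "2 * n ^ 3 / K5 \<le> norm (\<Sum>d\<in>I. \<Sum>y\<in>{0..<M}. F0 x y * F1 (x + d) y * zchar M (- (\<xi> * (y + d\<^sup>2))))"
    unfolding n_def I_def K6 by blast
  from mj obtain q where q: "0 < q" "of_int q \<le> K6" "dist_circle (of_int q * (of_int \<xi> / of_int M)) \<le> K6 / (of_int N)\<^sup>2"
    unfolding major_def by blast
  \<comment> \<open>The sign comes from the conjugate character; the denominator \<open>q\<close> is
    unaffected.\<close>
  define \<alpha> where "\<alpha> = - (of_int \<xi> / real_of_int M)"
  have "dist_circle (of_int q * \<alpha>) = dist_circle (of_int q * (of_int \<xi> / of_int M))"
    unfolding \<alpha>_def mult_minus_right dist_circle_minus ..
  then have qa: "dist_circle (of_int q * \<alpha>) \<le> K6 / (of_int N)\<^sup>2" using q by simp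
  have "(\<Sum>d\<in>I. \<Sum>y\<in>{0..<M}. F0 x y * F1 (x + d) y * zchar M (- (\<xi> * (y + d\<^sup>2))))
    = (\<Sum>d\<in>I. \<Sum>y\<in>{1..N\<^sup>2}. f0 (x, y) * (F1 (x + d) y * zchar M (- (\<xi> * (y + d\<^sup>2)))))"
    unfolding restrict[symmetric] by (simp only: mult.assoc)
  also have "\<dots> = (\<Sum>y\<in>{1..N\<^sup>2}. \<Sum>d\<in>I. f0 (x, y) * (F1 (x + d) y * zchar M (- (\<xi> * (y + d\<^sup>2)))))" by (rule sum.swap)
  also have "\<dots> = (\<Sum>y\<in>{1..N\<^sup>2}. f0 (x, y) * zchar M (- (\<xi> * y)) * (\<Sum>d\<in>I. f1 (x + d, y) * add_char (\<alpha> * (of_int d)\<^sup>2)))"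
    unfolding sum_distrib_left
  proof (rule sum.cong[OF refl], rule sum.cong[OF refl])
    fix y d assume y: "y \<in> {1..N\<^sup>2}"
    have "- (\<xi> * (y + d\<^sup>2)) = - (\<xi> * y) + - (\<xi> * d\<^sup>2)" by (simp add: distrib_left)
    then have "zchar M (- (\<xi> * (y + d\<^sup>2))) = zchar M (- (\<xi> * y)) * zchar M (- (\<xi> * d\<^sup>2))" by (simp only: zchar_add)
    also have "zchar M (- (\<xi> * d\<^sup>2)) = add_char (\<alpha> * (of_int d)\<^sup>2)" unfolding zchar_def \<alpha>_def by simp
    finally have z: "zchar M (- (\<xi> * (y + d\<^sup>2))) = zchar M (- (\<xi> * y)) * add_char (\<alpha> * (of_int d)\<^sup>2)" .
    show "f0 (x, y) * (F1 (x + d) y * zchar M (- (\<xi> * (y + d\<^sup>2)))) = f0 (x, y) * zchar M (- (\<xi> * y)) * (f1 (x + d, y) * add_char (\<alpha> * (of_int d)\<^sup>2))"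
      unfolding z F1_def yM[OF y] by (simp only: mult_ac)
  qed
  also have "norm \<dots> \<le> (\<Sum>y\<in>{1..N\<^sup>2}. norm (\<Sum>d\<in>I. f1 (x + d, y) * add_char (\<alpha> * (of_int d)\<^sup>2)))"
    using f0 by (intro sum_norm_le) (simp add: norm_mult zchar_def mult_left_le_one_le)
  finally have "2 * n ^ 3 / K5 \<le> (\<Sum>y\<in>{1..N\<^sup>2}. norm (\<Sum>d\<in>I. f1 (x + d, y) * add_char (\<alpha> * (of_int d)\<^sup>2)))" using lg by linarith
  moreover have "n ^ 3 / K6 \<le> 2 * n ^ 3 / K5"
  proof -
    have k: "1 \<le> K1" unfolding K1 using K by (intro one_le_power) auto
    have k2: "1 \<le> K2" unfolding K2 using k by (rule one_le_power)
    have k3: "1 \<le> K3" unfolding K3 using k2 by (rule one_le_power)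
    have k4: "1 \<le> K4" unfolding K4 using k3 by (rule one_le_power)
    have k5: "1 \<le> K5" unfolding K5 using k4 by (rule one_le_power)
    then have "K5 \<le> K6" unfolding K6 by (intro self_le_power) auto
    then have "n ^ 3 / K6 \<le> n ^ 3 / K5" using k5 n0 by (intro divide_left_mono) auto
    also have "\<dots> \<le> 2 * n ^ 3 / K5" using k5 n0 by (intro divide_right_mono) auto
    finally show ?thesis .
  qed
  ultimately have fin: "n ^ 3 / K6 \<le> (\<Sum>y\<in>{1..N\<^sup>2}. norm (\<Sum>d\<in>I. f1 (x + d, y) * add_char (\<alpha> * (of_int d)\<^sup>2)))" by linarith
  show ?thesis
    using q(1,2) qa fin unfolding n_def I_def by (intro bexI[OF _ x] exI[of _ \<alpha>] exI[of _ q]) auto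
qed

text \<open>Collects the tower of parameters into one exponent. It is left as an unevaluated product
  of the stage exponents, the last being the \<open>33\<close> of the passage to linear phases, so
  that it unfolds as an iterated power.\<close>

lemma large_box_form_imp_large_coefficient:
  "\<exists>c::nat. \<forall>(N::int) (j::int) (K::real) (f0 :: int \<times> int \<Rightarrow> complex) f1 f2.
    N > 0 \<longrightarrow> 1 \<le> j \<longrightarrow> j \<le> N \<longrightarrow> K \<ge> 2 \<longrightarrow> (\<forall>p. norm (f0 p) \<le> 1) \<longrightarrow> (\<forall>p. norm (f1 p) \<le> 1) \<longrightarrow> (\<forall>p. norm (f2 p) \<le> 1) \<longrightarrow>
    K ^ c \<le> of_int N \<longrightarrow>
    of_int N ^ 4 / K \<le> norm (\<Sum>x\<in>{1..N}. \<Sum>y\<in>{1..N\<^sup>2}. \<Sum>d\<in>{-j<..<j}. f0 (x, y) * f1 (x + d, y) * f2 (x, y + d\<^sup>2)) \<longrightarrow>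
    (\<exists>\<beta> q::int. 1 \<le> q \<and> of_int q \<le> K ^ c \<and> dist_circle (of_int q * \<beta>) \<le> K ^ c / of_int N \<and>
      of_int N ^ 3 / K ^ c \<le> (\<Sum>y\<in>{1..N\<^sup>2}. norm (\<Sum>x\<in>{-N..2*N}. f1 (x, y) * add_char (\<beta> * of_int x))))"
proof (rule exI[of _ "5 * 35 * 142476 * 76858 * 7192 * 4914988 * 1200 * 33"], intro allI impI)
  fix N j :: int and K :: real and f0 f1 f2 :: "int \<times> int \<Rightarrow> complex"
  let ?c = "5 * 35 * 142476 * 76858 * 7192 * 4914988 * 1200 * 33 :: nat"
  assume N0: "N > 0" and j: "1 \<le> j" "j \<le> N" and K: "K \<ge> 2" and f0: "\<forall>p. norm (f0 p) \<le> 1" and f1: "\<forall>p. norm (f1 p) \<le> 1" and f2: "\<forall>p. norm (f2 p) \<le> 1"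
    and N: "K ^ ?c \<le> of_int N"
    and big: "of_int N ^ 4 / K \<le> norm (\<Sum>x\<in>{1..N}. \<Sum>y\<in>{1..N\<^sup>2}. \<Sum>d\<in>{-j<..<j}. f0 (x, y) * f1 (x + d, y) * f2 (x, y + d\<^sup>2))"
  define K1 where "K1 = (K ^ 5) ^ 35"
  define K2 where "K2 = K1 ^ 142476"
  define K3 where "K3 = K2 ^ 76858"
  define K4 where "K4 = K3 ^ 7192"
  define K5 where "K5 = K4 ^ 4914988"
  define K6 where "K6 = K5 ^ 1200"
  have Kc: "K ^ ?c = K6 ^ 33"
    unfolding K6_def K5_def K4_def K3_def K2_def K1_def by (simp only: power_mult)
  have K62: "K6 \<ge> 2"
  proof -
    have two: "2 \<le> b ^ m" if "2 \<le> b" "m > 0" for b :: real and m using self_le_power[of b m] that by auto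
    show ?thesis unfolding K6_def K5_def K4_def K3_def K2_def K1_def using K by (intro two) auto
  qed
  have mono: "K6 ^ m \<le> K6 ^ 33" if "m \<le> 33" for m using K62 that by (intro power_increasing) auto
  have N33: "K6 ^ 33 \<le> of_int N" using N unfolding Kc .
  have N1: "K6 \<le> of_int N" using mono[of 1] N33 by simp
  have N13: "K6 ^ 13 \<le> of_int N" using mono[of 13] N33 by simp
  from major_coefficient_of_large_box_form[OF N0 j f0[rule_format] f1[rule_format] f2[rule_format] K K1_def K2_def K3_def K4_def K5_def K6_def N1 big]
  obtain x \<alpha> q where x: "x \<in> {1..N}" and q: "1 \<le> q" "of_int q \<le> K6" "dist_circle (of_int q * \<alpha>) \<le> K6 / (of_int N)\<^sup>2"
    and s: "of_int N ^ 3 / K6 \<le> (\<Sum>y\<in>{1..N\<^sup>2}. norm (\<Sum>d\<in>{-j<..<j}. f1 (x + d, y) * add_char (\<alpha> * (of_int d)\<^sup>2)))"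
    by blast
  \<comment> \<open>Truncation to \<open>{-N..2 * N}\<close> changes nothing in the window sums,
    where \<open>x + d\<close> always lies in this range, and provides the vanishing needed for
    periodisation.\<close>
  define h where "h = (\<lambda>y u. if u \<in> {-N..2*N} then f1 (u, y) else 0)"
  have h: "norm (h y u) \<le> 1" "u \<notin> {-N..2*N} \<Longrightarrow> h y u = 0" for y u unfolding h_def using f1 by auto
  have "h y (x + d) = f1 (x + d, y)" if "d \<in> {-j<..<j}" for d y using that x j unfolding h_def by auto
  then have s': "of_int N ^ 3 / K6 \<le> (\<Sum>y\<in>{1..N\<^sup>2}. norm (\<Sum>d\<in>{-j<..<j}. h y (x + d) * add_char (\<alpha> * (of_int d)\<^sup>2)))"
    using s by simp
  have cY: "real (card {1..N\<^sup>2}) \<le> (of_int N)\<^sup>2" by simp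
  from fourier_coefficient_of_quadratic_sums[OF K62 N13 j x q finite_atLeastAtMost_int cY h s']
  obtain \<beta> where b: "dist_circle (of_int q * \<beta>) \<le> K6 ^ 18 / of_int N"
    "of_int N ^ 3 / K6 ^ 33 \<le> (\<Sum>y\<in>{1..N\<^sup>2}. norm (\<Sum>x\<in>{-N..2*N}. h y x * add_char (\<beta> * of_int x)))" by blast
  have "(\<Sum>x\<in>{-N..2*N}. h y x * add_char (\<beta> * of_int x)) = (\<Sum>x\<in>{-N..2*N}. f1 (x, y) * add_char (\<beta> * of_int x))" for y
    unfolding h_def by (rule sum.cong[OF refl]) simp
  moreover have "dist_circle (of_int q * \<beta>) \<le> K6 ^ 33 / of_int N"
    using b(1) divide_right_mono[OF mono[of 18], of "of_int N"] N0 by simp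
  moreover have "of_int q \<le> K6 ^ 33" using q(2) mono[of 1] by simp
  ultimately show "\<exists>\<beta> q::int. 1 \<le> q \<and> of_int q \<le> K ^ ?c \<and> dist_circle (of_int q * \<beta>) \<le> K ^ ?c / of_int N \<and>
      of_int N ^ 3 / K ^ ?c \<le> (\<Sum>y\<in>{1..N\<^sup>2}. norm (\<Sum>x\<in>{-N..2*N}. f1 (x, y) * add_char (\<beta> * of_int x)))"
    unfolding Kc using q(1) b(2) by (intro exI[of _ \<beta>] exI[of _ q]) simp
qed

section \<open>Fejer weights as averages of windows, and the conclusion\<close>

text \<open>A given \<open>d\<close> lies in the window of radius \<open>j\<close> exactly for the
  \<open>N - \<bar>d\<bar>\<close> values \<open>j > \<bar>d\<bar>\<close> up to \<open>N\<close>.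
  This exchanges the weight for sharp cutoffs, which suit geometric sums.\<close>

lemma fejer_eq_average:
  assumes N: "N > 0" and d: "\<bar>d\<bar> < int N"
  shows "fejer N d = (\<Sum>j\<in>{1..int N}. of_bool (d \<in> {-j<..<j})) / (real N)\<^sup>2"
proof -
  have "(\<Sum>j\<in>{1..int N}. of_bool (d \<in> {-j<..<j})) = (\<Sum>j\<in>{\<bar>d\<bar>+1..int N}. 1 :: real)"
    by (rule sum.mono_neutral_cong_right) auto
  also have "\<dots> = real N - of_int \<bar>d\<bar>" using d by simp
  finally have s: "(\<Sum>j\<in>{1..int N}. of_bool (d \<in> {-j<..<j})) = real N - of_int \<bar>d\<bar>" .
  have "of_int \<bar>d\<bar> < real N" using d by linarith
  then show ?thesis unfolding s fejer_def using N by (simp add: field_simps power2_eq_square)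
qed

text \<open>The factor \<open>N^5\<close> clears the averages over \<open>x\<close> and
  \<open>y\<close>, which contribute \<open>N\<close> and \<open>N^2\<close>, and the normalisation
  \<open>N^2\<close> of the window average.\<close>

lemma corner_form_eq_average_of_box_forms:
  assumes N: "N > 0"
  shows "of_nat N ^ 5 * corner_form N f0 f1 f2 =
    (\<Sum>j\<in>{1..int N}. \<Sum>x\<in>{1..int N}. \<Sum>y\<in>{1..(int N)\<^sup>2}. \<Sum>d\<in>{-j<..<j}. f0 (x, y) * f1 (x + d, y) * f2 (x, y + d\<^sup>2))"
proof -
  define t where "t = (\<lambda>x y d. f0 (x, y) * f1 (x + d, y) * f2 (x, y + d\<^sup>2))"
  define D where "D = {-int N<..<int N}"
  have inner: "(\<Sum>\<^sub>\<infinity>d\<in>UNIV. of_real (fejer N d) * f0 (x, y) * f1 (x + d, y) * f2 (x, y + d\<^sup>2))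
    = (\<Sum>j\<in>{1..int N}. \<Sum>d\<in>{-j<..<j}. t x y d) / of_nat N ^ 2" for x y
  proof -
    have "(\<Sum>\<^sub>\<infinity>d\<in>UNIV. of_real (fejer N d) * f0 (x, y) * f1 (x + d, y) * f2 (x, y + d\<^sup>2)) = (\<Sum>\<^sub>\<infinity>d\<in>D. of_real (fejer N d) * t x y d)"
    proof (rule infsum_cong_neutral)
      fix d assume "d \<in> UNIV - D"
      then have "\<bar>d\<bar> \<ge> int N" unfolding D_def by auto
      then have "\<bar>real_of_int d\<bar> \<ge> real N" by linarith
      then have "fejer N d = 0" unfolding fejer_def using N by (simp add: field_simps)
      then show "of_real (fejer N d) * f0 (x, y) * f1 (x + d, y) * f2 (x, y + d\<^sup>2) = 0" by simp
    qed (auto simp: t_def mult.assoc)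
    also have "\<dots> = (\<Sum>d\<in>D. of_real (fejer N d) * t x y d)" by (simp add: D_def)
    also have "\<dots> = (\<Sum>d\<in>D. (\<Sum>j\<in>{1..int N}. of_bool (d \<in> {-j<..<j}) * t x y d) / of_nat N ^ 2)"
    proof (rule sum.cong[OF refl])
      fix d assume "d \<in> D"
      then have "\<bar>d\<bar> < int N" unfolding D_def by auto
      from fejer_eq_average[OF N this]
      have e: "complex_of_real (fejer N d) = (\<Sum>j\<in>{1..int N}. of_bool (d \<in> {-j<..<j})) / of_nat N ^ 2" by simp
      show "of_real (fejer N d) * t x y d = (\<Sum>j\<in>{1..int N}. of_bool (d \<in> {-j<..<j}) * t x y d) / of_nat N ^ 2"
        unfolding e sum_distrib_right[symmetric] by (simp only: times_divide_eq_left)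
    qed
    also have "\<dots> = (\<Sum>j\<in>{1..int N}. \<Sum>d\<in>D. of_bool (d \<in> {-j<..<j}) * t x y d) / of_nat N ^ 2"
      unfolding sum_divide_distrib[symmetric] by (subst sum.swap) simp
    also have "(\<Sum>j\<in>{1..int N}. \<Sum>d\<in>D. of_bool (d \<in> {-j<..<j}) * t x y d) = (\<Sum>j\<in>{1..int N}. \<Sum>d\<in>{-j<..<j}. t x y d)"
      by (rule sum.cong[OF refl], rule sum.mono_neutral_cong_right) (auto simp: D_def)
    finally show ?thesis .
  qed
  have "corner_form N f0 f1 f2 = (\<Sum>x\<in>{1..int N}. (\<Sum>y\<in>{1..(int N)\<^sup>2}. (\<Sum>j\<in>{1..int N}. \<Sum>d\<in>{-j<..<j}. t x y d) / of_nat N ^ 2) / of_nat N ^ 2) / of_nat N"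
    unfolding corner_form_def avg_def inner by (simp add: nat_power_eq)
  also have "\<dots> = (\<Sum>x\<in>{1..int N}. \<Sum>y\<in>{1..(int N)\<^sup>2}. \<Sum>j\<in>{1..int N}. \<Sum>d\<in>{-j<..<j}. t x y d) / of_nat N ^ 5"
    unfolding sum_divide_distrib[symmetric] by (simp add: eval_nat_numeral mult_ac)
  also have "(\<Sum>x\<in>{1..int N}. \<Sum>y\<in>{1..(int N)\<^sup>2}. \<Sum>j\<in>{1..int N}. \<Sum>d\<in>{-j<..<j}. t x y d) = (\<Sum>j\<in>{1..int N}. \<Sum>x\<in>{1..int N}. \<Sum>y\<in>{1..(int N)\<^sup>2}. \<Sum>d\<in>{-j<..<j}. t x y d)"
    by (rule sum_swap3[symmetric])
  finally show ?thesis using N unfolding t_def by simp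
qed

lemma sum_odd_int: "(\<Sum>j\<in>{1..int k}. 2 * real_of_int j - 1) = (real k)\<^sup>2"
proof (induction k)
  case (Suc k)
  have "{1..int (Suc k)} = insert (int k + 1) {1..int k}" by auto
  then show ?case using Suc by (simp add: power2_eq_square algebra_simps)
qed simp

text \<open>Some window does at least as well as the average. The trivial bounds, with
  \<open>2 * j - 1\<close> values of \<open>d\<close> in the window of radius \<open>j\<close>, add
  up to exactly \<open>N^5\<close>; hence \<open>\<delta> \<le> 1\<close>, which is what makes
  \<open>2 / \<delta>\<close> an admissible parameter.\<close>

lemma large_box_form_of_large_corner_form:
  assumes N: "N > 0" and f: "\<And>p. norm (f0 p) \<le> 1" "\<And>p. norm (f1 p) \<le> 1" "\<And>p. norm (f2 p) \<le> 1"
    and \<delta>: "\<delta> > 0" "norm (corner_form N f0 f1 f2) \<ge> \<delta>"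
  shows "\<delta> \<le> 1"
    and "\<exists>j\<in>{1..int N}. \<delta> * real N ^ 4 \<le> norm (\<Sum>x\<in>{1..int N}. \<Sum>y\<in>{1..(int N)\<^sup>2}. \<Sum>d\<in>{-j<..<j}. f0 (x, y) * f1 (x + d, y) * f2 (x, y + d\<^sup>2))"
proof -
  define \<Phi> where "\<Phi> = (\<lambda>j. norm (\<Sum>x\<in>{1..int N}. \<Sum>y\<in>{1..(int N)\<^sup>2}. \<Sum>d\<in>{-j<..<j}. f0 (x, y) * f1 (x + d, y) * f2 (x, y + d\<^sup>2)))"
  have "\<delta> * real N ^ 5 \<le> real N ^ 5 * norm (corner_form N f0 f1 f2)"
    using mult_right_mono[OF \<delta>(2), of "real N ^ 5"] by (simp add: mult.commute)
  also have "\<dots> = norm (of_nat N ^ 5 * corner_form N f0 f1 f2)" by (simp add: norm_mult norm_power)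
  also have "\<dots> \<le> (\<Sum>j\<in>{1..int N}. \<Phi> j)"
    unfolding corner_form_eq_average_of_box_forms[OF N] \<Phi>_def by (rule norm_sum)
  finally have s: "\<delta> * real N ^ 5 \<le> (\<Sum>j\<in>{1..int N}. \<Phi> j)" .
  have "\<exists>j\<in>{1..int N}. \<delta> * real N ^ 5 / real N \<le> \<Phi> j"
    by (rule exists_ge_average[OF _ s]) (use N \<delta> in auto)
  then show "\<exists>j\<in>{1..int N}. \<delta> * real N ^ 4 \<le> norm (\<Sum>x\<in>{1..int N}. \<Sum>y\<in>{1..(int N)\<^sup>2}. \<Sum>d\<in>{-j<..<j}. f0 (x, y) * f1 (x + d, y) * f2 (x, y + d\<^sup>2))"
    using N unfolding \<Phi>_def by (simp add: eval_nat_numeral)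
  have "\<Phi> j \<le> real N ^ 3 * (2 * of_int j - 1)" if j: "j \<in> {1..int N}" for j
  proof -
    have "\<Phi> j \<le> (\<Sum>x\<in>{1..int N}. \<Sum>y\<in>{1..(int N)\<^sup>2}. \<Sum>d\<in>{-j<..<j}. 1)"
      unfolding \<Phi>_def using f by (intro sum_norm_le) (simp add: norm_mult mult_le_one)
    also have "\<dots> = real N ^ 3 * (2 * of_int j - 1)" using j by (simp add: nat_power_eq eval_nat_numeral)
    finally show ?thesis .
  qed
  then have "(\<Sum>j\<in>{1..int N}. \<Phi> j) \<le> (\<Sum>j\<in>{1..int N}. real N ^ 3 * (2 * of_int j - 1))" by (rule sum_mono)
  also have "\<dots> = real N ^ 5" unfolding sum_distrib_left[symmetric] sum_odd_int by (simp flip: power_add)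
  finally have "\<delta> * real N ^ 5 \<le> 1 * real N ^ 5" using s by simp
  then show "\<delta> \<le> 1" by (rule mult_right_le_imp_le) (use N in simp)
qed

theorem theorem5p1:
  "\<exists>C c :: real. C \<ge> 1 \<and> c > 0 \<and>
     (\<forall>(N::nat) (\<delta>::real) (f0 :: int \<times> int \<Rightarrow> complex) (f1 :: int \<times> int \<Rightarrow> complex)
        (f2 :: int \<times> int \<Rightarrow> complex).
        N > 0 \<longrightarrow> \<delta> > 0 \<longrightarrow>
        (\<forall>p. norm (f0 p) \<le> 1) \<longrightarrow> (\<forall>p. norm (f1 p) \<le> 1) \<longrightarrow> (\<forall>p. norm (f2 p) \<le> 1) \<longrightarrow>
        norm (corner_form N f0 f1 f2) \<ge> \<delta> \<longrightarrow>
        real N \<le> C * \<delta> powr (- C) \<or>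
        (\<exists>(\<beta>::real) (q::nat).
           q > 0 \<and> real q \<le> C * \<delta> powr (- C) \<and>
           dist_circle (real q * \<beta>) \<le> C * \<delta> powr (- C) / real N \<and>
           avg {1..(int N)\<^sup>2} (\<lambda>y.
             norm (avg {- int N..2 * int N} (\<lambda>x. f1 (x, y) * add_char (\<beta> * of_int x))))
           \<ge> c * \<delta> powr C))"
proof -
  from large_box_form_imp_large_coefficient obtain c :: nat where main: "\<forall>(N::int) (j::int) (K::real) (f0 :: int \<times> int \<Rightarrow> complex) f1 f2.
    N > 0 \<longrightarrow> 1 \<le> j \<longrightarrow> j \<le> N \<longrightarrow> K \<ge> 2 \<longrightarrow> (\<forall>p. norm (f0 p) \<le> 1) \<longrightarrow> (\<forall>p. norm (f1 p) \<le> 1) \<longrightarrow> (\<forall>p. norm (f2 p) \<le> 1) \<longrightarrow>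
    K ^ c \<le> of_int N \<longrightarrow>
    of_int N ^ 4 / K \<le> norm (\<Sum>x\<in>{1..N}. \<Sum>y\<in>{1..N\<^sup>2}. \<Sum>d\<in>{-j<..<j}. f0 (x, y) * f1 (x + d, y) * f2 (x, y + d\<^sup>2)) \<longrightarrow>
    (\<exists>\<beta> q::int. 1 \<le> q \<and> of_int q \<le> K ^ c \<and> dist_circle (of_int q * \<beta>) \<le> K ^ c / of_int N \<and>
      of_int N ^ 3 / K ^ c \<le> (\<Sum>y\<in>{1..N\<^sup>2}. norm (\<Sum>x\<in>{-N..2*N}. f1 (x, y) * add_char (\<beta> * of_int x))))"
    by (elim exE)
  \<comment> \<open>With parameter \<open>2 / \<delta>\<close> the loss is
    \<open>2^c * \<delta>^(-c)\<close>. Thus \<open>2^c\<close> is the right multiplicative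
    constant, and being at least \<open>c\<close> it is also large enough as an exponent because
    \<open>\<delta> \<le> 1\<close>.\<close>
  define C where "C = (2::real) ^ c"
  have Cc: "real c \<le> C" unfolding C_def using of_nat_less_two_power[of c, where 'a = real] by simp
  have C1: "C \<ge> 1" unfolding C_def by simp
  show ?thesis
  \<comment> \<open>The factor \<open>4\<close> covers the cardinality
    \<open>3 * N + 1 \<le> 4 * N\<close> of \<open>{-N..2 * N}\<close>; the factor \<open>C\<close>
    is the constant in the loss.\<close>
  proof (rule exI[of _ C], rule exI[of _ "1 / (4 * C)"], intro conjI allI impI)
    show "C \<ge> 1" "1 / (4 * C) > 0" using C1 by auto
    fix N :: nat and \<delta> :: real and f0 f1 f2 :: "int \<times> int \<Rightarrow> complex"
    assume N: "N > 0" and \<delta>: "\<delta> > 0" and f: "\<forall>p. norm (f0 p) \<le> 1" "\<forall>p. norm (f1 p) \<le> 1" "\<forall>p. norm (f2 p) \<le> 1"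
      and big: "norm (corner_form N f0 f1 f2) \<ge> \<delta>"
    have \<delta>1: "\<delta> \<le> 1" using large_box_form_of_large_corner_form(1)[OF N _ _ _ \<delta> big] f by blast
    obtain j where j: "j \<in> {1..int N}"
      and Bj: "\<delta> * real N ^ 4 \<le> norm (\<Sum>x\<in>{1..int N}. \<Sum>y\<in>{1..(int N)\<^sup>2}. \<Sum>d\<in>{-j<..<j}. f0 (x, y) * f1 (x + d, y) * f2 (x, y + d\<^sup>2))"
      using large_box_form_of_large_corner_form(2)[OF N _ _ _ \<delta> big] f by blast
    \<comment> \<open>The numerator \<open>2\<close> secures \<open>K \<ge> 2\<close>, on which the
      absorption of constants depends; \<open>1 / \<delta>\<close> could be as small as
      \<open>1\<close>.\<close>
    define K where "K = 2 / \<delta>"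
    have K2: "K \<ge> 2" unfolding K_def using \<delta> \<delta>1 by (simp add: field_simps)
    define W where "W = C * \<delta> powr (- C)"
    have KW: "K ^ c \<le> W"
    proof -
      have "K ^ c = C * \<delta> powr (- real c)"
        unfolding K_def C_def using \<delta> by (simp add: power_divide powr_minus powr_realpow divide_inverse power_inverse)
      also have "\<dots> \<le> W" unfolding W_def using C1 \<delta> \<delta>1 Cc by (intro mult_left_mono powr_mono') auto
      finally show ?thesis .
    qed
    have Kc: "K ^ c > 0" using K2 by simp
    show "real N \<le> C * \<delta> powr (- C) \<or>
        (\<exists>(\<beta>::real) (q::nat).
           q > 0 \<and> real q \<le> C * \<delta> powr (- C) \<and>
           dist_circle (real q * \<beta>) \<le> C * \<delta> powr (- C) / real N \<and>
           avg {1..(int N)\<^sup>2} (\<lambda>y.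
             norm (avg {- int N..2 * int N} (\<lambda>x. f1 (x, y) * add_char (\<beta> * of_int x))))
           \<ge> 1 / (4 * C) * \<delta> powr C)"
    proof (cases "real N \<le> W")
      case True
      then show ?thesis unfolding W_def by blast
    next
      case False
      then have KN: "K ^ c \<le> of_int (int N)" using KW by simp
      have N0: "int N > 0" and j1: "1 \<le> j" "j \<le> int N" using N j by auto
      have "of_int (int N) ^ 4 / K = \<delta> * real N ^ 4 / 2" unfolding K_def using \<delta> by (simp add: field_simps)
      also have "\<dots> \<le> \<delta> * real N ^ 4" using \<delta> by simp
      finally have "of_int (int N) ^ 4 / K \<le> norm (\<Sum>x\<in>{1..int N}. \<Sum>y\<in>{1..(int N)\<^sup>2}. \<Sum>d\<in>{-j<..<j}. f0 (x, y) * f1 (x + d, y) * f2 (x, y + d\<^sup>2))"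
        using Bj by linarith
      from main[rule_format, OF N0 j1 K2 f(1)[rule_format] f(2)[rule_format] f(3)[rule_format] KN this]
      obtain \<beta> and q :: int where q: "1 \<le> q" "of_int q \<le> K ^ c" "dist_circle (of_int q * \<beta>) \<le> K ^ c / of_int (int N)"
        and s: "of_int (int N) ^ 3 / K ^ c \<le> (\<Sum>y\<in>{1..(int N)\<^sup>2}. norm (\<Sum>x\<in>{-int N..2*int N}. f1 (x, y) * add_char (\<beta> * of_int x)))"
        by (elim exE conjE)
      have rq: "real (nat q) = of_int q" using q by simp
      define A where "A = (\<lambda>y. \<Sum>x\<in>{-int N..2*int N}. f1 (x, y) * add_char (\<beta> * of_int x))"
      have s': "real N ^ 3 / K ^ c \<le> (\<Sum>y\<in>{1..(int N)\<^sup>2}. norm (A y))" using s unfolding A_def by simp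
      have N1: "real N \<ge> 1" using N by simp
      have av: "avg {1..(int N)\<^sup>2} (\<lambda>y. norm (avg {- int N..2 * int N} (\<lambda>x. f1 (x, y) * add_char (\<beta> * of_int x))))
        = (\<Sum>y\<in>{1..(int N)\<^sup>2}. norm (A y)) / ((3 * real N + 1) * real N ^ 2)"
      proof -
        have "card {- int N..2 * int N} = 3 * N + 1" by simp
        then have "norm (avg {- int N..2 * int N} (\<lambda>x. f1 (x, y) * add_char (\<beta> * of_int x))) = norm (A y) / (3 * real N + 1)" for y
          unfolding avg_def A_def norm_divide norm_of_nat by (simp add: add.commute)
        moreover have "card {1..(int N)\<^sup>2} = N ^ 2" by (simp add: nat_power_eq)
        ultimately show ?thesis unfolding avg_def by (simp add: sum_divide_distrib[symmetric])
      qed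
      have "1 / (4 * C) * \<delta> powr C = 1 / (4 * W)" unfolding W_def using \<delta> by (simp add: powr_minus field_simps)
      also have "\<dots> \<le> 1 / (4 * K ^ c)" using KW Kc by (intro divide_left_mono) auto
      also have "\<dots> = real N ^ 3 / K ^ c / (4 * real N * real N ^ 2)" using N1 by (simp add: eval_nat_numeral)
      also have "\<dots> \<le> real N ^ 3 / K ^ c / ((3 * real N + 1) * real N ^ 2)"
        using N1 Kc by (intro divide_left_mono mult_right_mono mult_pos_pos) auto
      also have "\<dots> \<le> (\<Sum>y\<in>{1..(int N)\<^sup>2}. norm (A y)) / ((3 * real N + 1) * real N ^ 2)"
        using s' by (intro divide_right_mono) auto
      finally have "avg {1..(int N)\<^sup>2} (\<lambda>y. norm (avg {- int N..2 * int N} (\<lambda>x. f1 (x, y) * add_char (\<beta> * of_int x)))) \<ge> 1 / (4 * C) * \<delta> powr C"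
        unfolding av .
      moreover have "dist_circle (real (nat q) * \<beta>) \<le> W / real N"
        using q(3) divide_right_mono[OF KW, of "real N"] unfolding rq by simp
      moreover have "nat q > 0" "real (nat q) \<le> W" using q KW unfolding rq by auto
      ultimately show ?thesis unfolding W_def by (intro disjI2 exI[of _ \<beta>] exI[of _ "nat q"]) simp
    qed
  qed
qed

end
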